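(* Let $T$ be an $m$-linear Calderón–Zygmund operator on $\mathbb{R}^n$ with kernel $K$. Let $\vec\omega=(\omega_1,\dots,\omega_m)\in A_{(1,\dots,1)}$ and $\vec b=(b_1,\dots,b_m)\in (BMO(\mathbb{R}^n))^m$. Then there exists a constant $C$, depending on $\vec b$, such that for all $t>0$ and all $\vec f=(f_1,\dots,f_m)$, $$\nu_{\vec\omega}\Big(\big\{x\in\mathbb{R}^n:\ T_{*,\Pi b}(\vec f)(x)>t^m\big\}\Big)\le C\bigg(\prod_{i=1}^m\int_{\mathbb{R}^n}\Phi^{(m)}\Big(\frac{|f_i(y_i)|}{t}\Big)\omega_i(y_i)\,dy_i\bigg)^{1/m},$$ where $\Phi(s)=s(1+\log^+s)$ and $\Phi^{(m)}=\Phi\circ\cdots\circ\Phi$ ($m$ times).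
   Context: $m\ge1$ and $n\ge 1$ are integers. An $m$-linear operator $T:\mathscr S(\mathbb{R}^n)\times\cdots\times\mathscr S(\mathbb{R}^n)\to\mathscr S'(\mathbb{R}^n)$ is an $m$-linear Calderón–Zygmund operator if for some $1\le q_j<\infty$ it extends to a bounded multilinear operator from $L^{q_1}\times\cdots\times L^{q_m}$ to $L^q$, $\frac1q=\frac1{q_1}+\cdots+\frac1{q_m}$, and if there is a function $K$, defined off the diagonal $x=y_1=\cdots=y_m$ in $(\mathbb{R}^n)^{m+1}$, such that $$T(f_1,\dots,f_m)(x)=\int_{(\mathbb{R}^n)^m}K(x,y_1,\dots,y_m)f_1(y_1)\cdots f_m(y_m)\,dy_1\cdots dy_m$$ for all $x\notin\bigcap_{j=1}^m\operatorname{supp}f_j$, and, for some $A>0$ and $\varepsilon>0$, $$|K(y_0,y_1,\dots,y_m)|\le\frac{A}{\big(\sum_{k,l=0}^m|y_k-y_l|\big)^{mn}},$$ $$|K(y_0,\dots,y_j,\dots,y_m)-K(y_0,\dots,y_j',\dots,y_m)|\le\frac{A|y_j-y_j'|^\varepsilon}{\big(\sum_{k,l=0}^m|y_k-y_l|\big)^{mn+\varepsilon}}$$ for all $0\le j\le m$ whenever $|y_j-y_j'|\le\frac12\max_{0\le k\le m}|y_j-y_k|$. The iterated commutator of the maximal operator is $$T_{*,\Pi b}(\vec f)(x)=\sup_{\delta>0}\bigg|\int_{|x-y_1|^2+\cdots+|x-y_m|^2>\delta^2}\prod_{j=1}^m(b_j(x)-b_j(y_j))\,K(x,y_1,\dots,y_m)\prod_{i=1}^mf_i(y_i)\,d\vec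 y\bigg|,\qquad d\vec y=dy_1\cdots dy_m.$$ Multiple weights: for weights (nonnegative functions) $\omega_1,\dots,\omega_m$ on $\mathbb{R}^n$ and all exponents equal to $1$ (so $p=1/m$), put $\nu_{\vec\omega}=\prod_{j=1}^m\omega_j^{1/m}$. Then $\vec\omega\in A_{(1,\dots,1)}$ means $$\sup_Q\Big(\frac1{|Q|}\int_Q\nu_{\vec\omega}\Big)^{m}\prod_{i=1}^m\big(\inf_Q\omega_i\big)^{-1}<\infty,$$ the supremum over all cubes $Q\subset\mathbb{R}^n$ (essential infima). For a weight $w$ and a measurable set $E$, $w(E)=\int_Ew(x)\,dx$. *)

theory Defs
  imports "HOL-Analysis.Analysis"
begin

text \<open>
  Throughout, \<^typ>\<open>real ^ 'n\<close> is Euclidean \<open>n\<close>-space, the slots \<open>1, \<dots>, m\<close> are the elements of a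
  finite type \<open>'m\<close>, and \<open>(y\<^sub>1, \<dots>, y\<^sub>m)\<close> is a vector \<open>y :: real ^ 'n ^ 'm\<close>.
  All functions and kernels are complex-valued; weights are real-valued.
\<close>

section \<open>Schwartz functions and tempered distributions\<close>

definition partial :: "'n::finite \<Rightarrow> (real ^ 'n \<Rightarrow> complex) \<Rightarrow> real ^ 'n \<Rightarrow> complex" where
  "partial i f = (\<lambda>x. frechet_derivative f (at x) (axis i 1))"

text \<open>The iterated derivative \<open>\<partial>\<^sup>\<beta>\<close>; the multi-index is given as the list of differentiation directions.\<close>

definition partials :: "'n::finite list \<Rightarrow> (real ^ 'n \<Rightarrow> complex) \<Rightarrow> real ^ 'n \<Rightarrow> complex" where
  "partials is f = fold partial is f"

text \<open>\<open>C\<^sup>\<infinity>\<close>: differentiability of every iterated partial derivative also gives their continuity.\<close>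

definition smooth :: "(real ^ 'n::finite \<Rightarrow> complex) \<Rightarrow> bool" where
  "smooth f \<longleftrightarrow> (\<forall>is x. partials is f differentiable (at x))"

definition schwartz :: "(real ^ 'n::finite \<Rightarrow> complex) set" where
  "schwartz = {f. smooth f \<and>
     (\<forall>k::nat. \<forall>is. bounded (range (\<lambda>x. norm x ^ k * norm (partials is f x))))}"

definition schwartz_seminorm :: "nat \<Rightarrow> 'n::finite list \<Rightarrow> (real ^ 'n \<Rightarrow> complex) \<Rightarrow> real" where
  "schwartz_seminorm k is f = (SUP x. norm x ^ k * norm (partials is f x))"

definition supp :: "(real ^ 'n::finite \<Rightarrow> complex) \<Rightarrow> (real ^ 'n) set" where
  "supp f = closure {x. f x \<noteq> 0}"

definition test_functions :: "(real ^ 'n::finite \<Rightarrow> complex) set" where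
  "test_functions = {f. smooth f \<and> compact (supp f)}"

text \<open>
  A functional is a total function of which only the values on \<^const>\<open>schwartz\<close> matter. The Schwartz
  topology is metrizable, so continuity of a linear functional is sequential continuity at \<open>0\<close>.
\<close>

definition tempered_distribution :: "((real ^ 'n::finite \<Rightarrow> complex) \<Rightarrow> complex) \<Rightarrow> bool" where
  "tempered_distribution u \<longleftrightarrow>
     (\<forall>\<phi>\<in>schwartz. \<forall>\<psi>\<in>schwartz. \<forall>a b. u (\<lambda>x. a * \<phi> x + b * \<psi> x) = a * u \<phi> + b * u \<psi>) \<and>
     (\<forall>\<phi>. (\<forall>j::nat. \<phi> j \<in> schwartz) \<and>
          (\<forall>k is. (\<lambda>j. schwartz_seminorm k is (\<phi> j)) \<longlonglongrightarrow> 0)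
          \<longrightarrow> (\<lambda>j. u (\<phi> j)) \<longlonglongrightarrow> 0)"

text \<open>The distribution \<open>u\<close> coincides with the function \<open>g\<close> on the open set \<open>U\<close>.\<close>

definition coincides_on ::
  "(real ^ 'n::finite) set \<Rightarrow> ((real ^ 'n \<Rightarrow> complex) \<Rightarrow> complex) \<Rightarrow> (real ^ 'n \<Rightarrow> complex) \<Rightarrow> bool" where
  "coincides_on U u g \<longleftrightarrow>
     (\<forall>\<phi>\<in>test_functions. supp \<phi> \<subseteq> U \<longrightarrow>
        integrable lebesgue (\<lambda>x. g x * \<phi> x) \<and> u \<phi> = (\<integral>x. g x * \<phi> x \<partial>lebesgue))"

section \<open>Lebesgue spaces and multilinear operators\<close>

text \<open>\<open>x\<^sup>a\<close> for \<open>x \<in> [0, \<infinity>]\<close> and \<open>a > 0\<close>.\<close>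

definition ennreal_powr :: "ennreal \<Rightarrow> real \<Rightarrow> ennreal" where
  "ennreal_powr x a = (if x = \<infinity> then \<infinity> else ennreal (enn2real x powr a))"

definition Lp_norm :: "real \<Rightarrow> (real ^ 'n::finite \<Rightarrow> complex) \<Rightarrow> ennreal" where
  "Lp_norm p f = ennreal_powr (\<integral>\<^sup>+x. ennreal (norm (f x) powr p) \<partial>lebesgue) (1 / p)"

definition Lp :: "real \<Rightarrow> (real ^ 'n::finite \<Rightarrow> complex) set" where
  "Lp p = {f. f \<in> borel_measurable lebesgue \<and> Lp_norm p f < \<infinity>}"

text \<open>Multilinearity on \<open>\<Prod>\<^sub>j V\<^sub>j\<close>, where the values are only considered up to the equivalence \<open>E\<close>.\<close>

definition multilinear_upto ::
  "(('b \<Rightarrow> complex) \<Rightarrow> ('b \<Rightarrow> complex) \<Rightarrow> bool) \<Rightarrow> ('m \<Rightarrow> ('a \<Rightarrow> complex) set) \<Rightarrow>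
   (('m \<Rightarrow> 'a \<Rightarrow> complex) \<Rightarrow> 'b \<Rightarrow> complex) \<Rightarrow> bool" where
  "multilinear_upto E V T \<longleftrightarrow>
     (\<forall>f j g h a b. (\<forall>i. f i \<in> V i) \<and> g \<in> V j \<and> h \<in> V j \<longrightarrow>
        E (T (f(j := \<lambda>x. a * g x + b * h x)))
          (\<lambda>z. a * T (f(j := g)) z + b * T (f(j := h)) z))"

text \<open>
  Operators on \<open>L\<^sup>p\<close> spaces act on representatives; that the a.e. class of the result depends only on
  the classes of the arguments follows from multilinearity and boundedness.
\<close>

definition bounded_multilinear_Lp ::
  "('m::finite \<Rightarrow> real) \<Rightarrow> real \<Rightarrow>
   (('m \<Rightarrow> real ^ 'n::finite \<Rightarrow> complex) \<Rightarrow> real ^ 'n \<Rightarrow> complex) \<Rightarrow> bool" where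
  "bounded_multilinear_Lp p q S \<longleftrightarrow>
     (\<forall>f. (\<forall>j. f j \<in> Lp (p j)) \<longrightarrow> S f \<in> Lp q) \<and>
     multilinear_upto (\<lambda>g h. AE x in lebesgue. g x = h x) (\<lambda>j. Lp (p j)) S \<and>
     (\<exists>B::real. \<forall>f. (\<forall>j. f j \<in> Lp (p j)) \<longrightarrow>
        Lp_norm q (S f) \<le> ennreal B * (\<Prod>j\<in>UNIV. Lp_norm (p j) (f j)))"

section \<open>Multilinear Calderon--Zygmund operators\<close>

text \<open>
  A point \<open>(y\<^sub>0, y\<^sub>1, \<dots>, y\<^sub>m)\<close> is a function on \<^typ>\<open>'m option\<close>, with \<^const>\<open>None\<close> in the role of
  the index \<open>0\<close>. Kernels are total; their values on the diagonal are irrelevant.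
\<close>

definition point :: "real ^ 'n \<Rightarrow> real ^ 'n ^ 'm \<Rightarrow> 'm option \<Rightarrow> real ^ 'n" where
  "point x y = case_option x (\<lambda>j. y $ j)"

definition off_diagonal :: "('m option \<Rightarrow> real ^ 'n) set" where
  "off_diagonal = {y. \<exists>k l. y k \<noteq> y l}"

definition CZ_kernel :: "(('m::finite option \<Rightarrow> real ^ 'n::finite) \<Rightarrow> complex) \<Rightarrow> bool" where
  "CZ_kernel K \<longleftrightarrow>
     (\<exists>A>0. \<exists>\<epsilon>>0.
        (\<forall>y\<in>off_diagonal.
           norm (K y) \<le> A / (\<Sum>k\<in>UNIV. \<Sum>l\<in>UNIV. norm (y k - y l)) ^ (CARD('m) * CARD('n))) \<and>
        (\<forall>y\<in>off_diagonal. \<forall>j z.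
           norm (y j - z) \<le> 1/2 * Max (range (\<lambda>k. norm (y j - y k))) \<longrightarrow>
           norm (K y - K (y(j := z))) \<le> A * norm (y j - z) powr \<epsilon> /
             (\<Sum>k\<in>UNIV. \<Sum>l\<in>UNIV. norm (y k - y l)) powr (real (CARD('m) * CARD('n)) + \<epsilon>)))"

text \<open>
  The exponents satisfy \<open>1 \<le> p\<^sub>j < \<infinity>\<close> and \<open>1/q = \<Sum>\<^sub>j 1/p\<^sub>j\<close>. As \<open>T f\<close> is a distribution, ``\<open>S\<close>
  extends \<open>T\<close>'' and the kernel representation off \<open>\<Inter>\<^sub>j supp f\<^sub>j\<close> are equalities of distributions
  with functions.
\<close>

definition CZ_operator ::
  "(('m::finite \<Rightarrow> real ^ 'n::finite \<Rightarrow> complex) \<Rightarrow> (real ^ 'n \<Rightarrow> complex) \<Rightarrow> complex) \<Rightarrow>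
   (('m option \<Rightarrow> real ^ 'n) \<Rightarrow> complex) \<Rightarrow> bool" where
  "CZ_operator T K \<longleftrightarrow>
     (\<forall>f. (\<forall>j. f j \<in> schwartz) \<longrightarrow> tempered_distribution (T f)) \<and>
     multilinear_upto (\<lambda>u v. \<forall>\<phi>\<in>schwartz. u \<phi> = v \<phi>) (\<lambda>j. schwartz) T \<and>
     (\<exists>p q S. (\<forall>j. 1 \<le> p j) \<and> 1 / q = (\<Sum>j\<in>UNIV. 1 / p j) \<and>
        bounded_multilinear_Lp p q S \<and>
        (\<forall>f. (\<forall>j. f j \<in> schwartz) \<longrightarrow> coincides_on UNIV (T f) (S f))) \<and>
     CZ_kernel K \<and>
     (\<forall>f. (\<forall>j. f j \<in> schwartz) \<longrightarrow>
        coincides_on (- (\<Inter>j. supp (f j))) (T f)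
          (\<lambda>x. \<integral>y. K (point x y) * (\<Prod>j\<in>UNIV. f j (y $ j)) \<partial>lebesgue))"

text \<open>The supremum is taken in \<open>[0, \<infinity>]\<close>; the Bochner integral of a non-integrable function is \<open>0\<close>.\<close>

definition maximal_iterated_commutator ::
  "(('m::finite option \<Rightarrow> real ^ 'n::finite) \<Rightarrow> complex) \<Rightarrow> ('m \<Rightarrow> real ^ 'n \<Rightarrow> complex) \<Rightarrow>
   ('m \<Rightarrow> real ^ 'n \<Rightarrow> complex) \<Rightarrow> real ^ 'n \<Rightarrow> ennreal" where
  "maximal_iterated_commutator K b f x =
     (SUP \<delta>\<in>{0<..}. ennreal (norm
        (LINT y:{y. (\<Sum>j\<in>UNIV. (norm (x - y $ j))\<^sup>2) > \<delta>\<^sup>2}|lebesgue.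
           (\<Prod>j\<in>UNIV. b j x - b j (y $ j)) * K (point x y) * (\<Prod>i\<in>UNIV. f i (y $ i)))))"

section \<open>BMO and multiple weights\<close>

definition cubes :: "(real ^ 'n::finite) set set" where
  "cubes = {cbox c (\<chi> i. c $ i + r) | c r. r > 0}"

definition average :: "(real ^ 'n::finite) set \<Rightarrow> (real ^ 'n \<Rightarrow> complex) \<Rightarrow> complex" where
  "average Q b = (LINT x:Q|lebesgue. b x) /\<^sub>R measure lebesgue Q"

definition BMO :: "(real ^ 'n::finite \<Rightarrow> complex) set" where
  "BMO = {b. (\<forall>S. compact S \<longrightarrow> set_integrable lebesgue S b) \<and>
     (SUP Q\<in>cubes. (\<integral>\<^sup>+x\<in>Q. ennreal (norm (b x - average Q b)) \<partial>lebesgue)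
        / emeasure lebesgue Q) < \<infinity>}"

definition ess_inf_on :: "(real ^ 'n::finite) set \<Rightarrow> (real ^ 'n \<Rightarrow> real) \<Rightarrow> ennreal" where
  "ess_inf_on Q w = Sup {c. AE x in lebesgue. x \<in> Q \<longrightarrow> c \<le> ennreal (w x)}"

definition weight :: "(real ^ 'n::finite \<Rightarrow> real) \<Rightarrow> bool" where
  "weight w \<longleftrightarrow> w \<in> borel_measurable lebesgue \<and> (\<forall>x. 0 \<le> w x)"

definition weighted_measure :: "(real ^ 'n::finite \<Rightarrow> real) \<Rightarrow> (real ^ 'n) set \<Rightarrow> ennreal" where
  "weighted_measure w E = (\<integral>\<^sup>+x\<in>E. ennreal (w x) \<partial>lebesgue)"

definition nu :: "('m::finite \<Rightarrow> real ^ 'n::finite \<Rightarrow> real) \<Rightarrow> real ^ 'n \<Rightarrow> real" where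
  "nu \<omega> x = (\<Prod>j\<in>UNIV. \<omega> j x powr (1 / CARD('m)))"

definition A_ones :: "('m::finite \<Rightarrow> real ^ 'n::finite \<Rightarrow> real) set" where
  "A_ones = {\<omega>. (\<forall>i. weight (\<omega> i)) \<and>
     (SUP Q\<in>cubes. (weighted_measure (nu \<omega>) Q / emeasure lebesgue Q) ^ CARD('m)
        * (\<Prod>i\<in>UNIV. inverse (ess_inf_on Q (\<omega> i)))) < \<infinity>}"

section \<open>The Young function\<close>

definition log_plus :: "real \<Rightarrow> real" where
  "log_plus s = (if s \<le> 1 then 0 else ln s)"

definition Phi :: "real \<Rightarrow> real" where
  "Phi s = s * (1 + log_plus s)"

end

theory Submission
  imports Defs
begin

text \<open>
 The extended operator \<open>S\<close> is of weak type (1,...,1), by Calderon--Zygmund decomposition in one slot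
 after the other. Comparing the truncated integrals at comparable scales with \<open>S\<close> (a Cotlar inequality) bounds
 all truncations localised to a dyadic cube, outside of a subset of small measure. Expanding
 \<open>\<Prod>j. (b j x - c j) - (b j y - c j)\<close> with averages \<open>c j\<close> and iterating over stopping cubes dominates the truncated
 commutator by a sparse sum of \<open>(\<Prod>j. 1 + |b j x - c j|) * (\<Prod>j. \<alpha> j)\<close>, where \<open>\<alpha> j\<close> is the average of
 \<open>(1 + |b j - c j|) * |f j|\<close>.

 The weight \<open>\<nu>\<close> satisfies an A1-type condition, so the John--Nirenberg inequality holds for \<open>\<nu>\<close> and the first factors
 have polynomially decaying distribution on each cube. Since the \<open>\<nu>\<close>-measure of the layers of a sparse family decays
 geometrically, grouping the cubes by the size \<open>4 ^ -r\<close> of \<open>\<Prod>j. \<alpha> j\<close> reduces the theorem to a weak type bound for the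
 maximal function of \<open>\<Prod>j. \<alpha> j\<close>. By the Young inequality for exp and L log L each \<open>\<alpha> j\<close> is controlled by an L log L
 average of \<open>f j\<close>, and that bound follows from a Vitali covering and the A(1,...,1) condition.
\<close>

text \<open>The target is weak L^(1/m), with no duality and no triangle inequality to use, and the
  assumed bound lands in an L^q where q may be below 1. Hence estimates are statements about
  exceptional sets: a fraction \<eta> of a cube is thrown away and only the constant pays. A second
  obstacle is that the operator meets its kernel only through distributions on Schwartz functions;
  the representation must first be carried to integrable inputs, almost everywhere on open sets
  where one slot vanishes. A third is the product of m averages: its level sets say nothing about a
  single factor. One logarithm per slot resolves this: after \<open>Phi\<close> of the rescaled
  function is split off from \<open>Phi ^^ m\<close>, there remain m - 1 logarithms in each slot,
  and together they pay for the slots with tiny averages (\<open>hh_prod\<close>). The price is that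
  the maximal function is controlled only by N / s^2 for s \<le> 1. The oscillation factors make up
  for it with decay t^-5: since 2^5 exceeds 4^2, the levels 4^-r can be summed with thresholds
  growing like 2^r.\<close>

type_synonym 'n cfun = "real ^ 'n \<Rightarrow> complex"

abbreviation "borel_fun \<equiv> borel_measurable borel"

abbreviation "leb_fun \<equiv> borel_measurable lebesgue"

abbreviation vol :: "'a::euclidean_space set \<Rightarrow> ennreal" where "vol \<equiv> emeasure lborel"

abbreviation lvol :: "'a::euclidean_space set \<Rightarrow> ennreal" where "lvol \<equiv> emeasure lebesgue"

abbreviation wm :: "('a::euclidean_space \<Rightarrow> ennreal) \<Rightarrow> 'a set \<Rightarrow> ennreal" where "wm w \<equiv> emeasure (density lborel w)"

abbreviation en :: "('a \<Rightarrow> 'b::real_normed_vector) \<Rightarrow> 'a \<Rightarrow> ennreal" where "en f \<equiv> \<lambda>y. ennreal (norm (f y))"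

abbreviation nn_lborel :: "('a::euclidean_space \<Rightarrow> ennreal) \<Rightarrow> ennreal" (binder "NN " 10) where "nn_lborel \<equiv> nn_integral lborel"

abbreviation L1 :: "('a::euclidean_space \<Rightarrow> 'b::real_normed_vector) \<Rightarrow> ennreal" where "L1 f \<equiv> \<integral>\<^sup>+y. ennreal (norm (f y)) \<partial>lborel"

abbreviation prod_UNIV :: "('i \<Rightarrow> 'a) \<Rightarrow> 'a::comm_monoid_mult" (binder "PU " 10) where "prod_UNIV f \<equiv> prod f UNIV"


section \<open>Product measure\<close>

lemma measurable_vec_nth [measurable]:
 "(\<lambda>y :: 'a::euclidean_space ^ 'm::finite. y $ j) \<in> borel_fun"
 by (intro borel_measurable_continuous_onI continuous_intros)

lemma measurable_vec_lambda_PiM: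
 "(\<lambda>f. \<chi> j. f j) \<in> measurable (Pi\<^sub>M (UNIV :: 'm::finite set) (\<lambda>_. borel)) (borel :: ('a::euclidean_space ^ 'm) measure)"
proof (subst borel_measurable_euclidean_space, intro ballI)
 fix i :: "'a ^ 'm" assume "i \<in> Basis"
 then obtain k u where i: "i = axis k u" by (auto simp: Basis_vec_def)
 have "(\<lambda>f. f k \<bullet> u) \<in> borel_measurable (Pi\<^sub>M (UNIV :: 'm set) (\<lambda>_. borel :: 'a measure))"
  by measurable
 then show "(\<lambda>f. (\<chi> j. f j) \<bullet> i) \<in> borel_measurable (Pi\<^sub>M (UNIV :: 'm set) (\<lambda>_. borel :: 'a measure))"
  by (simp add: i inner_axis)
qed

text \<open>Lebesgue measure is determined by its values on boxes, and a box of tuples is a product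
  of boxes because the basis vectors are \<open>axis j b\<close>. This opens Fubini for finite
  products to integrals over tuples.\<close>

lemma lborel_vec_eq:
 "(lborel :: ('a::euclidean_space ^ 'm::finite) measure) =
   distr (Pi\<^sub>M (UNIV :: 'm set) (\<lambda>_. lborel)) borel (\<lambda>f. \<chi> j. f j)"
proof (rule lborel_eqI)
 interpret product_sigma_finite "\<lambda>_::'m. lborel :: 'a measure" by standard
 have m: "(\<lambda>f. \<chi> j. f j) \<in> measurable (Pi\<^sub>M (UNIV :: 'm set) (\<lambda>_. lborel)) (borel :: ('a ^ 'm) measure)"
  using measurable_vec_lambda_PiM by (subst measurable_cong_sets[OF sets_PiM_cong refl]) auto
 fix l u :: "'a ^ 'm"
 assume lu: "\<And>b. b \<in> Basis ==> l \<bullet> b \<le> u \<bullet> b"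
 have lu': "l $ j \<bullet> b \<le> u $ j \<bullet> b" if "b \<in> Basis" for j b
  using lu[of "axis j b"] that by (auto simp: inner_axis Basis_vec_def)
 have box: "(\<lambda>f. \<chi> j. f j) -` box l u \<inter> space (Pi\<^sub>M (UNIV :: 'm set) (\<lambda>_. lborel)) = Pi\<^sub>E UNIV (\<lambda>j. box (l $ j) (u $ j))"
  by (auto simp: box_def Basis_vec_def inner_axis space_PiM PiE_def)
 have "emeasure (distr (Pi\<^sub>M (UNIV :: 'm set) (\<lambda>_. lborel)) borel (\<lambda>f. \<chi> j. f j)) (box l u) =
   emeasure (Pi\<^sub>M (UNIV :: 'm set) (\<lambda>_. lborel :: 'a measure)) (Pi\<^sub>E UNIV (\<lambda>j. box (l $ j) (u $ j)))"
  by (subst emeasure_distr[OF m]) (simp_all add: box)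
 also have "\<dots> = (PU j. vol (box (l $ j) (u $ j)))"
  by (rule emeasure_PiM) auto
 also have "\<dots> = (PU j. ennreal (\<Prod>b\<in>Basis. (u $ j - l $ j) \<bullet> b))"
  by (intro prod.cong refl emeasure_lborel_box) (auto simp: lu')
 also have "\<dots> = ennreal (PU j. \<Prod>b\<in>Basis. (u $ j - l $ j) \<bullet> b)"
  by (rule prod_ennreal) (auto intro!: prod_nonneg simp: inner_diff_left lu')
 also have "(\<Prod>j\<in>(UNIV::'m set). \<Prod>b\<in>Basis. (u $ j - l $ j) \<bullet> b) = (\<Prod>(j, b)\<in>UNIV \<times> Basis. (u $ j - l $ j) \<bullet> b)"
  by (simp add: prod.cartesian_product)
 also have "\<dots> = (\<Prod>b\<in>Basis. (u - l) \<bullet> b)"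
 proof -
  have "bij_betw (\<lambda>(j, b). axis j b) (UNIV \<times> Basis) (Basis :: ('a ^ 'm) set)"
   by (auto simp: bij_betw_def inj_on_def Basis_vec_def axis_eq_axis image_iff)
  then show ?thesis
   by (subst prod.reindex_bij_betw[symmetric]) (auto simp: inner_axis split_beta)
 qed
 finally show "emeasure (distr (Pi\<^sub>M (UNIV :: 'm set) (\<lambda>_. lborel)) borel (\<lambda>f. \<chi> j. f j)) (box l u) =
  ennreal (\<Prod>b\<in>Basis. (u - l) \<bullet> b)" .
qed auto

lemma measurable_vec_lambda_lborel:
 "(\<lambda>f. \<chi> j. f j) \<in> measurable (Pi\<^sub>M (UNIV :: 'm::finite set) (\<lambda>_. lborel)) (borel :: ('a::euclidean_space ^ 'm) measure)"
 using measurable_vec_lambda_PiM by (subst measurable_cong_sets[OF sets_PiM_cong refl]) auto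

lemma nn_integral_prod_vec:
 fixes F :: "'m::finite => 'a::euclidean_space => ennreal"
 assumes [measurable]: "\<And>j. F j \<in> borel_fun"
 shows "(NN y. (PU j. F j (y $ j))) = (PU j. NN x. F j x)"
proof -
 interpret product_sigma_finite "\<lambda>_::'m. lborel :: 'a measure" by standard
 have "(NN y. (PU j. F j (y $ j))) =
   (\<integral>\<^sup>+y. (PU j. F j (y j)) \<partial>(Pi\<^sub>M (UNIV :: 'm set) (\<lambda>_. lborel)))"
  by (subst lborel_vec_eq, subst nn_integral_distr[OF measurable_vec_lambda_lborel]) auto
 also have "\<dots> = (PU j. NN x. F j x)"
  by (rule product_nn_integral_prod) auto
 finally show ?thesis .
qed

definition upd :: "'a ^ 'm => 'm => 'a => 'a ^ 'm" where
 "upd y j z = (\<chi> i. if i = j then z else y $ i)"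

lemma upd_nth [simp]: "upd y j z $ i = (if i = j then z else y $ i)"
 by (simp add: upd_def)

lemma integral_cancel_slot:
 fixes \<psi> :: "'a::euclidean_space => complex" and H :: "'a ^ 'm::finite => complex"
 assumes int: "integrable lborel (\<lambda>y. H y * \<psi> (y $ j))"
  and H: "\<And>y z. H (upd y j z) = H y"
  and \<psi>: "(\<integral>x. \<psi> x \<partial>lborel) = 0"
 shows "(\<integral>y. H y * \<psi> (y $ j) \<partial>lborel) = 0"
proof -
 interpret product_sigma_finite "\<lambda>_::'m. lborel :: 'a measure" by standard
 let ?P = "Pi\<^sub>M (UNIV :: 'm set) (\<lambda>_. lborel :: 'a measure)"
 let ?G = "\<lambda>f. H (\<chi> i. f i) * \<psi> (f j)"
 have meas: "(\<lambda>y. H y * \<psi> (y $ j)) \<in> borel_fun"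
  using borel_measurable_integrable[OF int] by simp
 have intG: "integrable ?P ?G"
  using int by (subst (asm) lborel_vec_eq, subst (asm) integrable_distr_eq[OF measurable_vec_lambda_lborel meas]) simp
 have "(\<integral>y. H y * \<psi> (y $ j) \<partial>lborel) = (\<integral>f. ?G f \<partial>?P)"
  by (subst lborel_vec_eq, subst integral_distr[OF measurable_vec_lambda_lborel meas]) simp
 also have "\<dots> = (\<integral>f. ?G f \<partial>(Pi\<^sub>M (insert j (UNIV - {j})) (\<lambda>_. lborel)))"
  by (simp add: insert_UNIV insert_absorb)
 also have "\<dots> = (\<integral>x. (\<integral>z. ?G (x(j := z)) \<partial>lborel) \<partial>(Pi\<^sub>M (UNIV - {j}) (\<lambda>_. lborel)))"
  by (rule product_integral_insert) (use intG in \<open>auto simp: insert_UNIV insert_absorb\<close>)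
 also have "\<dots> = (\<integral>x. 0 \<partial>(Pi\<^sub>M (UNIV - {j}) (\<lambda>_. lborel :: 'a measure)))"
 proof (rule Bochner_Integration.integral_cong[OF refl])
  fix x :: "'m => 'a"
  have "H (\<chi> i. (x(j := z)) i) = H (\<chi> i. x i)" for z
  proof -
   have "(\<chi> i. (x(j := z)) i) = upd (\<chi> i. x i) j z" by (simp add: vec_eq_iff)
   then show ?thesis by (simp add: H)
  qed
  then have "(\<integral>z. ?G (x(j := z)) \<partial>lborel) = (\<integral>z. H (\<chi> i. x i) * \<psi> z \<partial>lborel)"
   by (intro Bochner_Integration.integral_cong) auto
  also have "\<dots> = 0" by (simp add: \<psi>)
  finally show "(\<integral>z. ?G (x(j := z)) \<partial>lborel) = 0" .
 qed
 finally show ?thesis by simp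
qed

lemma norm_integral_le_nn:
 fixes f :: "'a => 'b::{banach, second_countable_topology}"
 shows "ennreal (norm (\<integral>x. f x \<partial>M)) \<le> (\<integral>\<^sup>+x. en f x \<partial>M)"
 by (cases "integrable M f") (auto simp: integral_norm_bound_ennreal not_integrable_integral_eq)

lemma integrable_prod_vec:
 fixes g :: "'m::finite => 'a::euclidean_space => complex"
 assumes "\<And>j. integrable lborel (g j)"
 shows "integrable lborel (\<lambda>y. PU j. g j (y $ j))"
proof (rule integrableI_bounded)
 have [measurable]: "g j \<in> borel_fun" for j using borel_measurable_integrable[OF assms] by simp
 show "(\<lambda>y. PU j. g j (y $ j)) \<in> borel_measurable lborel" by measurable
 have "(NN y. ennreal (norm (PU j. g j (y $ j)))) = (NN y. (PU j. ennreal (norm (g j (y $ j)))))"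
  by (simp add: prod_norm[symmetric] prod_ennreal)
 also have "\<dots> = (PU j. NN x. en (g j) x)"
  by (rule nn_integral_prod_vec) measurable
 also have "\<dots> < \<infinity>"
 proof -
  have "L1 (g j) \<noteq> \<infinity>" for j
   using assms[of j] by (simp add: integrable_iff_bounded)
  then show ?thesis by (simp add: less_top[symmetric] ennreal_prod_eq_top)
 qed
 finally show "(NN y. ennreal (norm (PU j. g j (y $ j)))) < \<infinity>" .
qed

section \<open>Maximal functions and tails\<close>

text \<open>The centred Hardy-Littlewood maximal function of \<open>u\<close> at \<open>x\<close> is
  at most \<open>A\<close> divided by the volume of the unit ball: masses are compared with powers
  of the radius instead of ball volumes.\<close>

definition maxbd :: "('a::euclidean_space => ennreal) => real => 'a => bool" where
 "maxbd u A x \<longleftrightarrow> (\<forall>r>0. (NN y. u y * indicator (cball x r) y) \<le> ennreal (A * r ^ DIM('a)))"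

text \<open>Strict inequality leaves room to enlarge the radius by some \<open>d\<close>, and the
  ball of radius \<open>r + d\<close> about any centre within \<open>d\<close> contains the
  violating ball. Openness makes the exceptional sets Borel.\<close>

lemma open_not_maxbd:
 fixes u :: "'a::euclidean_space => ennreal"
 assumes [measurable]: "u \<in> borel_fun"
 shows "open {x. \<not> maxbd u A x}"
 unfolding open_contains_ball
proof safe
 fix x assume "\<not> maxbd u A x"
 then obtain r where r: "r > 0" "(NN y. u y * indicator (cball x r) y) > ennreal (A * r ^ DIM('a))"
  by (auto simp: maxbd_def not_le)
 let ?I = "NN y. u y * indicator (cball x r) y"
 have "((\<lambda>d. ennreal (A * (r + d) ^ DIM('a))) \<longlongrightarrow> ennreal (A * (r + 0) ^ DIM('a))) (at_right 0)"
  by (intro tendsto_intros)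
 then have "eventually (\<lambda>d. ennreal (A * (r + d) ^ DIM('a)) < ?I) (at_right 0)"
  using r by (intro order_tendstoD) auto
 then obtain d where d: "d > 0" "ennreal (A * (r + d) ^ DIM('a)) < ?I"
 proof -
  assume "eventually (\<lambda>d. ennreal (A * (r + d) ^ DIM('a)) < ?I) (at_right 0)"
   and *: "\<And>d. d > 0 ==> ennreal (A * (r + d) ^ DIM('a)) < ?I ==> thesis"
  then obtain b :: real where b: "b > 0" "\<forall>y>0. y < b --> ennreal (A * (r + y) ^ DIM('a)) < ?I"
   by (auto simp: eventually_at_right_field)
  then show thesis by (intro *[of "b / 2"]) auto
 qed
 show "\<exists>e>0. ball x e \<subseteq> {x. \<not> maxbd u A x}"
 proof (intro exI[of _ d] conjI subsetI CollectI notI)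
  fix z assume z: "z \<in> ball x d" and m: "maxbd u A z"
  have "?I \<le> (NN y. u y * indicator (cball z (r + d)) y)"
  proof (intro nn_integral_mono mult_left_mono)
   fix y
   have "dist z y \<le> dist x z + dist x y" by (metis dist_commute dist_triangle)
   show "(indicator (cball x r) y :: ennreal) \<le> indicator (cball z (r + d)) y"
    using \<open>dist z y \<le> dist x z + dist x y\<close> z by (auto simp: indicator_def)
  qed simp
  also have "\<dots> \<le> ennreal (A * (r + d) ^ DIM('a))"
   using m r(1) d(1) by (auto simp: maxbd_def)
  finally show False using d by simp
 qed (use d in auto)
qed

lemma emeasure_UN_countable_le:
 assumes C: "countable C" and X [measurable]: "\<And>i. i \<in> C ==> X i \<in> sets M"
 shows "emeasure M (\<Union>i\<in>C. X i) \<le> (\<integral>\<^sup>+i. emeasure M (X i) \<partial>count_space C)"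
proof -
 have meas: "(\<Union>i\<in>C. X i) \<in> sets M" using C X by (intro sets.countable_UN'') auto
 have "emeasure M (\<Union>i\<in>C. X i) = (\<integral>\<^sup>+x. indicator (\<Union>i\<in>C. X i) x \<partial>M)"
  using meas by simp
 also have "\<dots> \<le> (\<integral>\<^sup>+x. (\<integral>\<^sup>+i. indicator (X i) x \<partial>count_space C) \<partial>M)"
 proof (rule nn_integral_mono)
  fix x
  show "indicator (\<Union>i\<in>C. X i) x \<le> (\<integral>\<^sup>+i. indicator (X i) x \<partial>count_space C :: ennreal)"
  proof (cases "x \<in> (\<Union>i\<in>C. X i)")
   case True
   then obtain i where i: "i \<in> C" "x \<in> X i" by auto
   then have "(indicator (\<Union>i\<in>C. X i) x :: ennreal) \<le> indicator (X i) x" by (auto simp: indicator_def)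
   also have "\<dots> \<le> (\<integral>\<^sup>+i. indicator (X i) x \<partial>count_space C)"
    using i(1) by (rule nn_integral_ge_point)
   finally show ?thesis .
  qed simp
 qed
 also have "\<dots> = (\<integral>\<^sup>+i. (\<integral>\<^sup>+x. indicator (X i) x \<partial>M) \<partial>count_space C)"
  using C by (intro nn_integral_count_space_nn_integral) auto
 also have "\<dots> = (\<integral>\<^sup>+i. emeasure M (X i) \<partial>count_space C)"
  by (intro nn_integral_cong) (auto simp: X)
 finally show ?thesis .
qed

text \<open>Vitali: disjoint violating balls each carry mass above \<open>A * r ^ n\<close>, and
  their fivefold dilates cover the set.\<close>

lemma maxbd_weak_type:
 fixes u :: "'a::euclidean_space => ennreal"
 assumes [measurable]: "u \<in> borel_fun" and A: "A > 0"
 shows "vol {x. \<not> maxbd u A x} \<le> ennreal (unit_ball_vol (DIM('a)) * 5 ^ DIM('a) / A) * (NN y. u y)"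
proof (cases "(NN y. u y) = \<infinity>")
 case True
 have "unit_ball_vol (real DIM('a)) * 5 ^ DIM('a) / A > 0" using A by (simp add: unit_ball_vol_pos)
 then have "ennreal (unit_ball_vol (real DIM('a)) * 5 ^ DIM('a) / A) * \<infinity> = \<infinity>"
  by (metis ennreal_eq_0_iff ennreal_mult_top infinity_ennreal_def not_le)
 then show ?thesis by (simp only: True) simp
next
 case False
 then obtain U where U: "(NN y. u y) = ennreal U" "U \<ge> 0"
  by (cases "NN y. u y") auto
 let ?n = "DIM('a)"
 let ?K = "{x. \<not> maxbd u A x}"
 have "\<forall>x\<in>?K. \<exists>r>0. (NN y. u y * indicator (cball x r) y) > ennreal (A * r ^ ?n)"
  by (auto simp: maxbd_def not_le)
 then obtain r where r: "\<And>x. x \<in> ?K ==> r x > 0"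
  "\<And>x. x \<in> ?K ==> (NN y. u y * indicator (cball x (r x)) y) > ennreal (A * r x ^ ?n)"
  by metis
 \<comment> \<open>The covering lemma wants bounded radii. A radius above 1 satisfies r \<le> r^n,
   and A r^n is below the total mass U.\<close>
 have bound: "r x \<le> max 1 (U / A)" if "x \<in> ?K" for x
 proof (cases "r x \<le> 1")
  case False
  have "(NN y. u y * indicator (cball x (r x)) y) \<le> (NN y. u y)"
   by (intro nn_integral_mono) (auto simp: indicator_def)
  then have "ennreal (A * r x ^ ?n) < ennreal U" using r(2)[OF that] U by simp
  then have "A * r x ^ ?n < U" using A r(1)[OF that] U by (simp add: ennreal_less_iff)
  moreover have "r x \<le> r x ^ ?n" using False by (intro self_le_power) auto
  ultimately have "A * r x < U" using A by (meson le_less_trans mult_left_mono less_imp_le)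
  then have "r x \<le> U / A" using A by (simp add: field_simps)
  then show ?thesis by simp
 qed auto
 obtain C where C: "countable C" "C \<subseteq> ?K" "pairwise (\<lambda>i j. disjnt (cball i (r i)) (cball j (r j))) C"
  "?K \<subseteq> (\<Union>i\<in>C. cball i (5 * r i))"
 proof (rule Vitali_covering_lemma_cballs[where S = ?K and K = ?K and a = "\<lambda>x. x" and r = r and B = "max 1 (U / A)"])

   show "?K \<subseteq> (\<Union>i\<in>?K. cball i (r i))"
   proof
    fix x assume x: "x \<in> ?K"
    have "x \<in> cball x (r x)" using r(1)[OF x] by simp
    then show "x \<in> (\<Union>i\<in>?K. cball i (r i))" using x by blast
   qed
   show "0 < r i \<and> r i \<le> max 1 (U / A)" if "i \<in> ?K" for i
    using r(1)[OF that] bound[OF that] by blast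
  qed
 have disj: "disjoint_family_on (\<lambda>i. cball i (r i)) C"
  using C(3) by (auto simp: disjoint_family_on_def pairwise_def disjnt_def)
 have "vol ?K \<le> vol (\<Union>i\<in>C. cball i (5 * r i))"
  by (intro emeasure_mono C(4) sets.countable_UN'' C(1)) simp
 also have "\<dots> \<le> (\<integral>\<^sup>+i. vol (cball i (5 * r i)) \<partial>count_space C)"
  by (intro emeasure_UN_countable_le C(1)) simp
 also have "\<dots> \<le> (\<integral>\<^sup>+i. ennreal (unit_ball_vol ?n * 5 ^ ?n / A) * (NN y. u y * indicator (cball i (r i)) y) \<partial>count_space C)"
 proof (rule nn_integral_mono)
  fix i assume "i \<in> space (count_space C)"
  then have i: "i \<in> ?K" using C by auto
  have "vol (cball i (5 * r i)) = ennreal (unit_ball_vol ?n * (5 * r i) ^ ?n)"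
   using r(1)[OF i] by (intro emeasure_cball) auto
  also have "unit_ball_vol ?n * (5 * r i) ^ ?n = (unit_ball_vol ?n * 5 ^ ?n / A) * (A * r i ^ ?n)"
   using A by (simp add: power_mult_distrib field_simps)
  also have "ennreal \<dots> = ennreal (unit_ball_vol ?n * 5 ^ ?n / A) * ennreal (A * r i ^ ?n)"
  proof (rule ennreal_mult)
   show "0 \<le> unit_ball_vol ?n * 5 ^ ?n / A" using A by (simp add: unit_ball_vol_nonneg)
   show "0 \<le> A * r i ^ ?n" using A r(1)[OF i] by simp
  qed
  also have "\<dots> \<le> ennreal (unit_ball_vol ?n * 5 ^ ?n / A) * (NN y. u y * indicator (cball i (r i)) y)"
   using r(2)[OF i] by (intro mult_left_mono) auto
  finally show "vol (cball i (5 * r i)) \<le> \<dots>" .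
 qed
 also have "\<dots> = ennreal (unit_ball_vol ?n * 5 ^ ?n / A) * (\<integral>\<^sup>+i. (NN y. u y * indicator (cball i (r i)) y) \<partial>count_space C)"
  by (rule nn_integral_cmult) simp
 also have "(\<integral>\<^sup>+i. (NN y. u y * indicator (cball i (r i)) y) \<partial>count_space C) =
   (\<integral>\<^sup>+i. emeasure (density lborel u) (cball i (r i)) \<partial>count_space C)"
  by (intro nn_integral_cong, subst emeasure_density) simp_all
 also have "\<dots> = emeasure (density lborel u) (\<Union>i\<in>C. cball i (r i))"
  by (intro emeasure_UN_countable[symmetric] C(1) disj) simp
 also have "\<dots> \<le> emeasure (density lborel u) (space (density lborel u))"
  by (intro emeasure_space)
 also have "\<dots> = (NN y. u y)"
  by (subst emeasure_density) simp_all
 finally show ?thesis by (simp add: mult_left_mono)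
qed

lemma measurable_indicator_cball [measurable]:
 fixes x :: "'a::euclidean_space"
 shows "(\<lambda>y. indicator (cball x r) y :: ennreal) \<in> borel_fun"
 "(\<lambda>y. y \<in> cball x r) \<in> measurable borel (count_space UNIV)"
 by (rule borel_measurable_indicator, simp) (simp add: pred_def)

text \<open>The value of the series in \<open>tail_bound\<close>:
  \<open>2 powr (n + \<gamma>)\<close> is lost when the distance is compared with a dyadic radius,
  and the denominator sums the ratio \<open>2 powr - \<gamma>\<close>.\<close>

definition tailc :: "nat => real => real" where "tailc n \<gamma> = 2 powr (n + \<gamma>) / (1 - 2 powr - \<gamma>)"

lemma tailc_pos: "0 < \<gamma> ==> 0 < tailc n \<gamma>" by (simp add: tailc_def powr_less_one)

text \<open>The ball of radius 2^k r has mass at most A (2^k r)^n, while the weight on its outer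
  shell is of order (2^k r)^-(n + \<gamma>); the surplus 2^(-k \<gamma>) makes the series over k
  converge.\<close>

lemma tail_bound:
 fixes \<gamma> :: real and u :: "'a::euclidean_space => ennreal"
 assumes \<gamma>: "\<gamma> > 0" and [measurable]: "u \<in> borel_fun" and m: "maxbd u A x" and A: "A \<ge> 0" and r: "r > 0"
 shows "(NN y. u y * ennreal ((r + dist x y) powr - (DIM('a) + \<gamma>))) \<le> ennreal (tailc DIM('a) \<gamma> * A * r powr - \<gamma>)"
proof -
 let ?n = "DIM('a)" let ?s = "real ?n + \<gamma>"
 let ?q = "2 powr - \<gamma>"
 have q: "0 < ?q" "?q < 1" using \<gamma> by (auto simp: powr_less_one)
 let ?f = "\<lambda>k y. ennreal (2 powr ?s * (2 ^ k * r) powr - ?s) * (u y * indicator (cball x (2 ^ k * r)) y)"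
 have pw: "u y * ennreal ((r + dist x y) powr - ?s) \<le> (\<Sum>k. ?f k y)" for y
 proof -
  \<comment> \<open>The least dyadic multiple of \<open>r\<close> whose ball about \<open>x\<close>
    contains \<open>y\<close>; by minimality it is comparable to
    \<open>r + dist x y\<close>.\<close>
  obtain k where k: "dist x y \<le> 2 ^ k * r" "2 ^ k * r \<le> 2 * (r + dist x y)"
  proof (cases "dist x y \<le> r")
   case True
   then show ?thesis using r by (intro that[of 0]) simp_all
  next
   case False
   obtain N where N: "dist x y / r < 2 ^ N" using real_arch_pow[of 2 "dist x y / r"] by auto
   define k where "k = (LEAST k. dist x y \<le> 2 ^ k * r)"
   have "dist x y \<le> 2 ^ N * r" using N r by (simp add: pos_divide_less_eq)
   then have k1: "dist x y \<le> 2 ^ k * r"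
    unfolding k_def by (rule LeastI)
   then have "k \<noteq> 0" using False by (cases k) auto
   then obtain k' where k': "k = Suc k'" by (cases k) auto
   have "\<not> dist x y \<le> 2 ^ k' * r" using not_less_Least[of k' "\<lambda>k. dist x y \<le> 2 ^ k * r"] k' by (auto simp: k_def)
   then have "2 ^ k * r \<le> 2 * dist x y" using k' by simp
   then show ?thesis using k1 r by (intro that[of k]) simp_all
  qed
  have "(r + dist x y) powr - ?s \<le> ((2 ^ k * r) / 2) powr - ?s"
   using k r \<gamma> by (intro powr_mono2') auto
  also have "\<dots> = 2 powr ?s * (2 ^ k * r) powr - ?s"
   using r by (simp add: powr_divide powr_minus divide_simps) (simp add: powr_add[symmetric])
  finally have "u y * ennreal ((r + dist x y) powr - ?s) \<le> ?f k y"
   using k by (simp add: mult.commute mult_left_mono)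
  also have "\<dots> = (\<Sum>i\<in>{k}. ?f i y)" by simp
  also have "\<dots> \<le> (\<Sum>k. ?f k y)" by (rule sum_le_suminf) auto
  finally show ?thesis .
 qed
 have "(NN y. u y * ennreal ((r + dist x y) powr - ?s)) \<le> (NN y. (\<Sum>k. ?f k y))"
  by (intro nn_integral_mono pw)
 also have "\<dots> = (\<Sum>k. \<integral>\<^sup>+y. ?f k y \<partial>lborel)"
  by (rule nn_integral_suminf) measurable
 also have "\<dots> \<le> (\<Sum>k. ennreal (2 powr ?s * A * r powr - \<gamma> * ?q ^ k))"
 proof (intro suminf_le)
  fix k :: nat
  have "(NN y. ?f k y) = ennreal (2 powr ?s * (2 ^ k * r) powr - ?s) * (NN y. u y * indicator (cball x (2 ^ k * r)) y)"
   by (rule nn_integral_cmult) measurable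
  also have "\<dots> \<le> ennreal (2 powr ?s * (2 ^ k * r) powr - ?s) * ennreal (A * (2 ^ k * r) ^ ?n)"
   using m r by (intro mult_left_mono) (auto simp: maxbd_def)
  also have "\<dots> = ennreal (2 powr ?s * (2 ^ k * r) powr - ?s * (A * (2 ^ k * r) ^ ?n))"
   using A r by (intro ennreal_mult[symmetric]) auto
  also have "2 powr ?s * (2 ^ k * r) powr - ?s * (A * (2 ^ k * r) ^ ?n) = 2 powr ?s * A * ((2 ^ k * r) powr - ?s * (2 ^ k * r) powr (real ?n))"
   using r by (simp add: powr_realpow)
  also have "(2 ^ k * r) powr - ?s * (2 ^ k * r) powr (real ?n) = (2 ^ k * r) powr - \<gamma>"
   by (simp add: powr_add[symmetric])
  also have "\<dots> = r powr - \<gamma> * ?q ^ k"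
   using r by (simp add: powr_mult powr_realpow[symmetric] powr_powr mult.commute)
  finally show "(NN y. ?f k y) \<le> ennreal (2 powr ?s * A * r powr - \<gamma> * ?q ^ k)"
   by (simp add: mult.assoc)
 qed auto
 also have "\<dots> = ennreal (\<Sum>k. 2 powr ?s * A * r powr - \<gamma> * ?q ^ k)"
  using A q by (intro suminf_ennreal2 summable_mult summable_geometric) auto
 also have "(\<Sum>k. 2 powr ?s * A * r powr - \<gamma> * ?q ^ k) = tailc ?n \<gamma> * A * r powr - \<gamma>"
  using q by (subst suminf_mult) (auto simp: suminf_geometric summable_geometric tailc_def)
 finally show ?thesis .
qed

lemma maxbd_one: "maxbd (\<lambda>_::'a::euclidean_space. 1) (unit_ball_vol DIM('a)) x"
 by (auto simp: maxbd_def emeasure_cball)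

section \<open>Dyadic cubes\<close>

text \<open>Half-open, so that the dyadic cubes of one generation partition the space exactly;
  closed cubes differ by a null set (\<open>AE_hcube_cbox\<close>).\<close>

definition hcube :: "real ^ 'n::finite => real => (real ^ 'n) set" where
 "hcube c r = {y. \<forall>i. c $ i \<le> y $ i \<and> y $ i < c $ i + r}"

lemma hcube_borel [measurable]: "hcube c r \<in> sets borel"
proof -
 have "hcube c r = (\<Inter>i. {y. c $ i \<le> y $ i \<and> y $ i < c $ i + r})" by (auto simp: hcube_def)
 also have "\<dots> \<in> sets borel" by (intro sets.countable_INT) auto
 finally show ?thesis .
qed

lemma box_subset_hcube: "box c (\<chi> i. c $ i + r) \<subseteq> hcube c r"
 and hcube_subset_cbox: "hcube c r \<subseteq> cbox c (\<chi> i. c $ i + r)"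
 by (auto simp: hcube_def mem_box_cart less_imp_le)

lemma emeasure_cbox_cube:
 assumes "r \<ge> 0"
 shows "vol (cbox (c :: real ^ 'n::finite) (\<chi> i. c $ i + r)) = ennreal (r ^ CARD('n))"
  and "vol (box (c :: real ^ 'n::finite) (\<chi> i. c $ i + r)) = ennreal (r ^ CARD('n))"
proof -
 have inner: "c \<bullet> b \<le> (\<chi> i. c $ i + r) \<bullet> b" "((\<chi> i. c $ i + r) - c) \<bullet> b = r" if "b \<in> Basis" for b :: "real ^ 'n"
  using that assms by (auto simp: Basis_vec_def inner_axis)
 have "(\<Prod>b\<in>(Basis::(real ^ 'n) set). ((\<chi> i. c $ i + r) - c) \<bullet> b) = (\<Prod>b\<in>(Basis::(real ^ 'n) set). r)"
  using inner(2) by (intro prod.cong) auto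
 also have "\<dots> = r ^ CARD('n)" by simp
 finally have e: "(\<Prod>b\<in>(Basis::(real ^ 'n) set). ((\<chi> i. c $ i + r) - c) \<bullet> b) = r ^ CARD('n)" .
 show "vol (cbox c (\<chi> i. c $ i + r)) = ennreal (r ^ CARD('n))"
  by (subst emeasure_lborel_cbox) (simp_all add: inner(1) e)
 show "vol (box c (\<chi> i. c $ i + r)) = ennreal (r ^ CARD('n))"
  by (subst emeasure_lborel_box) (simp_all add: inner(1) e)
qed

lemma emeasure_hcube:
 assumes "r \<ge> 0"
 shows "vol (hcube (c :: real ^ 'n::finite) r) = ennreal (r ^ CARD('n))"
proof (rule antisym)
 show "vol (hcube c r) \<le> ennreal (r ^ CARD('n))"
  using emeasure_mono[OF hcube_subset_cbox[of c r], of lborel] emeasure_cbox_cube(1)[OF assms, of c] by simp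
 show "ennreal (r ^ CARD('n)) \<le> vol (hcube c r)"
  using emeasure_mono[OF box_subset_hcube[of c r], of lborel] emeasure_cbox_cube(2)[OF assms, of c] by simp
qed

lemma AE_hcube_cbox:
 assumes "r \<ge> 0"
 shows "AE y in lborel. y \<in> hcube (c :: real ^ 'n::finite) r \<longleftrightarrow> y \<in> cbox c (\<chi> i. c $ i + r)"
proof (rule AE_I)
 show "{y \<in> space lborel. \<not> (y \<in> hcube c r \<longleftrightarrow> y \<in> cbox c (\<chi> i. c $ i + r))} \<subseteq> cbox c (\<chi> i. c $ i + r) - hcube c r"
  using hcube_subset_cbox[of c r] by auto
 show "vol (cbox c (\<chi> i. c $ i + r) - hcube c r) = 0"
  using hcube_subset_cbox[of c r] assms by (subst emeasure_Diff) (auto simp: emeasure_hcube emeasure_cbox_cube)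
qed auto

lemma dist_hcube:
 fixes x :: "real ^ 'n::finite"
 assumes "x \<in> hcube c r" "y \<in> hcube c r"
 shows "dist x y \<le> real CARD('n) * r"
proof -
 have "dist x y \<le> (\<Sum>i\<in>UNIV. \<bar>(x - y) $ i\<bar>)" unfolding dist_norm by (rule norm_le_l1_cart)
 also have "\<dots> \<le> (\<Sum>i\<in>(UNIV::'n set). r)"
 proof (rule sum_mono)
  fix i
  have "c $ i \<le> x $ i" "x $ i < c $ i + r" "c $ i \<le> y $ i" "y $ i < c $ i + r"
   using assms by (auto simp: hcube_def)
  then show "\<bar>(x - y) $ i\<bar> \<le> r" by simp
 qed
 finally show ?thesis by simp
qed

text \<open>The dyadic cube of generation \<open>k\<close> through \<open>x\<close> in the grid with
  origin \<open>a\<close> and unit \<open>L\<close>, described by equal integer addresses. Any point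
  of a cube names it, so families of cubes become predicates on a generation and a point.\<close>

definition dy :: "real ^ 'n::finite => real => nat => real ^ 'n => (real ^ 'n) set" where
 "dy a L k x = {y. \<forall>i. \<lfloor>2 ^ k * (y $ i - a $ i) / L\<rfloor> = \<lfloor>2 ^ k * (x $ i - a $ i) / L\<rfloor>}"

definition dlo :: "real ^ 'n::finite => real => nat => real ^ 'n => real ^ 'n" where
 "dlo a L k x = (\<chi> i. a $ i + L / 2 ^ k * of_int \<lfloor>2 ^ k * (x $ i - a $ i) / L\<rfloor>)"

lemma dy_hcube:
 assumes "L > 0"
 shows "dy a L k x = hcube (dlo a L k x) (L / 2 ^ k)"
proof -
 have "\<lfloor>2 ^ k * (y - a) / L\<rfloor> = z \<longleftrightarrow> a + L / 2 ^ k * of_int z \<le> y \<and> y < a + L / 2 ^ k * of_int z + L / 2 ^ k"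
  for y a :: real and z :: int
 proof -
  have "\<lfloor>2 ^ k * (y - a) / L\<rfloor> = z \<longleftrightarrow> of_int z \<le> 2 ^ k * (y - a) / L \<and> 2 ^ k * (y - a) / L < of_int z + 1"
   by (rule floor_eq_iff)
  also have "\<dots> \<longleftrightarrow> L * of_int z \<le> 2 ^ k * (y - a) \<and> 2 ^ k * (y - a) < L * of_int z + L"
   using assms by (simp add: pos_le_divide_eq pos_divide_less_eq algebra_simps)
  also have "\<dots> \<longleftrightarrow> L / 2 ^ k * of_int z \<le> y - a \<and> y - a < L / 2 ^ k * of_int z + L / 2 ^ k"
  proof -
   have "L / 2 ^ k * of_int z \<le> y - a \<longleftrightarrow> L * of_int z \<le> 2 ^ k * (y - a)"
    by (simp add: pos_divide_le_eq mult.commute)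
   moreover have "y - a < L / 2 ^ k * of_int z + L / 2 ^ k \<longleftrightarrow> 2 ^ k * (y - a) < L * of_int z + L"
    by (simp add: add_divide_distrib[symmetric] pos_less_divide_eq mult.commute)
   ultimately show ?thesis by simp
  qed
  also have "\<dots> \<longleftrightarrow> a + L / 2 ^ k * of_int z \<le> y \<and> y < a + L / 2 ^ k * of_int z + L / 2 ^ k" by auto
  finally show ?thesis .
 qed
 then show ?thesis by (auto simp: dy_def hcube_def dlo_def)
qed

lemma dy_self [simp]: "x \<in> dy a L k x" by (simp add: dy_def)

lemma dy_eq: "y \<in> dy a L k x ==> dy a L k y = dy a L k x" by (simp add: dy_def)

text \<open>Halving the mesh doubles the number to be rounded, and
  \<open>\<lfloor>t\<rfloor> = \<lfloor>2 * t\<rfloor> div 2\<close> recovers the address of the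
  parent.\<close>

lemma dy_Suc: "dy a L (Suc k) x \<subseteq> dy a L k x"
proof -
 have "\<lfloor>t\<rfloor> = \<lfloor>2 * t\<rfloor> div 2" for t :: real
  using floor_divide_of_int_eq[of "\<lfloor>2 * t\<rfloor>" 2] floor_divide_real_eq_div[of 2 "2 * t"] by simp
 from this[of "2 ^ k * (y $ i - a $ i) / L" for y i]
 have *: "\<lfloor>2 ^ k * (y $ i - a $ i) / L\<rfloor> = \<lfloor>2 ^ Suc k * (y $ i - a $ i) / L\<rfloor> div 2" for y i
  by (simp only: power_Suc mult.assoc times_divide_eq_right)
 show ?thesis
 proof
  fix y assume "y \<in> dy a L (Suc k) x"
  then have "\<lfloor>2 ^ Suc k * (y $ i - a $ i) / L\<rfloor> = \<lfloor>2 ^ Suc k * (x $ i - a $ i) / L\<rfloor>" for i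
   unfolding dy_def by blast
  then show "y \<in> dy a L k x" unfolding dy_def using *[of y] *[of x] by simp
 qed
qed

lemma dy_mono: "k \<le> l ==> dy a L l x \<subseteq> dy a L k x"
 by (induction l rule: dec_induct) (use dy_Suc in blast)+

lemma dy_top: "L > 0 ==> dy a L 0 a = hcube a L"
 by (simp add: dy_hcube dlo_def)

lemma dy_borel [measurable]: "dy a L k x \<in> sets borel"
proof -
 have "dy a L k x = (\<Inter>i. {y. \<lfloor>2 ^ k * (y $ i - a $ i) / L\<rfloor> = \<lfloor>2 ^ k * (x $ i - a $ i) / L\<rfloor>})" by (auto simp: dy_def)
 also have "\<dots> \<in> sets borel" by (intro sets.countable_INT) auto
 finally show ?thesis .
qed

lemma emeasure_dy:
 "L > 0 ==> vol (dy (a :: real ^ 'n::finite) L k x) = ennreal ((L / 2 ^ k) ^ CARD('n))"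
 by (simp add: dy_hcube emeasure_hcube)

lemma dist_dy: "L > 0 ==> y \<in> dy a L k x ==> z \<in> dy a L k x ==> dist y z \<le> real CARD('n) * (L / 2 ^ k)"
 for a :: "real ^ 'n::finite"
 by (rule dist_hcube[of _ "dlo a L k x"]) (auto simp: dy_hcube)

lemma countable_dy: "countable (range (dy a L k))"
proof (rule countable_subset)
 show "range (dy a L k) \<subseteq> range (\<lambda>f :: 'a => int. {y. \<forall>i. \<lfloor>2 ^ k * (y $ i - a $ i) / L\<rfloor> = f i})"
  by (auto simp: dy_def)
qed auto

lemma countable_dy_all: "countable {dy a L k x | k x. True}"
proof -
 have "{dy a L k x | k x. True} = (\<Union>k. range (dy a L k))" by auto
 then show ?thesis by (simp add: countable_dy)
qed

text \<open>The Calderon--Zygmund selection: from each point of \<open>Q\<close> one descends below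
  generation \<open>k\<close> until \<open>Bd\<close> first occurs. \<open>Q\<close> may be any set,
  and then the chosen cubes can stick out of it.\<close>

definition stopfam :: "real ^ 'n::finite => real => nat => (real ^ 'n) set => ((real ^ 'n) set => bool) => (real ^ 'n) set set" where
 "stopfam a L k Q Bd = {dy a L l y | l y. y \<in> Q \<and> k < l \<and> Bd (dy a L l y) \<and> (\<forall>i. k < i \<and> i < l --> \<not> Bd (dy a L i y))}"

lemma countable_stopfam: "countable (stopfam a L k Q Bd)"
 by (rule countable_subset[OF _ countable_dy_all[of a L]]) (auto simp: stopfam_def)

lemma stopfam_borel: "P \<in> stopfam a L k Q Bd ==> P \<in> sets borel"
 unfolding stopfam_def using dy_borel by blast

text \<open>Two chosen cubes through a common point are both the first bad cube at that
  point.\<close>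

lemma stopfam_disjoint: "disjoint (stopfam a L k Q Bd)"
proof (rule disjointI)
 fix P P' assume P: "P \<in> stopfam a L k Q Bd" "P' \<in> stopfam a L k Q Bd" "P \<noteq> P'"
 show "P \<inter> P' = {}"
 proof (rule ccontr)
  assume "P \<inter> P' \<noteq> {}"
  then obtain z where z: "z \<in> P" "z \<in> P'" by auto
  have least: "\<exists>l. S = dy a L l z \<and> k < l \<and> Bd (dy a L l z) \<and> (\<forall>i. k < i \<and> i < l --> \<not> Bd (dy a L i z))"
   if S: "S \<in> stopfam a L k Q Bd" "z \<in> S" for S
  proof -
   obtain l y where S': "S = dy a L l y" "k < l" "Bd (dy a L l y)" "\<forall>i. k < i \<and> i < l --> \<not> Bd (dy a L i y)"
    using S by (auto simp: stopfam_def)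
   have e: "dy a L i z = dy a L i y" if "i \<le> l" for i
    using dy_mono[OF that, of a L y] S(2) S'(1) by (intro dy_eq) auto
   show ?thesis using S' e by (intro exI[of _ l]) simp
  qed
  obtain l l' where l: "P = dy a L l z" "k < l" "Bd (dy a L l z)" "\<forall>i. k < i \<and> i < l --> \<not> Bd (dy a L i z)"
   and l': "P' = dy a L l' z" "k < l'" "Bd (dy a L l' z)" "\<forall>i. k < i \<and> i < l' --> \<not> Bd (dy a L i z)"
   using least[OF P(1) z(1)] least[OF P(2) z(2)] by auto
  have "l = l'" by (metis l(2-4) l'(2-4) linorder_neqE_nat)
  then show False using l l' P(3) by simp
 qed
qed

lemma Union_stopfam_supset:
 "{y \<in> Q. \<exists>l>k. Bd (dy a L l y)} \<subseteq> \<Union>(stopfam a L k Q Bd)"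
proof safe
 fix y l assume y: "y \<in> Q" "k < l" "Bd (dy a L l y)"
 define l' where "l' = (LEAST l. k < l \<and> Bd (dy a L l y))"
 have l': "k < l' \<and> Bd (dy a L l' y)" unfolding l'_def by (rule LeastI[of "\<lambda>l. k < l \<and> Bd (dy a L l y)" l]) (use y in simp)
 have "\<not> Bd (dy a L i y)" if "k < i" "i < l'" for i
  using not_less_Least[of i "\<lambda>l. k < l \<and> Bd (dy a L l y)"] that by (auto simp: l'_def)
 then have "dy a L l' y \<in> stopfam a L k Q Bd" using y(1) l' by (auto simp: stopfam_def)
 then show "y \<in> \<Union>(stopfam a L k Q Bd)" by (rule UnionI) simp
qed

lemma Union_stopfam:
 "\<Union>(stopfam a L k (dy a L k x) Bd) = {y \<in> dy a L k x. \<exists>l>k. Bd (dy a L l y)}"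
proof (rule antisym[OF _ Union_stopfam_supset], safe)
 fix P y assume "P \<in> stopfam a L k (dy a L k x) Bd" and y: "y \<in> P"
 then obtain l z where P: "P = dy a L l z" "z \<in> dy a L k x" "k < l" "Bd P" by (auto simp: stopfam_def)
 have "P \<subseteq> dy a L k z" using P dy_mono[of k l a L z] by auto
 then show "y \<in> dy a L k x" using y dy_eq[OF P(2)] by auto
 show "\<exists>l>k. Bd (dy a L l y)" using P y dy_eq[of y a L l z] by auto
qed

text \<open>Countable additivity carries a comparison of two measures from each cube of a disjoint
  family to their union; most stopping arguments end with it.\<close>

lemma emeasure_Union_le:
 assumes F: "countable F" "disjoint F" "\<And>P. P \<in> F ==> P \<in> sets borel"
  and M: "sets M = sets borel" and N: "sets N = sets borel"
  and le: "\<And>P. P \<in> F ==> emeasure M P \<le> c * emeasure N P"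
 shows "emeasure M (\<Union>F) \<le> c * emeasure N (\<Union>F)"
proof -
 have disj: "disjoint_family_on (\<lambda>P. P) F" using F(2) unfolding disjoint_family_on_def disjoint_def by blast
 have "emeasure M (\<Union>P\<in>F. P) = (\<integral>\<^sup>+P. emeasure M P \<partial>count_space F)"
  by (intro emeasure_UN_countable F(1) disj) (simp add: F(3) M)
 also have "\<dots> \<le> (\<integral>\<^sup>+P. c * emeasure N P \<partial>count_space F)"
  by (intro nn_integral_mono) (auto simp: le)
 also have "\<dots> = c * (\<integral>\<^sup>+P. emeasure N P \<partial>count_space F)"
  by (intro nn_integral_cmult) auto
 also have "(\<integral>\<^sup>+P. emeasure N P \<partial>count_space F) = emeasure N (\<Union>P\<in>F. P)"
  by (intro emeasure_UN_countable[symmetric] F(1) disj) (simp add: F(3) N)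
 finally show ?thesis by (simp only: image_ident)
qed

lemma Union_borel: "countable F ==> (\<And>P. P \<in> F ==> P \<in> sets borel) ==> \<Union>F \<in> sets borel"
 using sets.countable_Union[of F borel] by blast

lemma Union_stopfam_borel [measurable]: "\<Union>(stopfam a L k Q Bd) \<in> sets borel"
 by (rule Union_borel[OF countable_stopfam stopfam_borel])

text \<open>A one-sided Lebesgue differentiation theorem; outer regularity suffices for it.\<close>

lemma dyadic_AE_le:
 fixes g :: "real ^ 'n::finite => ennreal"
 assumes L: "L > 0" and [measurable]: "g \<in> borel_fun" "E \<in> sets borel"
  and E: "vol E < \<infinity>" and \<Lambda>: "\<Lambda> \<ge> 0"
  and avg: "\<And>x l. x \<in> E ==> k < l ==> (NN y. g y * indicator (dy a L l x) y) \<le> ennreal \<Lambda> * vol (dy a L l x)"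
 shows "AE x in lborel. x \<in> E --> g x \<le> ennreal \<Lambda>"
proof -
 have null: "vol {x \<in> E. g x \<ge> ennreal (\<Lambda> + \<eta>)} = 0" if \<eta>: "\<eta> > 0" for \<eta>
 proof -
  define F where "F = {x \<in> E. g x \<ge> ennreal (\<Lambda> + \<eta>)}"
  have [measurable]: "F \<in> sets borel" unfolding F_def by measurable
  have "vol F \<le> vol E" by (intro emeasure_mono) (auto simp: F_def)
  with E obtain v where v: "vol F = ennreal v" "v \<ge> 0"
   by (cases "vol F") (auto simp: top_unique)
  \<comment> \<open>\<open>F\<close> is covered by disjoint dyadic cubes inside an open set
    exceeding it by less than \<open>e\<close>. Each cube contains a point of \<open>E\<close>, so
    the mean of \<open>g\<close> on it is at most \<Lambda>, while \<open>g\<close> is at least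
    \<Lambda> + \<eta> on \<open>F\<close>.\<close>
  have le: "(\<Lambda> + \<eta>) * v \<le> \<Lambda> * (v + e)" if e: "e > 0" for e
  proof -
   obtain G where G: "open G" "F \<subseteq> G" "vol (G - F) < ennreal e"
    using \<open>F \<in> sets borel\<close> e by (rule outer_regular_lborel)
   have [measurable]: "G \<in> sets borel" using G by auto
   define S where "S = stopfam a L k F (\<lambda>P. P \<subseteq> G)"
   have FS: "F \<subseteq> \<Union>S"
   proof -
    have "\<exists>l>k. dy a L l y \<subseteq> G" if yF: "y \<in> F" for y
    proof -
     obtain d where d: "d > 0" "ball y d \<subseteq> G"
      using openE[OF G(1), of y] subsetD[OF G(2) yF] by blast
     obtain N where N: "real CARD('n) * L / d < 2 ^ N" using real_arch_pow[of 2 "real CARD('n) * L / d"] by auto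
     define l where "l = Suc (k + N)"
     have "(2::real) ^ N \<le> 2 ^ l" by (intro power_increasing) (auto simp: l_def)
     with N have "real CARD('n) * L / d < 2 ^ l" by linarith
     then have "real CARD('n) * L < d * 2 ^ l" using d by (simp add: pos_divide_less_eq mult.commute)
     then have "real CARD('n) * (L / 2 ^ l) < d" by (simp add: pos_divide_less_eq)
     then have "dy a L l y \<subseteq> ball y d"
      using dist_dy[OF L dy_self, of _ a l y] by (force intro: le_less_trans)
     then show ?thesis using d by (intro exI[of _ l]) (auto simp: l_def)
    qed
    then show ?thesis using Union_stopfam_supset[of F k "\<lambda>P. P \<subseteq> G" a L] by (auto simp: S_def)
   qed
   have SG: "\<Union>S \<subseteq> G" by (auto simp: S_def stopfam_def)
   have "emeasure (density lborel g) (\<Union>S) \<le> ennreal \<Lambda> * vol (\<Union>S)"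
   proof (rule emeasure_Union_le)
    fix P assume "P \<in> S"
    then obtain l y where P: "P = dy a L l y" "y \<in> F" "k < l" by (auto simp: S_def stopfam_def)
    show "emeasure (density lborel g) P \<le> ennreal \<Lambda> * vol P"
     using avg[of y l] P by (simp add: emeasure_density F_def)
   qed (auto simp: S_def countable_stopfam stopfam_disjoint stopfam_borel)
   moreover have "ennreal ((\<Lambda> + \<eta>) * v) \<le> emeasure (density lborel g) (\<Union>S)"
   proof -
    have "ennreal ((\<Lambda> + \<eta>) * v) = (NN x. ennreal (\<Lambda> + \<eta>) * indicator F x)"
     using \<Lambda> \<eta> v by (simp add: nn_integral_cmult_indicator ennreal_mult)
    also have "\<dots> \<le> (NN x. g x * indicator (\<Union>S) x)"
     using FS by (intro nn_integral_mono) (auto simp: indicator_def F_def)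
    also have "\<dots> = emeasure (density lborel g) (\<Union>S)"
     by (subst emeasure_density) (auto simp: S_def)
    finally show ?thesis .
   qed
   moreover have "vol (\<Union>S) \<le> ennreal (v + e)"
   proof -
    have "vol (\<Union>S) \<le> vol (F \<union> (G - F))" using SG by (intro emeasure_mono) auto
    also have "\<dots> \<le> vol F + vol (G - F)" by (intro emeasure_subadditive) auto
    also have "\<dots> \<le> ennreal v + ennreal e" using v G by (intro add_mono) auto
    finally show ?thesis using v e by (simp add: ennreal_plus)
   qed
   ultimately have "ennreal ((\<Lambda> + \<eta>) * v) \<le> ennreal \<Lambda> * ennreal (v + e)"
    by (elim order_trans) (intro mult_left_mono, simp_all)
   then show ?thesis using \<Lambda> v e by (simp add: ennreal_mult[symmetric] del: ennreal_plus)
  qed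
  have "\<eta> * v \<le> 0 + e" if e: "e > 0" for e
  proof -
   \<comment> \<open>The excess \<open>e / (\<Lambda> + 1)\<close> absorbs the factor \<Lambda> and
     makes sense for \<Lambda> = 0 too.\<close>
   have "(\<Lambda> + \<eta>) * v \<le> \<Lambda> * (v + e / (\<Lambda> + 1))" using e \<Lambda> by (intro le) simp
   then have "\<eta> * v \<le> \<Lambda> / (\<Lambda> + 1) * e" by (simp add: algebra_simps)
   also have "\<dots> \<le> 1 * e" using e \<Lambda> by (intro mult_right_mono) auto
   finally show ?thesis by simp
  qed
  then have "\<eta> * v \<le> 0" by (rule field_le_epsilon)
  then have "v \<le> 0" using \<eta> by (simp add: mult_le_0_iff)
  then show ?thesis using v by (simp add: F_def)
 qed
 have "AE x in lborel. \<forall>i::nat. \<not> (x \<in> E \<and> g x \<ge> ennreal (\<Lambda> + 1 / Suc i))"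
 proof (rule AE_all_countable[THEN iffD2], rule allI)
  fix i :: nat
  show "AE x in lborel. \<not> (x \<in> E \<and> g x \<ge> ennreal (\<Lambda> + 1 / Suc i))"
   by (rule AE_I[OF _ null[of "1 / Suc i"]]) auto
 qed
 then show ?thesis
 proof eventually_elim
  case (elim x)
  show ?case
  proof
   assume "x \<in> E"
   then have *: "g x \<le> ennreal (\<Lambda> + 1 / Suc i)" for i :: nat using elim by (simp add: not_le less_imp_le)
   have "(\<lambda>i. ennreal (\<Lambda> + 1 / Suc i)) \<longlonglongrightarrow> ennreal (\<Lambda> + 0)"
    by (intro tendsto_ennrealI tendsto_intros LIMSEQ_Suc[OF lim_1_over_n])
   then show "g x \<le> ennreal \<Lambda>" using * by (intro tendsto_lowerbound[of _ _ sequentially "g x"]) auto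
  qed
 qed
qed


section \<open>Weights with the doubling and absolute continuity properties of A1\<close>

text \<open>Finiteness on cubes and an equivalent form of the A1 condition (mean at most
  \<open>D\<close> times the essential infimum): the infimum is tested on subsets \<open>E\<close>
  and denominators are cleared, which suits \<open>ennreal\<close>.\<close>

definition A1m :: "real => (real ^ 'n::finite => ennreal) => bool" where
 "A1m D w \<longleftrightarrow> w \<in> borel_fun \<and> 1 \<le> D \<and>
   (\<forall>c r. 0 < r --> wm w (hcube c r) < \<infinity> \<and>
    (\<forall>E\<in>sets borel. E \<subseteq> hcube c r -->
     wm w (hcube c r) * vol E \<le> ennreal (D * r ^ CARD('n)) * wm w E))"

lemma A1m_one: "A1m 1 (\<lambda>_ :: real ^ 'n::finite. 1)"
proof -
 have "density lborel (\<lambda>_ :: real ^ 'n. 1) = lborel"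
  by (rule density_1)
 then show ?thesis by (auto simp: A1m_def emeasure_hcube)
qed

text \<open>The defining inequality with the smaller cube as \<open>E\<close>.\<close>

lemma A1m_doubling:
 fixes w :: "real ^ 'n::finite => ennreal"
 assumes w: "A1m D w" and r: "0 < r" "0 < R" and sub: "hcube c r \<subseteq> hcube c' R"
 shows "wm w (hcube c' R) \<le> ennreal (D * (R / r) ^ CARD('n)) * wm w (hcube c r)"
proof -
 let ?m = "wm w" let ?n = "CARD('n)"
 have D: "D \<ge> 1" using w by (simp add: A1m_def)
 have "?m (hcube c' R) * ennreal (r ^ ?n) \<le> ennreal (D * R ^ ?n) * ?m (hcube c r)"
  using w r sub emeasure_hcube[of r c] unfolding A1m_def by (metis hcube_borel less_imp_le)
 then have "ennreal (inverse (r ^ ?n)) * (?m (hcube c' R) * ennreal (r ^ ?n)) \<le> ennreal (inverse (r ^ ?n)) * (ennreal (D * R ^ ?n) * ?m (hcube c r))"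
  by (rule mult_left_mono) simp
 also have "ennreal (inverse (r ^ ?n)) * (?m (hcube c' R) * ennreal (r ^ ?n)) = ?m (hcube c' R) * ennreal (inverse (r ^ ?n) * r ^ ?n)"
  using r by (subst ennreal_mult) (auto simp: mult_ac)
 also have "inverse (r ^ ?n) * r ^ ?n = 1" using r by simp
 also have "ennreal (inverse (r ^ ?n)) * (ennreal (D * R ^ ?n) * ?m (hcube c r)) = ennreal (inverse (r ^ ?n) * (D * R ^ ?n)) * ?m (hcube c r)"
  using r D by (subst ennreal_mult) (auto simp: mult_ac)
 also have "inverse (r ^ ?n) * (D * R ^ ?n) = D * (R / r) ^ ?n" by (simp add: power_divide field_simps)
 finally show ?thesis by simp
qed

lemma ennreal_add_less_le:
 fixes a b c d :: ennreal
 assumes "a < c" "b \<le> d" "d < \<infinity>"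
 shows "a + b < c + d"
proof -
 have "a + b \<le> a + d" using assms by (intro add_left_mono)
 also have "\<dots> < c + d" using assms by (simp add: ennreal_add_left_cancel_less add.commute[of _ d])
 finally show ?thesis .
qed

text \<open>The complement fills at least half of the cube, so it carries at least the fraction
  \<open>1 / (2 * D)\<close> of the weight.\<close>

lemma A1m_half:
 fixes w :: "real ^ 'n::finite => ennreal"
 assumes w: "A1m D w" and r: "0 < r" and E [measurable]: "E \<in> sets borel" and sub: "E \<subseteq> hcube c r"
  and half: "vol E \<le> ennreal (r ^ CARD('n) / 2)"
 shows "wm w E \<le> ennreal (1 - 1 / (2 * D)) * wm w (hcube c r)"
proof -
 let ?m = "wm w" let ?n = "CARD('n)" let ?Q = "hcube c r"
 have D: "D \<ge> 1" and fin: "?m ?Q < \<infinity>" using w r by (auto simp: A1m_def)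
 have [measurable]: "w \<in> borel_fun" using w by (simp add: A1m_def)
 have add: "?m E + ?m (?Q - E) = ?m ?Q" "vol E + vol (?Q - E) = ennreal (r ^ ?n)"
  using plus_emeasure[of E "density lborel w" "?Q - E"] plus_emeasure[of E lborel "?Q - E"] sub r
  by (auto simp: Un_absorb1 emeasure_hcube)
 have fE: "?m E < \<infinity>" "?m (?Q - E) < \<infinity>" using fin add(1) by (metis ennreal_add_eq_top infinity_ennreal_def less_top)+
 then obtain e d where ed: "?m E = ennreal e" "0 \<le> e" "?m (?Q - E) = ennreal d" "0 \<le> d"
  by (metis ennreal_cases infinity_ennreal_def less_irrefl)
 then have mQ: "?m ?Q = ennreal (e + d)" using add(1) by simp
 have "ennreal (r ^ ?n / 2) \<le> vol (?Q - E)"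
 proof (rule ccontr)
  assume "\<not> ?thesis"
  then have "vol (?Q - E) + vol E < ennreal (r ^ ?n / 2) + ennreal (r ^ ?n / 2)"
   using half by (intro ennreal_add_less_le) (auto simp: not_le)
  also have "\<dots> = ennreal (r ^ ?n)" using r by (subst ennreal_plus[symmetric]) (auto simp del: ennreal_plus)
  finally show False using add(2) by (simp add: add.commute)
 qed
 then have "?m ?Q * ennreal (r ^ ?n / 2) \<le> ?m ?Q * vol (?Q - E)" by (intro mult_left_mono) auto
 also have "\<dots> \<le> ennreal (D * r ^ ?n) * ?m (?Q - E)" using w r by (auto simp: A1m_def)
 finally have "ennreal (e + d) * ennreal (r ^ ?n / 2) \<le> ennreal (D * r ^ ?n) * ennreal d" by (simp only: mQ ed)
 then have "(e + d) * (r ^ ?n / 2) \<le> D * r ^ ?n * d" using ed D r by (simp add: ennreal_mult[symmetric] del: ennreal_plus)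
 then have "(e + d) * r ^ ?n \<le> (2 * D * d) * r ^ ?n" by (simp add: algebra_simps)
 then have "e + d \<le> 2 * D * d" using r by simp
 then have "e \<le> (1 - 1 / (2 * D)) * (e + d)" using D by (simp add: field_simps)
 moreover have "0 \<le> 1 - 1 / (2 * D)" using D by (simp add: field_simps)
 ultimately show ?thesis using ed mQ by (simp add: ennreal_mult[symmetric] del: ennreal_plus)
qed

section \<open>The John--Nirenberg inequality\<close>

definition av :: "'n::finite cfun => real ^ 'n => real => complex" where
 "av b c r = (LINT y:hcube c r|lborel. b y) /\<^sub>R r ^ CARD('n)"

definition bmo :: "'n::finite cfun => real => bool" where
 "bmo b M \<longleftrightarrow> 0 < M \<and> b \<in> borel_fun \<and>
   (\<forall>c r. 0 < r --> set_integrable lborel (hcube c r) b \<and>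
    (NN y. ennreal (norm (b y - av b c r)) * indicator (hcube c r) y) \<le> ennreal (M * r ^ CARD('n)))"

lemma norm_av_diff_le:
 fixes b :: "'n::finite cfun"
 assumes b: "set_integrable lborel (hcube c r) b" and r: "0 < r" and C: "0 \<le> C"
  and le: "(NN y. ennreal (norm (b y - z)) * indicator (hcube c r) y) \<le> ennreal (C * r ^ CARD('n))"
 shows "norm (av b c r - z) \<le> C"
proof -
 let ?n = "CARD('n)" let ?Q = "hcube c r"
 have iz: "set_integrable lborel ?Q (\<lambda>_. z)"
  using r by (simp add: set_integrable_def emeasure_hcube)
 have "(LINT y:?Q|lborel. b y - z) = (LINT y:?Q|lborel. b y) - (LINT y:?Q|lborel. z)"
  using b iz by (rule set_integral_diff)
 also have "(LINT y:?Q|lborel. z) = r ^ ?n *\<^sub>R z"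
  using r by (simp add: set_lebesgue_integral_def measure_def emeasure_hcube)
 finally have e: "(LINT y:?Q|lborel. b y - z) = r ^ ?n *\<^sub>R (av b c r - z)"
  using r by (simp add: av_def scaleR_diff_right)
 have "ennreal (norm (LINT y:?Q|lborel. b y - z)) \<le> (NN y. ennreal (norm (indicator ?Q y *\<^sub>R (b y - z))))"
  unfolding set_lebesgue_integral_def by (rule norm_integral_le_nn)
 also have "\<dots> = (NN y. ennreal (norm (b y - z)) * indicator ?Q y)"
  by (intro nn_integral_cong) (auto simp: indicator_def)
 also have "\<dots> \<le> ennreal (C * r ^ ?n)" by (rule le)
 finally have "r ^ ?n * norm (av b c r - z) \<le> C * r ^ ?n" using r C by (simp add: e)
 then have "norm (av b c r - z) * r ^ ?n \<le> C * r ^ ?n" by (simp add: mult.commute)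
 then show ?thesis using r by simp
qed

text \<open>Induction over \<open>k\<close> for all cubes at once. The stopping cubes, on which the
  mean deviation from \<open>z\<close> exceeds 2 M, fill at most half of the volume, hence by
  \<open>A1m_half\<close> at most the fraction 1 - 1/(2 D) of the weight; and passing to one of them
  changes the average by at most 2^(n+1) M.\<close>

lemma John_Nirenberg:
 fixes b :: "'n::finite cfun" and w :: "real ^ 'n => ennreal"
 assumes w: "A1m D w" and b: "bmo b M" and r: "0 < r"
 shows "wm w {y \<in> hcube c r. norm (b y - av b c r) > real k * (2 ^ (CARD('n) + 1) * M)}
  \<le> ennreal ((1 - 1 / (2 * D)) ^ k) * wm w (hcube c r)"
 using r
proof (induction k arbitrary: c r)
 case 0
 then show ?case by (auto intro!: emeasure_mono)
next
 case (Suc k)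
 let ?m = "wm w" let ?n = "CARD('n)" let ?Q = "hcube c r"
 let ?\<Lambda> = "2 ^ (?n + 1) * M" let ?\<eta> = "1 - 1 / (2 * D)"
 have M: "0 < M" and [measurable]: "b \<in> borel_fun" "w \<in> borel_fun" and D: "1 \<le> D"
  using b w by (auto simp: bmo_def A1m_def)
 have \<eta>: "0 \<le> ?\<eta>" using D by (simp add: field_simps)
 have r: "0 < r" by fact
 define z where "z = av b c r"
 define g where "g y = ennreal (norm (b y - z))" for y
 have [measurable]: "g \<in> borel_fun" unfolding g_def by measurable
 define Bd where "Bd P \<longleftrightarrow> ennreal (2 * M) * vol P < (NN y. g y * indicator P y)" for P
 define F where "F = stopfam c r 0 ?Q Bd"
 have Q: "?Q = dy c r 0 c" using dy_top[OF r, of c] by simp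
 have intQ: "(NN y. g y * indicator ?Q y) \<le> ennreal (M * r ^ ?n)"
  using b r by (auto simp: bmo_def g_def z_def)
 have UF: "\<Union>F = {y \<in> ?Q. \<exists>l>0. Bd (dy c r l y)}"
  unfolding F_def Q by (rule Union_stopfam)
 have [measurable]: "\<Union>F \<in> sets borel" by (simp add: F_def)
 have F: "countable F" "disjoint F" "\<And>P. P \<in> F ==> P \<in> sets borel"
  by (auto simp: F_def countable_stopfam stopfam_disjoint stopfam_borel)
 have half: "vol (\<Union>F) \<le> ennreal (r ^ ?n / 2)"
 proof -
  have "vol (\<Union>F) \<le> ennreal (1 / (2 * M)) * emeasure (density lborel g) (\<Union>F)"
  proof (rule emeasure_Union_le[OF F])
   fix P assume P: "P \<in> F"
   then have "Bd P" by (auto simp: F_def stopfam_def)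
   then have "ennreal (1 / (2 * M)) * (ennreal (2 * M) * vol P) \<le> ennreal (1 / (2 * M)) * emeasure (density lborel g) P"
    using F(3)[OF P] by (intro mult_left_mono) (auto simp: Bd_def emeasure_density)
   also have "ennreal (1 / (2 * M)) * (ennreal (2 * M) * vol P) = ennreal (1 / (2 * M) * (2 * M)) * vol P"
    using M by (subst ennreal_mult) (auto simp: mult.assoc)
   finally show "vol P \<le> ennreal (1 / (2 * M)) * emeasure (density lborel g) P" using M by simp
  qed auto
  also have "emeasure (density lborel g) (\<Union>F) \<le> emeasure (density lborel g) ?Q"
   using UF by (intro emeasure_mono) auto
  also have "\<dots> \<le> ennreal (M * r ^ ?n)" using intQ by (simp add: emeasure_density)
  finally have "vol (\<Union>F) \<le> ennreal (1 / (2 * M)) * ennreal (M * r ^ ?n)"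
   by (simp add: mult_left_mono)
  also have "\<dots> = ennreal (1 / (2 * M) * (M * r ^ ?n))" using M r by (intro ennreal_mult[symmetric]) auto
  also have "1 / (2 * M) * (M * r ^ ?n) = r ^ ?n / 2" using M by simp
  finally show ?thesis .
 qed
 have off: "AE y in lborel. y \<in> ?Q - \<Union>F --> g y \<le> ennreal (2 * M)"
 proof (rule dyadic_AE_le[OF r, where k = 0 and a = c])
  have "vol (?Q - \<Union>F) \<le> vol ?Q" by (intro emeasure_mono) auto
  then show "vol (?Q - \<Union>F) < \<infinity>" using r by (auto simp: emeasure_hcube intro: le_less_trans)
  fix x l assume "x \<in> ?Q - \<Union>F" and l: "0 < (l::nat)"
  then have "\<not> Bd (dy c r l x)" unfolding UF using l by blast
  then show "(NN y. g y * indicator (dy c r l x) y) \<le> ennreal (2 * M) * vol (dy c r l x)"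
   by (simp add: Bd_def not_less)
 qed (use M in auto)
 define A where "A c' r' = {y \<in> hcube c' r'. norm (b y - av b c' r') > real k * ?\<Lambda>}" for c' r'
 \<comment> \<open>The parent of a stopping cube is either not bad or the top cube, where the mean
   deviation is at most \<open>M\<close>; passing to the child costs the volume ratio
   \<open>2 ^ n\<close>.\<close>
 have cube: "\<exists>c' r'. P = hcube c' r' \<and> 0 < r' \<and> norm (av b c' r' - z) \<le> ?\<Lambda>" if P: "P \<in> F" for P
 proof -
  obtain l y where l: "P = dy c r l y" "y \<in> ?Q" "0 < l" "\<forall>i. 0 < i \<and> i < l --> \<not> Bd (dy c r i y)"
   using P by (auto simp: F_def stopfam_def)
  obtain j where j: "l = Suc j" using l(3) by (cases l) auto
  have par: "(NN x. g x * indicator (dy c r j y) x) \<le> ennreal (2 * M * (r / 2 ^ j) ^ ?n)"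
  proof (cases "j = 0")
   case True
   have "dy c r 0 y = ?Q" using l(2) Q dy_eq by metis
   then have "(NN x. g x * indicator (dy c r j y) x) \<le> ennreal (M * r ^ ?n)" using intQ True by simp
   also have "\<dots> \<le> ennreal (2 * M * (r / 2 ^ j) ^ ?n)" using True M r by (intro ennreal_leI) auto
   finally show ?thesis .
  next
   case False
   then have "\<not> Bd (dy c r j y)" using l(4) j by auto
   then have "(NN x. g x * indicator (dy c r j y) x) \<le> ennreal (2 * M) * ennreal ((r / 2 ^ j) ^ ?n)"
    using r by (simp add: Bd_def not_less emeasure_dy)
   also have "\<dots> = ennreal (2 * M * (r / 2 ^ j) ^ ?n)" using M r by (intro ennreal_mult[symmetric]) auto
   finally show ?thesis .
  qed
  let ?c = "dlo c r l y" let ?r = "r / 2 ^ l"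
  have P': "P = hcube ?c ?r" and r': "0 < ?r" using r by (auto simp: l(1) dy_hcube)
  have "(NN x. ennreal (norm (b x - z)) * indicator (hcube ?c ?r) x) \<le> (NN x. g x * indicator (dy c r j y) x)"
  proof -
   have "hcube ?c ?r \<subseteq> dy c r j y" using dy_Suc[of c r j y] l(1) j P' by simp
   then show ?thesis unfolding g_def by (intro nn_integral_mono mult_left_mono) (auto simp: indicator_def)
  qed
  also have "\<dots> \<le> ennreal (2 * M * (r / 2 ^ j) ^ ?n)" by (rule par)
  also have "2 * M * (r / 2 ^ j) ^ ?n = ?\<Lambda> * ?r ^ ?n" by (simp add: j power_divide power_mult_distrib)
  finally have "norm (av b ?c ?r - z) \<le> ?\<Lambda>"
   using b r' M by (intro norm_av_diff_le) (auto simp: bmo_def)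
  then show ?thesis using P' r' by blast
 qed
 then obtain cc rr where cr: "\<And>P. P \<in> F ==> P = hcube (cc P) (rr P)" "\<And>P. P \<in> F ==> 0 < rr P"
  "\<And>P. P \<in> F ==> norm (av b (cc P) (rr P) - z) \<le> ?\<Lambda>"
  by metis
 have A [measurable]: "A c' r' \<in> sets borel" for c' r' unfolding A_def by measurable
 have UA: "(\<Union>P\<in>F. A (cc P) (rr P)) \<in> sets borel" using F(1) A by (intro sets.countable_UN'') auto
 \<comment> \<open>Off the stopping cubes the deviation is almost everywhere at most 2 M, below the
   threshold. On a stopping cube the change of average uses up one of the k + 1 multiples of the
   threshold.\<close>
 have "AE y in lborel. y \<in> {y \<in> ?Q. norm (b y - z) > real (Suc k) * ?\<Lambda>} --> y \<in> (\<Union>P\<in>F. A (cc P) (rr P))"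
  using off
 proof eventually_elim
  case (elim y)
  show ?case
  proof
   assume y: "y \<in> {y \<in> ?Q. norm (b y - z) > real (Suc k) * ?\<Lambda>}"
   have "?\<Lambda> \<le> real (Suc k) * ?\<Lambda>" using M by simp
   moreover have "2 * M \<le> ?\<Lambda>" using M one_le_power[of "2::real" ?n] by simp
   moreover have "real (Suc k) * ?\<Lambda> < norm (b y - z)" using y by blast
   ultimately have "2 * M < norm (b y - z)" by linarith
   then have "\<not> g y \<le> ennreal (2 * M)" using M by (simp add: g_def)
   then have "y \<in> \<Union>F" using elim y by auto
   then obtain P where P: "P \<in> F" "y \<in> P" by auto
   have "norm (b y - z) \<le> norm (b y - av b (cc P) (rr P)) + norm (av b (cc P) (rr P) - z)"
    using norm_triangle_ineq[of "b y - av b (cc P) (rr P)" "av b (cc P) (rr P) - z"] by simp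
   then have "norm (b y - av b (cc P) (rr P)) > real k * ?\<Lambda>"
    using y cr(3)[OF P(1)] by (simp add: algebra_simps)
   then have "y \<in> A (cc P) (rr P)" using P cr(1)[OF P(1)] by (simp add: A_def)
   then show "y \<in> (\<Union>P\<in>F. A (cc P) (rr P))" using P(1) by blast
  qed
 qed
 then have "?m {y \<in> ?Q. norm (b y - z) > real (Suc k) * ?\<Lambda>} \<le> ?m (\<Union>P\<in>F. A (cc P) (rr P))"
  using UA by (intro emeasure_mono_AE) (auto simp: AE_density)
 also have "\<dots> \<le> (\<integral>\<^sup>+P. ?m (A (cc P) (rr P)) \<partial>count_space F)"
  using F(1) by (intro emeasure_UN_countable_le) auto
 also have "\<dots> \<le> (\<integral>\<^sup>+P. ennreal (?\<eta> ^ k) * ?m P \<partial>count_space F)"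
 proof (rule nn_integral_mono)
  fix P assume "P \<in> space (count_space F)"
  then have P: "P \<in> F" by simp
  show "?m (A (cc P) (rr P)) \<le> ennreal (?\<eta> ^ k) * ?m P"
   using Suc.IH[OF cr(2)[OF P], of "cc P"] cr(1)[OF P] by (simp add: A_def)
 qed
 also have "\<dots> = ennreal (?\<eta> ^ k) * (\<integral>\<^sup>+P. ?m P \<partial>count_space F)" by (rule nn_integral_cmult) auto
 also have "(\<integral>\<^sup>+P. ?m P \<partial>count_space F) = ?m (\<Union>P\<in>F. P)"
  by (intro emeasure_UN_countable[symmetric] F(1)) (use F(2,3) in \<open>auto simp: disjoint_family_on_def disjoint_def\<close>)
 also have "(\<Union>P\<in>F. P) = \<Union>F" by (rule image_ident[THEN arg_cong[where f = Union]])
 also have "?m (\<Union>F) \<le> ennreal ?\<eta> * ?m ?Q"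
 proof (rule A1m_half[OF w r _ _ half])
  show "\<Union>F \<subseteq> ?Q" unfolding UF by blast
 qed simp
 finally have "?m {y \<in> ?Q. norm (b y - z) > real (Suc k) * ?\<Lambda>} \<le> ennreal (?\<eta> ^ k) * (ennreal ?\<eta> * ?m ?Q)"
  by (simp add: mult_left_mono)
 also have "\<dots> = ennreal (?\<eta> ^ Suc k) * ?m ?Q" using \<eta> by (simp add: ennreal_mult mult_ac)
 finally show ?case by (simp add: z_def)
qed

text \<open>The exponent \<theta> carries all dependence on \<open>b\<close>; the fixed 7 is the
  value 1 + (3/2) 4 of the series in \<open>John_Nirenberg_exp\<close>.\<close>

definition expint :: "real => 'n::finite cfun => bool" where
 "expint \<theta> b \<longleftrightarrow> (\<forall>c r. 0 < r -->
  (NN y. ennreal (exp (\<theta> * norm (b y - av b c r))) * indicator (hcube c r) y) \<le> ennreal (7 * r ^ CARD('n)))"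

lemma John_Nirenberg_exp:
 assumes b: "bmo b M"
 obtains \<theta> where "0 < \<theta>" "expint \<theta> (b :: 'n::finite cfun)"
proof (unfold expint_def, rule that, unfold expint_def, safe)
 let ?n = "CARD('n)" let ?\<Lambda> = "2 ^ (?n + 1) * M"
 have M: "0 < M" and [measurable]: "b \<in> borel_fun" using b by (auto simp: bmo_def)
 have \<Lambda>: "0 < ?\<Lambda>" using M by simp
 \<comment> \<open>One step of length \<open>2 ^ (CARD('n) + 1) * M\<close> raises the exponential
   by the factor 3/2, while for Lebesgue measure (D = 1) the layers shrink by 1/2; the ratio 3/4 is
   summable.\<close>
 define \<theta> where "\<theta> = ln (3 / 2) / ?\<Lambda>"
 show "0 < \<theta>" using \<Lambda> by (simp add: \<theta>_def)
 have e\<theta>: "exp (\<theta> * (real k * ?\<Lambda>)) = (3 / 2) ^ k" for k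
 proof -
  have "\<theta> * ?\<Lambda> = ln (3 / 2)" unfolding \<theta>_def using \<Lambda> by (simp only: nonzero_eq_divide_eq less_imp_neq[symmetric] divide_self_if times_divide_eq_left nonzero_mult_div_cancel_right not_False_eq_True)
  then have "\<theta> * (real k * ?\<Lambda>) = real k * ln (3 / 2)" by (metis mult.left_commute)
  then show ?thesis by (simp only: exp_of_nat_mult) simp
 qed
 fix c :: "real ^ 'n" and r :: real assume r: "0 < r"
 let ?Q = "hcube c r" let ?u = "\<lambda>y. norm (b y - av b c r)"
 let ?A = "\<lambda>k. {y \<in> ?Q. ?u y > real k * ?\<Lambda>}"
 have [measurable]: "?A k \<in> sets borel" for k by measurable
 have pw: "ennreal (exp (\<theta> * ?u y)) * indicator ?Q y \<le> indicator ?Q y + (\<Sum>k. ennreal ((3 / 2) ^ (k + 1)) * indicator (?A k) y)" for y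
 proof (cases "y \<in> ?Q \<and> ?u y > 0")
  case False
  then show ?thesis by (auto simp: indicator_def)
 next
  case True
  define k where "k = nat \<lceil>?u y / ?\<Lambda>\<rceil> - 1"
  have pos: "0 < ?u y / ?\<Lambda>" using True \<Lambda> by (intro divide_pos_pos) auto
  then have k1: "real (k + 1) = of_int \<lceil>?u y / ?\<Lambda>\<rceil>" by (simp add: k_def of_nat_diff nat_diff_distrib)
  then have "?u y / ?\<Lambda> \<le> real (k + 1)" "real k < ?u y / ?\<Lambda>" by linarith+
  then have k: "?u y \<le> real (k + 1) * ?\<Lambda>" "real k * ?\<Lambda> < ?u y"
   using \<Lambda> by (auto simp only: pos_divide_le_eq pos_less_divide_eq)
  have "exp (\<theta> * ?u y) \<le> exp (\<theta> * (real (k + 1) * ?\<Lambda>))" using k(1) \<open>0 < \<theta>\<close> by simp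
  also have "\<dots> = (3 / 2) ^ (k + 1)" by (rule e\<theta>)
  finally have "ennreal (exp (\<theta> * ?u y)) * indicator ?Q y \<le> ennreal ((3 / 2) ^ (k + 1)) * indicator (?A k) y"
   using True k(2) by (simp add: ennreal_leI)
  also have "\<dots> = (\<Sum>i\<in>{k}. ennreal ((3 / 2) ^ (i + 1)) * indicator (?A i) y)" by (simp only: sum.insert sum.empty finite.emptyI empty_iff not_False_eq_True add_0_right)
  also have "\<dots> \<le> (\<Sum>k. ennreal ((3 / 2) ^ (k + 1)) * indicator (?A k) y)" by (rule sum_le_suminf) auto
  finally show ?thesis by (simp add: add_increasing)
 qed
 have "(NN y. ennreal (exp (\<theta> * ?u y)) * indicator ?Q y) \<le>
   (NN y. indicator ?Q y + (\<Sum>k. ennreal ((3 / 2) ^ (k + 1)) * indicator (?A k) y))"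
  by (intro nn_integral_mono pw)
 also have "\<dots> = (NN y. indicator ?Q y) + (NN y. (\<Sum>k. ennreal ((3 / 2) ^ (k + 1)) * indicator (?A k) y))"
  by (rule nn_integral_add) measurable
 also have "(NN y. (\<Sum>k. ennreal ((3 / 2) ^ (k + 1)) * indicator (?A k) y)) = (\<Sum>k. \<integral>\<^sup>+y. ennreal ((3 / 2) ^ (k + 1)) * indicator (?A k) y \<partial>lborel)"
  by (rule nn_integral_suminf) measurable
 also have "\<dots> \<le> (\<Sum>k. ennreal (3 / 2 * r ^ ?n * (3 / 4) ^ k))"
 proof (intro suminf_le)
  fix k
  have "(NN y. ennreal ((3 / 2) ^ (k + 1)) * indicator (?A k) y) = ennreal ((3 / 2) ^ (k + 1)) * vol (?A k)"
   by (rule nn_integral_cmult_indicator) simp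
  also have "\<dots> \<le> ennreal ((3 / 2) ^ (k + 1)) * (ennreal ((1 / 2) ^ k) * ennreal (r ^ ?n))"
   using John_Nirenberg[OF A1m_one b r, of c k] r by (intro mult_left_mono) (auto simp: density_1 emeasure_hcube)
  also have "\<dots> = ennreal ((3 / 2) ^ (k + 1) * ((1 / 2) ^ k * r ^ ?n))"
   using r by (subst ennreal_mult, simp, simp, subst ennreal_mult) auto
  also have "(3 / 2) ^ (k + 1) * ((1 / 2) ^ k * r ^ ?n) = 3 / 2 * r ^ ?n * ((3 / 2) * (1 / 2)) ^ k"
   unfolding power_mult_distrib by simp
  also have "(3 / 2) * (1 / 2) = (3 / 4 :: real)" by simp
  finally show "(NN y. ennreal ((3 / 2) ^ (k + 1)) * indicator (?A k) y) \<le> ennreal (3 / 2 * r ^ ?n * (3 / 4) ^ k)" .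
 qed auto
 also have "(\<Sum>k. ennreal (3 / 2 * r ^ ?n * (3 / 4) ^ k)) = ennreal (\<Sum>k. 3 / 2 * r ^ ?n * (3 / 4) ^ k)"
  using r by (intro suminf_ennreal2 summable_mult summable_geometric) auto
 also have "(\<Sum>k. 3 / 2 * r ^ ?n * (3 / 4) ^ k) = 3 / 2 * r ^ ?n * 4"
  by (subst suminf_mult) (auto simp: suminf_geometric summable_geometric)
 also have "(NN y. indicator ?Q y) = ennreal (r ^ ?n)" using r by (simp add: emeasure_hcube)
 finally have "(NN y. ennreal (exp (\<theta> * ?u y)) * indicator ?Q y) \<le> ennreal (r ^ ?n) + ennreal (3 / 2 * r ^ ?n * 4)"
  by (simp add: add_left_mono)
 also have "\<dots> = ennreal (7 * r ^ ?n)" using r by (subst ennreal_plus[symmetric]) (auto simp del: ennreal_plus)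
 finally show "(NN y. ennreal (exp (\<theta> * ?u y)) * indicator ?Q y) \<le> ennreal (7 * r ^ ?n)" .
qed

section \<open>Smooth approximations of boxes\<close>

text \<open>The flat function exp(-e/t) with powers of 1/t: the factor \<open>t ^ k\<close> makes
  the family closed, up to linear combinations, under differentiation
  (\<open>sg_deriv\<close>).\<close>

definition sg :: "nat => real => real => real" where
 "sg k e t = (if 0 < t then exp (- e / t) / t ^ k else 0)"

lemma power_le_fact_exp: "0 \<le> x ==> x ^ n \<le> fact n * exp x" for x :: real
proof -
 assume x: "0 \<le> x"
 have "x ^ n /\<^sub>R fact n = (\<Sum>i\<in>{n}. x ^ i /\<^sub>R fact i)" by simp
 also have "\<dots> \<le> (\<Sum>i. x ^ i /\<^sub>R fact i)"
  using x by (intro sum_le_suminf summable_exp_generic) (auto simp: divide_simps)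
 finally have "x ^ n /\<^sub>R fact n \<le> exp x" by (simp add: exp_def)
 then show ?thesis by (simp add: divide_simps mult.commute)
qed

text \<open>From x^N \<le> N! exp x at x = e/t with N = k + j: the function vanishes at 0 to any
  order \<open>j\<close>. Order 2 settles the derivative at 0.\<close>

lemma sg_le:
 assumes e: "0 < e"
 shows "\<bar>sg k e t\<bar> \<le> fact (k + j) / e ^ (k + j) * \<bar>t\<bar> ^ j"
proof (cases "0 < t")
 case True
 have "(e / t) ^ (k + j) \<le> fact (k + j) * exp (e / t)" using True e by (intro power_le_fact_exp) auto
 then have "e ^ (k + j) \<le> fact (k + j) * exp (e / t) * t ^ (k + j)" using True by (simp add: power_divide pos_divide_le_eq)
 then have "e ^ (k + j) * exp (- (e / t)) \<le> fact (k + j) * exp (e / t) * t ^ (k + j) * exp (- (e / t))" by (rule mult_right_mono) simp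
 also have "\<dots> = fact (k + j) * t ^ (k + j)" by (simp add: exp_minus)
 finally have "e ^ (k + j) * exp (- (e / t)) \<le> fact (k + j) * t ^ j * t ^ k" by (simp add: power_add mult_ac)
 then have "exp (- (e / t)) / t ^ k \<le> fact (k + j) * t ^ j / e ^ (k + j)"
  using True e by (simp add: divide_simps mult_ac)
 then show ?thesis using True by (simp add: sg_def)
next
 case False
 then show ?thesis using e by (simp add: sg_def)
qed

lemma sg_deriv:
 assumes e: "0 < e"
 shows "(sg k e has_real_derivative (- real k * sg (k + 1) e t + e * sg (k + 2) e t)) (at t)"
proof -
 consider "0 < t" | "t < 0" | "t = 0" by linarith
 then show ?thesis
 proof cases
  case 1
  have "((\<lambda>t. exp (- e / t) / t ^ k) has_real_derivative (- real k * sg (k + 1) e t + e * sg (k + 2) e t)) (at t)"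
   using 1 by (auto intro!: derivative_eq_intros simp: sg_def field_simps power2_eq_square)
    (cases k; simp add: field_simps power2_eq_square)
  then show ?thesis
   by (rule has_field_derivative_transform_within_open[of _ _ _ "{0<..}"]) (use 1 in \<open>auto simp: sg_def\<close>)
 next
  case 2
  have "((\<lambda>_. 0 :: real) has_real_derivative 0) (at t)" by simp
  then have "(sg k e has_real_derivative 0) (at t)"
   by (rule has_field_derivative_transform_within_open[of _ _ _ "{..<0}"]) (use 2 in \<open>auto simp: sg_def\<close>)
  then show ?thesis using 2 by (simp add: sg_def)
 next
  case 3
  let ?C = "fact (k + 2) / e ^ (k + 2)"
  have "((\<lambda>h. (sg k e (0 + h) - sg k e 0) / h) \<longlongrightarrow> 0) (at 0)"
  proof (rule Lim_null_comparison)
   have "\<bar>sg k e h / h\<bar> \<le> ?C * \<bar>h\<bar>" for h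
   proof (cases "h = 0")
    case False
    have "\<bar>sg k e h\<bar> \<le> ?C * \<bar>h\<bar> ^ 2" by (rule sg_le[OF e])
    then have "\<bar>sg k e h\<bar> / \<bar>h\<bar> \<le> ?C * \<bar>h\<bar> ^ 2 / \<bar>h\<bar>" by (rule divide_right_mono) simp
    also have "?C * \<bar>h\<bar> ^ 2 / \<bar>h\<bar> = ?C * \<bar>h\<bar>" using False by (simp only: power2_eq_square times_divide_eq_right[symmetric]) simp
    finally show ?thesis by (simp only: abs_divide)
   qed simp
   then show "\<forall>\<^sub>F h in at 0. norm ((sg k e (0 + h) - sg k e 0) / h) \<le> ?C * \<bar>h\<bar>"
    by (intro always_eventually) (simp add: sg_def[of _ _ 0])
   have "((\<lambda>h::real. ?C * \<bar>h\<bar>) \<longlongrightarrow> ?C * \<bar>0\<bar>) (at 0)" by (intro tendsto_intros)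
   then show "((\<lambda>h::real. ?C * \<bar>h\<bar>) \<longlongrightarrow> 0) (at 0)" by simp
  qed
  then show ?thesis using 3 by (simp add: DERIV_def sg_def[of _ _ 0])
 qed
qed

text \<open>An algebra that contains the bumps and is stable under partial derivatives, so
  smoothness of bumps and of their products follows by induction, with no formula for higher
  derivatives.\<close>

inductive_set smg :: "'n::finite cfun set" where
 const: "(\<lambda>_. c) \<in> smg"
| base: "0 < e ==> (\<lambda>x. of_real (sg k e (s * (x $ i - c)))) \<in> smg"
| add: "f \<in> smg ==> g \<in> smg ==> (\<lambda>x. f x + g x) \<in> smg"
| mult: "f \<in> smg ==> g \<in> smg ==> (\<lambda>x. f x * g x) \<in> smg"

lemma partial_eq: "(f has_derivative f') (at x) ==> partial i f x = f' (axis i 1)"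
 unfolding partial_def by (simp add: frechet_derivative_at[symmetric])

lemma smg_derivative:
 fixes f :: "'n::finite cfun"
 shows "f \<in> smg ==> (\<forall>x. f differentiable (at x)) \<and> (\<forall>i. partial i f \<in> smg)"
proof (induction rule: smg.induct)
 case (const c)
 have d: "((\<lambda>_. c) has_derivative (\<lambda>_. 0)) (at x)" for x :: "real ^ 'n" by (rule has_derivative_const)
 have "partial i (\<lambda>_. c) = (\<lambda>_ :: real ^ 'n. 0)" for i by (rule ext) (rule partial_eq[OF d])
 then show ?case using smg.const[of 0] by simp
next
 case (base e k s j c)
 let ?g = "\<lambda>t. - real k * sg (k + 1) e t + e * sg (k + 2) e t"
 have d: "((\<lambda>x. of_real (sg k e (s * (x $ j - c))) :: complex) has_derivative (\<lambda>h. of_real (?g (s * (x $ j - c)) * (s * h $ j)))) (at x)" for x :: "real ^ 'n"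
 proof (rule has_derivative_of_real)
  have "((\<lambda>x :: real ^ 'n. s * (x $ j - c)) has_derivative (\<lambda>h. s * h $ j)) (at x)"
   by (auto intro!: derivative_eq_intros bounded_linear.has_derivative[OF bounded_linear_vec_nth])
  moreover have "(sg k e has_derivative (\<lambda>h. h * ?g (s * (x $ j - c)))) (at (s * (x $ j - c)))"
   using sg_deriv[OF base(1), of k "s * (x $ j - c)"] unfolding has_field_derivative_def
   by (rule has_derivative_eq_rhs) (simp add: fun_eq_iff mult.commute)
  ultimately have "(sg k e \<circ> (\<lambda>x. s * (x $ j - c)) has_derivative (\<lambda>h. h * ?g (s * (x $ j - c))) \<circ> (\<lambda>h. s * h $ j)) (at x)"
   by (rule diff_chain_at)
  then show "((\<lambda>x. sg k e (s * (x $ j - c))) has_derivative (\<lambda>h. ?g (s * (x $ j - c)) * (s * h $ j))) (at x)"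
   by (simp add: o_def mult_ac)
 qed
 have p: "partial i (\<lambda>x. of_real (sg k e (s * (x $ j - c))) :: complex) =
   (\<lambda>x. of_real (s * (if i = j then 1 else 0)) * (of_real (- real k) * of_real (sg (k + 1) e (s * (x $ j - c))) + of_real e * of_real (sg (k + 2) e (s * (x $ j - c)))))" for i
  by (rule ext) (simp add: partial_eq[OF d] axis_def)
 have "partial i (\<lambda>x. of_real (sg k e (s * (x $ j - c))) :: complex) \<in> smg" for i
  unfolding p by (intro smg.mult smg.add smg.const smg.base base)
 then show ?case using d unfolding differentiable_def by blast
next
 case (add f g)
 then have df: "(f has_derivative frechet_derivative f (at x)) (at x)" and dg: "(g has_derivative frechet_derivative g (at x)) (at x)" for x
  by (auto simp: frechet_derivative_works)
 have d: "((\<lambda>x. f x + g x) has_derivative (\<lambda>h. frechet_derivative f (at x) h + frechet_derivative g (at x) h)) (at x)" for x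
  by (rule has_derivative_add[OF df dg])
 have p: "partial i (\<lambda>x. f x + g x) = (\<lambda>x. partial i f x + partial i g x)" for i
  by (rule ext) (simp add: partial_eq[OF d], simp add: partial_def)
 have "partial i (\<lambda>x. f x + g x) \<in> smg" for i unfolding p using add by (intro smg.add) auto
 then show ?case using d unfolding differentiable_def by blast
next
 case (mult f g)
 then have df: "(f has_derivative frechet_derivative f (at x)) (at x)" and dg: "(g has_derivative frechet_derivative g (at x)) (at x)" for x
  by (auto simp: frechet_derivative_works)
 have d: "((\<lambda>x. f x * g x) has_derivative (\<lambda>h. f x * frechet_derivative g (at x) h + frechet_derivative f (at x) h * g x)) (at x)" for x
  by (rule has_derivative_mult[OF df dg])
 have p: "partial i (\<lambda>x. f x * g x) = (\<lambda>x. f x * partial i g x + partial i f x * g x)" for i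
  by (rule ext) (simp add: partial_eq[OF d], simp add: partial_def)
 have "partial i (\<lambda>x. f x * g x) \<in> smg" for i unfolding p using mult by (intro smg.add smg.mult) auto
 then show ?case using d unfolding differentiable_def by blast
qed

lemma smg_partials: "f \<in> smg ==> partials is f \<in> smg"
proof (induction "is" arbitrary: f)
 case (Cons i "is")
 then show ?case using smg_derivative[of f] by (auto simp: partials_def)
qed (simp add: partials_def)

lemma smg_smooth: "f \<in> smg ==> smooth f"
 using smg_partials smg_derivative by (auto simp: smooth_def)

lemma partials_vanish:
 assumes "open W" "\<And>x. x \<in> W ==> f x = 0" "x \<in> W"
 shows "partials is f x = 0"
 using assms(2,3)
proof (induction "is" arbitrary: f x)
 case (Cons i "is")
 have "partial i f y = 0" if y: "y \<in> W" for y
 proof -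
  have "((\<lambda>_. 0) has_derivative (\<lambda>_. 0)) (at y)" by (rule has_derivative_const)
  then have "(f has_derivative (\<lambda>_. 0)) (at y)"
   by (rule has_derivative_transform_within_open[OF _ assms(1) y]) (simp add: Cons.prems)
  then show ?thesis by (simp add: partial_eq)
 qed
 then have "partials is (partial i f) x = 0" using Cons.prems by (intro Cons.IH) auto
 then show ?case by (simp add: partials_def)
qed (simp add: partials_def)

lemma smg_test:
 assumes f: "f \<in> smg" and van: "\<And>x. x \<notin> box a b ==> f x = 0"
 shows "f \<in> test_functions" "f \<in> schwartz" "supp f \<subseteq> cbox a b"
proof -
 have "{x. f x \<noteq> 0} \<subseteq> cbox a b" using van box_subset_cbox by blast
 then show s: "supp f \<subseteq> cbox a b" unfolding supp_def by (intro closure_minimal) auto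
 have "compact (supp f)" using compact_Int_closed[OF compact_cbox[of a b], of "supp f"] s by (simp add: supp_def Int_absorb1)
 then show "f \<in> test_functions" using smg_smooth[OF f] by (simp add: test_functions_def)
 have "bounded (range (\<lambda>x. norm x ^ k * norm (partials is f x)))" for k "is"
 proof -
  have "continuous_on (cbox a b) (partials is f)"
   using smg_derivative[OF smg_partials[OF f]] by (intro continuous_at_imp_continuous_on ballI differentiable_imp_continuous_within) auto
  then have "continuous_on (cbox a b) (\<lambda>x. norm x ^ k * norm (partials is f x))"
   by (intro continuous_intros)
  then have "bounded ((\<lambda>x. norm x ^ k * norm (partials is f x)) ` cbox a b)"
   by (intro compact_imp_bounded compact_continuous_image) auto
  then have "bounded (insert 0 ((\<lambda>x. norm x ^ k * norm (partials is f x)) ` cbox a b))" by simp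
  moreover have "partials is f x = 0" if "x \<notin> cbox a b" for x
   by (rule partials_vanish[of "- cbox a b"]) (use that van box_subset_cbox[of a b] in \<open>auto simp: open_Compl closed_cbox\<close>)
  then have "range (\<lambda>x. norm x ^ k * norm (partials is f x)) \<subseteq> insert 0 ((\<lambda>x. norm x ^ k * norm (partials is f x)) ` cbox a b)"
  proof (intro subsetI, elim rangeE)
   fix y x assume "\<And>x. x \<notin> cbox a b ==> partials is f x = 0" and "y = norm x ^ k * norm (partials is f x)"
   then show "y \<in> insert 0 ((\<lambda>x. norm x ^ k * norm (partials is f x)) ` cbox a b)"
    by (cases "x \<in> cbox a b") auto
  qed
  ultimately show ?thesis by (rule bounded_subset)
 qed
 then show "f \<in> schwartz" using smg_smooth[OF f] by (simp add: schwartz_def)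
qed

text \<open>Two flat factors per coordinate: nonzero exactly inside the box, at most 1 in norm for
  \<open>e > 0\<close>, and tending to the indicator of the box as \<open>e\<close> tends to 0 from
  above.\<close>

definition bump :: "real ^ 'n::finite => real ^ 'n => real => 'n cfun" where
 "bump a b e x = (PU i. of_real (sg 0 e (x $ i - a $ i)) * of_real (sg 0 e (b $ i - x $ i)))"

lemma smg_prod: "finite I ==> (\<And>i. i \<in> I ==> f i \<in> smg) ==> (\<lambda>x. \<Prod>i\<in>I. f i x) \<in> smg"
 by (induction I rule: finite_induct) (auto intro: smg.const smg.mult)

lemma bump_smg: "0 < e ==> bump a b e \<in> smg"
proof -
 assume e: "0 < e"
 have "(\<lambda>x :: real ^ 'a. PU i. of_real (sg 0 e (1 * (x $ i - a $ i))) * of_real (sg 0 e ((-1) * (x $ i - b $ i))) :: complex) \<in> smg"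
  by (intro smg_prod smg.mult smg.base e) auto
 then show ?thesis by (simp add: bump_def[abs_def])
qed

lemma bump_zero: "x \<notin> box a b ==> bump a b e x = 0"
proof -
 assume "x \<notin> box a b"
 then obtain i where "x $ i \<le> a $ i \<or> b $ i \<le> x $ i" by (auto simp: mem_box_cart not_less)
 then have "\<exists>i\<in>UNIV. of_real (sg 0 e (x $ i - a $ i)) * of_real (sg 0 e (b $ i - x $ i)) = (0 :: complex)"
  by (intro bexI[of _ i]) (auto simp: sg_def)
 then show ?thesis unfolding bump_def by (intro prod_zero) auto
qed

lemma bump_nonzero: "x \<in> box a b ==> bump a b e x \<noteq> 0"
 by (auto simp: bump_def mem_box_cart sg_def)

lemma norm_bump_le: "0 < e ==> norm (bump a b e x) \<le> indicator (box a b) x"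
proof (cases "x \<in> box a b")
 case True
 assume e: "0 < e"
 have "norm (bump a b e x) = (PU i. \<bar>sg 0 e (x $ i - a $ i)\<bar> * \<bar>sg 0 e (b $ i - x $ i)\<bar>)"
  by (simp add: bump_def norm_mult prod_norm[symmetric])
 also have "\<dots> \<le> 1" using e by (intro prod_le_1) (auto simp: sg_def intro!: mult_le_one)
 finally show ?thesis using True by simp
qed (simp add: bump_zero)

lemma bump_tendsto: "(\<lambda>k. bump a b (1 / real (Suc k)) x) \<longlonglongrightarrow> indicator (box a b) x"
proof (cases "x \<in> box a b")
 case True
 have "(\<lambda>k. sg 0 (1 / real (Suc k)) t) \<longlonglongrightarrow> 1" if "0 < t" for t
 proof -
  have "(\<lambda>k. exp (- (1 / real (Suc k)) / t)) \<longlonglongrightarrow> exp (- 0 / t)"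
   by (intro tendsto_intros LIMSEQ_Suc[OF lim_1_over_n]) (use that in auto)
  then show ?thesis using that by (simp add: sg_def)
 qed
 then have "(\<lambda>k. PU i. of_real (sg 0 (1 / real (Suc k)) (x $ i - a $ i)) * of_real (sg 0 (1 / real (Suc k)) (b $ i - x $ i)) :: complex)
   \<longlonglongrightarrow> (\<Prod>i\<in>(UNIV :: 'a set). of_real 1 * of_real 1)"
  using True by (intro tendsto_prod tendsto_mult tendsto_of_real) (auto simp: mem_box_cart)
 then show ?thesis using True by (simp add: bump_def)
qed (simp add: bump_zero)

lemma smg_borel: "f \<in> smg ==> f \<in> borel_fun"
 using smg_derivative[of f]
 by (intro borel_measurable_continuous_onI continuous_at_imp_continuous_on ballI differentiable_imp_continuous_within) auto

section \<open>Calderon--Zygmund kernels\<close>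

text \<open>Keeps only distances from \<open>x\<close> out of the double sum in the kernel
  conditions; as a lower bound for that sum (\<open>rho_le_sum\<close>) it yields upper bounds for
  the kernel.\<close>

definition rho :: "real ^ 'n::finite => real ^ 'n ^ 'm::finite => real" where
 "rho x y = (\<Sum>j\<in>UNIV. norm (x - y $ j))"

lemma rho_nonneg: "0 \<le> rho x y" by (simp add: rho_def sum_nonneg)

lemma norm_le_rho: "norm (x - y $ j) \<le> rho x y"
 unfolding rho_def by (rule member_le_sum) auto

locale CZ_ker =
 fixes K :: "('m::finite option => real ^ 'n::finite) => complex" and A \<epsilon> :: real
 assumes A: "0 < A" and eps: "0 < \<epsilon>"
  and size: "\<And>y. y \<in> off_diagonal ==>
   norm (K y) \<le> A / (\<Sum>k\<in>UNIV. \<Sum>l\<in>UNIV. norm (y k - y l)) ^ (CARD('m) * CARD('n))"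
  and smooth: "\<And>y j z. y \<in> off_diagonal ==> norm (y j - z) \<le> 1/2 * Max (range (\<lambda>k. norm (y j - y k))) ==>
   norm (K y - K (y(j := z))) \<le> A * norm (y j - z) powr \<epsilon> /
    (\<Sum>k\<in>UNIV. \<Sum>l\<in>UNIV. norm (y k - y l)) powr (real (CARD('m) * CARD('n)) + \<epsilon>)"
begin

lemma rho_le_sum: "rho x y \<le> (\<Sum>k\<in>UNIV. \<Sum>l\<in>UNIV. norm (point x y k - point x y l))"
proof -
 have "rho x y = (\<Sum>l\<in>range Some. norm (point x y None - point x y l))"
  by (subst sum.reindex) (auto simp: rho_def point_def)
 also have "\<dots> \<le> (\<Sum>l\<in>UNIV. norm (point x y None - point x y l))"
  by (rule sum_mono2) auto
 also have "\<dots> \<le> (\<Sum>k\<in>UNIV. \<Sum>l\<in>UNIV. norm (point x y k - point x y l))"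
  by (rule member_le_sum) (auto intro: sum_nonneg)
 finally show ?thesis .
qed

lemma point_off: "0 < rho x y ==> point x y \<in> off_diagonal"
proof (rule ccontr)
 assume r: "0 < rho x y" and n: "point x y \<notin> off_diagonal"
 have "x = y $ j" for j
 proof -
  have "point x y None = point x y (Some j)" using n unfolding off_diagonal_def by blast
  then show ?thesis by (simp add: point_def)
 qed
 then have "rho x y = 0" unfolding rho_def by (metis (mono_tags, lifting) diff_self norm_zero sum.neutral)
 then show False using r by simp
qed

lemma K_size:
 assumes "0 < d" "d \<le> rho x y"
 shows "norm (K (point x y)) \<le> A / d ^ (CARD('m) * CARD('n))"
proof -
 have "norm (K (point x y)) \<le> A / (\<Sum>k\<in>UNIV. \<Sum>l\<in>UNIV. norm (point x y k - point x y l)) ^ (CARD('m) * CARD('n))"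
  using assms by (intro size point_off) auto
 also have "\<dots> \<le> A / d ^ (CARD('m) * CARD('n))"
  using assms rho_le_sum[of x y] A by (intro divide_left_mono power_mono mult_pos_pos zero_less_power) auto
 finally show ?thesis .
qed

lemma Max_point_ge: "norm (point x y j - point x y k) \<le> Max (range (\<lambda>k. norm (point x y j - point x y k)))"
 by (rule Max_ge) auto

lemma K_smooth:
 assumes d: "0 < d" "d \<le> rho x y" and le: "norm (point x y j - z) \<le> 1/2 * norm (point x y j - point x y k)"
 shows "norm (K (point x y) - K ((point x y)(j := z))) \<le> A * norm (point x y j - z) powr \<epsilon> / d powr (real (CARD('m) * CARD('n)) + \<epsilon>)"
proof -
 have "norm (K (point x y) - K ((point x y)(j := z))) \<le> A * norm (point x y j - z) powr \<epsilon> /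
    (\<Sum>k\<in>UNIV. \<Sum>l\<in>UNIV. norm (point x y k - point x y l)) powr (real (CARD('m) * CARD('n)) + \<epsilon>)"
  using d by (intro smooth point_off order_trans[OF le] mult_left_mono Max_point_ge) auto
 also have "\<dots> \<le> A * norm (point x y j - z) powr \<epsilon> / d powr (real (CARD('m) * CARD('n)) + \<epsilon>)"
 proof (intro divide_left_mono powr_mono2)
  have "0 < (\<Sum>k\<in>UNIV. \<Sum>l\<in>UNIV. norm (point x y k - point x y l))" using d rho_le_sum[of x y] by linarith
  then show "0 < (\<Sum>k\<in>UNIV. \<Sum>l\<in>UNIV. norm (point x y k - point x y l)) powr (real (CARD('m) * CARD('n)) + \<epsilon>) * d powr (real (CARD('m) * CARD('n)) + \<epsilon>)"
   using d by simp
 qed (use d rho_le_sum[of x y] eps A in auto)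
 finally show ?thesis .
qed

lemma K_smooth_x:
 assumes d: "0 < d" "d \<le> rho x y" and le: "norm (x - x') \<le> 1/2 * norm (x - y $ j)"
 shows "norm (K (point x y) - K (point x' y)) \<le> A * norm (x - x') powr \<epsilon> / d powr (real (CARD('m) * CARD('n)) + \<epsilon>)"
proof -
 have "(point x y)(None := x') = point x' y" by (auto simp: point_def fun_eq_iff split: option.split)
 then show ?thesis using K_smooth[OF d, of None x' "Some j"] le by (simp add: point_def)
qed

lemma point_upd: "(point x y)(Some j := z) = point x (upd y j z)"
 by (auto simp: point_def fun_eq_iff split: option.split)

lemma K_smooth_y:
 assumes d: "0 < d" "d \<le> rho x y" and le: "norm (y $ j - z) \<le> 1/2 * norm (x - y $ j)"
 shows "norm (K (point x y) - K (point x (upd y j z))) \<le> A * norm (y $ j - z) powr \<epsilon> / d powr (real (CARD('m) * CARD('n)) + \<epsilon>)"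
proof -
 have "norm (point x y (Some j) - z) \<le> 1/2 * norm (point x y (Some j) - point x y None)"
  using le by (simp add: point_def norm_minus_commute)
 from K_smooth[OF d this] show ?thesis unfolding point_upd by (simp add: point_def)
qed

text \<open>The regularity condition moves one variable at a time, so the coordinates of
  \<open>y0\<close> are exchanged for those of \<open>y\<close> slot by slot. The purpose is
  measurability of the kernel.\<close>

lemma K_continuous:
 assumes y0: "0 < rho x y0"
 shows "((\<lambda>y. K (point x y)) \<longlongrightarrow> K (point x y0)) (at y0)"
proof -
 define mix where "mix J y = (\<chi> i. if i \<in> J then y $ i else y0 $ i)" for J :: "'m set" and y
 have mix_tend: "((\<lambda>y. point x (mix J y) k) \<longlongrightarrow> point x y0 k) (at y0)" for J k
 proof (cases k)
  case (Some i)
  have "((\<lambda>y. y $ i) \<longlongrightarrow> y0 $ i) (at y0)" by (intro tendsto_intros)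
  then show ?thesis using Some by (cases "i \<in> J") (auto simp: mix_def point_def)
 qed (simp add: point_def)
 have "((\<lambda>y. K (point x (mix J y))) \<longlongrightarrow> K (point x y0)) (at y0)" for J
  using finite[of J]
 proof (induction J rule: finite_induct)
  case empty
  have "mix {} y = y0" for y by (simp add: mix_def vec_eq_iff)
  then show ?case by simp
 next
  case (insert j J)
  let ?p = "\<lambda>y. point x (mix J y)"
  \<comment> \<open>The limit point is off the diagonal, so some coordinate differs from slot
    \<open>j\<close>; their distance \<open>D\<close> keeps the half-distance condition valid near
    \<open>y0\<close>.\<close>
  obtain k where k: "point x y0 (Some j) \<noteq> point x y0 k"
  proof (rule ccontr)
   assume "\<not> thesis"
   then have "point x y0 k = point x y0 l" for k l using that by metis
   then show False using point_off[OF y0] by (auto simp: off_diagonal_def)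
  qed
  define D where "D = norm (point x y0 (Some j) - point x y0 k)"
  have D: "0 < D" using k by (simp add: D_def)
  have "((\<lambda>y. norm (?p y (Some j) - ?p y k)) \<longlongrightarrow> D) (at y0)"
   unfolding D_def by (intro tendsto_intros mix_tend)
  then have ev1: "\<forall>\<^sub>F y in at y0. norm (?p y (Some j) - ?p y k) > D / 2"
   using D by (intro order_tendstoD) auto
  have "((\<lambda>y. norm (y0 $ j - y $ j)) \<longlongrightarrow> norm (y0 $ j - y0 $ j)) (at y0)"
   by (intro tendsto_intros)
  then have t0: "((\<lambda>y. norm (y0 $ j - y $ j)) \<longlongrightarrow> 0) (at y0)" by simp
  then have ev2: "\<forall>\<^sub>F y in at y0. norm (y0 $ j - y $ j) < D / 4"
   using D by (intro order_tendstoD) auto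
  have "((\<lambda>y. K (?p y) - K (point x (mix (insert j J) y))) \<longlongrightarrow> 0) (at y0)"
  proof (rule Lim_null_comparison)
   show "\<forall>\<^sub>F y in at y0. norm (K (?p y) - K (point x (mix (insert j J) y))) \<le>
     A * norm (y0 $ j - y $ j) powr \<epsilon> / (D / 2) powr (real (CARD('m) * CARD('n)) + \<epsilon>)"
    using ev1 ev2
   proof eventually_elim
    case (elim y)
    have pj: "?p y (Some j) = y0 $ j" using insert by (simp add: point_def mix_def)
    have e: "(?p y)(Some j := y $ j) = point x (mix (insert j J) y)"
     unfolding point_upd by (rule arg_cong[where f = "point x"]) (simp add: mix_def vec_eq_iff)
    have off: "?p y \<in> off_diagonal" using elim(1) D unfolding off_diagonal_def by (intro CollectI exI[of _ "Some j"] exI[of _ k]) auto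
    let ?s = "\<Sum>k\<in>UNIV. \<Sum>l\<in>UNIV. norm (?p y k - ?p y l)"
    have "norm (?p y (Some j) - ?p y k) \<le> (\<Sum>l\<in>UNIV. norm (?p y (Some j) - ?p y l))" by (rule member_le_sum) auto
    also have "\<dots> \<le> ?s" by (rule member_le_sum) (auto intro: sum_nonneg)
    finally have s: "D / 2 \<le> ?s" using elim(1) by simp
    have "norm (K (?p y) - K ((?p y)(Some j := y $ j))) \<le> A * norm (?p y (Some j) - y $ j) powr \<epsilon> / ?s powr (real (CARD('m) * CARD('n)) + \<epsilon>)"
    proof (rule smooth[OF off])
     show "norm (?p y (Some j) - y $ j) \<le> 1/2 * Max (range (\<lambda>k. norm (?p y (Some j) - ?p y k)))"
      by (rule order_trans[OF _ mult_left_mono[OF Max_point_ge[of x "mix J y" "Some j" k]]]) (use elim in \<open>simp_all add: pj\<close>)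
    qed
    also have "\<dots> \<le> A * norm (?p y (Some j) - y $ j) powr \<epsilon> / (D / 2) powr (real (CARD('m) * CARD('n)) + \<epsilon>)"
     using s D A eps by (intro divide_left_mono powr_mono2 mult_pos_pos) auto
    finally show ?case by (simp add: e pj)
   qed
   have "((\<lambda>y. norm (y0 $ j - y $ j) powr \<epsilon>) \<longlongrightarrow> 0) (at y0)"
    using eps by (intro tendsto_zero_powrI[OF t0 tendsto_const]) auto
   then have "((\<lambda>y. A * norm (y0 $ j - y $ j) powr \<epsilon> / (D / 2) powr (real (CARD('m) * CARD('n)) + \<epsilon>)) \<longlongrightarrow> A * 0 / (D / 2) powr (real (CARD('m) * CARD('n)) + \<epsilon>)) (at y0)"
    using D by (intro tendsto_intros) auto
   then show "((\<lambda>y. A * norm (y0 $ j - y $ j) powr \<epsilon> / (D / 2) powr (real (CARD('m) * CARD('n)) + \<epsilon>)) \<longlongrightarrow> 0) (at y0)" by simp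
  qed
  then have "((\<lambda>y. K (?p y) - (K (?p y) - K (point x (mix (insert j J) y)))) \<longlongrightarrow> K (point x y0) - 0) (at y0)"
   using insert.IH by (rule tendsto_diff[rotated])
  then show ?case by simp
 qed
 from this[of UNIV] show ?thesis by (simp add: mix_def)
qed

lemma K_measurable [measurable]: "(\<lambda>y. K (point x y)) \<in> borel_fun"
proof (rule borel_measurable_continuous_countable_exceptions[of "{\<chi> j. x}"])
 show "continuous_on (- {\<chi> j. x}) (\<lambda>y. K (point x y))"
  unfolding continuous_on_def
 proof (intro ballI tendsto_within_subset[OF K_continuous])
  fix y :: "real ^ 'n ^ 'm" assume "y \<in> - {\<chi> j. x}"
  then obtain j where "y $ j \<noteq> x" by (auto simp: vec_eq_iff)
  then have "0 < norm (x - y $ j)" by simp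
  also have "\<dots> \<le> rho x y" by (rule norm_le_rho)
  finally show "0 < rho x y" .
 qed simp
qed simp

end

section \<open>Admissible functions and the extended operator\<close>

text \<open>Membership in L^1 serves the kernel integrals and the weak type bound, membership in L^r
  the boundedness of the operator.\<close>

definition adm :: "real => ('a::euclidean_space => complex) => bool" where
 "adm r g \<longleftrightarrow> g \<in> borel_fun \<and> integrable lborel g \<and> integrable lborel (\<lambda>x. norm (g x) powr r)"

lemma adm_borel: "adm r g ==> g \<in> borel_fun"
 and adm_integrable: "adm r g ==> integrable lborel g"
 by (auto simp: adm_def)

lemma adm_dominated:
 assumes g: "adm r g" and r: "1 \<le> r" and h: "h \<in> borel_fun" and c: "0 \<le> c" and le: "\<And>x. norm (h x) \<le> c * norm (g x)"
 shows "adm r h"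
proof -
 have [measurable]: "h \<in> borel_fun" by (rule h)
 have "integrable lborel (\<lambda>x. c * norm (g x))" using adm_integrable[OF g] by simp
 then have 1: "integrable lborel h"
  by (rule Bochner_Integration.integrable_bound) (use le in \<open>auto intro!: AE_I2 order_trans[OF le]\<close>)
 have "integrable lborel (\<lambda>x. c powr r * norm (g x) powr r)" using g by (simp add: adm_def)
 then have 2: "integrable lborel (\<lambda>x. norm (h x) powr r)"
 proof (rule Bochner_Integration.integrable_bound)
  show "AE x in lborel. norm (norm (h x) powr r) \<le> norm (c powr r * norm (g x) powr r)"
   using powr_mono2[OF _ _ le, of r] r c by (intro AE_I2) (auto simp: powr_mult[symmetric])
 qed measurable
 show ?thesis using 1 2 by (simp add: adm_def)
qed

lemma powr_add_le: "0 \<le> a ==> 0 \<le> b ==> 0 \<le> r ==> (a + b) powr r \<le> 2 powr r * (a powr r + b powr r)" for a b r :: real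
proof -
 assume *: "0 \<le> a" "0 \<le> b" "0 \<le> r"
 have "(a + b) powr r \<le> (2 * max a b) powr r" using * by (intro powr_mono2) auto
 also have "\<dots> = 2 powr r * max a b powr r" using * by (simp add: powr_mult)
 also have "max a b powr r \<le> a powr r + b powr r" by (simp add: max_def)
 finally show ?thesis by simp
qed

lemma adm_add:
 assumes g: "adm r g" and h: "adm r h" and r: "1 \<le> r"
 shows "adm r (\<lambda>x. g x + h x)"
proof -
 have [measurable]: "g \<in> borel_fun" "h \<in> borel_fun" using g h by (auto simp: adm_def)
 have "integrable lborel (\<lambda>x. 2 powr r * (norm (g x) powr r + norm (h x) powr r))" using g h by (simp add: adm_def)
 then have "integrable lborel (\<lambda>x. norm (g x + h x) powr r)"
 proof (rule Bochner_Integration.integrable_bound)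
  show "AE x in lborel. norm (norm (g x + h x) powr r) \<le> norm (2 powr r * (norm (g x) powr r + norm (h x) powr r))"
  proof (rule AE_I2)
   fix x
   have "norm (g x + h x) powr r \<le> (norm (g x) + norm (h x)) powr r"
    using r by (intro powr_mono2) (auto simp: norm_triangle_ineq)
   also have "\<dots> \<le> 2 powr r * (norm (g x) powr r + norm (h x) powr r)" using r by (intro powr_add_le) auto
   finally show "norm (norm (g x + h x) powr r) \<le> norm (2 powr r * (norm (g x) powr r + norm (h x) powr r))" by simp
  qed
 qed measurable
 then show ?thesis using g h by (simp add: adm_def)
qed

lemma adm_cmult: "adm r g ==> adm r (\<lambda>x. a * g x)"
 by (auto simp: adm_def norm_mult powr_mult)

lemma adm_lincomb: "adm r g ==> adm r h ==> 1 \<le> r ==> adm r (\<lambda>x. a * g x + b * h x)"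
 by (intro adm_add adm_cmult)

lemma adm_indicator:
 assumes [measurable]: "E \<in> sets borel" and "vol E < \<infinity>"
 shows "adm r (\<lambda>x. indicator E x :: complex)"
proof -
 have e: "(\<lambda>x. norm (indicator E x :: complex) powr r) = (\<lambda>x. indicator E x :: real)"
  by (auto simp: indicator_def fun_eq_iff)
 show ?thesis unfolding adm_def e using assms integrable_of_real[OF integrable_real_indicator[of E lborel], where 'a = complex]
  by (auto simp: integrable_real_indicator of_real_indicator)
qed

lemma adm_mult_indicator:
 assumes "adm r g" "1 \<le> r" "E \<in> sets borel"
 shows "adm r (\<lambda>x. indicator E x * g x)"
 by (rule adm_dominated[OF assms(1,2), where c = 1])
  (use assms(3) adm_borel[OF assms(1)] in \<open>auto simp: indicator_def\<close>)

lemma adm_nn_integral: "adm r g ==> L1 g < \<infinity>"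
 by (simp add: adm_def integrable_iff_bounded)

lemma adm_Lp:
 assumes g: "adm r g" and r: "1 \<le> r"
 shows "g \<in> Lp r" "Lp_norm r g = ennreal ((\<integral>x. norm (g x) powr r \<partial>lborel) powr (1 / r))"
proof -
 have [measurable]: "g \<in> borel_fun" using g by (simp add: adm_def)
 have "(\<integral>\<^sup>+x. ennreal (norm (g x) powr r) \<partial>lebesgue) = (NN x. ennreal (norm (g x) powr r))"
  by (rule nn_integral_completion)
 also have "\<dots> = ennreal (\<integral>x. norm (g x) powr r \<partial>lborel)"
  using g by (intro nn_integral_eq_integral) (auto simp: adm_def)
 finally show n: "Lp_norm r g = ennreal ((\<integral>x. norm (g x) powr r \<partial>lborel) powr (1 / r))"
  by (simp add: Lp_norm_def ennreal_powr_def)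
 have "g \<in> leb_fun" by (rule measurable_completion) simp
 then show "g \<in> Lp r" by (simp add: Lp_def n)
qed

section \<open>The kernel representation of the extended operator\<close>

text \<open>The witnesses of \<open>CZ_operator\<close>: an extension \<open>S\<close> with its
  exponents and the kernel constants. \<open>T\<close> stays as the link between \<open>S\<close>
  and \<open>K\<close> on Schwartz functions. As \<open>q\<close> may be below 1, \<open>S\<close>
  is handled through integrals of \<open>norm (S f x) powr q\<close>.\<close>

locale CZ_op = CZ_ker K A \<epsilon>
 for K :: "('m::finite option => real ^ 'n::finite) => complex" and A \<epsilon> :: real +
 fixes T :: "('m => 'n cfun) => 'n cfun => complex"
  and S :: "('m => 'n cfun) => 'n cfun"
  and p :: "'m => real" and q B :: real
 assumes p: "\<And>j. 1 \<le> p j" and q: "1 / q = (\<Sum>j\<in>UNIV. 1 / p j)"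
  and S_Lp: "\<And>f. (\<And>j. f j \<in> Lp (p j)) ==> S f \<in> Lp q"
  and S_lin: "multilinear_upto (\<lambda>g h. AE x in lebesgue. g x = h x) (\<lambda>j. Lp (p j)) S"
  and B: "0 \<le> B" and S_norm: "\<And>f. (\<And>j. f j \<in> Lp (p j)) ==> Lp_norm q (S f) \<le> ennreal B * (PU j. Lp_norm (p j) (f j))"
  and T_S: "\<And>f. (\<And>j. f j \<in> schwartz) ==> coincides_on UNIV (T f) (S f)"
  and T_K: "\<And>f. (\<And>j. f j \<in> schwartz) ==> coincides_on (- (\<Inter>j. supp (f j))) (T f)
     (\<lambda>x. \<integral>y. K (point x y) * (PU j. f j (y $ j)) \<partial>lebesgue)"
begin

lemma q_pos: "0 < q"
proof -
 have "0 < (\<Sum>j\<in>(UNIV :: 'm set). 1 / p j)" using p by (intro sum_pos divide_pos_pos) (auto intro: less_le_trans[of 0 1])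
 then show ?thesis using q by (metis zero_less_divide_1_iff)
qed

lemma S_meas: "(\<And>j. adm (p j) (f j)) ==> S f \<in> leb_fun"
 using S_Lp[of f] adm_Lp(1) p by (auto simp: Lp_def)

lemma S_comb:
 assumes "\<And>i. adm (p i) (f i)" "adm (p j) g" "adm (p j) h"
 shows "AE x in lebesgue. S (f(j := \<lambda>x. a * g x + b * h x)) x = a * S (f(j := g)) x + b * S (f(j := h)) x"
 using S_lin assms adm_Lp(1) p unfolding multilinear_upto_def by blast

definition Ip :: "('m => 'n cfun) => real" where
 "Ip f = (PU j. (\<integral>x. norm (f j x) powr p j \<partial>lborel) powr (1 / p j))"

lemma Ip_nonneg: "0 \<le> Ip f" by (simp add: Ip_def prod_nonneg)

lemma S_int:
 assumes f: "\<And>j. adm (p j) (f j)"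
 shows "(\<integral>\<^sup>+x. ennreal (norm (S f x) powr q) \<partial>lebesgue) \<le> ennreal ((B * Ip f) powr q)"
proof -
 let ?I = "\<integral>\<^sup>+x. ennreal (norm (S f x) powr q) \<partial>lebesgue"
 have "Lp_norm q (S f) \<le> ennreal B * (PU j. Lp_norm (p j) (f j))"
  using f p by (intro S_norm adm_Lp)
 also have "(PU j. Lp_norm (p j) (f j)) = (PU j. ennreal ((\<integral>x. norm (f j x) powr p j \<partial>lborel) powr (1 / p j)))"
  using f p by (intro prod.cong adm_Lp(2)) auto
 also have "\<dots> = ennreal (Ip f)" unfolding Ip_def by (rule prod_ennreal) simp
 also have "ennreal B * ennreal (Ip f) = ennreal (B * Ip f)" using B Ip_nonneg by (simp add: ennreal_mult)
 finally have le: "ennreal_powr ?I (1 / q) \<le> ennreal (B * Ip f)" by (simp add: Lp_norm_def)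
 then have fin: "?I \<noteq> \<infinity>" by (auto simp: ennreal_powr_def top_unique)
 then obtain v where v: "?I = ennreal v" "0 \<le> v" by (cases ?I) auto
 then have "v powr (1 / q) \<le> B * Ip f" using le B Ip_nonneg[of f] by (simp add: ennreal_powr_def)
 then have "(v powr (1 / q)) powr q \<le> (B * Ip f) powr q" using q_pos by (intro powr_mono2) auto
 then show ?thesis using v q_pos by (simp add: powr_powr ennreal_leI)
qed

lemma S_weak:
 assumes f: "\<And>j. adm (p j) (f j)" and l: "0 < t"
 shows "lvol {x. norm (S f x) > t} \<le> ennreal ((B * Ip f / t) powr q)"
proof -
 have [measurable]: "S f \<in> leb_fun" using f by (rule S_meas)
 have "lvol {x. norm (S f x) > t} = (\<integral>\<^sup>+x. indicator {x. norm (S f x) > t} x \<partial>lebesgue)"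
 proof (rule nn_integral_indicator[symmetric])
  have "{x \<in> space lebesgue. norm (S f x) > t} \<in> sets lebesgue" by measurable
  then show "{x. norm (S f x) > t} \<in> sets lebesgue" by simp
 qed
 also have "\<dots> \<le> (\<integral>\<^sup>+x. ennreal (1 / t powr q) * ennreal (norm (S f x) powr q) \<partial>lebesgue)"
 proof (rule nn_integral_mono)
  fix x
  show "indicator {x. norm (S f x) > t} x \<le> ennreal (1 / t powr q) * ennreal (norm (S f x) powr q)"
  proof (cases "norm (S f x) > t")
   case True
   have "1 \<le> 1 / t powr q * norm (S f x) powr q"
    using True l q_pos powr_mono2[of q t "norm (S f x)"] by (simp add: field_simps)
   then show ?thesis using True by (simp add: ennreal_mult[symmetric] ennreal_leI[of 1, simplified])
  qed simp
 qed
 also have "\<dots> = ennreal (1 / t powr q) * (\<integral>\<^sup>+x. ennreal (norm (S f x) powr q) \<partial>lebesgue)"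
  by (rule nn_integral_cmult) measurable
 also have "\<dots> \<le> ennreal (1 / t powr q) * ennreal ((B * Ip f) powr q)"
  by (intro mult_left_mono S_int f) simp
 also have "\<dots> = ennreal ((B * Ip f / t) powr q)"
  using l B Ip_nonneg[of f] by (simp add: ennreal_mult[symmetric] powr_divide)
 finally show ?thesis .
qed

text \<open>Dominated convergence sends the norm of the difference in slot \<open>j\<close> to 0;
  linearity and boundedness pass this to \<open>S\<close>. The q-th powers then converge in L^1,
  which also covers q < 1, and a subsequence converges almost everywhere.\<close>

lemma S_limit:
 assumes f: "\<And>i. adm (p i) (f i)" and g: "adm (p j) g" and h: "\<And>k. h k \<in> borel_fun"
  and le: "\<And>k x. norm (h k x) \<le> norm (g x)" and lim: "\<And>x. (\<lambda>k. h k x) \<longlonglongrightarrow> h' x"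
 shows "\<exists>r. strict_mono r \<and> (AE x in lebesgue. (\<lambda>k. S (f(j := h (r k))) x) \<longlonglongrightarrow> S (f(j := h')) x)"
  and "(\<lambda>k. Ip (f(j := \<lambda>x. h k x - h' x))) \<longlonglongrightarrow> 0"
proof -
 have h'_meas: "h' \<in> borel_fun"
  by (rule borel_measurable_LIMSEQ_metric[OF h lim])
 have le': "norm (h' x) \<le> norm (g x)" for x
  by (rule tendsto_upperbound[OF tendsto_norm[OF lim]]) (auto simp: le)
 have ah: "adm (p j) (h k)" "adm (p j) h'" for k
  by (rule adm_dominated[OF g p, where c = 1]; simp add: h h'_meas le le')+
 let ?d = "\<lambda>k x. 1 * h k x + (-1) * h' x"
 have ad: "adm (p j) (?d k)" for k by (rule adm_lincomb[OF ah(1) ah(2) p])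
 have [measurable]: "h k \<in> borel_fun" "h' \<in> borel_fun" for k using h h'_meas by auto
 have [measurable]: "g \<in> borel_fun" using adm_borel[OF g] .
 have lim_I: "(\<lambda>k. \<integral>x. norm (?d k x) powr p j \<partial>lborel) \<longlonglongrightarrow> (\<integral>x. 0 \<partial>(lborel :: (real ^ 'n) measure))"
 proof (rule integral_dominated_convergence)
  show "integrable lborel (\<lambda>x. 2 powr p j * norm (g x) powr p j)" using g by (simp add: adm_def)
  show "AE x in lborel. (\<lambda>k. norm (?d k x) powr p j) \<longlonglongrightarrow> 0"
  proof (rule AE_I2)
   fix x
   have "(\<lambda>k. ?d k x) \<longlonglongrightarrow> 1 * h' x + (-1) * h' x" by (intro tendsto_intros lim)
   then have "(\<lambda>k. norm (?d k x)) \<longlonglongrightarrow> 0" by (simp add: tendsto_norm_zero)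
   then show "(\<lambda>k. norm (?d k x) powr p j) \<longlonglongrightarrow> 0"
    using p[of j] by (intro tendsto_zero_powrI[OF _ tendsto_const]) auto
  qed
  show "AE x in lborel. norm (norm (?d k x) powr p j) \<le> 2 powr p j * norm (g x) powr p j" for k
  proof (rule AE_I2)
   fix x
   have "norm (?d k x) \<le> norm (h k x) + norm (h' x)" using norm_triangle_ineq4[of "h k x" "h' x"] by simp
   also have "\<dots> \<le> 2 * norm (g x)" using le[of k x] le'[of x] by simp
   finally have "norm (?d k x) powr p j \<le> (2 * norm (g x)) powr p j" using p[of j] by (intro powr_mono2) auto
   then show "norm (norm (?d k x) powr p j) \<le> 2 powr p j * norm (g x) powr p j" by (simp add: powr_mult)
  qed
 qed auto
 define C where "C = (\<Prod>i\<in>UNIV - {j}. (\<integral>x. norm (f i x) powr p i \<partial>lborel) powr (1 / p i))"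
 have Ip_eq: "Ip (f(j := ?d k)) = (\<integral>x. norm (?d k x) powr p j \<partial>lborel) powr (1 / p j) * C" for k
  unfolding Ip_def C_def by (subst prod.remove[of _ j]) auto
 have pj: "0 < p j" using p[of j] by simp
 have "(\<lambda>k. (\<integral>x. norm (?d k x) powr p j \<partial>lborel) powr (1 / p j)) \<longlonglongrightarrow> 0"
  using lim_I pj by (intro tendsto_zero_powrI[OF _ tendsto_const]) auto
 then have "(\<lambda>k. (\<integral>x. norm (?d k x) powr p j \<partial>lborel) powr (1 / p j) * C) \<longlonglongrightarrow> 0 * C" by (intro tendsto_intros)
 then have lim_Ip: "(\<lambda>k. Ip (f(j := ?d k))) \<longlonglongrightarrow> 0" unfolding Ip_eq by simp
 then show "(\<lambda>k. Ip (f(j := \<lambda>x. h k x - h' x))) \<longlonglongrightarrow> 0" by simp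
 have admd: "adm (p i) ((f(j := ?d k)) i)" for i k using f ad by auto
 let ?u = "\<lambda>k x. norm (S (f(j := ?d k)) x) powr q"
 have [measurable]: "S (f(j := ?d k)) \<in> leb_fun" for k by (rule S_meas) (rule admd)
 have SI: "(\<integral>\<^sup>+x. ennreal (?u k x) \<partial>lebesgue) \<le> ennreal ((B * Ip (f(j := ?d k))) powr q)" for k
  by (rule S_int) (rule admd)
 have int_u: "integrable lebesgue (?u k)" for k
 proof (rule integrableI_bounded)
  have "(\<integral>\<^sup>+x. en (?u k) x \<partial>lebesgue) \<le> ennreal ((B * Ip (f(j := ?d k))) powr q)"
   using SI[of k] by simp
  then show "(\<integral>\<^sup>+x. en (?u k) x \<partial>lebesgue) < \<infinity>" by (rule le_less_trans) simp
 qed measurable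
 have "(\<lambda>k. \<integral>x. norm (?u k x) \<partial>lebesgue) \<longlonglongrightarrow> 0"
 proof (rule tendsto_sandwich[OF _ _ tendsto_const])
  show "\<forall>\<^sub>F k in sequentially. (\<integral>x. norm (?u k x) \<partial>lebesgue) \<le> (B * Ip (f(j := ?d k))) powr q"
  proof (rule always_eventually, rule allI)
   fix k
   have "ennreal (\<integral>x. norm (?u k x) \<partial>lebesgue) = (\<integral>\<^sup>+x. en (?u k) x \<partial>lebesgue)"
    using int_u by (intro nn_integral_eq_integral[symmetric]) auto
   also have "\<dots> \<le> ennreal ((B * Ip (f(j := ?d k))) powr q)" using SI[of k] by simp
   finally show "(\<integral>x. norm (?u k x) \<partial>lebesgue) \<le> (B * Ip (f(j := ?d k))) powr q" by simp
  qed
  have "(\<lambda>k. B * Ip (f(j := ?d k))) \<longlonglongrightarrow> B * 0" by (intro tendsto_intros lim_Ip)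
  then show "(\<lambda>k. (B * Ip (f(j := ?d k))) powr q) \<longlonglongrightarrow> 0"
   using q_pos B Ip_nonneg by (intro tendsto_zero_powrI[OF _ tendsto_const]) (auto intro!: always_eventually mult_nonneg_nonneg)
 qed auto
 from tendsto_L1_AE_subseq[OF int_u this] obtain r where r: "strict_mono r" "AE x in lebesgue. (\<lambda>k. ?u (r k) x) \<longlonglongrightarrow> 0" by auto
 have "AE x in lebesgue. \<forall>k. S (f(j := ?d k)) x = 1 * S (f(j := h k)) x + (-1) * S (f(j := h')) x"
  unfolding AE_all_countable using S_comb[OF f ah(1) ah(2)] by blast
 with r(2) have "AE x in lebesgue. (\<lambda>k. S (f(j := h (r k))) x) \<longlonglongrightarrow> S (f(j := h')) x"
 proof eventually_elim
  case (elim x)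
  have "(\<lambda>k. ?u (r k) x powr (1 / q)) \<longlonglongrightarrow> 0"
   using q_pos by (intro tendsto_zero_powrI[OF elim(1) tendsto_const]) auto
  moreover have "?u (r k) x powr (1 / q) = norm (S (f(j := ?d (r k))) x)" for k using q_pos by (simp add: powr_powr)
  ultimately have "(\<lambda>k. norm (S (f(j := ?d (r k))) x)) \<longlonglongrightarrow> 0" by (simp only:)
  then have "(\<lambda>k. S (f(j := h (r k))) x - S (f(j := h')) x) \<longlonglongrightarrow> 0"
   using elim(2) by (simp add: tendsto_norm_zero_iff)
  then show ?case by (simp add: LIM_zero_iff)
 qed
 then show "\<exists>r. strict_mono r \<and> (AE x in lebesgue. (\<lambda>k. S (f(j := h (r k))) x) \<longlonglongrightarrow> S (f(j := h')) x)" using r(1) by blast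
qed

definition Kint :: "('m => 'n cfun) => 'n cfun" where
 "Kint f x = (\<integral>y. K (point x y) * (PU j. f j (y $ j)) \<partial>lborel)"

text \<open>The kernel representation in pointwise form, almost everywhere because
  \<open>S f\<close> is an L^q function. It is applied with open sets \<open>U\<close> on which one
  slot vanishes.\<close>

definition Rep :: "(real ^ 'n) set => ('m => 'n cfun) => bool" where
 "Rep U f \<longleftrightarrow> (AE x in lebesgue. x \<in> U --> S f x = Kint f x)"

text \<open>Either \<open>y $ j0\<close> lies in \<open>U\<close> and the product vanishes, or it
  keeps a fixed distance from \<open>x\<close>, where the size condition bounds the kernel.\<close>

lemma K_bound_off:
 assumes U: "open U" "x \<in> U" and van: "\<And>z. z \<in> U ==> g j0 z = (0 :: complex)"
 obtains C where "0 \<le> C" "\<And>y. norm (K (point x y) * (PU j. g j (y $ j))) \<le> C * norm (PU j. g j (y $ j))"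
proof -
 obtain d where d: "0 < d" "ball x d \<subseteq> U" using U openE by blast
 have "norm (K (point x y) * (PU j. g j (y $ j))) \<le> A / d ^ (CARD('m) * CARD('n)) * norm (PU j. g j (y $ j))" for y
 proof (cases "y $ j0 \<in> U")
  case True
  then have "(PU j. g j (y $ j)) = 0" using van by (intro prod_zero) auto
  then show ?thesis by (simp only:) simp
 next
  case False
  then have "d \<le> norm (x - y $ j0)" using d by (auto simp: dist_norm subset_iff not_less[symmetric])
  also have "\<dots> \<le> rho x y" by (rule norm_le_rho)
  finally have "norm (K (point x y)) \<le> A / d ^ (CARD('m) * CARD('n))" using d by (intro K_size) auto
  then show ?thesis unfolding norm_mult by (intro mult_right_mono) auto
 qed
 then show ?thesis using d A by (intro that[of "A / d ^ (CARD('m) * CARD('n))"]) auto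
qed

lemma adm_prod_integrable:
 "(\<And>i. adm (p i) (f i)) ==> integrable lborel (\<lambda>y. PU j. f j (y $ j))"
 by (intro integrable_prod_vec adm_integrable)

lemma prod_vec_borel [measurable]:
 assumes "\<And>i. adm (p i) (f i)"
 shows "(\<lambda>y. PU j. f j (y $ j)) \<in> borel_fun"
 using adm_prod_integrable[of f] assms borel_measurable_integrable by fastforce

lemma Kint_integrable:
 assumes f: "\<And>i. adm (p i) (f i)" and U: "open U" "x \<in> U" and van: "\<And>z. z \<in> U ==> f j0 z = 0"
 shows "integrable lborel (\<lambda>y. K (point x y) * (PU j. f j (y $ j)))"
proof -
 obtain C where C: "0 \<le> C" "\<And>y. norm (K (point x y) * (PU j. f j (y $ j))) \<le> C * norm (PU j. f j (y $ j))"
  using K_bound_off[of U x f j0, OF U van] by blast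
 have "integrable lborel (\<lambda>y. C * norm (PU j. f j (y $ j)))"
  using adm_prod_integrable[of f] f by (intro integrable_mult_right integrable_norm) auto
 then show ?thesis
  by (rule Bochner_Integration.integrable_bound)
   (use C f in \<open>auto intro!: borel_measurable_times K_measurable prod_vec_borel\<close>)
qed

lemma prod_upd: "(\<Prod>i\<in>(UNIV :: 'm set). (f(j := h)) i (y $ i)) = h (y $ j) * (\<Prod>i\<in>UNIV - {j}. f i (y $ i))"
 by (subst prod.remove[of _ j]) auto

lemma Rep_comb:
 assumes U: "open U" and f: "\<And>i. adm (p i) (f i)" and g: "adm (p j) g" and h: "adm (p j) h"
  and van: "\<And>z. z \<in> U ==> (f(j := g)) j0 z = 0" "\<And>z. z \<in> U ==> (f(j := h)) j0 z = 0"
  and rep: "Rep U (f(j := g))" "Rep U (f(j := h))"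
 shows "Rep U (f(j := \<lambda>x. a * g x + b * h x))"
 using S_comb[OF f g h, of a b] rep unfolding Rep_def
proof eventually_elim
 case (elim x)
 show ?case
 proof
  assume x: "x \<in> U"
  have "Kint (f(j := \<lambda>x. a * g x + b * h x)) x = a * Kint (f(j := g)) x + b * Kint (f(j := h)) x"
  proof -
   have i1: "integrable lborel (\<lambda>y. K (point x y) * (PU i. (f(j := g)) i (y $ i)))"
    by (rule Kint_integrable[where f = "f(j := g)", OF _ U x van(1)]) (use f g in auto)
   have i2: "integrable lborel (\<lambda>y. K (point x y) * (PU i. (f(j := h)) i (y $ i)))"
    by (rule Kint_integrable[where f = "f(j := h)", OF _ U x van(2)]) (use f h in auto)
   have "Kint (f(j := \<lambda>x. a * g x + b * h x)) x = (\<integral>y. a * (K (point x y) * (PU i. (f(j := g)) i (y $ i))) + b * (K (point x y) * (PU i. (f(j := h)) i (y $ i))) \<partial>lborel)"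
    unfolding Kint_def prod_upd by (intro Bochner_Integration.integral_cong) (auto simp: algebra_simps)
   also have "\<dots> = a * Kint (f(j := g)) x + b * Kint (f(j := h)) x"
    unfolding Kint_def using i1 i2 by (subst Bochner_Integration.integral_add) auto
   finally show ?thesis .
  qed
  then show "S (f(j := \<lambda>x. a * g x + b * h x)) x = Kint (f(j := \<lambda>x. a * g x + b * h x)) x"
   using elim x by simp
 qed
qed

text \<open>Both sides pass to the limit: the left along a subsequence by \<open>S_limit\<close>,
  the right by dominated convergence with the bound of \<open>K_bound_off\<close>.\<close>

lemma Rep_limit:
 assumes U: "open U" and f: "\<And>i. adm (p i) (f i)" and g: "adm (p j) g" and h: "\<And>k. h k \<in> borel_fun"
  and le: "\<And>k x. norm (h k x) \<le> norm (g x)" and lim: "\<And>x. (\<lambda>k. h k x) \<longlonglongrightarrow> h' x"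
  and van: "\<And>z. z \<in> U ==> (f(j := g)) j0 z = 0"
  and rep: "\<And>k. Rep U (f(j := h k))"
 shows "Rep U (f(j := h'))"
proof -
 obtain r where r: "strict_mono r" "AE x in lebesgue. (\<lambda>k. S (f(j := h (r k))) x) \<longlonglongrightarrow> S (f(j := h')) x"
  using S_limit(1)[OF f g h le lim] by blast
 have "AE x in lebesgue. \<forall>k. x \<in> U --> S (f(j := h k)) x = Kint (f(j := h k)) x"
  unfolding AE_all_countable using rep by (simp add: Rep_def)
 with r(2) show ?thesis unfolding Rep_def
 proof eventually_elim
  case (elim x)
  show ?case
  proof
   assume x: "x \<in> U"
   let ?g = "f(j := g)"
   have ag: "adm (p i) (?g i)" for i using f g by auto
   have ah: "adm (p i) ((f(j := h k)) i)" for i k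
    using f adm_dominated[OF g p h, of 1 k] le by auto
   have h': "adm (p i) ((f(j := h')) i)" for i
   proof -
    have "h' \<in> borel_fun" by (rule borel_measurable_LIMSEQ_metric[OF h lim])
    moreover have "norm (h' x) \<le> 1 * norm (g x)" for x
     by (rule tendsto_upperbound[OF tendsto_norm[OF lim]]) (auto simp: le)
    ultimately show ?thesis using f adm_dominated[OF g p, of h' 1] by auto
   qed
   obtain C where C: "0 \<le> C" "\<And>y. norm (K (point x y) * (PU i. ?g i (y $ i))) \<le> C * norm (PU i. ?g i (y $ i))"
    using K_bound_off[OF U x, of ?g j0, OF van] by blast
   have "(\<lambda>k. Kint (f(j := h k)) x) \<longlonglongrightarrow> Kint (f(j := h')) x"
    unfolding Kint_def
   proof (rule integral_dominated_convergence[where w = "\<lambda>y. C * norm (PU i. ?g i (y $ i))"])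
    show "integrable lborel (\<lambda>y. C * norm (PU i. ?g i (y $ i)))"
     using adm_prod_integrable[of ?g] ag by (intro integrable_mult_right integrable_norm) auto
    show "AE y in lborel. (\<lambda>k. K (point x y) * (PU i. (f(j := h k)) i (y $ i))) \<longlonglongrightarrow> K (point x y) * (PU i. (f(j := h')) i (y $ i))"
     unfolding prod_upd by (intro AE_I2 tendsto_intros lim)
    show "AE y in lborel. norm (K (point x y) * (PU i. (f(j := h k)) i (y $ i))) \<le> C * norm (PU i. ?g i (y $ i))" for k
    proof (rule AE_I2)
     fix y
     have "norm (K (point x y) * (PU i. (f(j := h k)) i (y $ i))) \<le> norm (K (point x y) * (PU i. ?g i (y $ i)))"
      unfolding prod_upd norm_mult by (intro mult_left_mono mult_right_mono le) auto
     also have "\<dots> \<le> C * norm (PU i. ?g i (y $ i))" by (rule C)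
     finally show "norm (K (point x y) * (PU i. (f(j := h k)) i (y $ i))) \<le> C * norm (PU i. ?g i (y $ i))" .
    qed
    show "(\<lambda>y. K (point x y) * (PU i. (f(j := h')) i (y $ i))) \<in> borel_measurable lborel"
     using borel_measurable_times[OF K_measurable prod_vec_borel[of "f(j := h')", OF h']] by simp
    show "(\<lambda>y. K (point x y) * (PU i. (f(j := h k)) i (y $ i))) \<in> borel_measurable lborel" for k
     using borel_measurable_times[OF K_measurable prod_vec_borel[of "f(j := h k)", OF ah]] by simp
   qed
   then have "(\<lambda>k. Kint (f(j := h (r k))) x) \<longlonglongrightarrow> Kint (f(j := h')) x"
    using LIMSEQ_subseq_LIMSEQ[OF _ r(1)] by (simp add: o_def)
   then have "(\<lambda>k. S (f(j := h (r k))) x) \<longlonglongrightarrow> Kint (f(j := h')) x" using elim(2) x by simp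
   then show "S (f(j := h')) x = Kint (f(j := h')) x" using elim(1) LIMSEQ_unique by blast
  qed
 qed
qed

end

section \<open>Functions determined by their integrals over boxes\<close>

lemma Int_stable_boxes: "Int_stable (range (\<lambda>(a, b). box a b :: 'a::euclidean_space set))"
proof (rule Int_stableI)
 fix A B :: "'a set" assume "A \<in> range (\<lambda>(a, b). box a b)" "B \<in> range (\<lambda>(a, b). box a b)"
 then obtain a b c d where "A = box a b" "B = box c d" by auto
 then obtain u v where "A \<inter> B = (\<lambda>(a, b). box a b) (u, v)" by (simp add: box_Int_box)
 then show "A \<inter> B \<in> range (\<lambda>(a, b). box a b)" by (simp only: rangeI)
qed

lemma disjoint_family_Int_prev:
 assumes "disjoint_family A"
 shows "A (k::nat) \<inter> (\<Union>i<k. A i) = {}"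
proof -
 have "A k \<inter> A i = {}" if "i < k" for i
  using disjoint_family_onD[OF assms, of k i] that by simp
 then show ?thesis by blast
qed

lemma borel_version:
 fixes f :: "'a::euclidean_space => complex"
 assumes "f \<in> leb_fun"
 obtains g where "g \<in> borel_fun" "AE x in lborel. f x = g x"
proof -
 have "(\<lambda>x. Re (f x)) \<in> leb_fun" "(\<lambda>x. Im (f x)) \<in> leb_fun" using assms by measurable
 from this[THEN completion_ex_borel_measurable_real] obtain u v where u: "u \<in> borel_measurable lborel" "AE x in lborel. Re (f x) = u x"
  and v: "v \<in> borel_measurable lborel" "AE x in lborel. Im (f x) = v x" by blast
 show thesis
 proof (rule that[of "\<lambda>x. complex_of_real (u x) + \<i> * complex_of_real (v x)"])
  show "(\<lambda>x. complex_of_real (u x) + \<i> * complex_of_real (v x)) \<in> borel_fun" using u v by measurable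
  show "AE x in lborel. f x = complex_of_real (u x) + \<i> * complex_of_real (v x)"
   using u(2) v(2) by eventually_elim (metis complex_eq)
 qed
qed

text \<open>The positive and the negative part define measures that agree on boxes, a generating
  system closed under intersection; hence the densities agree.\<close>

lemma AE_zero_if_box_integrals_real:
 fixes g :: "'a::euclidean_space => real"
 assumes g: "integrable lborel g" and box: "\<And>a b. (\<integral>x. g x * indicator (box a b) x \<partial>lborel) = 0"
 shows "AE x in lborel. g x = 0"
proof -
 have [measurable]: "g \<in> borel_fun" using g by auto
 have fin: "(NN x. ennreal (s * (g x * indicator X x))) < \<infinity>" if "X \<in> sets borel" "\<bar>s\<bar> = 1" for X s
 proof -
  have "(NN x. ennreal (s * (g x * indicator X x))) \<le> L1 g"
   using that(2) by (intro nn_integral_mono ennreal_leI) (auto simp: indicator_def abs_if split: if_splits)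
  also have "\<dots> < \<infinity>" using g by (simp add: integrable_iff_bounded)
  finally show ?thesis .
 qed
 have enn2real_inj: "A = B" if "enn2real A = enn2real B" "A \<noteq> \<infinity>" "B \<noteq> \<infinity>" for A B
  using that by (cases A; cases B) auto
 have eq: "wm (\<lambda>x. ennreal (g x)) (box a b) = wm (\<lambda>x. ennreal (- g x)) (box a b) \<and> wm (\<lambda>x. ennreal (g x)) (box a b) \<noteq> \<infinity>" for a b
 proof -
  let ?f = "\<lambda>s x. s * (g x * indicator (box a b) x)"
  have e: "wm (\<lambda>x. ennreal (s * g x)) (box a b) = (NN x. ennreal (?f s x))" for s
   by (subst emeasure_density) (auto intro!: nn_integral_cong simp: indicator_def)
  have f: "(NN x. ennreal (?f s x)) \<noteq> \<infinity>" if "\<bar>s\<bar> = 1" for s using fin[of "box a b" s] that by auto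
  have "integrable lborel (?f 1)" using integrable_mult_indicator[OF _ g, of "box a b"] by (simp add: mult.commute)
  from real_lebesgue_integral_def[OF this] have "enn2real (NN x. ennreal (?f 1 x)) = enn2real (NN x. ennreal (?f (-1) x))"
   using box[of a b] by simp
  then have "(NN x. ennreal (?f 1 x)) = (NN x. ennreal (?f (-1) x))"
   by (rule enn2real_inj[OF _ f f]) auto
  then show ?thesis using e[of 1] e[of "-1"] f[of 1] by simp
 qed
 have "density lborel (\<lambda>x. ennreal (g x)) = density lborel (\<lambda>x. ennreal (- g x))"
 proof (rule measure_eqI_generator_eq[OF Int_stable_boxes, of UNIV _ _ "\<lambda>k. box (- (real k *\<^sub>R One)) (real k *\<^sub>R One)"])
  show "(\<Union>k. box (- (real k *\<^sub>R One)) (real k *\<^sub>R One)) = (UNIV :: 'a set)" by (rule UN_box_eq_UNIV)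
   show "wm (\<lambda>x. ennreal (g x)) (box (- (real k *\<^sub>R One)) (real k *\<^sub>R One)) \<noteq> \<infinity>" for k using eq by blast
 qed (use eq in \<open>auto simp: borel_eq_box\<close>)
 then have "AE x in lborel. ennreal (g x) = ennreal (- g x)" by (intro sigma_finite_measure.density_unique[OF sigma_finite_lborel]) auto
 then show ?thesis
 proof eventually_elim
  case (elim x)
  then show ?case by (cases "0 \<le> g x") (auto simp: ennreal_neg ennreal_eq_0_iff)
 qed
qed

lemma AE_zero_if_box_integrals:
 fixes G :: "'a::euclidean_space => complex"
 assumes G: "integrable lebesgue G" and box: "\<And>a b. (\<integral>x. indicator (box a b) x *\<^sub>R G x \<partial>lebesgue) = 0"
 shows "AE x in lebesgue. G x = 0"
proof -
 obtain g where g: "g \<in> borel_fun" "AE x in lborel. G x = g x" by (rule borel_version[OF borel_measurable_integrable[OF G]])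
 have AE: "AE x in lebesgue. G x = g x" by (rule AE_completion[OF g(2)])
 have "integrable lebesgue g" by (rule integrable_cong_AE_imp[OF G _ AE]) (use g(1) in \<open>auto intro: measurable_completion\<close>)
 then have ig: "integrable lborel g" using g(1) by (simp add: integrable_completion)
 have z: "(\<integral>x. indicator (box a b) x *\<^sub>R g x \<partial>lborel) = 0" for a b
 proof -
  have [measurable]: "G \<in> leb_fun" "g \<in> leb_fun" using G g(1) by (auto intro: measurable_completion)
  have "(\<integral>x. indicator (box a b) x *\<^sub>R g x \<partial>lborel) = (\<integral>x. indicator (box a b) x *\<^sub>R g x \<partial>lebesgue)"
   using g(1) by (intro integral_completion[symmetric]) auto
  also have "\<dots> = (\<integral>x. indicator (box a b) x *\<^sub>R G x \<partial>lebesgue)"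
   using AE by (intro integral_cong_AE) (auto intro!: borel_measurable_scaleR borel_measurable_indicator)
  finally show ?thesis using box by simp
 qed
 have ib: "integrable lborel (\<lambda>x. indicator (box a b) x *\<^sub>R g x)" for a b
  by (rule integrable_mult_indicator[OF _ ig]) auto
 have "AE x in lborel. Re (g x) = 0"
  using ig arg_cong[OF z, of Re] integral_Re[OF ib] by (intro AE_zero_if_box_integrals_real) (auto simp: mult.commute)
 moreover have "AE x in lborel. Im (g x) = 0"
  using ig arg_cong[OF z, of Im] integral_Im[OF ib] by (intro AE_zero_if_box_integrals_real) (auto simp: mult.commute)
 ultimately have "AE x in lborel. G x = 0" using g(2) by eventually_elim (simp add: complex_eq_iff)
 then show ?thesis by (rule AE_completion)
qed

lemma bump_borel: "0 < e ==> bump a b e \<in> borel_fun"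
 by (intro smg_borel bump_smg)

lemma norm_bump_le': "0 < e ==> norm (bump a b e x) \<le> norm (indicator (box a b) x :: complex)"
 using norm_bump_le[of e a b x] by (cases "x \<in> box a b") simp_all

lemma AE_cbox_box: "AE x in lebesgue. x \<in> cbox a b --> x \<in> box a (b :: 'a::euclidean_space)"
proof (rule AE_completion, rule AE_I)
 show "vol (cbox a b - box a b) = 0"
  using box_subset_cbox[of a b] emeasure_lborel_cbox_eq[of a b] emeasure_lborel_box_eq[of a b]
  by (subst emeasure_Diff) (auto simp: emeasure_lborel_box_eq)
qed auto

context CZ_op
begin

text \<open>Here the hypotheses on \<open>T\<close> enter: on \<open>U\<close> the distribution is
  given both by \<open>S f\<close> and by the kernel integral. Their difference \<open>G\<close> is
  annihilated by test functions, and bumps turn this into vanishing integrals over boxes.\<close>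

lemma Rep_bump:
 assumes e: "\<And>i. 0 < e i" and U: "open U" and disj: "box (a j0) (b j0) \<inter> U = {}"
 shows "Rep U (\<lambda>i. bump (a i) (b i) (e i))"
proof -
 define f where "f i = bump (a i) (b i) (e i)" for i
 have smg: "f i \<in> smg" for i unfolding f_def by (rule bump_smg[OF e])
 have sch: "f i \<in> schwartz" for i using smg bump_zero by (intro smg_test(2)) (auto simp: f_def)
 have "{x. f j0 x \<noteq> 0} \<inter> U = {}" using disj bump_zero[of _ "a j0" "b j0"] by (auto simp: f_def)
 then have "supp (f j0) \<inter> U = {}" unfolding supp_def using open_Int_closure_eq_empty[OF U] by (simp add: Int_commute)
 then have UW: "U \<subseteq> - (\<Inter>j. supp (f j))" by blast
 have Kint': "(\<lambda>x. \<integral>y. K (point x y) * (PU j. f j (y $ j)) \<partial>lebesgue) = Kint f"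
 proof
  fix x
  have [measurable]: "f i \<in> borel_fun" for i by (rule smg_borel[OF smg])
  show "(\<integral>y. K (point x y) * (PU j. f j (y $ j)) \<partial>lebesgue) = Kint f x"
   unfolding Kint_def by (rule integral_completion) measurable
 qed
 define G where "G x = S f x - Kint f x" for x
 have G: "integrable lebesgue (\<lambda>x. G x * \<phi> x)" "(\<integral>x. G x * \<phi> x \<partial>lebesgue) = 0"
  if "\<phi> \<in> smg" "\<And>x. x \<notin> box c d ==> \<phi> x = 0" "cbox c d \<subseteq> U" for \<phi> c d
 proof -
  have t: "\<phi> \<in> test_functions" "supp \<phi> \<subseteq> cbox c d" using smg_test[OF that(1,2)] by auto
  have 1: "integrable lebesgue (\<lambda>x. S f x * \<phi> x)" "T f \<phi> = (\<integral>x. S f x * \<phi> x \<partial>lebesgue)"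
   using T_S[of f] sch t unfolding coincides_on_def by auto
  have 2: "integrable lebesgue (\<lambda>x. Kint f x * \<phi> x)" "T f \<phi> = (\<integral>x. Kint f x * \<phi> x \<partial>lebesgue)"
   using T_K[of f] sch t that(3) UW unfolding coincides_on_def Kint' by auto
  have e: "(\<lambda>x. G x * \<phi> x) = (\<lambda>x. S f x * \<phi> x - Kint f x * \<phi> x)" by (simp add: G_def algebra_simps)
  show "integrable lebesgue (\<lambda>x. G x * \<phi> x)" unfolding e using 1 2 by simp
  show "(\<integral>x. G x * \<phi> x \<partial>lebesgue) = 0" unfolding e using 1 2 by (subst Bochner_Integration.integral_diff) auto
 qed
 have on_box: "AE x in lebesgue. x \<in> X --> S f x = Kint f x" if X: "X \<subseteq> U" "X = cbox c d" for X c d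
 proof -
  \<comment> \<open>This fixed bump makes the difference integrable over the whole space and is
    nonzero inside the box, so it can be divided out at the end.\<close>
  let ?\<phi> = "bump c d 1"
  have \<phi>: "?\<phi> \<in> smg" by (rule bump_smg) simp
  let ?G = "\<lambda>x. G x * ?\<phi> x"
  have iG: "integrable lebesgue ?G" by (rule G(1)[OF \<phi> bump_zero]) (use X in auto)
  have "AE x in lebesgue. ?G x = 0"
  proof (rule AE_zero_if_box_integrals[OF iG])
   fix a' b' :: "real ^ 'n"
   have z: "(\<integral>x. bump a' b' (1 / real (Suc k)) x * ?G x \<partial>lebesgue) = 0" for k
   proof -
    have "(\<lambda>x. bump a' b' (1 / real (Suc k)) x * ?\<phi> x) \<in> smg" by (intro smg.mult bump_smg) auto
    then have "(\<integral>x. G x * (bump a' b' (1 / real (Suc k)) x * ?\<phi> x) \<partial>lebesgue) = 0"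
     by (rule G(2)[of _ c d]) (use X in \<open>auto simp: bump_zero\<close>)
    then show ?thesis by (simp add: mult_ac)
   qed
   have "(\<lambda>k. \<integral>x. bump a' b' (1 / real (Suc k)) x * ?G x \<partial>lebesgue) \<longlonglongrightarrow> (\<integral>x. indicator (box a' b') x * ?G x \<partial>lebesgue)"
   proof (rule integral_dominated_convergence)
    show "integrable lebesgue (\<lambda>x. norm (?G x))" using iG by simp
    show "AE x in lebesgue. (\<lambda>k. bump a' b' (1 / real (Suc k)) x * ?G x) \<longlonglongrightarrow> indicator (box a' b') x * ?G x"
     by (intro AE_I2 tendsto_mult bump_tendsto tendsto_const)
    show "AE x in lebesgue. norm (bump a' b' (1 / real (Suc k)) x * ?G x) \<le> norm (?G x)" for k
    proof (rule AE_I2)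
     fix x
     have "norm (bump a' b' (1 / real (Suc k)) x) \<le> indicator (box a' b') x" by (rule norm_bump_le) simp
     also have "\<dots> \<le> 1" by (simp add: indicator_def)
     finally show "norm (bump a' b' (1 / real (Suc k)) x * ?G x) \<le> norm (?G x)"
      using mult_right_mono[of "norm (bump a' b' (1 / real (Suc k)) x)" 1 "norm (?G x)"] by (simp add: norm_mult)
    qed
    have mG: "?G \<in> leb_fun" using iG by (rule borel_measurable_integrable)
    have "bump a' b' (1 / real (Suc k)) \<in> leb_fun" for k
     by (rule measurable_completion) (simp add: bump_borel)
    then show "(\<lambda>x. bump a' b' (1 / real (Suc k)) x * ?G x) \<in> leb_fun" for k
     by (intro borel_measurable_times mG)
    show "(\<lambda>x. indicator (box a' b') x * ?G x) \<in> leb_fun"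
     by (intro borel_measurable_times mG borel_measurable_indicator) auto
   qed
   then have "(\<integral>x. indicator (box a' b') x * ?G x \<partial>lebesgue) = 0" unfolding z by (simp add: LIMSEQ_const_iff)
   then show "(\<integral>x. indicator (box a' b') x *\<^sub>R ?G x \<partial>lebesgue) = 0"
    by (simp add: scaleR_conv_of_real of_real_indicator)
  qed
  with AE_cbox_box[of c d] show ?thesis
  proof eventually_elim
   case (elim x)
   show ?case
   proof
    assume "x \<in> X"
    then have "bump c d 1 x \<noteq> 0" using elim(1) X(2) bump_nonzero by blast
    then show "S f x = Kint f x" using elim(2) by (simp add: G_def)
   qed
  qed
 qed
 obtain \<D> where D0: "countable \<D>" "\<D> \<subseteq> Pow U" "\<And>X. X \<in> \<D> ==> \<exists>c d. X = cbox c d" "\<Union>\<D> = U"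
  by (rule open_countable_Union_open_cbox[OF assms(2)]) blast
 have D: "countable \<D>" "\<And>X. X \<in> \<D> ==> X \<subseteq> U" "\<And>X. X \<in> \<D> ==> \<exists>c d. X = cbox c d" "\<Union>\<D> = U"
  using D0 by auto
 have "AE x in lebesgue. \<forall>X\<in>\<D>. x \<in> X --> S f x = Kint f x"
 proof (subst AE_ball_countable[OF D(1)], rule ballI)
  fix X assume X: "X \<in> \<D>"
  then obtain c d where "X = cbox c d" using D(3) by blast
  then show "AE x in lebesgue. x \<in> X --> S f x = Kint f x" by (rule on_box[OF D(2)[OF X]])
 qed
 then have "Rep U f" unfolding Rep_def
 proof eventually_elim
  case (elim x)
  show ?case
  proof
   assume "x \<in> U"
   then obtain X where "X \<in> \<D>" "x \<in> X" using D(4) by blast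
   then show "S f x = Kint f x" using elim by blast
  qed
 qed
 then show ?thesis by (simp add: f_def[abs_def])
qed

section \<open>Kernel representation: from bumps to all admissible inputs\<close>

lemma adm_box: "adm r (\<lambda>x. indicator (box a b) x :: complex)"
 by (intro adm_indicator) (auto simp: emeasure_lborel_box_eq)

lemma adm_bump: "0 < e ==> 1 \<le> r ==> adm r (bump a b e)"
 by (rule adm_dominated[OF adm_box[of r a b], where c = 1]) (simp_all add: bump_borel norm_bump_le')

text \<open>Bumps are replaced by box indicators one slot at a time, \<open>J\<close> being the
  slots already done. \<open>V\<close> prescribes where each slot may live, so that slot
  \<open>j0\<close> keeps vanishing on \<open>U\<close>.\<close>

lemma Rep_box:
 fixes V :: "'m => (real ^ 'n) set"
 assumes U: "open U" "V j0 \<inter> U = {}" and J: "finite J"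
  and J1: "\<And>i. i \<in> J ==> \<exists>a b. box a b \<subseteq> V i \<and> f i = indicator (box a b)"
  and J2: "\<And>i. i \<notin> J ==> \<exists>a b e. box a b \<subseteq> V i \<and> 0 < e \<and> f i = bump a b e"
 shows "Rep U f"
 using J J1 J2
proof (induction J arbitrary: f rule: finite_induct)
 case empty
 then have "\<forall>i. \<exists>a b e. box a b \<subseteq> V i \<and> 0 < e \<and> f i = bump a b e" by simp
 then obtain a b e where "\<And>i. box (a i) (b i) \<subseteq> V i" "\<And>i. 0 < e i" "\<And>i. f i = bump (a i) (b i) (e i)" by metis
 moreover from this have "f = (\<lambda>i. bump (a i) (b i) (e i))" by auto
 ultimately show ?case using Rep_bump[of e U a j0 b] U by auto
next
 case (insert j J)
 obtain a b where ab: "box a b \<subseteq> V j" "f j = indicator (box a b)" using insert.prems(1)[of j] by auto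
 have adm: "adm (p i) (f i)" for i
  using insert.prems(1)[of i] insert.prems(2)[of i] adm_bump[OF _ p] adm_box by (cases "i \<in> insert j J") auto
 have van: "f j0 z = 0" if z: "z \<in> U" for z
 proof (cases "j0 \<in> insert j J")
  case True
  then show ?thesis using insert.prems(1)[of j0] z U(2) by (auto simp: indicator_def)
 next
  case False
  then obtain a b e where "box a b \<subseteq> V j0" "f j0 = bump a b e" using insert.prems(2)[of j0] by auto
  then show ?thesis using z U(2) bump_zero[of z a b e] by auto
 qed
 have "Rep U (f(j := indicator (box a b)))"
 proof (rule Rep_limit[OF U(1) adm adm_box])
  show "bump a b (1 / real (Suc k)) \<in> borel_fun" for k by (rule bump_borel) simp
  show "norm (bump a b (1 / real (Suc k)) x) \<le> norm (indicator (box a b) x :: complex)" for k x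
   by (rule norm_bump_le') simp
  show "(\<lambda>k. bump a b (1 / real (Suc k)) x) \<longlonglongrightarrow> indicator (box a b) x" for x by (rule bump_tendsto)
  show "(f(j := indicator (box a b))) j0 z = 0" if "z \<in> U" for z using van[OF that] ab by auto
  show "Rep U (f(j := bump a b (1 / real (Suc k))))" for k
  proof (rule insert.IH)
   show "\<exists>c d. box c d \<subseteq> V i \<and> (f(j := bump a b (1 / real (Suc k)))) i = indicator (box c d)" if "i \<in> J" for i
    using that insert.prems(1)[of i] insert.hyps by auto
   show "\<exists>c d e. box c d \<subseteq> V i \<and> 0 < e \<and> (f(j := bump a b (1 / real (Suc k)))) i = bump c d e" if "i \<notin> J" for i
   proof (cases "i = j")
    case True
    then show ?thesis using ab(1) by (intro exI[of _ a] exI[of _ b] exI[of _ "1 / real (Suc k)"]) auto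
   next
    case False
    then show ?thesis using that insert.prems(2)[of i] by auto
   qed
  qed
 qed
 then show ?case using ab(2) by (metis fun_upd_triv)
qed

text \<open>With the other slots fixed, the good functions in slot \<open>j\<close> contain box
  indicators and are closed under linear combinations and dominated limits; this reaches every
  admissible function vanishing off \<open>V\<close>.\<close>

lemma Rep_slot:
 assumes U: "open U" and f: "\<And>i. adm (p i) (f i)" and V: "open V"
  and van: "\<And>h z. (\<And>x. x \<notin> V ==> h x = 0) ==> z \<in> U ==> (f(j := h)) j0 z = 0"
  and base: "\<And>a b. box a b \<subseteq> V ==> Rep U (f(j := indicator (box a b)))"
  and h: "adm (p j) h" "\<And>x. x \<notin> V ==> h x = 0"
 shows "Rep U (f(j := h))"
proof -
 define Q where "Q h = Rep U (f(j := h))" for h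
 have Qi: "indicator E = (\<lambda>x. indicator E x :: complex)" for E :: "(real ^ 'n) set" by simp
 have comb: "Q (\<lambda>x. a * g x + b * h x)" if "Q g" "Q h" "adm (p j) g" "adm (p j) h" "\<And>x. x \<notin> V ==> g x = 0" "\<And>x. x \<notin> V ==> h x = 0" for a b g h
  unfolding Q_def by (rule Rep_comb[OF U f that(3,4) van van that(1,2)[unfolded Q_def]]) (use that in auto)
 have lim: "Q h'" if "adm (p j) g" "\<And>x. x \<notin> V ==> g x = 0" "\<And>k. h k \<in> borel_fun" "\<And>k x. norm (h k x) \<le> norm (g x)"
   "\<And>x. (\<lambda>k. h k x) \<longlonglongrightarrow> h' x" "\<And>k. Q (h k)" for g h h'
  unfolding Q_def by (rule Rep_limit[OF U f that(1,3,4,5) van that(6)[unfolded Q_def]]) (use that in auto)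
 have base': "Q (indicator (box a b))" if "box a b \<subseteq> V" for a b unfolding Q_def by (rule base[OF that])
 have Q0: "Q (\<lambda>x. 0)"
 proof -
  have "box 0 (0 :: real ^ 'n) = {}" by simp
  moreover have "indicator (box 0 (0 :: real ^ 'n)) = (\<lambda>x. 0 :: complex)" by (rule ext) simp
  ultimately show ?thesis using base'[of 0 0] by simp
 qed
 \<comment> \<open>Dynkin induction over Borel sets, inside one box so that all indicators are
   dominated by an admissible function.\<close>
 have S1: "Q (\<lambda>x. indicator (E \<inter> box a b) x)" if E: "E \<in> sets borel" and ab: "box a b \<subseteq> V" for E a b
 proof -
  have adm': "adm (p j) (\<lambda>x. indicator (E \<inter> box a b) x)" if "E \<in> sets borel" for E
  proof (rule adm_indicator)
   have "vol (E \<inter> box a b) \<le> vol (box a b)" using that by (intro emeasure_mono) auto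
   then show "vol (E \<inter> box a b) < \<infinity>" by (rule le_less_trans) (simp add: emeasure_lborel_box_eq)
  qed (use that in auto)
  have z: "indicator (E \<inter> box a b) x = (0 :: complex)" if "x \<notin> V" for E x using that ab by (auto simp: indicator_def)
  have "Int_stable (range (\<lambda>(a, b). box a b :: (real ^ 'n) set))" by (rule Int_stable_boxes)
  moreover have "range (\<lambda>(a, b). box a b :: (real ^ 'n) set) \<subseteq> Pow UNIV" by simp
  moreover have "E \<in> sigma_sets UNIV (range (\<lambda>(a, b). box a b))" using E by (simp add: borel_eq_box)
  ultimately show ?thesis
  proof (induction rule: sigma_sets_induct_disjoint)
   case (basic E)
   then obtain c d where "E = box c d" by auto
   then obtain c' d' where e: "E \<inter> box a b = box c' d'" by (auto simp: box_Int_box)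
   then have "box c' d' \<subseteq> V" using ab by auto
   then show ?case using base'[of c' d'] e by simp
  next
   case empty
   show ?case using Q0 by simp
  next
   case (compl E)
   then have E: "E \<in> sets borel" by (simp add: borel_eq_box)
   have "Q (\<lambda>x. 1 * indicator (box a b) x + (-1) * indicator (E \<inter> box a b) x)"
    by (intro comb base'[OF ab] compl(2) adm' E adm_box) (use ab in \<open>auto simp: indicator_def\<close>)
   moreover have "(\<lambda>x. 1 * indicator (box a b) x + (-1) * indicator (E \<inter> box a b) x) = (\<lambda>x. indicator ((UNIV - E) \<inter> box a b) x :: complex)"
    by (auto simp: indicator_def fun_eq_iff)
   ultimately show ?case by (simp only:)
  next
   case (union B)
   then have B: "B i \<in> sets borel" for i by (auto simp: borel_eq_box)
   have fin: "Q (\<lambda>x. indicator ((\<Union>i<k. B i) \<inter> box a b) x)" for k :: nat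
   proof (induction k)
    case 0
    show ?case using Q0 by simp
   next
    case (Suc k)
    have "Q (\<lambda>x. 1 * indicator ((\<Union>i<k. B i) \<inter> box a b) x + 1 * indicator (B k \<inter> box a b) x)"
     by (intro comb Suc adm' z union(3) B sets.countable_UN'') auto
    moreover have "(\<lambda>x. 1 * indicator ((\<Union>i<k. B i) \<inter> box a b) x + 1 * indicator (B k \<inter> box a b) x) = (\<lambda>x. indicator ((\<Union>i<Suc k. B i) \<inter> box a b) x :: complex)"
    proof
     fix x
     have "B k \<inter> (\<Union>i<k. B i) = {}" by (rule disjoint_family_Int_prev[OF union(1)])
     then show "1 * indicator ((\<Union>i<k. B i) \<inter> box a b) x + 1 * indicator (B k \<inter> box a b) x = (indicator ((\<Union>i<Suc k. B i) \<inter> box a b) x :: complex)"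
      by (auto simp: indicator_def lessThan_Suc)
    qed
    ultimately show ?case by (simp only:)
   qed
   show ?case
   proof (rule lim[OF adm_box[of "p j" a b] _ _ _ _ fin])
    show "(\<lambda>x. indicator ((\<Union>i<k. B i) \<inter> box a b) x) \<in> borel_fun" for k :: nat using B by measurable
    show "(\<lambda>k. indicator ((\<Union>i<k. B i) \<inter> box a b) x :: complex) \<longlonglongrightarrow> indicator (\<Union> (range B) \<inter> box a b) x" for x
    proof -
     have "(\<lambda>k. indicator (\<Union>i<k. B i) x * indicator (box a b) x :: complex) \<longlonglongrightarrow> indicator (\<Union> (range B)) x * indicator (box a b) x"
      by (intro tendsto_intros LIMSEQ_indicator_UN)
     then show ?thesis by (simp add: indicator_inter_arith)
    qed
   qed (use ab in \<open>auto simp: indicator_def\<close>)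
  qed
 qed
 \<comment> \<open>The open set \<open>V\<close> is a countable union of boxes; each stage adds the
   part of \<open>E\<close> in the next box that was not covered before.\<close>
 have S2: "Q (\<lambda>x. indicator E x)" if E: "E \<in> sets borel" "E \<subseteq> V" "vol E < \<infinity>" for E
 proof (cases "E = {}")
  case True
  then show ?thesis using Q0 by simp
 next
  case False
  obtain \<D> where D0: "countable \<D>" "\<D> \<subseteq> Pow V" "\<And>X. X \<in> \<D> ==> \<exists>c d. X = box c d" "\<Union>\<D> = V"
   by (rule open_countable_Union_open_box[OF V]) blast
  have D: "countable \<D>" "\<And>X. X \<in> \<D> ==> X \<subseteq> V" "\<And>X. X \<in> \<D> ==> \<exists>c d. X = box c d" "\<Union>\<D> = V"
   using D0 by auto
  have ne: "\<D> \<noteq> {}" using False E D(4) by auto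
  define B where "B = from_nat_into \<D>"
  have B: "B n \<in> \<D>" for n using from_nat_into[OF ne] by (simp add: B_def)
  have B': "B n \<in> sets borel" for n using D(3)[OF B[of n]] by auto
  have UB: "(\<Union>n. B n) = V" using D(4) range_from_nat_into[OF ne D(1)] by (simp add: B_def)
  have fin: "Q (\<lambda>x. indicator (E \<inter> (\<Union>i<k. B i)) x)" for k :: nat
  proof (induction k)
   case 0
   then show ?case using Q0 by simp
  next
   case (Suc k)
   obtain c d where cd: "B k = box c d" using D(3)[OF B] by metis
   have Q: "Q (\<lambda>x. indicator ((E - (\<Union>i<k. B i)) \<inter> box c d) x)"
    using E B' D(2)[OF B, of k] cd by (intro S1) auto
   have adm': "adm (p j) (\<lambda>x. indicator (E \<inter> F) x)" if "F \<in> sets borel" for F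
   proof (rule adm_indicator)
    have "vol (E \<inter> F) \<le> vol E" using that E by (intro emeasure_mono) auto
    then show "vol (E \<inter> F) < \<infinity>" using E(3) by (rule le_less_trans)
   qed (use that E in auto)
   have eq: "(E - (\<Union>i<k. B i)) \<inter> box c d = E \<inter> (box c d - (\<Union>i<k. B i))" by auto
   have "Q (\<lambda>x. 1 * indicator (E \<inter> (\<Union>i<k. B i)) x + 1 * indicator ((E - (\<Union>i<k. B i)) \<inter> box c d) x)"
   proof (intro comb Suc Q)
    show "adm (p j) (\<lambda>x. indicator (E \<inter> (\<Union>i<k. B i)) x)" by (intro adm' sets.countable_UN'' B') auto
    show "adm (p j) (\<lambda>x. indicator ((E - (\<Union>i<k. B i)) \<inter> box c d) x)"
     unfolding eq by (intro adm' sets.Diff sets.countable_UN'' B') auto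
   qed (use E(2) in \<open>auto simp: indicator_def\<close>)
   moreover have "(\<lambda>x. 1 * indicator (E \<inter> (\<Union>i<k. B i)) x + 1 * indicator ((E - (\<Union>i<k. B i)) \<inter> box c d) x) = (\<lambda>x. indicator (E \<inter> (\<Union>i<Suc k. B i)) x :: complex)"
    by (auto simp: indicator_def fun_eq_iff lessThan_Suc cd)
   ultimately show ?case by (simp only:)
  qed
  show ?thesis
  proof (rule lim[OF adm_indicator[OF E(1,3)] _ _ _ _ fin])
   show "(\<lambda>x. indicator (E \<inter> (\<Union>i<k. B i)) x) \<in> borel_fun" for k :: nat using B' E by measurable
   show "(\<lambda>k. indicator (E \<inter> (\<Union>i<k. B i)) x :: complex) \<longlonglongrightarrow> indicator E x" for x
   proof -
    have "(\<lambda>k. indicator E x * indicator (\<Union>i<k. B i) x :: complex) \<longlonglongrightarrow> indicator E x * indicator (\<Union>i. B i) x"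
     by (intro tendsto_intros LIMSEQ_indicator_UN)
    then have "(\<lambda>k. indicator (E \<inter> (\<Union>i<k. B i)) x :: complex) \<longlonglongrightarrow> indicator (E \<inter> V) x" by (simp add: indicator_inter_arith UB)
    then show ?thesis using E(2) by (simp add: Int_absorb2)
   qed
  qed (use E in \<open>auto simp: indicator_def\<close>)
 qed
 have S3: "Q (\<lambda>x. \<Sum>c\<in>C. c * indicator (E c) x) \<and> adm (p j) (\<lambda>x. \<Sum>c\<in>C. c * indicator (E c) x)"
  if "finite C" "\<And>c. c \<in> C ==> E c \<in> sets borel \<and> E c \<subseteq> V \<and> vol (E c) < \<infinity>" for C :: "complex set" and E
  using that
 proof (induction C rule: finite_induct)
  case empty
  have "adm (p j) (\<lambda>x. indicator {} x :: complex)" using adm_indicator[of "{}"] by simp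
  then show ?case using Q0 by simp
 next
  case (insert c C)
  have E: "E c \<in> sets borel" "E c \<subseteq> V" "vol (E c) < \<infinity>" using insert.prems[of c] by auto
  have z: "(\<Sum>c\<in>C. c * indicator (E c) x) = 0" if "x \<notin> V" for x
   using insert.prems that by (intro sum.neutral) (force simp: indicator_def)
  have IH: "Q (\<lambda>x. \<Sum>c\<in>C. c * indicator (E c) x)" "adm (p j) (\<lambda>x. \<Sum>c\<in>C. c * indicator (E c) x)"
   using insert.IH insert.prems by auto
  have "Q (\<lambda>x. c * indicator (E c) x + 1 * (\<Sum>c\<in>C. c * indicator (E c) x))"
   by (intro comb IH S2 adm_indicator z E) (use E(2) in \<open>auto simp: indicator_def\<close>)
  moreover have "adm (p j) (\<lambda>x. c * indicator (E c) x + 1 * (\<Sum>c\<in>C. c * indicator (E c) x))"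
   by (intro adm_lincomb IH adm_indicator E p)
  ultimately show ?case unfolding sum.insert[OF insert.hyps] mult_1_left ..
 qed
 have hm: "h \<in> borel_fun" by (rule adm_borel[OF h(1)])
 obtain s where s: "\<And>i. simple_function borel (s i)" "\<And>x. (\<lambda>i. s i x) \<longlonglongrightarrow> h x" "\<And>i x. dist (s i x) 0 \<le> 2 * dist (h x) 0"
  using borel_measurable_implies_sequence_metric[OF hm, of 0] by auto
 have sle: "norm (s i x) \<le> norm (2 * h x)" for i x using s(3)[of i x] by (simp add: norm_mult)
 have "Q h"
 proof (rule lim[OF adm_cmult[OF h(1), of 2] _ _ sle s(2)])
  show "s i \<in> borel_fun" for i by (rule borel_measurable_simple_function[OF s(1)])
  fix i
  \<comment> \<open>The nonzero values of the simple function: without 0, each level set lies in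
    \<open>V\<close> and has finite measure.\<close>
  define C where "C = range (s i) - {0}"
  have C: "finite C" using simple_functionD(1)[OF s(1)[of i]] by (simp add: C_def)
  have "s i x = (\<Sum>c\<in>C. c * indicator (s i -` {c}) x)" for x
  proof (cases "s i x = 0")
   case True
   then have "(\<Sum>c\<in>C. c * indicator (s i -` {c}) x) = 0" by (intro sum.neutral) (auto simp: indicator_def)
   then show ?thesis using True by simp
  next
   case False
   then have "s i x \<in> C" by (simp add: C_def)
   then have "(\<Sum>c\<in>C. c * indicator (s i -` {c}) x) = (\<Sum>c\<in>{s i x}. c * indicator (s i -` {c}) x)"
    using C by (intro sum.mono_neutral_right) (auto simp: indicator_def)
   then show ?thesis by simp
  qed
  then have e: "s i = (\<lambda>x. \<Sum>c\<in>C. c * indicator (s i -` {c}) x)" by (rule ext)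
  have "s i -` {c} \<in> sets borel \<and> s i -` {c} \<subseteq> V \<and> vol (s i -` {c}) < \<infinity>" if c: "c \<in> C" for c
  proof (intro conjI)
   show m: "s i -` {c} \<in> sets borel" using simple_functionD(2)[OF s(1)[of i], of "{c}"] by simp
   have c0: "c \<noteq> 0" using c by (simp add: C_def)
   show "s i -` {c} \<subseteq> V"
   proof
    fix x assume "x \<in> s i -` {c}"
    then have "s i x \<noteq> 0" using c0 by auto
    then have "h x \<noteq> 0" using sle[of i x] by auto
    then show "x \<in> V" using h(2) by blast
   qed
   have "vol (s i -` {c}) = (NN x. indicator (s i -` {c}) x)" using m by simp
   also have "\<dots> \<le> (NN x. ennreal (2 / norm c) * en h x)"
   proof (rule nn_integral_mono)
    fix x
    show "(indicator (s i -` {c}) x :: ennreal) \<le> ennreal (2 / norm c) * en h x"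
    proof (cases "s i x = c")
     case True
     then have "norm c \<le> 2 * norm (h x)" using sle[of i x] by (simp add: norm_mult)
     then have "1 \<le> 2 / norm c * norm (h x)" using c0 by (simp add: field_simps)
     then have "ennreal 1 \<le> ennreal (2 / norm c * norm (h x))" by (rule ennreal_leI)
     also have "\<dots> = ennreal (2 / norm c) * en h x" by (intro ennreal_mult) auto
     finally show ?thesis using True by simp
    qed simp
   qed
   also have "\<dots> = ennreal (2 / norm c) * L1 h"
    using hm by (intro nn_integral_cmult) auto
   also have "\<dots> < \<infinity>" using adm_nn_integral[OF h(1)] by (simp add: ennreal_mult_less_top)
   finally show "vol (s i -` {c}) < \<infinity>" .
  qed
  from S3[OF C this] show "Q (s i)" by (subst e) auto
 qed (use h in auto)
 then show ?thesis by (simp add: Q_def)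
qed

text \<open>Slot \<open>j0\<close> is confined to \<open>V\<close>, all others range over the whole
  space, and \<open>Rep_slot\<close> is applied to one slot after another.\<close>

lemma Rep_general:
 assumes U: "open U" and V: "open V" "V \<inter> U = {}"
  and f: "\<And>i. adm (p i) (f i)" and van: "\<And>x. x \<notin> V ==> f j0 x = 0"
 shows "Rep U f"
proof -
 define W where "W i = (if i = j0 then V else UNIV)" for i
 have WU: "W j0 \<inter> U = {}" using V by (simp add: W_def)
 have W: "open (W i)" for i using V by (simp add: W_def)
 have "Rep U f" if "finite J" "\<And>i. i \<in> J ==> adm (p i) (f i) \<and> (\<forall>x. x \<notin> W i --> f i x = 0)"
   "\<And>i. i \<notin> J ==> \<exists>a b. box a b \<subseteq> W i \<and> f i = indicator (box a b)" for J f
  using that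
 proof (induction J arbitrary: f rule: finite_induct)
  case empty
  show ?case by (rule Rep_box[of U W j0 UNIV]) (use U WU empty in auto)
 next
  case (insert j J)
  have adm': "adm (p i) (f i)" for i
   using insert.prems(1)[of i] insert.prems(2)[of i] adm_box by (cases "i \<in> insert j J") auto
  have z: "f j0 z = 0" if "z \<in> U" for z
   using insert.prems(1)[of j0] insert.prems(2)[of j0] that WU by (cases "j0 \<in> insert j J") (auto simp: indicator_def)
  have "Rep U (f(j := f j))"
  proof (rule Rep_slot[OF U adm' W[of j]])
   show "(f(j := h)) j0 z = 0" if "\<And>x. x \<notin> W j ==> h x = 0" "z \<in> U" for h z
    using that z WU by auto
   show "Rep U (f(j := indicator (box a b)))" if "box a b \<subseteq> W j" for a b
   proof (rule insert.IH)
    show "adm (p i) ((f(j := indicator (box a b))) i) \<and> (\<forall>x. x \<notin> W i --> (f(j := indicator (box a b))) i x = 0)" if "i \<in> J" for i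
     using insert.prems(1)[of i] insert.hyps that by auto
    show "\<exists>c d. box c d \<subseteq> W i \<and> (f(j := indicator (box a b))) i = indicator (box c d)" if "i \<notin> J" for i
     using insert.prems(2)[of i] that \<open>box a b \<subseteq> W j\<close> by (cases "i = j") auto
   qed
  qed (use insert.prems(1)[of j] in auto)
  then show ?case by simp
 qed
 from this[of UNIV] show ?thesis using f van by (auto simp: W_def)
qed

end

section \<open>Calderon--Zygmund decomposition\<close>

lemma disjoint_THE:
 assumes "disjoint F" "P \<in> F" "y \<in> P"
 shows "(THE P. P \<in> F \<and> y \<in> P) = P"
 using assms by (intro the_equality) (auto simp: disjoint_def)

text \<open>Stopping at height \<open>t\<close> relative to a mean of at most 1. The good part
  \<open>h\<close> averages \<open>f\<close> over the stopping cubes, so \<open>f - h\<close> has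
  mean zero on each of them and the L^1 norm does not grow.\<close>

lemma CZ_decomposition:
 fixes f :: "'n::finite cfun"
 assumes r: "0 < r" and f: "integrable lborel f" "\<And>y. y \<notin> hcube c r ==> f y = 0"
  and le: "L1 f \<le> ennreal (r ^ CARD('n))" and t: "1 \<le> t"
 obtains F h where "countable F" "disjoint F" "\<And>P. P \<in> F ==> \<exists>c' r'. 0 < r' \<and> P = hcube c' r' \<and> P \<subseteq> hcube c r"
  "vol (\<Union>F) \<le> ennreal (r ^ CARD('n) / t)"
  "h \<in> borel_fun" "\<And>y. y \<notin> hcube c r ==> h y = 0" "AE y in lborel. norm (h y) \<le> 2 ^ CARD('n) * t"
  "\<And>y. y \<notin> \<Union>F ==> h y = f y"
  "\<And>P. P \<in> F ==> (\<integral>y. indicator P y *\<^sub>R (f y - h y) \<partial>lborel) = 0"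
  "\<And>P. P \<in> F ==> (NN y. en h y * indicator P y) \<le> (NN y. en f y * indicator P y)"
  "L1 h \<le> L1 f"
proof -
 let ?n = "CARD('n)" let ?Q = "hcube c r"
 have [measurable]: "f \<in> borel_fun" using f(1) by auto
 define g where "g y = en f y" for y
 have [measurable]: "g \<in> borel_fun" unfolding g_def by measurable
 define Bd where "Bd P \<longleftrightarrow> ennreal t * vol P < (NN y. g y * indicator P y)" for P
 define F where "F = stopfam c r 0 ?Q Bd"
 have Q: "?Q = dy c r 0 c" using dy_top[OF r, of c] by simp
 have UF: "\<Union>F = {y \<in> ?Q. \<exists>l>0. Bd (dy c r l y)}" unfolding F_def Q by (rule Union_stopfam)
 have UFQ: "\<Union>F \<subseteq> ?Q" unfolding UF by blast
 have mUF [measurable]: "\<Union>F \<in> sets borel" by (simp add: F_def)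
 have F: "countable F" "disjoint F" "\<And>P. P \<in> F ==> P \<in> sets borel"
  by (auto simp: F_def countable_stopfam stopfam_disjoint stopfam_borel)
 have intQ: "(NN y. g y * indicator P y) \<le> ennreal (r ^ ?n)" for P
 proof -
  have "(NN y. g y * indicator P y) \<le> (NN y. g y)" by (intro nn_integral_mono) (auto simp: indicator_def)
  then show ?thesis using le by (simp add: g_def)
 qed
 have small: "vol (\<Union>F) \<le> ennreal (r ^ ?n / t)"
 proof -
  have "vol (\<Union>F) \<le> ennreal (1 / t) * emeasure (density lborel g) (\<Union>F)"
  proof (rule emeasure_Union_le[OF F])
   fix P assume P: "P \<in> F"
   then have "Bd P" by (auto simp: F_def stopfam_def)
   then have "ennreal (1 / t) * (ennreal t * vol P) \<le> ennreal (1 / t) * emeasure (density lborel g) P"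
    using F(3)[OF P] by (intro mult_left_mono) (auto simp: Bd_def emeasure_density)
   also have "ennreal (1 / t) * (ennreal t * vol P) = ennreal (1 / t * t) * vol P"
    using t by (subst ennreal_mult) (auto simp: mult.assoc)
   finally show "vol P \<le> ennreal (1 / t) * emeasure (density lborel g) P" using t by simp
  qed auto
  also have "\<dots> \<le> ennreal (1 / t) * ennreal (r ^ ?n)"
   using intQ[of "\<Union>F"] by (intro mult_left_mono) (auto simp: emeasure_density)
  also have "\<dots> = ennreal (r ^ ?n / t)" using t r by (simp add: ennreal_mult[symmetric])
  finally show ?thesis .
 qed
 have cube: "\<exists>c' r'. 0 < r' \<and> P = hcube c' r' \<and> (NN x. g x * indicator P x) \<le> ennreal (2 ^ ?n * t * r' ^ ?n)" if P: "P \<in> F" for P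
 proof -
  obtain l y where l: "P = dy c r l y" "y \<in> ?Q" "0 < l" "\<forall>i. 0 < i \<and> i < l --> \<not> Bd (dy c r i y)"
   using P by (auto simp: F_def stopfam_def)
  obtain j where j: "l = Suc j" using l(3) by (cases l) auto
  \<comment> \<open>The parent is not bad, or it is the top cube, whose mean is at most 1 and hence
    at most \<open>t\<close>.\<close>
  have par: "(NN x. g x * indicator (dy c r j y) x) \<le> ennreal (t * (r / 2 ^ j) ^ ?n)"
  proof (cases "j = 0")
   case True
   have "(NN x. g x * indicator (dy c r j y) x) \<le> ennreal (r ^ ?n)" by (rule intQ)
   also have "\<dots> \<le> ennreal (t * (r / 2 ^ j) ^ ?n)" using True t r by (intro ennreal_leI) auto
   finally show ?thesis .
  next
   case False
   then have "\<not> Bd (dy c r j y)" using l(4) j by auto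
   then have "(NN x. g x * indicator (dy c r j y) x) \<le> ennreal t * ennreal ((r / 2 ^ j) ^ ?n)"
    using r by (simp add: Bd_def not_less emeasure_dy)
   also have "\<dots> = ennreal (t * (r / 2 ^ j) ^ ?n)" using t r by (intro ennreal_mult[symmetric]) auto
   finally show ?thesis .
  qed
  let ?c = "dlo c r l y" let ?r = "r / 2 ^ l"
  have P': "P = hcube ?c ?r" and r': "0 < ?r" using r by (auto simp: l(1) dy_hcube)
  have "(NN x. g x * indicator P x) \<le> (NN x. g x * indicator (dy c r j y) x)"
   using dy_Suc[of c r j y] l(1) j by (intro nn_integral_mono mult_left_mono) (auto simp: indicator_def)
  also have "\<dots> \<le> ennreal (t * (r / 2 ^ j) ^ ?n)" by (rule par)
  also have "t * (r / 2 ^ j) ^ ?n = 2 ^ ?n * t * ?r ^ ?n" by (simp add: j power_divide power_mult_distrib)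
  finally show ?thesis using P' r' by blast
 qed
 define z where "z P = (\<integral>y. indicator P y *\<^sub>R f y \<partial>lborel) /\<^sub>R measure lborel P" for P
 \<comment> \<open>The cubes are disjoint, so \<open>THE\<close> picks the single cube containing
   \<open>y\<close>.\<close>
 define h where "h y = (if y \<in> \<Union>F then z (THE P. P \<in> F \<and> y \<in> P) else f y)" for y
 have hP: "h y = z P" if "P \<in> F" "y \<in> P" for P y
  using that disjoint_THE[OF F(2) that] by (auto simp: h_def)
 have hm [measurable]: "h \<in> borel_fun"
 proof (rule borel_measurableI)
  fix U :: "complex set" assume U: "open U"
  have hoff: "h y = f y" if "y \<notin> \<Union>F" for y using that by (simp add: h_def)
  have "y \<in> h -` U \<longleftrightarrow> y \<in> \<Union>{P \<in> F. z P \<in> U} \<union> (f -` U - \<Union>F)" for y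
  proof (cases "y \<in> \<Union>F")
   case True
   then obtain P where P: "P \<in> F" "y \<in> P" by blast
   have "P' = P" if "P' \<in> F" "y \<in> P'" for P' using F(2) P that by (auto simp: disjoint_def)
   then have "y \<in> \<Union>{P \<in> F. z P \<in> U} \<longleftrightarrow> z P \<in> U" using P by blast
   then show ?thesis using hP[OF P] True by (simp only: Un_iff Diff_iff vimage_eq simp_thms)
  next
   case False
   then show ?thesis using hoff[OF False] by auto
  qed
  then have "h -` U \<inter> space borel = \<Union>{P \<in> F. z P \<in> U} \<union> (f -` U - \<Union>F)" by (simp add: set_eq_iff)
  moreover have "\<Union>{P \<in> F. z P \<in> U} \<in> sets borel"
   using F by (intro Union_borel countable_subset[OF _ F(1)]) auto
  moreover have "f -` U \<in> sets borel"
   using measurable_sets[of f borel borel U] U by simp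
  ultimately show "h -` U \<inter> space borel \<in> sets borel" using mUF by auto
 qed
 have zP: "norm (z P) \<le> 2 ^ ?n * t" "en z P * vol P \<le> (NN x. g x * indicator P x)"
  if P: "P \<in> F" for P
 proof -
  obtain c' r' where r': "0 < r'" "P = hcube c' r'" and b: "(NN x. g x * indicator P x) \<le> ennreal (2 ^ ?n * t * r' ^ ?n)"
   using cube[OF P] by blast
  have mP: "measure lborel P = r' ^ ?n" "vol P = ennreal (r' ^ ?n)" using r' by (auto simp: measure_def emeasure_hcube)
  have "ennreal (norm (\<integral>y. indicator P y *\<^sub>R f y \<partial>lborel)) \<le> (NN y. ennreal (norm (indicator P y *\<^sub>R f y)))"
   by (rule norm_integral_le_nn)
  also have "\<dots> = (NN x. g x * indicator P x)"
   by (intro nn_integral_cong) (auto simp: indicator_def g_def)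
  finally have I: "ennreal (norm (\<integral>y. indicator P y *\<^sub>R f y \<partial>lborel)) \<le> (NN x. g x * indicator P x)" .
  have e: "norm (\<integral>y. indicator P y *\<^sub>R f y \<partial>lborel) = norm (z P) * r' ^ ?n"
   using r'(1) by (simp add: z_def mP)
  show "en z P * vol P \<le> (NN x. g x * indicator P x)"
   using I r' unfolding e mP by (simp add: ennreal_mult)
  have "ennreal (norm (z P) * r' ^ ?n) \<le> ennreal (2 ^ ?n * t * r' ^ ?n)" using I b unfolding e by (rule order_trans)
  then have "norm (z P) * r' ^ ?n \<le> 2 ^ ?n * t * r' ^ ?n" using t r' by (subst (asm) ennreal_le_iff) auto
  then show "norm (z P) \<le> 2 ^ ?n * t" using r' by simp
 qed
 have hint: "(NN y. en h y * indicator P y) \<le> (NN y. g y * indicator P y)" if P: "P \<in> F" for P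
 proof -
  have "(NN y. en h y * indicator P y) = (NN y. en z P * indicator P y)"
   using hP[OF P] by (intro nn_integral_cong) (auto simp: indicator_def)
  also have "\<dots> = en z P * vol P" using F(3)[OF P] by (simp add: nn_integral_cmult_indicator)
  finally show ?thesis using zP(2)[OF P] by simp
 qed
 have off: "AE y in lborel. y \<in> ?Q - \<Union>F --> g y \<le> ennreal t"
 proof (rule dyadic_AE_le[OF r, where k = 0 and a = c])
  have "vol (?Q - \<Union>F) \<le> vol ?Q" by (intro emeasure_mono) auto
  then show "vol (?Q - \<Union>F) < \<infinity>" using r by (auto simp: emeasure_hcube intro: le_less_trans)
  fix x l assume x: "x \<in> ?Q - \<Union>F" and l: "0 < (l::nat)"
  then have "\<not> Bd (dy c r l x)" unfolding UF using l by blast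
  then show "(NN y. g y * indicator (dy c r l x) y) \<le> ennreal t * vol (dy c r l x)"
   by (simp add: Bd_def not_less)
 qed (use t in auto)
 show thesis
 proof (rule that[of F h])
  show "countable F" "disjoint F" by fact+
  show "\<exists>c' r'. 0 < r' \<and> P = hcube c' r' \<and> P \<subseteq> ?Q" if "P \<in> F" for P
   using cube[OF that] UFQ that by blast
  show "vol (\<Union>F) \<le> ennreal (r ^ ?n / t)" by fact
  show "h \<in> borel_fun" by fact
  show "h y = 0" if "y \<notin> ?Q" for y using that UFQ f(2) by (auto simp: h_def)
  show "h y = f y" if "y \<notin> \<Union>F" for y using that by (simp add: h_def)
  have t1: "t \<le> 2 ^ ?n * t" using t by simp
  show "AE y in lborel. norm (h y) \<le> 2 ^ ?n * t"
   using off
  proof eventually_elim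
   case (elim y)
   consider P where "P \<in> F" "y \<in> P" | "y \<in> ?Q - \<Union>F" | "y \<notin> ?Q" by auto
   then show ?case
   proof cases
    case 1
    then show ?thesis using hP zP by auto
   next
    case 2
    then have "norm (f y) \<le> t" using elim t by (auto simp: g_def)
    then show ?thesis using 2 t1 by (simp add: h_def)
   next
    case 3
    then have "h y = 0" using UFQ f(2) by (auto simp: h_def)
    then show ?thesis using t by simp
   qed
  qed
  show "(\<integral>y. indicator P y *\<^sub>R (f y - h y) \<partial>lborel) = 0" if P: "P \<in> F" for P
  proof -
   obtain c' r' where r': "0 < r'" "P = hcube c' r'" using cube[OF P] by blast
   have mP: "measure lborel P = r' ^ ?n" "vol P < \<infinity>" using r' by (auto simp: measure_def emeasure_hcube)
   have "(\<integral>y. indicator P y *\<^sub>R (f y - h y) \<partial>lborel) = (\<integral>y. indicator P y *\<^sub>R f y - indicator P y *\<^sub>R z P \<partial>lborel)"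
    using hP[OF P] by (intro Bochner_Integration.integral_cong) (auto simp: indicator_def)
   also have "\<dots> = (\<integral>y. indicator P y *\<^sub>R f y \<partial>lborel) - (\<integral>y. indicator P y *\<^sub>R z P \<partial>lborel)"
   proof (rule Bochner_Integration.integral_diff)
    show "integrable lborel (\<lambda>y. indicator P y *\<^sub>R f y)" using F(3)[OF P] f(1) by (intro integrable_mult_indicator) auto
    show "integrable lborel (\<lambda>y. indicator P y *\<^sub>R z P)" using F(3)[OF P] mP by (intro integrable_scaleR_left integrable_real_indicator) auto
   qed
   also have "(\<integral>y. indicator P y *\<^sub>R z P \<partial>lborel) = measure lborel P *\<^sub>R z P" using F(3)[OF P] mP by simp
   also have "\<dots> = (\<integral>y. indicator P y *\<^sub>R f y \<partial>lborel)" using r'(1) by (simp add: z_def mP)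
   finally show ?thesis by simp
  qed
  show "(NN y. en h y * indicator P y) \<le> (NN y. en f y * indicator P y)" if "P \<in> F" for P
   using hint[OF that] by (simp add: g_def)
  have "L1 h = (NN y. en h y * indicator (\<Union>F) y + en h y * indicator (- \<Union>F) y)"
   by (intro nn_integral_cong) (auto simp: indicator_def)
  also have "\<dots> = emeasure (density lborel (en h)) (\<Union>F) + (NN y. en h y * indicator (- \<Union>F) y)"
   by (subst nn_integral_add) (auto simp: emeasure_density)
  also have "emeasure (density lborel (en h)) (\<Union>F) \<le> 1 * emeasure (density lborel g) (\<Union>F)"
   by (rule emeasure_Union_le[OF F]) (use hint F(3) in \<open>auto simp: emeasure_density\<close>)
  also have "1 * emeasure (density lborel g) (\<Union>F) = (NN y. g y * indicator (\<Union>F) y)" by (simp add: emeasure_density)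
  also have "(NN y. en h y * indicator (- \<Union>F) y) = (NN y. g y * indicator (- \<Union>F) y)"
   by (intro nn_integral_cong) (auto simp: indicator_def h_def g_def)
  also have "(NN y. g y * indicator (\<Union>F) y) + (NN y. g y * indicator (- \<Union>F) y) = (NN y. g y * indicator (\<Union>F) y + g y * indicator (- \<Union>F) y)"
   by (rule nn_integral_add[symmetric]) auto
  also have "\<dots> = (NN y. g y)" by (intro nn_integral_cong) (auto simp: indicator_def)
  finally show "L1 h \<le> L1 f" by (simp add: g_def add_right_mono)
 qed
qed

section \<open>Kernel tails\<close>

context CZ_ker
begin

text \<open>The smoothness \<epsilon> split evenly over the slots: m (n + gam) = m n + \<epsilon>,
  so the decay of the kernel differences factors into one-variable tails.\<close>

definition gam :: real where "gam = \<epsilon> / real CARD('m)"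

lemma gam_pos: "0 < gam" using eps by (simp add: gam_def)

definition tgam :: real where "tgam = tailc CARD('n) gam"

lemma tgam_pos: "0 < tgam" unfolding tgam_def by (intro tailc_pos gam_pos)

lemma tail_gam:
 "(u :: real ^ 'n => ennreal) \<in> borel_fun ==> maxbd u a x ==> 0 \<le> a ==> 0 < r ==>
  (NN y. u y * ennreal ((r + dist x y) powr - (real CARD('n) + gam))) \<le> ennreal (tgam * a * r powr - gam)"
 using tail_bound[OF gam_pos, of u a x r] by (simp add: tgam_def)

lemma gam_mult: "real CARD('m) * (real CARD('n) + gam) = real (CARD('m) * CARD('n)) + \<epsilon>"
 by (simp add: gam_def algebra_simps)

text \<open>Each slot receives the share n + gam of the exponent, and each \<open>a i\<close> is at
  most \<open>c * t\<close>.\<close>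

lemma powr_sum_le_prod:
 assumes c: "0 < c" and a: "\<And>i. 0 < a i" "\<And>i. a i \<le> c * t"
 shows "1 / t powr (real (CARD('m) * CARD('n)) + \<epsilon>) \<le> c powr (real (CARD('m) * CARD('n)) + \<epsilon>) * (\<Prod>i\<in>(UNIV::'m set). a i powr - (real CARD('n) + gam))"
proof -
 let ?s = "real (CARD('m) * CARD('n)) + \<epsilon>"
 have "0 < c * t" using a(1)[of undefined] a(2)[of undefined] by linarith
 then have t: "0 < t" using c by (simp add: zero_less_mult_iff)
 have "(\<Prod>i\<in>(UNIV::'m set). (c * t) powr - (real CARD('n) + gam)) \<le> (\<Prod>i\<in>(UNIV::'m set). a i powr - (real CARD('n) + gam))"
  using a gam_pos by (intro prod_mono conjI powr_mono2') auto
 moreover have "(\<Prod>i\<in>(UNIV::'m set). (c * t) powr - (real CARD('n) + gam)) = (c * t) powr - ?s"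
 proof -
  have "(\<Prod>i\<in>(UNIV::'m set). (c * t) powr - (real CARD('n) + gam)) = ((c * t) powr - (real CARD('n) + gam)) powr real CARD('m)"
   using c t by (simp add: powr_realpow)
  also have "\<dots> = (c * t) powr (- (real CARD('n) + gam) * real CARD('m))" by (rule powr_powr)
  also have "- (real CARD('n) + gam) * real CARD('m) = - ?s" using gam_mult by (simp add: algebra_simps)
  finally show ?thesis .
 qed
 ultimately have "c powr ?s * (c * t) powr - ?s \<le> c powr ?s * (\<Prod>i\<in>(UNIV::'m set). a i powr - (real CARD('n) + gam))"
  using c by (intro mult_left_mono) auto
 moreover have "c powr ?s * (c * t) powr - ?s = 1 / t powr ?s"
 proof -
  have "c powr s * (c * t) powr - s = 1 / t powr s" for s
   using c t by (simp add: powr_mult powr_minus field_simps)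
  then show ?thesis .
 qed
 ultimately show ?thesis by (simp only:)
qed

lemma prod_tail_nn:
 assumes "\<And>i. (f :: 'm => 'n cfun) i \<in> borel_fun"
 shows "(NN y. ennreal ((PU i. (R + dist x (y $ i)) powr - (real CARD('n) + gam)) * norm (PU i. f i (y $ i))))
  = (PU i. NN y. en (f i) y * ennreal ((R + dist x y) powr - (real CARD('n) + gam)))"
proof -
 have [measurable]: "f i \<in> borel_fun" for i by (rule assms)
 have "(NN y. ennreal ((PU i. (R + dist x (y $ i)) powr - (real CARD('n) + gam)) * norm (PU i. f i (y $ i))))
  = (NN y. (PU i. ennreal (norm (f i (y $ i))) * ennreal ((R + dist x (y $ i)) powr - (real CARD('n) + gam))))"
  by (intro nn_integral_cong) (simp add: prod_norm[symmetric] prod.distrib[symmetric] ennreal_mult[symmetric] prod_ennreal mult.commute)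
 also have "\<dots> = (PU i. NN y. en (f i) y * ennreal ((R + dist x y) powr - (real CARD('n) + gam)))"
  by (rule nn_integral_prod_vec[where F = "\<lambda>i y. en (f i) y * ennreal ((R + dist x y) powr - (real CARD('n) + gam))"]) measurable
 finally show ?thesis .
qed

end

section \<open>The weak-type estimate for the extended operator\<close>

context CZ_op
begin

definition "ctail = tgam ^ (CARD('m) - 1)"

text \<open>Slot \<open>j\<close> is estimated by its L^1 norm and the largest weight, every other
  slot by its maximal function through \<open>tail_gam\<close>; the powers of \<open>R\<close> add
  up to n + gam + (m - 1) gam = n + \<epsilon>.\<close>

lemma Kint_tail:
 fixes f :: "'m => 'n cfun"
 assumes f: "\<And>i. adm (p i) (f i)" and R: "0 < R" and t: "0 \<le> t" and m: "\<And>i. i \<noteq> j ==> maxbd (en (f i)) t x"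
 shows "(PU i. NN y. en (f i) y * ennreal ((R + dist x y) powr - (real CARD('n) + gam)))
   \<le> ennreal (ctail * t ^ (CARD('m) - 1) * R powr - (real CARD('n) + \<epsilon>)) * L1 (f j)"
proof -
 have [measurable]: "f i \<in> borel_fun" for i using adm_borel[OF f] .
 let ?w = "\<lambda>y. ennreal ((R + dist x y) powr - (real CARD('n) + gam))"
 have 1: "(NN y. en (f j) y * ?w y) \<le> ennreal (R powr - (real CARD('n) + gam)) * L1 (f j)"
 proof -
  have "(NN y. en (f j) y * ?w y) \<le> (NN y. ennreal (R powr - (real CARD('n) + gam)) * en (f j) y)"
  proof (rule nn_integral_mono)
   fix y
   have "(R + dist x y) powr - (real CARD('n) + gam) \<le> R powr - (real CARD('n) + gam)"
    using R gam_pos by (intro powr_mono2') auto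
   then show "en (f j) y * ?w y \<le> ennreal (R powr - (real CARD('n) + gam)) * en (f j) y"
    by (subst mult.commute) (intro mult_right_mono ennreal_leI, auto)
  qed
  then show ?thesis by (simp add: nn_integral_cmult)
 qed
 have 2: "(NN y. en (f i) y * ?w y) \<le> ennreal (tgam * t * R powr - gam)" if "i \<noteq> j" for i
  by (rule tail_gam[OF _ m[OF that] t R]) measurable
 have "(PU i. NN y. en (f i) y * ?w y)
   = (NN y. en (f j) y * ?w y) * (\<Prod>i\<in>UNIV - {j}. \<integral>\<^sup>+y. en (f i) y * ?w y \<partial>lborel)"
  by (rule prod.remove) auto
 also have "\<dots> \<le> (ennreal (R powr - (real CARD('n) + gam)) * L1 (f j)) * (\<Prod>i\<in>UNIV - {j}. ennreal (tgam * t * R powr - gam))"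
  by (intro mult_mono 1 prod_mono_ennreal 2) auto
 also have "(\<Prod>i\<in>UNIV - {j}. ennreal (tgam * t * R powr - gam)) = ennreal ((tgam * t * R powr - gam) ^ (CARD('m) - 1))"
  using tgam_pos t by (simp add: ennreal_power card_Diff_singleton)
 also have "(ennreal (R powr - (real CARD('n) + gam)) * L1 (f j)) * ennreal ((tgam * t * R powr - gam) ^ (CARD('m) - 1))
   = ennreal (R powr - (real CARD('n) + gam) * (tgam * t * R powr - gam) ^ (CARD('m) - 1)) * L1 (f j)"
  using tgam_pos t by (subst ennreal_mult) (auto simp: mult_ac)
 also have "R powr - (real CARD('n) + gam) * (tgam * t * R powr - gam) ^ (CARD('m) - 1) = ctail * t ^ (CARD('m) - 1) * R powr - (real CARD('n) + \<epsilon>)"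
 proof -
  have m1: "0 < CARD('m)" by simp
  have "(R powr - gam) ^ (CARD('m) - 1) = R powr (- gam * (real CARD('m) - 1))"
   using R m1 by (simp add: powr_powr powr_realpow[symmetric] of_nat_diff)
  then have "R powr - (real CARD('n) + gam) * (R powr - gam) ^ (CARD('m) - 1) = R powr (- (real CARD('n) + gam) + (- gam * (real CARD('m) - 1)))"
   by (simp only: powr_add)
  also have "- (real CARD('n) + gam) + (- gam * (real CARD('m) - 1)) = - (real CARD('n) + \<epsilon>)"
  proof -
   have "gam * real CARD('m) = \<epsilon>" by (simp add: gam_def)
   then show ?thesis by (simp add: algebra_simps)
  qed
  finally show ?thesis by (simp add: power_mult_distrib mult_ac ctail_def)
 qed
 finally show ?thesis .
qed

definition "ccan = A * 3 powr (real (CARD('m) * CARD('n)) + \<epsilon>) * ctail"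

lemma ctail_pos: "0 < ctail" using tgam_pos by (simp add: ctail_def)

lemma ccan_pos: "0 < ccan" using A ctail_pos by (simp add: ccan_def)

text \<open>The kernel with slot \<open>j\<close> frozen at the centre \<open>z\<close> integrates
  to zero, so only the kernel difference counts, and smoothness in that slot gains
  \<open>s powr \<epsilon>\<close>.\<close>

lemma cancel_bound:
 assumes f: "\<And>i. adm (p i) (f i)" and s: "0 < s" and t: "0 \<le> t"
   and m: "\<And>i. i \<noteq> j ==> maxbd (en (f i)) t x"
   and supp: "\<And>y. y \<notin> cball z s ==> f j y = 0" and int0: "(\<integral>y. f j y \<partial>lborel) = 0" and x: "3 * s \<le> dist x z"
 shows "ennreal (norm (Kint f x)) \<le> ennreal (ccan * t ^ (CARD('m) - 1) * s powr \<epsilon> * dist x z powr - (real CARD('n) + \<epsilon>)) * L1 (f j)"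
proof -
 let ?N = "real (CARD('m) * CARD('n)) + \<epsilon>"
 have fm [measurable]: "f i \<in> borel_fun" for i using adm_borel[OF f] .
 have R: "0 < dist x z" using s x by linarith
 let ?P = "\<lambda>y. PU i. f i (y $ i)"
 let ?H = "\<lambda>y. K (point x (upd y j z)) * (\<Prod>i\<in>UNIV - {j}. f i (y $ i))"
 have P_eq: "?P y = (\<Prod>i\<in>UNIV - {j}. f i (y $ i)) * f j (y $ j)" for y
  by (subst prod.remove[of _ j]) (auto simp: mult.commute)
 have intP: "integrable lborel ?P" by (rule adm_prod_integrable[OF f])
 have upd_meas: "(\<lambda>y :: real ^ 'n ^ 'm. upd y j z) \<in> borel_fun"
  unfolding upd_def
 proof (intro borel_measurable_continuous_onI continuous_on_vec_lambda)
  show "continuous_on UNIV (\<lambda>y :: real ^ 'n ^ 'm. if i = j then z else y $ i)" for i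
   by (cases "i = j") (auto intro!: continuous_intros)
 qed
 have K2m [measurable]: "(\<lambda>y. K (point x (upd y j z))) \<in> borel_fun"
  using measurable_compose[OF upd_meas K_measurable[of x]] .
 have K2b: "norm (K (point x (upd y j z))) \<le> A / dist x z ^ (CARD('m) * CARD('n))" for y
  using norm_le_rho[of x "upd y j z" j] R by (intro K_size) (auto simp: dist_norm)
 have int2: "integrable lborel (\<lambda>y. K (point x (upd y j z)) * ?P y)"
 proof (rule Bochner_Integration.integrable_bound)
  show "integrable lborel (\<lambda>y. A / dist x z ^ (CARD('m) * CARD('n)) * norm (?P y))" using intP by (intro integrable_mult_right integrable_norm)
  show "AE y in lborel. norm (K (point x (upd y j z)) * ?P y) \<le> norm (A / dist x z ^ (CARD('m) * CARD('n)) * norm (?P y))"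
  proof (rule AE_I2)
   fix y
   have "norm (K (point x (upd y j z))) * norm (?P y) \<le> A / dist x z ^ (CARD('m) * CARD('n)) * norm (?P y)"
    by (intro mult_right_mono K2b) simp
   then show "norm (K (point x (upd y j z)) * ?P y) \<le> norm (A / dist x z ^ (CARD('m) * CARD('n)) * norm (?P y))"
    using A by (simp only: norm_mult) (simp add: abs_mult)
  qed
 qed (use intP in measurable)
 have zero: "(\<integral>y. K (point x (upd y j z)) * ?P y \<partial>lborel) = 0"
 proof -
  have e: "(\<lambda>y. K (point x (upd y j z)) * ?P y) = (\<lambda>y. ?H y * f j (y $ j))" by (simp add: P_eq mult.assoc)
  have "?H (upd y j w) = ?H y" for y w
  proof -
   have "upd (upd y j w) j z = upd y j z" by (simp add: vec_eq_iff)
   moreover have "(\<Prod>i\<in>UNIV - {j}. f i (upd y j w $ i)) = (\<Prod>i\<in>UNIV - {j}. f i (y $ i))" by (intro prod.cong) auto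
   ultimately show ?thesis by simp
  qed
  then show ?thesis unfolding e by (intro integral_cancel_slot int0) (use int2 in \<open>simp add: e\<close>)
 qed
 define U where "U = {w. s < dist z w}"
 have U: "open U" "x \<in> U" "\<And>w. w \<in> U ==> f j w = 0"
  using x s supp by (auto simp: U_def dist_commute open_Collect_less continuous_intros)
 have int1: "integrable lborel (\<lambda>y. K (point x y) * ?P y)" by (rule Kint_integrable[OF f U])
 \<comment> \<open>For \<open>y $ j\<close> in the ball, 3 s \<le> |x - z| leaves |x - y_j| \<ge> 2
   s, which is the half-distance condition. It also gives |x - z| \<le> 2 |x - y_j|; the constant 3
   allows for one further distance |x - y_i|.\<close>
 have pw: "norm ((K (point x y) - K (point x (upd y j z))) * ?P y)
   \<le> (A * s powr \<epsilon> * 3 powr ?N) * ((PU i. (dist x z + dist x (y $ i)) powr - (real CARD('n) + gam)) * norm (?P y))" for y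
 proof (cases "y $ j \<in> cball z s")
  case False
  then have "?P y = 0" using supp by (intro prod_zero) auto
  then show ?thesis by (simp only:) simp
 next
  case True
  have d1: "dist x z \<le> dist x (y $ j) + s" using True dist_triangle[of x z "y $ j"] by (simp add: dist_commute)
  then have d2: "2 * s \<le> norm (x - y $ j)" using x by (simp add: dist_norm)
  have rho: "norm (x - y $ i) \<le> rho x y" for i by (rule norm_le_rho)
  have rp: "0 < rho x y" using d2 s rho[of j] by linarith
  have "norm (K (point x y) - K (point x (upd y j z))) \<le> A * norm (y $ j - z) powr \<epsilon> / rho x y powr ?N"
   using True d2 by (intro K_smooth_y rp) (auto simp: dist_norm norm_minus_commute)
  also have "\<dots> = A * norm (y $ j - z) powr \<epsilon> * (1 / rho x y powr ?N)" by simp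
  also have "\<dots> \<le> A * s powr \<epsilon> * (3 powr ?N * (\<Prod>i\<in>(UNIV::'m set). (dist x z + dist x (y $ i)) powr - (real CARD('n) + gam)))"
  proof (intro mult_mono powr_sum_le_prod powr_mono2)
   show "norm (y $ j - z) \<le> s" using True by (simp add: dist_norm norm_minus_commute)
   show "dist x z + dist x (y $ i) \<le> 3 * rho x y" for i
   proof -
    have "dist x z \<le> 2 * norm (x - y $ j)" using d1 d2 s unfolding dist_norm by linarith
    then show ?thesis using rho[of j] rho[of i] by (simp add: dist_norm)
   qed
   show "0 < dist x z + dist x (y $ i)" for i using R by (simp add: add_pos_nonneg)
  qed (use A eps in auto)
  finally have "norm (K (point x y) - K (point x (upd y j z))) \<le> (A * s powr \<epsilon> * 3 powr ?N) * (\<Prod>i\<in>(UNIV::'m set). (dist x z + dist x (y $ i)) powr - (real CARD('n) + gam))"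
   by (simp add: mult.assoc)
  then show ?thesis unfolding norm_mult by (subst mult.assoc[symmetric]) (rule mult_right_mono, auto)
 qed
 have "Kint f x = (\<integral>y. K (point x y) * ?P y \<partial>lborel) - (\<integral>y. K (point x (upd y j z)) * ?P y \<partial>lborel)"
  by (simp add: Kint_def zero)
 also have "\<dots> = (\<integral>y. K (point x y) * ?P y - K (point x (upd y j z)) * ?P y \<partial>lborel)"
  using int1 int2 by (rule Bochner_Integration.integral_diff[symmetric])
 also have "\<dots> = (\<integral>y. (K (point x y) - K (point x (upd y j z))) * ?P y \<partial>lborel)" by (simp add: algebra_simps)
 finally have "Kint f x = (\<integral>y. (K (point x y) - K (point x (upd y j z))) * ?P y \<partial>lborel)" .
 then have "ennreal (norm (Kint f x)) \<le> (NN y. ennreal (norm ((K (point x y) - K (point x (upd y j z))) * ?P y)))"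
  by (simp only: norm_integral_le_nn)
 also have "\<dots> \<le> (NN y. ennreal (A * s powr \<epsilon> * 3 powr ?N) * ennreal ((PU i. (dist x z + dist x (y $ i)) powr - (real CARD('n) + gam)) * norm (?P y)))"
 proof (rule nn_integral_mono)
  fix y
  have "0 \<le> (\<Prod>i\<in>(UNIV::'m set). (dist x z + dist x (y $ i)) powr - (real CARD('n) + gam)) * norm (?P y)"
   by (intro mult_nonneg_nonneg prod_nonneg) auto
  then show "ennreal (norm ((K (point x y) - K (point x (upd y j z))) * ?P y)) \<le> ennreal (A * s powr \<epsilon> * 3 powr ?N) * ennreal ((PU i. (dist x z + dist x (y $ i)) powr - (real CARD('n) + gam)) * norm (?P y))"
   using A by (subst ennreal_mult[symmetric]) (simp_all only: ennreal_leI pw, simp)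
 qed
 also have "\<dots> = ennreal (A * s powr \<epsilon> * 3 powr ?N) * (NN y. ennreal ((PU i. (dist x z + dist x (y $ i)) powr - (real CARD('n) + gam)) * norm (?P y)))"
  by (rule nn_integral_cmult) measurable
 also have "\<dots> \<le> ennreal (A * s powr \<epsilon> * 3 powr ?N) * (ennreal (ctail * t ^ (CARD('m) - 1) * dist x z powr - (real CARD('n) + \<epsilon>)) * L1 (f j))"
  unfolding prod_tail_nn[OF fm] by (intro mult_left_mono Kint_tail[OF f R t m]) auto
 also have "\<dots> = ennreal (A * s powr \<epsilon> * 3 powr ?N * (ctail * t ^ (CARD('m) - 1) * dist x z powr - (real CARD('n) + \<epsilon>))) * L1 (f j)"
  using A ctail_pos t by (subst ennreal_mult[of "A * s powr \<epsilon> * 3 powr ?N"]) (auto simp: mult.assoc)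
 also have "A * s powr \<epsilon> * 3 powr ?N * (ctail * t ^ (CARD('m) - 1) * dist x z powr - (real CARD('n) + \<epsilon>)) = ccan * t ^ (CARD('m) - 1) * s powr \<epsilon> * dist x z powr - (real CARD('n) + \<epsilon>)"
  by (simp only: mult_ac ccan_def)
 finally show ?thesis .
qed

end

section \<open>The weak type bound by induction over the slots\<close>

lemma borel_measurable_nn_integral_count_space:
 fixes f :: "'i => 'a => ennreal"
 assumes I: "countable I" and f: "\<And>i. i \<in> I ==> f i \<in> borel_measurable M"
 shows "(\<lambda>x. \<integral>\<^sup>+i. f i x \<partial>count_space I) \<in> borel_measurable M"
proof (cases "finite I")
 case True
 then show ?thesis using f by (simp add: nn_integral_count_space_finite)
next
 case False
 then have ne: "I \<noteq> {}" by auto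
 have "(\<integral>\<^sup>+i. g i \<partial>count_space I) = (\<Sum>n. g (from_nat_into I n))" for g :: "'i => ennreal"
  by (simp add: nn_integral_bij_count_space[symmetric, OF bij_betw_from_nat_into[OF I False]] nn_integral_count_space_nat)
 then show ?thesis using f[OF from_nat_into[OF ne]] by (simp add: borel_measurable_suminf)
qed

lemma adm_AE_bounded:
 assumes h: "h \<in> borel_fun" and E: "E \<in> sets borel" "vol E < \<infinity>"
  and supp: "\<And>y. y \<notin> E ==> h y = 0" and le: "AE y in lborel. norm (h y :: complex) \<le> D" and r: "1 \<le> r"
 shows "adm r h" "(\<integral>y. norm (h y) powr r \<partial>lborel) \<le> D powr r * measure lborel E"
proof -
 have [measurable]: "h \<in> borel_fun" by (rule h)
 have iE: "integrable lborel (\<lambda>y. d * indicator E y :: real)" for d using E by (intro integrable_mult_right integrable_real_indicator) auto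
 have i1: "integrable lborel h"
 proof (rule Bochner_Integration.integrable_bound[OF iE[of D]])
  show "AE y in lborel. norm (h y) \<le> norm (D * indicator E y :: real)"
   using le by eventually_elim (use supp in \<open>auto simp: indicator_def\<close>)
 qed measurable
 have le2: "AE y in lborel. norm (h y) powr r \<le> D powr r * indicator E y"
  using le
 proof eventually_elim
  case (elim y)
  show ?case
  proof (cases "y \<in> E")
   case True
   then show ?thesis using elim r by (auto intro: powr_mono2)
  qed (simp add: supp)
 qed
 have i2: "integrable lborel (\<lambda>y. norm (h y) powr r)"
 proof (rule Bochner_Integration.integrable_bound[OF iE[of "D powr r"]])
  show "AE y in lborel. norm (norm (h y) powr r) \<le> norm (D powr r * indicator E y :: real)"
   using le2 by eventually_elim (auto simp: indicator_def)
 qed measurable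
 show "adm r h" using i1 i2 by (simp add: adm_def)
 have "(\<integral>y. norm (h y) powr r \<partial>lborel) \<le> (\<integral>y. D powr r * indicator E y \<partial>lborel)"
  by (rule integral_mono_AE[OF i2 iE le2])
 then show "(\<integral>y. norm (h y) powr r \<partial>lborel) \<le> D powr r * measure lborel E" using E by simp
qed

context CZ_op
begin

text \<open>For the inputs outside \<open>J\<close> boundedness is assumed; the weak type bound follows by enlarging \<open>J\<close>
 one slot at a time, replacing the input in that slot by the good part of its Calderon--Zygmund decomposition.\<close>

definition WTM :: "'m set => real => real => real => bool" where
 "WTM J \<eta> D M \<longleftrightarrow> (\<forall>c r (f :: 'm => 'n cfun). 0 < r --> (\<forall>i. adm (p i) (f i)) -->
   (\<forall>i y. y \<notin> hcube c r --> f i y = 0) --> (\<forall>i. L1 (f i) \<le> ennreal (r ^ CARD('n))) -->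
   (\<forall>i. i \<notin> J --> (AE y in lborel. norm (f i y) \<le> D)) -->
   lvol {x. norm (S f x) > M} \<le> ennreal (\<eta> * r ^ CARD('n)))"

text \<open>The level \<open>M\<close> has to be uniform in the cube and the inputs but may depend
  on \<open>D\<close>: the induction step feeds in a good part with a larger bound.\<close>

definition WT :: "'m set => bool" where
 "WT J \<longleftrightarrow> (\<forall>\<eta>>0. \<forall>D\<ge>0. \<exists>M>0. WTM J \<eta> D M)"

text \<open>All inputs are bounded and supported in one cube, so the assumed L^p bound and Chebyshev
  suffice; the powers of the volume match because 1/q is the sum of the 1/p_j.\<close>

lemma WT_empty: "WT {}"
 unfolding WT_def
proof (intro allI impI)
 fix \<eta> D :: real assume \<eta>: "0 < \<eta>" and D: "0 \<le> D"
 \<comment> \<open>Solves the Chebyshev bound for the fraction \<eta>; the added 1 keeps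
   \<open>M\<close> positive when \<open>B\<close> or \<open>D\<close> is 0.\<close>
 define M where "M = (B * D ^ CARD('m) + 1) / \<eta> powr (1 / q)"
 have BD: "0 \<le> B * D ^ CARD('m)" using B D by simp
 have M: "0 < M" unfolding M_def using \<eta> BD by (intro divide_pos_pos) auto
 show "\<exists>M>0. WTM {} \<eta> D M"
  unfolding WTM_def
 proof (intro exI[of _ M] conjI M allI impI)
  fix c r and f :: "'m => 'n cfun"
  assume r: "0 < r" and f: "\<forall>i. adm (p i) (f i)" and supp: "\<forall>i y. y \<notin> hcube c r --> f i y = 0"
   and le: "\<forall>i. i \<notin> {} --> (AE y in lborel. norm (f i y) \<le> D)"
  let ?v = "r ^ CARD('n)"
  have v: "0 < ?v" using r by simp
  have mQ: "measure lborel (hcube c r) = ?v" using r by (simp add: measure_def emeasure_hcube)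
  have I: "(\<integral>y. norm (f i y) powr p i \<partial>lborel) powr (1 / p i) \<le> D * ?v powr (1 / p i)" for i
  proof -
   have pi: "0 < p i" using p[of i] by linarith
   have "(\<integral>y. norm (f i y) powr p i \<partial>lborel) \<le> D powr p i * ?v"
    using adm_AE_bounded(2)[of "f i" "hcube c r" D "p i"] f supp le p r by (auto simp: adm_def emeasure_hcube mQ)
   then have "(\<integral>y. norm (f i y) powr p i \<partial>lborel) powr (1 / p i) \<le> (D powr p i * ?v) powr (1 / p i)"
    using pi by (intro powr_mono2) auto
   also have "\<dots> = D * ?v powr (1 / p i)" using D v pi by (simp add: powr_mult powr_powr)
   finally show ?thesis .
  qed
  have "Ip f \<le> (\<Prod>i\<in>(UNIV :: 'm set). D * ?v powr (1 / p i))"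
   unfolding Ip_def by (intro prod_mono conjI I) simp
  also have "\<dots> = D ^ CARD('m) * ?v powr (1 / q)"
   unfolding prod.distrib q using r by (subst powr_sum) auto
  finally have Ip: "Ip f \<le> D ^ CARD('m) * ?v powr (1 / q)" .
  have "B * Ip f / M \<le> B * (D ^ CARD('m) * ?v powr (1 / q)) / M"
   using Ip B M by (intro divide_right_mono mult_left_mono) auto
  also have "\<dots> = (B * D ^ CARD('m)) / (B * D ^ CARD('m) + 1) * (\<eta> powr (1 / q) * ?v powr (1 / q))"
   by (simp add: M_def)
  also have "\<dots> \<le> 1 * (\<eta> powr (1 / q) * ?v powr (1 / q))"
   using BD by (intro mult_right_mono) (auto simp: divide_le_eq_1)
  also have "\<dots> = (\<eta> * ?v) powr (1 / q)" using \<eta> v by (simp add: powr_mult)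
  finally have le1: "B * Ip f / M \<le> (\<eta> * ?v) powr (1 / q)" .
  have "(B * Ip f / M) powr q \<le> ((\<eta> * ?v) powr (1 / q)) powr q"
   using le1 q_pos B Ip_nonneg[of f] M by (intro powr_mono2) auto
  also have "\<dots> = \<eta> * ?v" using \<eta> v q_pos by (simp add: powr_powr)
  finally have le2: "(B * Ip f / M) powr q \<le> \<eta> * ?v" .
  have "lvol {x. norm (S f x) > M} \<le> ennreal ((B * Ip f / M) powr q)"
   using f M by (intro S_weak) auto
  also have "\<dots> \<le> ennreal (\<eta> * ?v)" using le2 by (rule ennreal_leI)
  finally show "lvol {x. norm (S f x) > M} \<le> ennreal (\<eta> * ?v)" .
 qed
qed

definition "cout = 2 powr (real CARD('n) + \<epsilon>) * tailc CARD('n) \<epsilon> * unit_ball_vol (real CARD('n))"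

lemma cout_pos: "0 < cout" using tailc_pos[OF eps] by (simp add: cout_def unit_ball_vol_pos)

lemma tail_outside:
 fixes z :: "real ^ 'n"
 assumes s: "0 < s"
 shows "(NN x. ennreal (s powr \<epsilon> * dist x z powr - (real CARD('n) + \<epsilon>)) * indicator {x. 3 * s \<le> dist x z} x) \<le> ennreal cout"
proof -
 let ?s = "real CARD('n) + \<epsilon>" let ?C0 = "tailc CARD('n) \<epsilon>"
 note C0 = tailc_pos[OF eps, of "CARD('n)"]
 have ub: "0 < unit_ball_vol (real CARD('n))" by (simp add: unit_ball_vol_pos)
 have "(NN x. ennreal (s powr \<epsilon> * dist x z powr - ?s) * indicator {x. 3 * s \<le> dist x z} x)
   \<le> (NN x. ennreal (s powr \<epsilon> * 2 powr ?s) * (1 * ennreal ((3 * s + dist z x) powr - ?s)))"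
 proof (rule nn_integral_mono)
  fix x
  show "ennreal (s powr \<epsilon> * dist x z powr - ?s) * indicator {x. 3 * s \<le> dist x z} x \<le> ennreal (s powr \<epsilon> * 2 powr ?s) * (1 * ennreal ((3 * s + dist z x) powr - ?s))"
  proof (cases "3 * s \<le> dist x z")
   case True
   have "dist x z powr - ?s \<le> ((3 * s + dist z x) / 2) powr - ?s"
    using True s eps by (intro powr_mono2') (auto simp: dist_commute)
   also have "\<dots> = 2 powr ?s * (3 * s + dist z x) powr - ?s"
   proof -
    have "(t / 2) powr - u = 2 powr u * t powr - u" if "0 \<le> t" for t u :: real
     using that by (simp add: powr_divide powr_minus field_simps)
    then show ?thesis using s by (simp only: add_nonneg_nonneg mult_nonneg_nonneg zero_le_dist less_imp_le zero_le_numeral)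
   qed
   finally have "s powr \<epsilon> * dist x z powr - ?s \<le> s powr \<epsilon> * 2 powr ?s * (3 * s + dist z x) powr - ?s"
    by (simp only: mult.assoc) (intro mult_left_mono, auto)
   then show ?thesis using True by (simp add: ennreal_mult[symmetric] ennreal_leI)
  qed simp
 qed
 also have "\<dots> = ennreal (s powr \<epsilon> * 2 powr ?s) * (NN x. 1 * ennreal ((3 * s + dist z x) powr - ?s))"
  by (rule nn_integral_cmult) measurable
 also have "\<dots> \<le> ennreal (s powr \<epsilon> * 2 powr ?s) * ennreal (?C0 * unit_ball_vol (real CARD('n)) * (3 * s) powr - \<epsilon>)"
  using tail_bound[OF eps _ maxbd_one, of "3 * s" z] s ub by (intro mult_left_mono) auto
 also have "\<dots> = ennreal (cout * (s powr \<epsilon> * (3 * s) powr - \<epsilon>))"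
  using C0 ub by (subst ennreal_mult[symmetric]) (auto simp: mult_ac cout_def)
 also have "s powr \<epsilon> * (3 * s) powr - \<epsilon> \<le> 1"
 proof -
  have "s powr \<epsilon> * (3 * s) powr - \<epsilon> = 3 powr - \<epsilon>" using s by (simp add: powr_mult powr_minus field_simps)
  also have "\<dots> \<le> 1" using eps by (simp add: powr_minus_divide ge_one_powr_ge_zero)
  finally show ?thesis .
 qed
 then have "ennreal (cout * (s powr \<epsilon> * (3 * s) powr - \<epsilon>)) \<le> ennreal cout"
  using cout_pos by (intro ennreal_leI mult_left_le) auto
 finally show ?thesis .
qed

text \<open>Slot \<open>j\<close> is split into its good part, covered by the induction hypothesis,
  and its bad part with mean zero on each stopping cube. Off the dilated cubes and off the sets of
  large maximal functions, \<open>cancel_bound\<close> controls the bad part by an integrable sum.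
  The fraction \<eta> is spent as 1/4 + 1/8 + 1/8 + 1/4 + 1/4 on \<open>?E1\<close>,
  \<open>?E2\<close>, \<open>?E3\<close>, \<open>\<Omega>\<close>, \<open>Bad\<close>.\<close>

lemma WT_step:
 assumes WT: "WT J"
 shows "WT (insert j J)"
 unfolding WT_def
proof (intro allI impI)
 fix \<eta> D :: real assume \<eta>: "0 < \<eta>" and D: "0 \<le> D"
 let ?n = "CARD('n)" let ?m = "CARD('m)" let ?ub = "unit_ball_vol (real CARD('n))"
 have ub: "0 < ?ub" by (simp add: unit_ball_vol_pos)
 \<comment> \<open>At height \<open>t0\<close> the balls of radius \<open>3 * s P\<close> around the
   stopping cubes fill at most \<eta>/4 of the volume; \<open>t1\<close> is the level that the
   \<open>m\<close> maximal functions exceed only on a set of that size.\<close>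
 define t0 where "t0 = max 1 (4 * ?ub * (3 * real ?n) ^ ?n / \<eta>)"
 define t1 where "t1 = 4 * real ?m * ?ub * 5 ^ ?n / \<eta>"
 have t0: "1 \<le> t0" by (simp add: t0_def)
 have t1: "0 < t1" unfolding t1_def using ub \<eta> by simp
 define D' where "D' = max D (2 ^ ?n * t0)"
 have D': "0 \<le> D'" using D by (simp add: D'_def)
 obtain M1 where M1: "0 < M1" "WTM J (\<eta> / 4) D' M1"
  using WT[unfolded WT_def, rule_format, of "\<eta> / 4" D'] \<eta> D' by auto
 \<comment> \<open>The integral of \<open>Bsum\<close> is at most 2 cout ccan t1^(m-1) r^n; division
   by \<open>M2\<close> leaves the fraction \<eta>/8.\<close>
 define M2 where "M2 = 16 * (ccan * t1 ^ (?m - 1)) * cout / \<eta>"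
 have M2: "0 < M2" unfolding M2_def using ccan_pos cout_pos t1 \<eta> by simp
 show "\<exists>M>0. WTM (insert j J) \<eta> D M"
  unfolding WTM_def
 proof (intro exI[of _ "M1 + 2 * M2"] conjI allI impI)
  show "0 < M1 + 2 * M2" using M1 M2 by simp
  fix c r and f :: "'m => 'n cfun"
  assume r: "0 < r" and f': "\<forall>i. adm (p i) (f i)" and supp: "\<forall>i y. y \<notin> hcube c r --> f i y = 0"
   and le: "\<forall>i. L1 (f i) \<le> ennreal (r ^ ?n)"
   and bd: "\<forall>i. i \<notin> insert j J --> (AE y in lborel. norm (f i y) \<le> D)"
  have f: "adm (p i) (f i)" for i using f' by simp
  have fm [measurable]: "f i \<in> borel_fun" for i using adm_borel[OF f] .
  let ?v = "r ^ ?n" have v: "0 < ?v" using r by simp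
  obtain F h where F: "countable F" "disjoint F" "\<And>P. P \<in> F ==> \<exists>c' r'. 0 < r' \<and> P = hcube c' r' \<and> P \<subseteq> hcube c r"
   and Fs: "vol (\<Union>F) \<le> ennreal (?v / t0)"
   and hm [measurable]: "h \<in> borel_fun" and h0: "\<And>y. y \<notin> hcube c r ==> h y = 0" and hb: "AE y in lborel. norm (h y) \<le> 2 ^ ?n * t0"
   and hf: "\<And>y. y \<notin> \<Union>F ==> h y = f j y"
   and can: "\<And>P. P \<in> F ==> (\<integral>y. indicator P y *\<^sub>R (f j y - h y) \<partial>lborel) = 0"
   and hP: "\<And>P. P \<in> F ==> (NN y. en h y * indicator P y) \<le> (NN y. en (f j) y * indicator P y)"
   and hi: "L1 h \<le> L1 (f j)"
   by (rule CZ_decomposition[OF r adm_integrable[OF f[of j]] supp[rule_format, of _ j] le[rule_format, of j] t0], assumption, rule that)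
  obtain cc rr where cr: "\<And>P. P \<in> F ==> 0 < rr P" "\<And>P. P \<in> F ==> P = hcube (cc P) (rr P)"
   using F(3) by metis
  have FB: "P \<in> sets borel" if "P \<in> F" for P using F(3)[OF that] by auto
  define s where "s P = real ?n * rr P" for P
  have s: "0 < s P" if "P \<in> F" for P using cr(1)[OF that] by (simp add: s_def)
  have Pball: "P \<subseteq> cball (cc P) (s P)" if P: "P \<in> F" for P
  proof
   fix y assume y: "y \<in> P"
   have "cc P \<in> hcube (cc P) (rr P)" using cr(1)[OF P] by (simp add: hcube_def)
   then show "y \<in> cball (cc P) (s P)" using dist_hcube[of "cc P" "cc P" "rr P" y] y cr(2)[OF P] by (simp add: s_def)
  qed
  define \<beta> where "\<beta> y = f j y - h y" for y
  have \<beta>m [measurable]: "\<beta> \<in> borel_fun" unfolding \<beta>_def by measurable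
  have ah: "adm (p j) h"
   using r h0 hb p by (intro adm_AE_bounded(1)[of _ "hcube c r" "2 ^ ?n * t0"]) (auto simp: emeasure_hcube)
  have a\<beta>: "adm (p j) \<beta>" using adm_lincomb[OF f[of j] ah p, of 1 "-1"] by (simp add: \<beta>_def[abs_def])
  have \<beta>0: "\<beta> y = 0" if "y \<notin> \<Union>F" for y using hf[OF that] by (simp add: \<beta>_def)
  have aI: "adm (p j) (\<lambda>y. indicator E y *\<^sub>R \<beta> y)" if "E \<in> sets borel" for E
   by (rule adm_dominated[OF a\<beta> p, where c = 1]) (use that in \<open>auto simp: indicator_def\<close>)
  define nb where "nb P = (NN y. ennreal (norm (\<beta> y)) * indicator P y)" for P
  have nb: "nb P \<le> 2 * (NN y. en (f j) y * indicator P y)" if P: "P \<in> F" for P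
  proof -
   have [measurable]: "P \<in> sets borel" using FB[OF P] .
   have "nb P \<le> (NN y. en (f j) y * indicator P y + en h y * indicator P y)"
    unfolding nb_def by (intro nn_integral_mono)
     (auto simp: indicator_def \<beta>_def ennreal_plus[symmetric] simp del: ennreal_plus intro!: ennreal_leI norm_triangle_ineq4)
   also have "\<dots> = (NN y. en (f j) y * indicator P y) + (NN y. en h y * indicator P y)"
    by (rule nn_integral_add) measurable
   also have "\<dots> \<le> 2 * (NN y. en (f j) y * indicator P y)"
    using hP[OF P] by (simp add: mult_2 add_left_mono)
   finally show ?thesis .
  qed
  define cst where "cst = ccan * t1 ^ (?m - 1)"
  have cst: "0 < cst" using ccan_pos t1 by (simp add: cst_def)
  \<comment> \<open>The bound of \<open>cancel_bound\<close> for the single cube \<open>P\<close>,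
    cut off to the region outside its dilate, where it is integrable.\<close>
  define b where "b P x = ennreal (s P powr \<epsilon> * dist x (cc P) powr - (real CARD('n) + \<epsilon>)) * indicator {x. 3 * s P \<le> dist x (cc P)} x * (ennreal cst * nb P)" for P x
  have ind_meas [measurable]: "(\<lambda>x. indicator {x. 3 * s P \<le> dist x (cc P)} x :: ennreal) \<in> borel_fun" for P
   by (intro borel_measurable_indicator borel_closed closed_Collect_le continuous_intros)
  have bm [measurable]: "b P \<in> borel_fun" for P
   unfolding b_def[abs_def] by measurable
  define Bsum where "Bsum x = (\<integral>\<^sup>+P. b P x \<partial>count_space F)" for x
  have Bsum_int: "(NN x. Bsum x) \<le> ennreal (cout * cst * (2 * ?v))"
  proof -
   have "(NN x. Bsum x) = (\<integral>\<^sup>+P. (NN x. b P x) \<partial>count_space F)"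
    unfolding Bsum_def using F(1) by (intro nn_integral_count_space_nn_integral) auto
   also have "\<dots> \<le> (\<integral>\<^sup>+P. ennreal (cout * cst * 2) * (NN y. en (f j) y * indicator P y) \<partial>count_space F)"
   proof (rule nn_integral_mono)
    fix P assume "P \<in> space (count_space F)"
    then have P: "P \<in> F" by simp
    have "(NN x. b P x) = (NN x. ennreal (s P powr \<epsilon> * dist x (cc P) powr - (real CARD('n) + \<epsilon>)) * indicator {x. 3 * s P \<le> dist x (cc P)} x) * (ennreal cst * nb P)"
     unfolding b_def by (intro nn_integral_multc borel_measurable_times) (use ind_meas in measurable)
    also have "\<dots> \<le> ennreal cout * (ennreal cst * (2 * (NN y. en (f j) y * indicator P y)))"
     by (intro mult_mono tail_outside s P nb mult_left_mono) auto
    also have "\<dots> = ennreal (cout * cst * 2) * (NN y. en (f j) y * indicator P y)"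
     using cout_pos cst by (simp add: ennreal_mult mult.assoc)
    finally show "(NN x. b P x) \<le> ennreal (cout * cst * 2) * (NN y. en (f j) y * indicator P y)" .
   qed
   also have "\<dots> = ennreal (cout * cst * 2) * (\<integral>\<^sup>+P. emeasure (density lborel (en (f j))) P \<partial>count_space F)"
    by (subst nn_integral_cmult) (auto intro!: arg_cong2[where f = "(*)"] nn_integral_cong simp: emeasure_density FB)
   also have "(\<integral>\<^sup>+P. emeasure (density lborel (en (f j))) P \<partial>count_space F) = emeasure (density lborel (en (f j))) (\<Union>P\<in>F. P)"
    by (intro emeasure_UN_countable[symmetric] F(1)) (use F(2) FB in \<open>auto simp: disjoint_family_on_def disjoint_def\<close>)
   also have "\<dots> \<le> emeasure (density lborel (en (f j))) UNIV"
    by (rule emeasure_mono) auto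
   also have "\<dots> = L1 (f j)" by (subst emeasure_density) auto
   also have "\<dots> \<le> ennreal ?v" using le by simp
   finally have "(NN x. Bsum x) \<le> ennreal (cout * cst * 2) * ennreal ?v" by (simp add: mult_left_mono)
   also have "\<dots> = ennreal (cout * cst * (2 * ?v))" using cout_pos cst v by (subst ennreal_mult[symmetric]) (auto simp: mult.assoc)
   finally show ?thesis .
  qed
  have Bm [measurable]: "Bsum \<in> borel_fun"
   unfolding Bsum_def[abs_def] by (intro borel_measurable_nn_integral_count_space F(1) bm)
  define \<Omega> where "\<Omega> = (\<Union>P\<in>F. cball (cc P) (3 * s P))"
  have \<Omega>m: "\<Omega> \<in> sets borel" unfolding \<Omega>_def using F(1) by (intro sets.countable_UN'') auto
  have \<Omega>s: "vol \<Omega> \<le> ennreal (\<eta> / 4 * ?v)"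
  proof -
   have "vol \<Omega> \<le> (\<integral>\<^sup>+P. vol (cball (cc P) (3 * s P)) \<partial>count_space F)"
    unfolding \<Omega>_def by (rule emeasure_UN_countable_le[OF F(1)]) simp
   also have "\<dots> = (\<integral>\<^sup>+P. ennreal (?ub * (3 * real ?n) ^ ?n) * vol P \<partial>count_space F)"
   proof (rule nn_integral_cong)
    fix P assume "P \<in> space (count_space F)"
    then have P: "P \<in> F" by simp
    have "vol (cball (cc P) (3 * s P)) = ennreal (?ub * (3 * s P) ^ ?n)"
     using s[OF P] by (subst emeasure_cball) auto
    also have "?ub * (3 * s P) ^ ?n = ?ub * (3 * real ?n) ^ ?n * rr P ^ ?n"
     by (simp add: s_def power_mult_distrib)
    also have "ennreal \<dots> = ennreal (?ub * (3 * real ?n) ^ ?n) * ennreal (rr P ^ ?n)"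
     using ub cr(1)[OF P] by (intro ennreal_mult) auto
    also have "ennreal (rr P ^ ?n) = vol P"
     using cr(1)[OF P] by (subst cr(2)[OF P]) (simp add: emeasure_hcube)
    finally show "vol (cball (cc P) (3 * s P)) = ennreal (?ub * (3 * real ?n) ^ ?n) * vol P" .
   qed
   also have "\<dots> = ennreal (?ub * (3 * real ?n) ^ ?n) * (\<integral>\<^sup>+P. vol P \<partial>count_space F)"
    by (rule nn_integral_cmult) auto
   also have "(\<integral>\<^sup>+P. vol P \<partial>count_space F) = vol (\<Union>P\<in>F. P)"
    by (intro emeasure_UN_countable[symmetric] F(1)) (use F(2) FB in \<open>auto simp: disjoint_family_on_def disjoint_def\<close>)
   also have "(\<Union>P\<in>F. P) = \<Union>F" by (rule image_ident[THEN arg_cong[where f = Union]])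
   also have "ennreal (?ub * (3 * real ?n) ^ ?n) * vol (\<Union>F) \<le> ennreal (?ub * (3 * real ?n) ^ ?n) * ennreal (?v / t0)"
    by (intro mult_left_mono Fs) simp
   also have "\<dots> = ennreal (?ub * (3 * real ?n) ^ ?n * (?v / t0))"
    using ub v t0 by (intro ennreal_mult[symmetric]) auto
   also have "?ub * (3 * real ?n) ^ ?n * (?v / t0) \<le> \<eta> / 4 * ?v"
   proof -
    have "4 * ?ub * (3 * real ?n) ^ ?n / \<eta> \<le> t0" by (simp add: t0_def)
    then have "4 * ?ub * (3 * real ?n) ^ ?n \<le> t0 * \<eta>" using \<eta> by (simp only: pos_divide_le_eq)
    then have "?ub * (3 * real ?n) ^ ?n \<le> \<eta> / 4 * t0" by (simp add: mult_ac)
    then have "?ub * (3 * real ?n) ^ ?n * (?v / t0) \<le> \<eta> / 4 * t0 * (?v / t0)"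
     using v t0 by (intro mult_right_mono) auto
    then show ?thesis using t0 by simp
   qed
   finally show ?thesis by (simp add: ennreal_leI)
  qed
  define Bad where "Bad = (\<Union>i. {x. \<not> maxbd (en (f i)) t1 x})"
  have Bm1: "{x. \<not> maxbd (en (f i)) t1 x} \<in> sets borel" for i
   by (intro borel_open open_not_maxbd) measurable
  have Badm: "Bad \<in> sets borel" unfolding Bad_def by (intro sets.countable_UN'' Bm1) auto
  have Bads: "vol Bad \<le> ennreal (\<eta> / 4 * ?v)"
  proof -
   have "vol Bad \<le> (\<Sum>i\<in>UNIV. vol {x. \<not> maxbd (en (f i)) t1 x})"
    unfolding Bad_def by (intro emeasure_subadditive_finite) (use Bm1 in auto)
   also have "\<dots> \<le> (\<Sum>i\<in>(UNIV::'m set). ennreal (\<eta> / (4 * real ?m) * ?v))"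
   proof (rule sum_mono)
    fix i
    have "vol {x. \<not> maxbd (en (f i)) t1 x} \<le> ennreal (?ub * 5 ^ ?n / t1) * L1 (f i)"
     using maxbd_weak_type[of "\<lambda>y. en (f i) y" t1] t1 by simp
    also have "\<dots> \<le> ennreal (?ub * 5 ^ ?n / t1) * ennreal ?v" using le by (intro mult_left_mono) auto
    also have "\<dots> = ennreal (?ub * 5 ^ ?n / t1 * ?v)" using ub t1 v by (intro ennreal_mult[symmetric]) auto
    also have "?ub * 5 ^ ?n / t1 = \<eta> / (4 * real ?m)" using \<eta> by (simp add: t1_def field_simps less_imp_neq[OF ub, symmetric])
    finally show "vol {x. \<not> maxbd (en (f i)) t1 x} \<le> ennreal (\<eta> / (4 * real ?m) * ?v)" .
   qed
   also have "\<dots> = ennreal (real ?m * (\<eta> / (4 * real ?m) * ?v))"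
    using \<eta> v by (subst sum_ennreal) auto
   also have "real ?m * (\<eta> / (4 * real ?m) * ?v) = \<eta> / 4 * ?v" by simp
   finally show ?thesis .
  qed
  \<comment> \<open>Linearity of \<open>S\<close> gives additivity for finite sums only, hence
    finite subfamilies \<open>G\<close>.\<close>
  have pwS: "AE x in lebesgue. x \<notin> \<Omega> \<union> Bad --> ennreal (norm (S (f(j := \<lambda>y. indicator (\<Union>G) y *\<^sub>R \<beta> y)) x)) \<le> (\<Sum>P\<in>G. b P x)"
   if "finite G" "G \<subseteq> F" for G
   using that
  proof (induction G rule: finite_induct)
   case empty
   have "AE x in lebesgue. S (f(j := \<lambda>y. 0 * \<beta> y + 0 * \<beta> y)) x = 0 * S (f(j := \<beta>)) x + 0 * S (f(j := \<beta>)) x"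
    by (rule S_comb[OF f a\<beta> a\<beta>])
   moreover have "(\<lambda>y. indicator (\<Union>{}) y *\<^sub>R \<beta> y) = (\<lambda>y. 0 * \<beta> y + 0 * \<beta> y)" by simp
   ultimately have "AE x in lebesgue. S (f(j := \<lambda>y. indicator (\<Union>{}) y *\<^sub>R \<beta> y)) x = 0" by (simp only: mult_zero_left add_0_left)
   then show ?case by eventually_elim (simp only: norm_zero ennreal_0 zero_le simp_thms)
  next
   case (insert P G)
   have P: "P \<in> F" and G: "G \<subseteq> F" using insert.prems by auto
   have Gb: "\<Union>G \<in> sets borel" using insert.hyps(1) G FB by (intro sets.countable_Union countable_finite) auto
   let ?bP = "\<lambda>y. indicator P y *\<^sub>R \<beta> y" let ?bG = "\<lambda>y. indicator (\<Union>G) y *\<^sub>R \<beta> y"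
   have "P \<inter> X = {}" if X: "X \<in> G" for X
    by (rule disjointD[OF F(2) P subsetD[OF G X]]) (use X insert.hyps(2) in blast)
   then have "P \<inter> \<Union>G = {}" by blast
   then have e: "(\<lambda>y. indicator (\<Union>(insert P G)) y *\<^sub>R \<beta> y) = (\<lambda>y. 1 * ?bP y + 1 * ?bG y)"
   proof (intro ext)
    fix y
    show "indicator (\<Union>(insert P G)) y *\<^sub>R \<beta> y = 1 * ?bP y + 1 * ?bG y"
    proof (cases "y \<in> P")
     case True
     then have "y \<notin> \<Union>G" using \<open>P \<inter> \<Union>G = {}\<close> by blast
     then show ?thesis using True by simp
    next
     case False
     then show ?thesis by (simp add: indicator_def)
    qed
   qed
   have c1: "AE x in lebesgue. S (f(j := \<lambda>y. indicator (\<Union>(insert P G)) y *\<^sub>R \<beta> y)) x = 1 * S (f(j := ?bP)) x + 1 * S (f(j := ?bG)) x"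
    unfolding e by (rule S_comb[OF f aI[OF FB[OF P]] aI[OF Gb]])
   have c2: "Rep {x. 2 * s P < dist (cc P) x} (f(j := ?bP))"
   proof (rule Rep_general[of _ "ball (cc P) (2 * s P)" _ j])
    show "open {x. 2 * s P < dist (cc P) x}" by (intro open_Collect_less continuous_intros)
    show "adm (p i) ((f(j := ?bP)) i)" for i using f aI[OF FB[OF P]] by auto
    show "(f(j := ?bP)) j x = 0" if "x \<notin> ball (cc P) (2 * s P)" for x
    proof -
     have "x \<notin> P" using Pball[OF P] s[OF P] that by force
     then show ?thesis by simp
    qed
   qed auto
   have IH: "AE x in lebesgue. x \<notin> \<Omega> \<union> Bad --> ennreal (norm (S (f(j := ?bG)) x)) \<le> (\<Sum>P\<in>G. b P x)"
    using insert.IH G by blast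
   from c1 c2[unfolded Rep_def] IH show ?case
   proof eventually_elim
    case (elim x)
    show ?case
    proof
     assume x: "x \<notin> \<Omega> \<union> Bad"
     have d: "3 * s P < dist x (cc P)" using x P by (auto simp: \<Omega>_def dist_commute not_le)
     have mb: "maxbd (en (f i)) t1 x" for i using x by (auto simp: Bad_def)
     have SK: "S (f(j := ?bP)) x = Kint (f(j := ?bP)) x" using elim(2) d s[OF P] by (auto simp: dist_commute)
     have "ennreal (norm (Kint (f(j := ?bP)) x)) \<le> ennreal (ccan * t1 ^ (?m - 1) * s P powr \<epsilon> * dist x (cc P) powr - (real CARD('n) + \<epsilon>)) * L1 ((f(j := ?bP)) j)"
     proof (rule cancel_bound[where z = "cc P"])
      show "adm (p i) ((f(j := ?bP)) i)" for i using f aI[OF FB[OF P]] by auto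
      show "maxbd (en ((f(j := ?bP)) i)) t1 x" if "i \<noteq> j" for i using mb that by simp
      show "(f(j := ?bP)) j y = 0" if "y \<notin> cball (cc P) (s P)" for y
      proof -
       have "y \<notin> P" using Pball[OF P] that by blast
       then show ?thesis by simp
      qed
      show "(\<integral>y. (f(j := ?bP)) j y \<partial>lborel) = 0" using can[OF P] by (simp add: \<beta>_def)
     qed (use s[OF P] t1 d in auto)
     also have "\<dots> = b P x"
     proof -
      have "L1 ((f(j := ?bP)) j) = nb P"
       unfolding nb_def by (intro nn_integral_cong) (auto simp: indicator_def)
      moreover have "ennreal (ccan * t1 ^ (?m - 1) * s P powr \<epsilon> * dist x (cc P) powr - (real CARD('n) + \<epsilon>)) = ennreal (s P powr \<epsilon> * dist x (cc P) powr - (real CARD('n) + \<epsilon>)) * ennreal cst"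
       using cst by (subst ennreal_mult[symmetric]) (auto simp: cst_def mult_ac)
      moreover have "(indicator {x. 3 * s P \<le> dist x (cc P)} x :: ennreal) = 1" using d by simp
      ultimately show ?thesis by (simp only: b_def mult_1_right mult.assoc)
     qed
     finally have "ennreal (norm (S (f(j := ?bP)) x)) \<le> b P x" by (simp only: SK)
     moreover have "ennreal (norm (S (f(j := ?bG)) x)) \<le> (\<Sum>P\<in>G. b P x)" using elim(3) x by blast
     moreover have "ennreal (norm (S (f(j := \<lambda>y. indicator (\<Union>(insert P G)) y *\<^sub>R \<beta> y)) x)) \<le> ennreal (norm (S (f(j := ?bP)) x)) + ennreal (norm (S (f(j := ?bG)) x))"
      unfolding elim(1) by (subst ennreal_plus[symmetric]) (auto simp del: ennreal_plus intro!: ennreal_leI norm_triangle_ineq)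
     ultimately show "ennreal (norm (S (f(j := \<lambda>y. indicator (\<Union>(insert P G)) y *\<^sub>R \<beta> y)) x)) \<le> (\<Sum>P\<in>insert P G. b P x)"
      unfolding sum.insert[OF insert.hyps] by (meson add_mono order_trans)
    qed
   qed
  qed
  \<comment> \<open>Initial segments of an enumeration; the intersection with \<open>F\<close>
    discards the arbitrary value of \<open>from_nat_into\<close> for empty \<open>F\<close>.\<close>
  define G where "G k = F \<inter> from_nat_into F ` {..<k}" for k :: nat
  have G: "finite (G k)" "G k \<subseteq> F" for k by (auto simp: G_def)
  define hk where "hk k y = indicator (\<Union>(G k)) y *\<^sub>R \<beta> y" for k y
  have Gm: "\<Union>(G k) \<in> sets borel" for k using G FB by (intro sets.countable_Union countable_finite) auto
  have ahk: "adm (p j) (hk k)" for k unfolding hk_def by (rule aI[OF Gm])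
  have hklim: "(\<lambda>k. hk k y) \<longlonglongrightarrow> \<beta> y" for y
  proof (cases "y \<in> \<Union>F")
   case True
   then obtain P where P: "P \<in> F" "y \<in> P" by blast
   then obtain i where i: "from_nat_into F i = P" using from_nat_into_surj[OF F(1)] by blast
   have "hk k y = \<beta> y" if "i < k" for k
   proof -
    have "P \<in> G k" using P(1) i that by (auto simp: G_def)
    then show ?thesis using P(2) by (auto simp: hk_def indicator_def)
   qed
   then have "\<forall>\<^sub>F k in sequentially. hk k y = \<beta> y" unfolding eventually_sequentially by (intro exI[of _ "Suc i"]) auto
   then show ?thesis by (rule tendsto_eventually)
  qed (simp add: hk_def \<beta>0)
  have "(\<lambda>k. Ip (f(j := \<lambda>x. hk k x - \<beta> x))) \<longlonglongrightarrow> 0"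
   by (rule S_limit(2)[OF f a\<beta> adm_borel[OF ahk] _ hklim]) (auto simp: hk_def indicator_def)
  then have "(\<lambda>k. B * Ip (f(j := \<lambda>x. hk k x - \<beta> x)) / M2) \<longlonglongrightarrow> B * 0 / M2" using M2 by (intro tendsto_intros) auto
  then have "(\<lambda>k. (B * Ip (f(j := \<lambda>x. hk k x - \<beta> x)) / M2) powr q) \<longlonglongrightarrow> 0"
   using q_pos B Ip_nonneg M2 by (intro tendsto_zero_powrI[OF _ tendsto_const]) (auto intro!: always_eventually divide_nonneg_pos mult_nonneg_nonneg)
  then have "\<forall>\<^sub>F k in sequentially. (B * Ip (f(j := \<lambda>x. hk k x - \<beta> x)) / M2) powr q < \<eta> / 8 * ?v"
   using \<eta> v by (intro order_tendstoD) auto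
  then obtain k where k: "(B * Ip (f(j := \<lambda>x. hk k x - \<beta> x)) / M2) powr q < \<eta> / 8 * ?v"
   unfolding eventually_sequentially by blast
  \<comment> \<open>The remainder of the bad part after finitely many cubes is small in L^p, so
    \<open>S_weak\<close> handles it without cancellation.\<close>
  let ?d = "\<lambda>x. 1 * hk k x + (-1) * \<beta> x"
  have ad: "adm (p j) ?d" by (rule adm_lincomb[OF ahk a\<beta> p])
  have adf: "adm (p i) ((f(j := ?d)) i)" for i using f ad by auto
  have ahf: "adm (p i) ((f(j := h)) i)" for i using f ah by auto
  let ?E1 = "{x. norm (S (f(j := h)) x) > M1}" let ?E2 = "{x. norm (S (f(j := ?d)) x) > M2}" let ?E3 = "{x. Bsum x \<ge> ennreal M2}"
  have E1: "lvol ?E1 \<le> ennreal (\<eta> / 4 * ?v)"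
  proof (rule M1(2)[unfolded WTM_def, rule_format, OF r])
   show "adm (p i) ((f(j := h)) i)" for i using ahf by blast
   show "(f(j := h)) i y = 0" if "y \<notin> hcube c r" for i y using supp h0 that by auto
   show "L1 ((f(j := h)) i) \<le> ennreal ?v" for i using le hi by (auto intro: order_trans)
   {
    fix i assume "i \<notin> J"
    show "AE y in lborel. norm ((f(j := h)) i y) \<le> D'"
    proof (cases "i = j")
     case True
     show ?thesis using hb by eventually_elim (simp add: True D'_def)
    next
     case False
     then have "AE y in lborel. norm (f i y) \<le> D" using bd \<open>i \<notin> J\<close> by blast
     then show ?thesis by eventually_elim (simp add: False D'_def)
    qed
   }
  qed
  have E2: "lvol ?E2 \<le> ennreal (\<eta> / 8 * ?v)"
  proof -
   have "lvol ?E2 \<le> ennreal ((B * Ip (f(j := ?d)) / M2) powr q)" by (rule S_weak[OF adf M2])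
   also have "\<dots> \<le> ennreal (\<eta> / 8 * ?v)" using k by (intro ennreal_leI) simp
   finally show ?thesis .
  qed
  have E3: "vol ?E3 \<le> ennreal (\<eta> / 8 * ?v)"
  proof -
   have "vol ?E3 = (NN x. indicator ?E3 x)" by (rule nn_integral_indicator[symmetric]) simp
   also have "\<dots> \<le> (NN x. ennreal (1 / M2) * Bsum x)"
   proof (rule nn_integral_mono)
    fix x
    show "indicator ?E3 x \<le> ennreal (1 / M2) * Bsum x"
    proof (cases "x \<in> ?E3")
     case True
     have "1 = ennreal (1 / M2) * ennreal M2" using M2 by (simp add: ennreal_mult[symmetric])
     also have "\<dots> \<le> ennreal (1 / M2) * Bsum x" using True by (intro mult_left_mono) auto
     finally show ?thesis using True by simp
    qed simp
   qed
   also have "\<dots> = ennreal (1 / M2) * (NN x. Bsum x)" by (rule nn_integral_cmult) simp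
   also have "\<dots> \<le> ennreal (1 / M2) * ennreal (cout * cst * (2 * ?v))" by (intro mult_left_mono Bsum_int) simp
   also have "\<dots> = ennreal (1 / M2 * (cout * cst * (2 * ?v)))" using M2 cout_pos cst v by (intro ennreal_mult[symmetric]) auto
   also have "1 / M2 * (cout * cst * (2 * ?v)) = \<eta> / 8 * ?v"
   proof -
    have "M2 = 16 * cst * cout / \<eta>" by (simp add: M2_def cst_def)
    then show ?thesis using cout_pos cst \<eta> by (simp only:) (simp add: field_simps)
   qed
   finally show ?thesis .
  qed
  have m1: "?E1 \<in> sets lebesgue" "?E2 \<in> sets lebesgue"
  proof -
   have [measurable]: "S (f(j := h)) \<in> leb_fun" "S (f(j := ?d)) \<in> leb_fun"
    by (rule S_meas, rule ahf) (rule S_meas, rule adf)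
   have "{x \<in> space lebesgue. norm (S (f(j := h)) x) > M1} \<in> sets lebesgue" "{x \<in> space lebesgue. norm (S (f(j := ?d)) x) > M2} \<in> sets lebesgue"
    by measurable
   then show "?E1 \<in> sets lebesgue" "?E2 \<in> sets lebesgue" by simp_all
  qed
  have m3: "?E3 \<in> sets borel" by measurable
  have bl: "X \<in> sets borel ==> X \<in> sets lebesgue" for X :: "(real ^ 'n) set" by auto
  have eqf: "f j = (\<lambda>x. 1 * h x + 1 * \<beta> x)" by (auto simp: \<beta>_def)
  have s1: "AE x in lebesgue. S f x = 1 * S (f(j := h)) x + 1 * S (f(j := \<beta>)) x"
   using S_comb[OF f ah a\<beta>, of 1 1] unfolding eqf[symmetric] by simp
  have s2: "AE x in lebesgue. S (f(j := ?d)) x = 1 * S (f(j := hk k)) x + (-1) * S (f(j := \<beta>)) x"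
   by (rule S_comb[OF f ahk a\<beta>])
  have "AE x in lebesgue. x \<in> {x. norm (S f x) > M1 + 2 * M2} --> x \<in> ?E1 \<union> ?E2 \<union> ?E3 \<union> \<Omega> \<union> Bad"
   using s1 s2 pwS[OF G(1)[of k] G(2)[of k]]
  proof eventually_elim
   case (elim x)
   show ?case
   proof (rule impI, rule ccontr)
    assume big: "x \<in> {x. norm (S f x) > M1 + 2 * M2}" and no: "x \<notin> ?E1 \<union> ?E2 \<union> ?E3 \<union> \<Omega> \<union> Bad"
    have "ennreal (norm (S (f(j := hk k)) x)) \<le> (\<Sum>P\<in>G k. b P x)" using elim(3) no by (simp add: hk_def[abs_def])
    also have "\<dots> = (\<integral>\<^sup>+P. b P x \<partial>count_space (G k))" using G by (simp add: nn_integral_count_space_finite)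
    also have "\<dots> \<le> Bsum x" unfolding Bsum_def using G(2)[of k]
     by (subst (1 2) nn_integral_count_space_indicator) (auto intro!: nn_integral_mono simp: indicator_def)
    also have "\<dots> < ennreal M2" using no by (simp add: not_le)
    finally have "norm (S (f(j := hk k)) x) < M2" by (simp add: ennreal_less_iff)
    moreover have "norm (S (f(j := h)) x) \<le> M1" "norm (S (f(j := ?d)) x) \<le> M2" using no by auto
    moreover have "S f x = S (f(j := h)) x + S (f(j := hk k)) x - S (f(j := ?d)) x" using elim(1,2) by simp
    then have "norm (S f x) \<le> norm (S (f(j := h)) x) + norm (S (f(j := hk k)) x) + norm (S (f(j := ?d)) x)"
     using norm_triangle_ineq4[of "S (f(j := h)) x + S (f(j := hk k)) x" "S (f(j := ?d)) x"]
      norm_triangle_ineq[of "S (f(j := h)) x" "S (f(j := hk k)) x"] by (simp only:)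
    ultimately show False using big by simp
   qed
  qed
  then have "lvol {x. norm (S f x) > M1 + 2 * M2} \<le> lvol (?E1 \<union> ?E2 \<union> ?E3 \<union> \<Omega> \<union> Bad)"
   by (rule emeasure_mono_AE) (intro sets.Un m1 bl m3 \<Omega>m Badm)
  also have "\<dots> \<le> lvol ?E1 + lvol ?E2 + lvol ?E3 + lvol \<Omega> + lvol Bad"
   by (intro order_trans[OF emeasure_subadditive] add_right_mono sets.Un m1 bl m3 \<Omega>m Badm order_refl)
  also have "\<dots> \<le> ennreal (\<eta> / 4 * ?v) + ennreal (\<eta> / 8 * ?v) + ennreal (\<eta> / 8 * ?v) + ennreal (\<eta> / 4 * ?v) + ennreal (\<eta> / 4 * ?v)"
  proof (intro add_mono E1 E2)
   show "lvol ?E3 \<le> ennreal (\<eta> / 8 * ?v)" using E3 m3 by simp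
   show "lvol \<Omega> \<le> ennreal (\<eta> / 4 * ?v)" using \<Omega>s \<Omega>m by simp
   show "lvol Bad \<le> ennreal (\<eta> / 4 * ?v)" using Bads Badm by simp
  qed
  also have "\<dots> = ennreal (\<eta> * ?v)"
   using \<eta> v by (subst ennreal_plus[symmetric], simp, simp)+ simp
  finally show "lvol {x. norm (S f x) > M1 + 2 * M2} \<le> ennreal (\<eta> * ?v)" .
 qed
qed

lemma WT_all: "WT UNIV"
proof -
 have "WT J" if "finite J" for J using that by (induction J rule: finite_induct) (auto intro: WT_empty WT_step)
 then show ?thesis by simp
qed

end

lemma measurable_vec_sets:
 assumes "E \<in> sets borel" shows "{y :: real ^ 'n::finite ^ 'm::finite. y $ j \<in> E} \<in> sets borel"
 using measurable_sets[OF measurable_vec_nth assms, of j] by (simp add: vimage_def)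

context CZ_op
begin

lemma S_scale:
 assumes f: "\<And>i. adm (p i) (f i)"
 shows "AE x in lebesgue. S (\<lambda>i y. c i * f i y) x = (PU i. c i) * S f x"
proof -
 have "AE x in lebesgue. S (\<lambda>i. if i \<in> J then (\<lambda>y. c i * f i y) else f i) x = (\<Prod>i\<in>J. c i) * S f x" if "finite J" for J
  using that
 proof (induction J rule: finite_induct)
  case (insert j J)
  let ?g = "\<lambda>i. if i \<in> J then (\<lambda>y. c i * f i y) else f i"
  have a: "adm (p i) (?g i)" for i using f adm_cmult by auto
  have e: "(\<lambda>i. if i \<in> insert j J then (\<lambda>y. c i * f i y) else f i) = ?g(j := \<lambda>y. c j * f j y + 0 * f j y)"
   using insert.hyps by (auto simp: fun_eq_iff)
  have "?g(j := f j) = ?g" using insert.hyps by (auto simp: fun_eq_iff)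
  then have "AE x in lebesgue. S (?g(j := \<lambda>y. c j * f j y + 0 * f j y)) x = c j * S ?g x + 0 * S ?g x"
   using S_comb[OF a f[of j] f[of j], of "c j" 0] by simp
  with insert.IH show ?case
  proof eventually_elim
   case (elim x)
   then show ?case unfolding e using insert.hyps by simp
  qed
 qed simp
 from this[of UNIV] show ?thesis by simp
qed

text \<open>One fixed level for each fraction, so that later constants are functions of
  \<eta>.\<close>

definition cweak :: "real => real" where "cweak \<eta> = (SOME M. 0 < M \<and> WTM UNIV \<eta> 0 M)"

lemma cweak: "0 < \<eta> ==> 0 < cweak \<eta> \<and> WTM UNIV \<eta> 0 (cweak \<eta>)"
 using someI_ex[OF WT_all[unfolded WT_def, rule_format, of \<eta> 0]] by (simp add: cweak_def)

text \<open>Multilinearity divides each input by \<open>a i\<close> and reduces to averages of at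
  most 1.\<close>

lemma weak_type:
 assumes \<eta>: "0 < \<eta>" and r: "0 < r" and f: "\<And>i. adm (p i) (f i)" and supp: "\<And>i y. y \<notin> hcube c r ==> f i y = 0"
  and a: "\<And>i. 0 < a i" and le: "\<And>i. L1 (f i) \<le> ennreal (a i * r ^ CARD('n))"
 shows "lvol {x. norm (S f x) > cweak \<eta> * (PU i. a i)} \<le> ennreal (\<eta> * r ^ CARD('n))"
proof -
 have [measurable]: "f i \<in> borel_fun" for i using adm_borel[OF f] .
 let ?g = "\<lambda>i y. of_real (1 / a i) * f i y"
 have 1: "lvol {x. norm (S ?g x) > cweak \<eta>} \<le> ennreal (\<eta> * r ^ CARD('n))"
 proof (rule cweak[OF \<eta>, THEN conjunct2, unfolded WTM_def, rule_format, OF r])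
  show "adm (p i) (?g i)" for i using f adm_cmult by blast
  show "?g i y = 0" if "y \<notin> hcube c r" for i y using supp[OF that] by simp
  show "L1 (?g i) \<le> ennreal (r ^ CARD('n))" for i
  proof -
   have "L1 (?g i) = (NN y. ennreal (1 / a i) * en (f i) y)"
    using a[of i] by (intro nn_integral_cong) (auto simp: norm_mult norm_divide ennreal_mult[symmetric])
   also have "\<dots> = ennreal (1 / a i) * L1 (f i)" by (rule nn_integral_cmult) measurable
   also have "\<dots> \<le> ennreal (1 / a i) * ennreal (a i * r ^ CARD('n))" by (intro mult_left_mono le) simp
   also have "\<dots> = ennreal (r ^ CARD('n))" using a[of i] r by (simp add: ennreal_mult[symmetric])
   finally show ?thesis .
  qed
 qed simp
 have prod: "0 < (PU i. a i)" using a by (simp add: prod_pos)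
 have [measurable]: "S ?g \<in> leb_fun" using f adm_cmult by (intro S_meas) blast
 have "AE x in lebesgue. x \<in> {x. norm (S f x) > cweak \<eta> * (PU i. a i)} --> x \<in> {x. norm (S ?g x) > cweak \<eta>}"
  using S_scale[OF f, where c = "\<lambda>i. of_real (1 / a i)"]
 proof eventually_elim
  case (elim x)
  have "norm (S ?g x) = norm (S f x) / (PU i. a i)"
   unfolding elim norm_mult prod_norm[symmetric] using a by (simp add: norm_divide prod_dividef abs_of_pos)
  then show ?case using prod by (simp add: pos_less_divide_eq)
 qed
 moreover have "{x \<in> space lebesgue. norm (S ?g x) > cweak \<eta>} \<in> sets lebesgue" by measurable
 ultimately have "lvol {x. norm (S f x) > cweak \<eta> * (PU i. a i)} \<le> lvol {x. norm (S ?g x) > cweak \<eta>}"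
  by (intro emeasure_mono_AE) simp_all
 also note 1
 finally show ?thesis .
qed

section \<open>Truncated kernels\<close>

definition TI :: "real ^ 'n => (real ^ 'n ^ 'm) set => ('m => 'n cfun) => complex" where
 "TI x V g = (\<integral>y. indicator V y *\<^sub>R (K (point x y) * (PU j. g j (y $ j))) \<partial>lborel)"

lemma prod_borel:
 assumes [measurable]: "\<And>j. g j \<in> borel_fun"
 shows "(\<lambda>y :: real ^ 'n ^ 'm. PU j. (g j (y $ j) :: complex)) \<in> borel_fun"
 by measurable

lemma TI_integrable:
 assumes g: "\<And>j. integrable lborel (g j)" and V [measurable]: "V \<in> sets borel" and d: "0 < d" "\<And>y. y \<in> V ==> d \<le> rho x y"
 shows "integrable lborel (\<lambda>y. indicator V y *\<^sub>R (K (point x y) * (PU j. g j (y $ j))))"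
proof (rule Bochner_Integration.integrable_bound)
 have gm [measurable]: "g j \<in> borel_fun" for j using borel_measurable_integrable[OF g[of j]] by simp
 show "integrable lborel (\<lambda>y. A / d ^ (CARD('m) * CARD('n)) * norm (PU j. g j (y $ j)))"
  by (intro integrable_mult_right integrable_norm integrable_prod_vec g)
 show "AE y in lborel. norm (indicator V y *\<^sub>R (K (point x y) * (PU j. g j (y $ j)))) \<le> norm (A / d ^ (CARD('m) * CARD('n)) * norm (PU j. g j (y $ j)))"
 proof (rule AE_I2)
  fix y
  show "norm (indicator V y *\<^sub>R (K (point x y) * (PU j. g j (y $ j)))) \<le> norm (A / d ^ (CARD('m) * CARD('n)) * norm (PU j. g j (y $ j)))"
  proof (cases "y \<in> V")
   case True
   have "norm (K (point x y)) * norm (PU j. g j (y $ j)) \<le> A / d ^ (CARD('m) * CARD('n)) * norm (PU j. g j (y $ j))"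
    by (intro mult_right_mono K_size d True) simp
   then show ?thesis using True A d(1) by (simp add: norm_mult abs_mult del: prod_norm)
  qed simp
 qed
 show "(\<lambda>y. indicator V y *\<^sub>R (K (point x y) * (PU j. g j (y $ j)))) \<in> borel_measurable lborel"
  using prod_borel[of g] by measurable
qed

lemma TI_bound:
 assumes g: "\<And>j. integrable lborel (g j)" and V [measurable]: "V \<in> sets borel" and d: "0 < d" "\<And>y. y \<in> V ==> d \<le> rho x y"
  and E [measurable]: "E \<in> sets borel" and VE: "\<And>y j. y \<in> V ==> g j (y $ j) \<noteq> 0 ==> y $ j \<in> E"
  and v: "\<And>j. 0 \<le> v j" "\<And>j. (NN y. en (g j) y * indicator E y) \<le> ennreal (v j)"
 shows "norm (TI x V g) \<le> A / d ^ (CARD('m) * CARD('n)) * (PU j. v j)"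
proof -
 have gm [measurable]: "g j \<in> borel_fun" for j using borel_measurable_integrable[OF g[of j]] by simp
 let ?c = "A / d ^ (CARD('m) * CARD('n))"
 have c: "0 \<le> ?c" using A d by simp
 have "ennreal (norm (TI x V g)) \<le> (NN y. ennreal (norm (indicator V y *\<^sub>R (K (point x y) * (PU j. g j (y $ j))))))"
  unfolding TI_def by (rule norm_integral_le_nn)
 also have "\<dots> \<le> (NN y. ennreal ?c * (PU j. ennreal (norm (g j (y $ j))) * indicator E (y $ j)))"
 proof (rule nn_integral_mono)
  fix y
  show "ennreal (norm (indicator V y *\<^sub>R (K (point x y) * (PU j. g j (y $ j))))) \<le> ennreal ?c * (PU j. ennreal (norm (g j (y $ j))) * indicator E (y $ j))"
  proof (cases "y \<in> V")
   case True
   have "norm (K (point x y)) * norm (PU j. g j (y $ j)) \<le> ?c * norm (PU j. g j (y $ j))"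
    by (intro mult_right_mono K_size d True) simp
   then have "ennreal (norm (indicator V y *\<^sub>R (K (point x y) * (PU j. g j (y $ j))))) \<le> ennreal (?c * norm (PU j. g j (y $ j)))"
    using True by (intro ennreal_leI) (simp add: norm_mult del: prod_norm)
   also have "\<dots> = ennreal ?c * ennreal (norm (PU j. g j (y $ j)))" by (rule ennreal_mult[OF c norm_ge_zero])
   also have "ennreal (norm (PU j. g j (y $ j))) = (PU j. ennreal (norm (g j (y $ j))))"
    by (simp add: prod_ennreal prod_norm[symmetric])
   also have "(PU j. ennreal (norm (g j (y $ j)))) = (PU j. ennreal (norm (g j (y $ j))) * indicator E (y $ j))"
    using VE[OF True] by (intro prod.cong) (auto simp: indicator_def)
   finally show ?thesis .
  qed simp
 qed
 also have "\<dots> = ennreal ?c * (NN y. (PU j. ennreal (norm (g j (y $ j))) * indicator E (y $ j)))"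
  by (rule nn_integral_cmult) measurable
 also have "(NN y. (PU j. ennreal (norm (g j (y $ j))) * indicator E (y $ j))) = (PU j. NN y. en (g j) y * indicator E y)"
  by (rule nn_integral_prod_vec[where F = "\<lambda>j y. en (g j) y * indicator E y"]) measurable
 also have "\<dots> \<le> (PU j. ennreal (v j))" by (intro prod_mono_ennreal v(2))
 also have "(PU j. ennreal (v j)) = ennreal (PU j. v j)" using v(1) by (intro prod_ennreal) auto
 finally have "ennreal (norm (TI x V g)) \<le> ennreal ?c * ennreal (PU j. v j)" by (simp add: mult_left_mono)
 also have "\<dots> = ennreal (?c * (PU j. v j))" by (rule ennreal_mult[symmetric, OF c prod_nonneg]) (use v in auto)
 finally have "ennreal (norm (TI x V g)) \<le> ennreal (?c * (PU j. v j))" .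
 moreover have "0 \<le> ?c * (PU j. v j)" using c v(1) by (intro mult_nonneg_nonneg prod_nonneg) auto
 ultimately show ?thesis by simp
qed

lemma TI_Un:
 assumes g: "\<And>j. integrable lborel (g j)" and V: "V \<in> sets borel" "W \<in> sets borel" "V \<inter> W = {}"
  and d: "0 < d" "\<And>y. y \<in> V \<union> W ==> d \<le> rho x y"
 shows "TI x (V \<union> W) g = TI x V g + TI x W g"
proof -
 have "TI x (V \<union> W) g = (\<integral>y. indicator V y *\<^sub>R (K (point x y) * (PU j. g j (y $ j))) + indicator W y *\<^sub>R (K (point x y) * (PU j. g j (y $ j))) \<partial>lborel)"
  unfolding TI_def using V(3) by (intro Bochner_Integration.integral_cong) (auto simp: indicator_def)
 also have "\<dots> = TI x V g + TI x W g"
  unfolding TI_def by (rule Bochner_Integration.integral_add; rule TI_integrable[OF g _ d(1)]; use V d(2) in blast)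
 finally show ?thesis .
qed

text \<open>Slots are cut off to the ball one by one; what is removed in each step vanishes on the
  ball, so the kernel represents its contribution there. The regions of integration are disjoint and
  exhaust the tuples with a coordinate outside the ball.\<close>

lemma S_local:
 fixes z0 :: "real ^ 'n"
 assumes g: "\<And>j. adm (p j) (g j)"
 shows "AE x in lebesgue. x \<in> ball z0 R -->
  S g x - S (\<lambda>j y. indicator (cball z0 R) y * g j y) x = TI x {y. \<exists>j. y $ j \<notin> cball z0 R} g"
proof -
 let ?B = "cball z0 R"
 have ag: "adm (p j) (\<lambda>y. indicator E y * g j y)" if "E \<in> sets borel" for j E
  by (rule adm_mult_indicator[OF g p that])
 define h where "h J i = (if i \<in> J then (\<lambda>y. indicator ?B y * g i y) else g i)" for J i
 have ah: "adm (p i) (h J i)" for J i using g ag by (auto simp: h_def)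
 define W where "W J = {y :: real ^ 'n ^ 'm. \<exists>j\<in>J. y $ j \<notin> ?B}" for J
 have Wm: "W J \<in> sets borel" for J
 proof -
  have "W J = (\<Union>j\<in>J. {y. y $ j \<in> - ?B})" by (auto simp: W_def)
  also have "\<dots> \<in> sets borel" by (intro sets.countable_UN'' measurable_vec_sets countable_finite) auto
  finally show ?thesis .
 qed
 have st: "AE x in lebesgue. x \<in> ball z0 R --> S g x - S (h J) x = TI x (W J) g" if "finite J" for J
  using that
 proof (induction J rule: finite_induct)
  case empty
  have "h {} = g" by (simp add: h_def fun_eq_iff)
  then show ?case by (simp add: W_def TI_def)
 next
  case (insert j J)
  let ?u = "\<lambda>y. indicator ?B y * g j y" let ?w = "\<lambda>y. indicator (- ?B) y * g j y"
  have hj: "h J = (h J)(j := \<lambda>y. 1 * ?u y + 1 * ?w y)" using insert.hyps by (auto simp: h_def fun_eq_iff indicator_def)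
  have hj': "h (insert j J) = (h J)(j := ?u)" by (auto simp: h_def fun_eq_iff)
  have au: "adm (p j) ?u" "adm (p j) ?w" by (intro ag; simp)+
  have c: "AE x in lebesgue. S ((h J)(j := \<lambda>y. 1 * ?u y + 1 * ?w y)) x = 1 * S ((h J)(j := ?u)) x + 1 * S ((h J)(j := ?w)) x"
   by (rule S_comb[OF ah au])
  have r: "Rep (ball z0 R) ((h J)(j := ?w))"
  proof (rule Rep_general[of _ "- ?B" _ j])
   show "adm (p i) (((h J)(j := ?w)) i)" for i using ah au by auto
   show "((h J)(j := ?w)) j x = 0" if "x \<notin> - ?B" for x using that by simp
  qed auto
  from insert.IH c r[unfolded Rep_def] show ?case
  proof eventually_elim
   case (elim x)
   show ?case
   proof
    assume x: "x \<in> ball z0 R"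
    \<comment> \<open>Slot \<open>j\<close> is outside the ball while all slots treated before are
      inside: the part by which \<open>W J\<close> grows.\<close>
    let ?V = "{y :: real ^ 'n ^ 'm. y $ j \<notin> ?B} \<inter> (- W J)"
    have Vm: "?V \<in> sets borel" using measurable_vec_sets[of "- ?B" j] Wm by (auto simp: Compl_eq)
    have d: "0 < R - dist z0 x" using x by simp
    have rh: "R - dist z0 x \<le> rho x y" if "y $ i \<notin> ?B" for y :: "real ^ 'n ^ 'm" and i
    proof -
     have "R < dist z0 (y $ i)" using that by simp
     also have "\<dots> \<le> dist z0 x + norm (x - y $ i)" using dist_triangle[of z0 "y $ i" x] by (simp add: dist_norm)
     finally show ?thesis using norm_le_rho[of x y i] by simp
    qed
    have "Kint ((h J)(j := ?w)) x = TI x ?V g"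
     unfolding Kint_def TI_def
    proof (rule Bochner_Integration.integral_cong[OF refl])
     fix y :: "real ^ 'n ^ 'm"
     have "(PU i. ((h J)(j := ?w)) i (y $ i)) = indicator ?V y *\<^sub>R (PU i. g i (y $ i))"
     proof (cases "y \<in> ?V")
      case True
      have "((h J)(j := ?w)) i (y $ i) = g i (y $ i)" for i
       using True by (auto simp: h_def W_def)
      then show ?thesis using True by simp
     next
      case False
      have "\<exists>i. ((h J)(j := ?w)) i (y $ i) = 0"
      proof (cases "y $ j \<in> ?B")
       case True
       then show ?thesis by (intro exI[of _ j]) simp
      next
       case nb: False
       then obtain i where i: "i \<in> J" "y $ i \<notin> ?B" using False by (auto simp: W_def)
       then have "i \<noteq> j" using insert.hyps by auto
       then show ?thesis using i by (intro exI[of _ i]) (simp add: h_def)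
      qed
      then have "(PU i. ((h J)(j := ?w)) i (y $ i)) = 0" by (intro prod_zero) auto
      moreover have "indicator ?V y = (0::real)" using False by (rule indicator_simps)
      ultimately show ?thesis by (simp only: scaleR_zero_left)
     qed
     then show "K (point x y) * (PU i. ((h J)(j := ?w)) i (y $ i)) = indicator ?V y *\<^sub>R (K (point x y) * (PU j. g j (y $ j)))"
      by (simp only: mult_scaleR_right)
    qed
    moreover have "TI x (W (insert j J)) g = TI x (W J) g + TI x ?V g"
    proof -
     have "W (insert j J) = W J \<union> ?V" by (auto simp: W_def)
     moreover have "TI x (W J \<union> ?V) g = TI x (W J) g + TI x ?V g"
      by (rule TI_Un[OF adm_integrable[OF g] Wm Vm _ d]) (use rh in \<open>auto simp: W_def\<close>)
     ultimately show ?thesis by simp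
    qed
    moreover have "S (h J) x = S (h (insert j J)) x + S ((h J)(j := ?w)) x"
     using elim(2) by (subst hj) (simp only: hj' mult_1_left)
    ultimately show "S g x - S (h (insert j J)) x = TI x (W (insert j J)) g"
     using elim(1,3) x by (simp add: algebra_simps)
   qed
  qed
 qed
 have h: "h UNIV = (\<lambda>j y. indicator ?B y * g j y)" by (simp add: h_def fun_eq_iff)
 have "W UNIV = {y. \<exists>j. y $ j \<notin> ?B}" by (simp add: W_def)
 with st[OF finite, of UNIV] show ?thesis unfolding h by simp
qed

end

section \<open>Truncations and dyadic scales\<close>

text \<open>\<open>n\<close> times the side length, a cheap upper bound for the diameter of a
  cube.\<close>

definition sd :: "real ^ 'n::finite => real => nat => real" where
 "sd a L k = real CARD('n) * (L / 2 ^ k)"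

lemma sd_pos: "0 < L ==> 0 < sd a L k" by (simp add: sd_def)

lemma sd_mono: "0 < L ==> k \<le> l ==> sd a L l \<le> sd a L k"
 unfolding sd_def by (intro mult_left_mono divide_left_mono power_increasing) auto

lemma sd_Suc: "sd a L (Suc k) = sd a L k / 2" by (simp add: sd_def)

text \<open>With radius 3 sd, every point outside is more than 2 sd away from each point of the cube
  (\<open>DB_far\<close>), and the balls decrease along the generations (\<open>DB_mono\<close>).
  Balls fit the Vitali covering in \<open>maximal_weak_type\<close>.\<close>

definition DB :: "real ^ 'n::finite => real => nat => real ^ 'n => (real ^ 'n) set" where
 "DB a L k x = cball (dlo a L k x) (3 * sd a L k)"

definition TR :: "real ^ 'n::finite => real => (real ^ 'n ^ 'm::finite) set" where
 "TR \<xi> \<delta> = {y. \<delta>\<^sup>2 < (\<Sum>j\<in>UNIV. (norm (\<xi> - y $ j))\<^sup>2)}"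

definition off :: "(real ^ 'n::finite) set => (real ^ 'n ^ 'm::finite) set" where
 "off Q = {y. \<exists>j. y $ j \<notin> Q}"

text \<open>From generation \<open>k\<close> up to but excluding \<open>l\<close>, the exceptional
  set \<open>F\<close> leaves room for good points in every cube on the path to \<open>x\<close>: no
  stop has occurred yet.\<close>

abbreviation half_on :: "(real ^ 'n::finite) set => real ^ 'n => real => nat => nat => real ^ 'n => bool" where
 "half_on F a L k l x \<equiv> \<forall>i. k \<le> i --> i < l --> vol (F \<inter> dy a L i x) \<le> ennreal ((L / 2 ^ i) ^ CARD('n) / 2)"

lemma DB_borel [measurable]: "DB a L k x \<in> sets borel" by (simp add: DB_def)

lemma TR_borel [measurable]: "TR \<xi> \<delta> \<in> sets borel" unfolding TR_def by measurable

lemma off_borel [measurable]: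
 assumes "Q \<in> sets borel" shows "off Q \<in> sets borel"
proof -
 have "off Q = (\<Union>j. {y. y $ j \<in> - Q})" by (auto simp: off_def)
 also have "\<dots> \<in> sets borel" using assms by (intro sets.countable_UN'' measurable_vec_sets) auto
 finally show ?thesis .
qed

lemma TR_rho: assumes "0 < \<delta>" "y \<in> TR \<xi> \<delta>" shows "\<delta> \<le> rho \<xi> y"
proof -
 have "\<delta>\<^sup>2 < (\<Sum>j\<in>UNIV. (norm (\<xi> - y $ j))\<^sup>2)" using assms by (simp add: TR_def)
 also have "\<dots> \<le> (\<Sum>j\<in>UNIV. rho \<xi> y * norm (\<xi> - y $ j))"
  unfolding power2_eq_square by (intro sum_mono mult_right_mono norm_le_rho) auto
 also have "\<dots> = (rho \<xi> y)\<^sup>2" by (simp add: sum_distrib_left[symmetric] rho_def power2_eq_square)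
 finally show ?thesis using power2_le_imp_le[OF less_imp_le rho_nonneg] by blast
qed

lemma TR_far: assumes "0 < \<delta>" "\<delta> < norm (\<xi> - y $ j)" shows "y \<in> TR \<xi> \<delta>"
proof -
 have "\<delta>\<^sup>2 < (norm (\<xi> - y $ j))\<^sup>2" using assms by (intro power_strict_mono) auto
 also have "\<dots> \<le> (\<Sum>j\<in>UNIV. (norm (\<xi> - y $ j))\<^sup>2)"
  by (rule member_le_sum[where f = "\<lambda>j. (norm (\<xi> - y $ j))\<^sup>2"]) auto
 finally show ?thesis by (simp add: TR_def)
qed

lemma dlo_dy: "0 < L ==> dlo a L k x \<in> dy a L k x"
 using dy_hcube[of L a k x] by (auto simp: hcube_def)

lemma dist_dlo: "0 < L ==> \<xi> \<in> dy a L k x ==> dist (dlo a L k x) \<xi> \<le> sd a L k" for a :: "real ^ 'n::finite"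
 unfolding sd_def by (rule dist_dy[OF _ dlo_dy])

lemma DB_far:
 assumes "0 < L" "\<xi> \<in> dy a L k x" "y \<notin> DB a L k x"
 shows "2 * sd a L k < norm (\<xi> - y)"
proof -
 have "3 * sd a L k < dist (dlo a L k x) y" using assms(3) by (simp add: DB_def)
 then show ?thesis using dist_dlo[OF assms(1,2)] dist_triangle[of "dlo a L k x" y \<xi>] unfolding dist_norm[of \<xi> y, symmetric] by linarith
qed

lemma DB_near:
 assumes "0 < L" "\<xi> \<in> dy a L k x" shows "DB a L k x \<subseteq> cball \<xi> (4 * sd a L k)"
proof
 fix y assume "y \<in> DB a L k x"
 then show "y \<in> cball \<xi> (4 * sd a L k)"
  using dist_dlo[OF assms] dist_triangle[of \<xi> y "dlo a L k x"] by (simp add: DB_def dist_commute)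
qed

lemma DB_mono:
 assumes L: "0 < L" and le: "k \<le> l" shows "DB a L l x \<subseteq> DB a L k x"
proof (cases "k = l")
 case False
 then have h: "sd a L l \<le> sd a L k / 2" using sd_mono[OF L, of "Suc k" l a] le by (simp add: sd_Suc)
 have "dist (dlo a L k x) (dlo a L l x) \<le> sd a L k"
  by (rule dist_dlo[OF L]) (use dy_mono[OF le] dlo_dy[OF L] in blast)
 then have "y \<in> DB a L k x" if "y \<in> DB a L l x" for y
  using that h dist_triangle[of "dlo a L k x" y "dlo a L l x"] sd_pos[OF L, of a k]
  by (simp add: DB_def)
 then show ?thesis by blast
qed simp

lemma dy_ball: "0 < L ==> dy a L k x \<subseteq> ball (dlo a L k x) (3 * sd a L k)" for a :: "real ^ 'n::finite"
 using dist_dlo[of L _ a k x] sd_pos[of L a k] by force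

lemma DB_hcube:
 assumes L: "0 < L"
 shows "DB a L k x \<subseteq> hcube (dlo a L k x - (\<chi> i. 3 * sd a L k)) (7 * sd a L k)"
proof
 fix y assume "y \<in> DB a L k x"
 then have "norm (y - dlo a L k x) \<le> 3 * sd a L k" by (simp add: DB_def dist_norm norm_minus_commute)
 then have "\<bar>y $ i - dlo a L k x $ i\<bar> \<le> 3 * sd a L k" for i
  using component_le_norm_cart[of "y - dlo a L k x" i] by simp
 then have "dlo a L k x $ i - 3 * sd a L k \<le> y $ i \<and> y $ i \<le> dlo a L k x $ i + 3 * sd a L k" for i
  by (auto simp: abs_le_iff algebra_simps)
 then show "y \<in> hcube (dlo a L k x - (\<chi> i. 3 * sd a L k)) (7 * sd a L k)"
  using sd_pos[OF L, of a k] unfolding hcube_def by (fastforce intro: le_less_trans)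
qed

context CZ_op
begin

definition "csm = A * 2 powr (real (CARD('m) * CARD('n)) + \<epsilon>) * tgam ^ CARD('m)"

lemma csm_pos: "0 < csm" using A tgam_pos by (simp add: csm_def)

text \<open>Smoothness in the first variable gains \<open>s powr \<epsilon>\<close> and turns the
  far region into a product of convergent tails, one per slot; all powers of \<open>s\<close>
  cancel.\<close>

lemma TI_smooth:
 assumes g: "\<And>j. adm (p j) (g j)" and s: "0 < s" and a: "\<And>j. 0 \<le> a j" and mb: "\<And>j. maxbd (en (g j)) (a j) z"
   and zx: "norm (z - \<xi>) \<le> s" and V [measurable]: "V \<in> sets borel" and far: "\<And>y. y \<in> V ==> \<exists>j. 2 * s \<le> norm (z - y $ j)"
 shows "norm (TI z V g - TI \<xi> V g) \<le> csm * (PU j. a j)"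
proof -
 let ?e = "real (CARD('m) * CARD('n)) + \<epsilon>"
 let ?c = "A * 2 powr ?e"
 have gm [measurable]: "g j \<in> borel_fun" for j using adm_borel[OF g] .
 let ?P = "\<lambda>y. PU j. g j (y $ j)"
 let ?w = "\<lambda>y. (PU i. (s + dist z (y $ i)) powr - (real CARD('n) + gam))"
 have rz: "2 * s \<le> rho z y" if "y \<in> V" for y using far[OF that] norm_le_rho[of z y] order_trans by blast
 have rx: "s \<le> rho \<xi> y" if y: "y \<in> V" for y
 proof -
  obtain j where "2 * s \<le> norm (z - y $ j)" using far[OF y] by blast
  also have "\<dots> \<le> norm (z - \<xi>) + norm (\<xi> - y $ j)" using norm_triangle_ineq[of "z - \<xi>" "\<xi> - y $ j"] by simp
  finally show ?thesis using zx norm_le_rho[of \<xi> y j] by simp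
 qed
 have K: "norm (K (point z y) - K (point \<xi> y)) \<le> ?c * s powr \<epsilon> * ?w y" if y: "y \<in> V" for y
 proof -
  obtain j where j: "2 * s \<le> norm (z - y $ j)" using far[OF y] by blast
  have r0: "0 < rho z y" using rz[OF y] s by linarith
  have "norm (K (point z y) - K (point \<xi> y)) \<le> A * norm (z - \<xi>) powr \<epsilon> / rho z y powr ?e"
   by (rule K_smooth_x[OF r0 order_refl, where j = j]) (use j zx in simp)
  also have "\<dots> \<le> A * s powr \<epsilon> / rho z y powr ?e"
   using A zx eps by (intro divide_right_mono mult_left_mono powr_mono2) auto
  also have "\<dots> = A * s powr \<epsilon> * (1 / rho z y powr ?e)" by simp
  also have "\<dots> \<le> A * s powr \<epsilon> * (2 powr ?e * ?w y)"
  proof (intro mult_left_mono powr_sum_le_prod)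
   show "s + dist z (y $ i) \<le> 2 * rho z y" for i
    using rz[OF y] norm_le_rho[of z y i] s by (simp add: dist_norm)
  qed (use s less_imp_le[OF A] in \<open>auto intro: add_pos_nonneg\<close>)
  finally show ?thesis by (simp add: mult_ac)
 qed
 have "TI z V g - TI \<xi> V g = (\<integral>y. indicator V y *\<^sub>R (K (point z y) * ?P y) - indicator V y *\<^sub>R (K (point \<xi> y) * ?P y) \<partial>lborel)"
  unfolding TI_def
  by (rule Bochner_Integration.integral_diff[symmetric]; rule TI_integrable[OF adm_integrable[OF g] V s]) (use rz rx s in fastforce)+
 then have "ennreal (norm (TI z V g - TI \<xi> V g)) \<le> (NN y. ennreal (norm (indicator V y *\<^sub>R (K (point z y) * ?P y) - indicator V y *\<^sub>R (K (point \<xi> y) * ?P y))))"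
  by (simp only: norm_integral_le_nn)
 also have "\<dots> \<le> (NN y. ennreal (?c * s powr \<epsilon>) * ennreal (?w y * norm (?P y)))"
 proof (rule nn_integral_mono)
  fix y
  show "ennreal (norm (indicator V y *\<^sub>R (K (point z y) * ?P y) - indicator V y *\<^sub>R (K (point \<xi> y) * ?P y))) \<le> ennreal (?c * s powr \<epsilon>) * ennreal (?w y * norm (?P y))"
  proof (cases "y \<in> V")
   case True
   have "norm (K (point z y) * ?P y - K (point \<xi> y) * ?P y) = norm (K (point z y) - K (point \<xi> y)) * norm (?P y)"
    by (simp only: left_diff_distrib[symmetric] norm_mult)
   also have "\<dots> \<le> (?c * s powr \<epsilon> * ?w y) * norm (?P y)" by (rule mult_right_mono[OF K[OF True] norm_ge_zero])
   finally have "ennreal (norm (K (point z y) * ?P y - K (point \<xi> y) * ?P y)) \<le> ennreal ((?c * s powr \<epsilon>) * (?w y * norm (?P y)))"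
    by (intro ennreal_leI) (simp only: mult.assoc)
   also have "\<dots> = ennreal (?c * s powr \<epsilon>) * ennreal (?w y * norm (?P y))"
    using A by (intro ennreal_mult mult_nonneg_nonneg prod_nonneg) auto
   finally show ?thesis using True by simp
  qed simp
 qed
 also have "\<dots> = ennreal (?c * s powr \<epsilon>) * (NN y. ennreal (?w y * norm (?P y)))"
  using prod_borel[of g] by (intro nn_integral_cmult) measurable
 also have "(NN y. ennreal (?w y * norm (?P y))) = (PU i. NN y. en (g i) y * ennreal ((s + dist z y) powr - (real CARD('n) + gam)))"
  by (rule prod_tail_nn) measurable
 also have "\<dots> \<le> (PU i. ennreal (tgam * a i * s powr - gam))"
  by (intro prod_mono_ennreal tail_gam[OF _ mb a s]) measurable
 also have "\<dots> = ennreal (PU i. tgam * a i * s powr - gam)" using tgam_pos a by (intro prod_ennreal) auto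
 also have "(PU i. tgam * a i * s powr - gam) = tgam ^ CARD('m) * (PU i. a i) * s powr - \<epsilon>"
  using s by (simp add: prod.distrib powr_powr powr_realpow[symmetric] gam_def)
 finally have "ennreal (norm (TI z V g - TI \<xi> V g)) \<le> ennreal (?c * s powr \<epsilon>) * ennreal (tgam ^ CARD('m) * (PU i. a i) * s powr - \<epsilon>)"
  by (simp add: mult_left_mono)
 also have "\<dots> = ennreal (?c * s powr \<epsilon> * (tgam ^ CARD('m) * (PU i. a i) * s powr - \<epsilon>))"
  using less_imp_le[OF A] less_imp_le[OF tgam_pos] a by (intro ennreal_mult[symmetric] mult_nonneg_nonneg prod_nonneg) auto
 also have "?c * s powr \<epsilon> * (tgam ^ CARD('m) * (PU i. a i) * s powr - \<epsilon>) = ?c * tgam ^ CARD('m) * (PU i. a i) * (s powr \<epsilon> * s powr - \<epsilon>)"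
  by (simp only: mult_ac)
 also have "s powr \<epsilon> * s powr - \<epsilon> = 1" using s by (simp add: powr_minus)
 finally have "ennreal (norm (TI z V g - TI \<xi> V g)) \<le> ennreal (?c * tgam ^ CARD('m) * (PU i. a i))" by simp
 then show ?thesis
  using less_imp_le[OF A] less_imp_le[OF tgam_pos] a unfolding csm_def by (subst (asm) ennreal_le_iff) (auto intro!: mult_nonneg_nonneg prod_nonneg)
qed

end

text \<open>At most 1/2 + 1/4 of \<open>Q\<close> is forbidden.\<close>

lemma exists_outside:
 assumes Q: "Q \<in> sets lebesgue" "lvol Q = ennreal v" "0 < v"
  and X: "X \<in> sets lebesgue" "lvol (X \<inter> Q) \<le> ennreal (v / 2)"
  and Y: "Y \<in> sets lebesgue" "lvol Y \<le> ennreal (v / 4)"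
  and ae: "AE x in lebesgue. P x"
 shows "\<exists>z\<in>Q. z \<notin> X \<and> z \<notin> Y \<and> P z"
proof (rule ccontr)
 assume c: "\<not> ?thesis"
 have "AE x in lebesgue. x \<in> Q --> x \<in> (X \<inter> Q) \<union> Y" using ae by eventually_elim (use c in blast)
 then have "lvol Q \<le> lvol ((X \<inter> Q) \<union> Y)"
  using Q(1) X(1) Y(1) by (intro emeasure_mono_AE) auto
 also have "\<dots> \<le> lvol (X \<inter> Q) + lvol Y" using Q X Y by (intro emeasure_subadditive) auto
 also have "\<dots> \<le> ennreal (v / 2) + ennreal (v / 4)" by (intro add_mono X Y)
 also have "\<dots> = ennreal (3 * v / 4)" using Q(3) by (subst ennreal_plus[symmetric]) auto
 finally show False using Q by simp
qed

lemma dlo_eq: "x \<in> dy a L k x0 ==> dlo a L k x = dlo a L k x0"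
 by (simp add: dlo_def dy_def)

section \<open>A Cotlar inequality for truncated integrals\<close>

context CZ_op
begin

text \<open>The multiple of \<open>\<alpha> j\<close> at which the maximal functions are cut: the
  \<open>m\<close> exceptional sets then add up to at most the fraction \<eta>/2.\<close>

definition "qtr \<eta> = 2 * real CARD('m) * (unit_ball_vol (DIM(real ^ 'n)) * 5 ^ DIM(real ^ 'n)) / \<eta>"

text \<open>Summands in order: \<open>S g\<close> at a good point; \<open>S\<close> of the input
  localised to \<open>DB\<close> there; the move from that point to \<xi>; the shell between a
  truncation radius and a dyadic scale; radii above the top scale. The factor 7 n comes from
  enclosing \<open>DB\<close> in a cube.\<close>

definition "ctr \<eta> = cweak (\<eta> / (2 * (7 * real CARD('n)) ^ CARD('n))) + cweak (1 / (4 * (7 * real CARD('n)) ^ CARD('n))) * qtr \<eta> ^ CARD('m) +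
  csm * qtr \<eta> ^ CARD('m) + A * 4 ^ (CARD('m) * CARD('n)) * qtr \<eta> ^ CARD('m) + A"

lemma ctr_pos: "0 < \<eta> ==> 0 < ctr \<eta>"
 unfolding ctr_def qtr_def using A csm_pos cweak by (intro add_pos_pos mult_pos_pos zero_less_power divide_pos_pos) auto

text \<open>Cotlar's comparison: at a good point the difference between \<open>S g\<close> and
  \<open>S\<close> of the input localised to \<open>DB\<close> is the kernel integral off
  \<open>DB\<close>, and smoothness moves it to \<xi>. The exceptional set is chosen before
  \<open>l\<close>, \<open>x\<close>, \<xi> and \<delta>, so one set serves all truncations as long
  as it fills at most half of each cube on the path.\<close>

lemma truncation_bound:
 assumes \<eta>: "0 < \<eta>" and L: "0 < L" and g: "\<And>j. adm (p j) (g j)" and supp: "\<And>j y. y \<notin> DB a L k x0 ==> g j y = 0" and al0: "\<And>j. 0 \<le> \<alpha> j"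
  and le: "\<And>j. L1 (g j) \<le> ennreal (\<alpha> j * (L / 2 ^ k) ^ CARD('n))"
 shows "\<exists>F\<in>sets borel. F \<subseteq> dy a L k x0 \<and> vol F \<le> ennreal (\<eta> * (L / 2 ^ k) ^ CARD('n)) \<and>
   (\<forall>l\<ge>k. \<forall>x\<in>dy a L k x0. half_on F a L k l x -->
     (\<forall>\<xi>\<in>dy a L l x. \<forall>\<delta>>0. norm (TI \<xi> (TR \<xi> \<delta> \<inter> off (DB a L l x)) g) \<le> ctr \<eta> * (PU j. \<alpha> j)))"
proof -
 let ?n = "CARD('n)" let ?m = "CARD('m)"
 define ub where "ub = unit_ball_vol (DIM(real ^ 'n)) * 5 ^ DIM(real ^ 'n)"
 have ub: "0 < ub" by (simp add: ub_def)
 define t where "t = 2 * real ?m * ub / \<eta>"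
 have t: "0 < t" using ub \<eta> by (simp add: t_def)
 define s where "s = (7 * real ?n) ^ ?n"
 have s: "0 < s" by (simp add: s_def)
 have "0 < \<eta> / (2 * s)" "0 < 1 / (4 * s)" using \<eta> s by auto
 define M1 where "M1 = cweak (\<eta> / (2 * s))"
 define M2 where "M2 = cweak (1 / (4 * s))"
 have "0 < M1" "0 < M2" unfolding M1_def M2_def using s \<eta> cweak by auto
 note M1 = this(1) weak_type[OF \<open>0 < \<eta> / (2 * s)\<close>, folded M1_def] and M2 = this(2) weak_type[OF \<open>0 < 1 / (4 * s)\<close>, folded M2_def]
 define M3 where "M3 = M1 + M2 * t ^ ?m + csm * t ^ ?m"
 define M4 where "M4 = A * 4 ^ (?m * ?n) * t ^ ?m"
 have M34: "0 < M3" "0 < M4" unfolding M3_def M4_def by (intro add_pos_pos mult_pos_pos zero_less_power M1(1) M2(1) csm_pos t A; simp)+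
 have cM: "ctr \<eta> = M3 + M4 + A" by (simp add: ctr_def qtr_def M1_def M2_def M3_def M4_def t_def ub_def s_def)
 have gm [measurable]: "g j \<in> borel_fun" for j using adm_borel[OF g] .
 have al0': "0 \<le> (PU j. \<alpha> j)" using al0 by (simp add: prod_nonneg)
 have dyx: "dy a L i x = dy a L i \<xi>" if "\<xi> \<in> dy a L i x" for i x \<xi> using dy_eq[OF that] by simp
 have size: "norm (TI \<xi> V g) \<le> A / d ^ (?m * ?n) * (PU j. \<alpha> j * (L / 2 ^ k) ^ ?n)"
  if "V \<in> sets borel" "0 < d" "\<And>y. y \<in> V ==> d \<le> rho \<xi> y" for \<xi> V d
 proof (rule TI_bound[OF adm_integrable[OF g] that, where E = UNIV])
  show "0 \<le> \<alpha> j * (L / 2 ^ k) ^ ?n" for j using al0[of j] L by (intro mult_nonneg_nonneg) auto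
  show "(NN y. en (g j) y * indicator UNIV y) \<le> ennreal (\<alpha> j * (L / 2 ^ k) ^ ?n)" for j
   using le[of j] by simp
 qed auto
 have pp: "(PU j. \<alpha> j * r ^ ?n) = (PU j. \<alpha> j) * r ^ (?m * ?n)" for r :: real
  by (simp add: prod.distrib power_mult[symmetric] mult.commute)
 have arith: "u / d ^ N * (P * r ^ N) = u * P * (r / d) ^ N" for u d P r :: real and N by (simp add: power_divide)
 show ?thesis
 proof (cases "\<exists>j. \<alpha> j = 0")
  \<comment> \<open>A vanishing average makes the input in that slot zero almost everywhere, and all
    integrals vanish; \<open>weak_type\<close> asks for positive averages.\<close>
  case True
  then obtain j where j: "\<alpha> j = 0" by blast
  have "norm (TI \<xi> (TR \<xi> \<delta> \<inter> off (DB a L l x)) g) \<le> (M3 + M4 + A) * (PU j. \<alpha> j)" if "0 < \<delta>" for \<xi> \<delta> l x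
  proof -
   have "(PU j. \<alpha> j * (L / 2 ^ k) ^ ?n) = 0" using j by (intro prod_zero) auto
   moreover have "norm (TI \<xi> (TR \<xi> \<delta> \<inter> off (DB a L l x)) g) \<le> A / \<delta> ^ (?m * ?n) * (PU j. \<alpha> j * (L / 2 ^ k) ^ ?n)"
    using that TR_rho[OF that, of _ \<xi>] by (intro size) auto
   moreover have "0 \<le> (M3 + M4 + A) * (PU j. \<alpha> j)" using M34 A al0' by (intro mult_nonneg_nonneg) auto
   ultimately show ?thesis by (simp only: mult_zero_right) 
  qed
  then show ?thesis unfolding cM using \<eta> L by (intro bexI[of _ "{}"]) auto
 next
  case False
  with al0 have al: "0 < \<alpha> j" for j by (metis less_le)
  then have alp: "0 < (PU j. \<alpha> j)" by (simp add: prod_pos)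
  have [measurable]: "S g \<in> leb_fun" using g by (rule S_meas)
  then have "(en (S g)) \<in> borel_measurable (completion lborel)" by measurable
  \<comment> \<open>A Borel version of the norm of \<open>S g\<close> keeps the exceptional set
    Borel; good points are taken where the two agree.\<close>
  then obtain S' where S' [measurable]: "S' \<in> borel_measurable lborel" and S'eq: "AE x in lborel. ennreal (norm (S g x)) = S' x"
   using completion_ex_borel_measurable by blast
  define X where "X = {x. ennreal (M1 * (PU j. \<alpha> j)) < S' x}"
  define Z where "Z j = {x. \<not> maxbd (en (g j)) (t * \<alpha> j) x}" for j
  define F where "F = dy a L k x0 \<inter> (X \<union> (\<Union>j. Z j))"
  have Xm [measurable]: "X \<in> sets borel" unfolding X_def using S' by simp
  have Zm [measurable]: "Z j \<in> sets borel" for j unfolding Z_def by (intro borel_open open_not_maxbd) simp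
  have Fm [measurable]: "F \<in> sets borel" unfolding F_def by measurable
  have r7: "(7 * sd a L i) ^ ?n = s * (L / 2 ^ i) ^ ?n" for i by (simp only: sd_def s_def power_mult_distrib mult.assoc)
  have sd: "L / 2 ^ i \<le> sd a L i" "0 < sd a L i" "0 < L / 2 ^ i" for i
  proof -
   show "0 < L / 2 ^ i" using L by simp
   then have "1 * (L / 2 ^ i) \<le> real ?n * (L / 2 ^ i)" by (intro mult_right_mono) (auto simp: Suc_leI)
   then show "L / 2 ^ i \<le> sd a L i" by (simp add: sd_def)
  qed (rule sd_pos[OF L])
  have mX: "vol X \<le> ennreal (\<eta> / 2 * (L / 2 ^ k) ^ ?n)"
  proof -
   have m: "{x. norm (S g x) > M1 * (PU i. \<alpha> i)} \<in> sets lebesgue"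
    using borel_measurable_less[of "\<lambda>_. M1 * (PU i. \<alpha> i)" lebesgue "\<lambda>x. norm (S g x)"] by simp
   have "vol X = lvol X" by simp
   also have "\<dots> \<le> lvol {x. norm (S g x) > M1 * (PU i. \<alpha> i)}"
   proof (rule emeasure_mono_AE[OF _ m])
    have "0 \<le> M1 * (PU j. \<alpha> j)" using M1 al0' by simp
    then show "AE x in lebesgue. x \<in> X --> x \<in> {x. norm (S g x) > M1 * (PU i. \<alpha> i)}"
     using AE_completion[OF S'eq] by (elim eventually_mono) (metis X_def ennreal_less_iff mem_Collect_eq)
   qed
   also have "\<dots> \<le> ennreal (\<eta> / (2 * s) * (7 * sd a L k) ^ ?n)"
   proof (rule M1(2)[where c = "dlo a L k x0 - (\<chi> i. 3 * sd a L k)"])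
    show "g i y = 0" if "y \<notin> hcube (dlo a L k x0 - (\<chi> i. 3 * sd a L k)) (7 * sd a L k)" for i y
     using supp DB_hcube[OF L] that by blast
    fix i
    have "\<alpha> i * (L / 2 ^ k) ^ ?n \<le> \<alpha> i * (7 * sd a L k) ^ ?n"
     using al0 sd[of k] by (intro mult_left_mono power_mono) auto
    then show "L1 (g i) \<le> ennreal (\<alpha> i * (7 * sd a L k) ^ ?n)"
     using le[of i] by (meson ennreal_leI order_trans)
   qed (use sd g al in auto)
   also have "\<eta> / (2 * s) * (7 * sd a L k) ^ ?n = \<eta> / 2 * (L / 2 ^ k) ^ ?n" unfolding r7 using s by simp
   finally show ?thesis .
  qed
  have mZ: "vol (Z j) \<le> ennreal (\<eta> / (2 * real ?m) * (L / 2 ^ k) ^ ?n)" for j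
  proof -
   have "0 < t * \<alpha> j" using t al by simp
   then have "vol (Z j) \<le> ennreal (ub / (t * \<alpha> j)) * L1 (g j)"
    unfolding Z_def ub_def by (intro maxbd_weak_type) simp
   also have "\<dots> \<le> ennreal (ub / (t * \<alpha> j)) * ennreal (\<alpha> j * (L / 2 ^ k) ^ ?n)" by (intro mult_left_mono le) simp
   also have "\<dots> = ennreal (ub / (t * \<alpha> j) * (\<alpha> j * (L / 2 ^ k) ^ ?n))" using ub t al[of j] L by (intro ennreal_mult[symmetric]) auto
   also have "ub / (t * \<alpha> j) * (\<alpha> j * (L / 2 ^ k) ^ ?n) = \<eta> / (2 * real ?m) * (L / 2 ^ k) ^ ?n"
    using al[of j] ub \<eta> by (simp add: t_def field_simps)
   finally show ?thesis .
  qed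
  have "vol F \<le> vol (X \<union> (\<Union>j. Z j))" unfolding F_def by (intro emeasure_mono) auto
  also have "\<dots> \<le> vol X + vol (\<Union>j. Z j)" by (intro emeasure_subadditive) auto
  also have "vol (\<Union>j. Z j) \<le> (\<Sum>j\<in>UNIV. vol (Z j))" by (intro emeasure_subadditive_finite) auto
  also have "\<dots> \<le> (\<Sum>j\<in>(UNIV :: 'm set). ennreal (\<eta> / (2 * real ?m) * (L / 2 ^ k) ^ ?n))" by (intro sum_mono mZ)
  also have "\<dots> = ennreal (\<eta> / 2 * (L / 2 ^ k) ^ ?n)" using \<eta> L by (subst sum_ennreal) auto
  finally have "vol F \<le> ennreal (\<eta> / 2 * (L / 2 ^ k) ^ ?n) + ennreal (\<eta> / 2 * (L / 2 ^ k) ^ ?n)"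
   using mX add_mono order_trans by blast
  also have "\<dots> = ennreal (\<eta> * (L / 2 ^ k) ^ ?n)" using \<eta> L by (subst ennreal_plus[symmetric]) auto
  finally have mF: "vol F \<le> ennreal (\<eta> * (L / 2 ^ k) ^ ?n)" .
  have dyv: "dy a L i x \<in> sets lebesgue" "lvol (dy a L i x) = ennreal ((L / 2 ^ i) ^ ?n)" "0 < (L / 2 ^ i) ^ ?n" for i x
   using emeasure_dy[OF L, of a i x] L by auto
  \<comment> \<open>Good points exist in every cube of which \<open>F\<close> fills at most half,
    even after removal of a further quarter \<open>Y\<close> and a null set.\<close>
  have pt: "\<exists>z\<in>dy a L i x. ennreal (norm (S g z)) = S' z \<and> z \<notin> Y \<and> P z \<and> z \<notin> X \<and> (\<forall>j. maxbd (en (g j)) (t * \<alpha> j) z)"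
   if i: "k \<le> i" "x \<in> dy a L k x0" and half: "vol (F \<inter> dy a L i x) \<le> ennreal ((L / 2 ^ i) ^ ?n / 2)"
    and Y: "Y \<in> sets lebesgue" "lvol Y \<le> ennreal ((L / 2 ^ i) ^ ?n / 4)" and P: "AE z in lebesgue. P z" for i x Y P
  proof -
   have "AE z in lebesgue. ennreal (norm (S g z)) = S' z \<and> P z" using AE_completion[OF S'eq] P by auto
   then obtain z where z: "z \<in> dy a L i x" "z \<notin> F" "z \<notin> Y" "ennreal (norm (S g z)) = S' z \<and> P z"
    using exists_outside[OF dyv(1)[of i x] dyv(2,3), where X = F and Y = Y and P = "\<lambda>z. ennreal (norm (S g z)) = S' z \<and> P z"] half Y by auto
   have "z \<in> dy a L k x0" using z(1) dy_mono[OF i(1)] dy_eq[OF i(2)] by blast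
   then show ?thesis using z by (auto simp: F_def Z_def)
  qed
  have near: "(NN y. en (g j) y * indicator (DB a L i x) y) \<le> ennreal (t * \<alpha> j * (4 * sd a L i) ^ ?n)"
   if z: "z \<in> dy a L i x" "maxbd (en (g j)) (t * \<alpha> j) z" for z i x j
  proof -
   have "(NN y. en (g j) y * indicator (DB a L i x) y) \<le> (NN y. en (g j) y * indicator (cball z (4 * sd a L i)) y)"
    using DB_near[OF L z(1)] by (intro nn_integral_mono mult_left_mono) (auto simp: indicator_def)
   also have "\<dots> \<le> ennreal (t * \<alpha> j * (4 * sd a L i) ^ DIM(real ^ 'n))"
    using sd(2)[of i] by (intro z(2)[unfolded maxbd_def, rule_format]) simp
   finally show ?thesis by simp
  qed
  have prod_t: "(PU j. t * \<alpha> j) = t ^ ?m * (PU j. \<alpha> j)" by (simp add: prod.distrib)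
  have farw: "\<exists>j. 2 * sd a L i < norm (\<xi> - y $ j)" if "\<xi> \<in> dy a L i x" "y \<in> off (DB a L i x)" for \<xi> y i x
   using DB_far[OF L that(1)] that(2) by (auto simp: off_def)
  have farr: "2 * sd a L i \<le> rho \<xi> y" if "\<xi> \<in> dy a L i x" "y \<in> off (DB a L i x)" for \<xi> y i x
   using farw[OF that] norm_le_rho[of \<xi> y] by (meson less_imp_le order_trans)
  \<comment> \<open>The whole far part: at a good point it is a difference of two values of
    \<open>S\<close>, each bounded by its weak type level, and \<open>TI_smooth\<close> passes to
    \<xi>.\<close>
  have full: "norm (TI \<xi> (off (DB a L i x)) g) \<le> M3 * (PU j. \<alpha> j)"
   if i: "k \<le> i" "x \<in> dy a L k x0" and half: "vol (F \<inter> dy a L i x) \<le> ennreal ((L / 2 ^ i) ^ ?n / 2)"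
    and xi: "\<xi> \<in> dy a L i x" for i x \<xi>
  proof -
   let ?B = "DB a L i x" let ?h = "\<lambda>j y. indicator ?B y * g j y"
   obtain x' where x': "x' \<in> dy a L i x" "\<forall>j. maxbd (en (g j)) (t * \<alpha> j) x'"
    using pt[OF i half, of "{}" "\<lambda>_. True"] L by auto
   have ah: "adm (p j) (?h j)" for j by (rule adm_mult_indicator[OF g p]) simp
   let ?Y = "{z. norm (S ?h z) > M2 * (PU j. t * \<alpha> j)}"
   have [measurable]: "S ?h \<in> leb_fun" using ah by (rule S_meas)
   have Ym: "?Y \<in> sets lebesgue"
    using borel_measurable_less[of "\<lambda>_. M2 * (PU i. t * \<alpha> i)" lebesgue "\<lambda>x. norm (S ?h x)"] by (simp del: Collect_const)
   have "lvol ?Y \<le> ennreal (1 / (4 * s) * (7 * sd a L i) ^ ?n)"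
   proof (rule M2(2)[where c = "dlo a L i x - (\<chi> j. 3 * sd a L i)"])
    show "?h j y = 0" if "y \<notin> hcube (dlo a L i x - (\<chi> j. 3 * sd a L i)) (7 * sd a L i)" for j y
     using DB_hcube[OF L] that by (auto simp: indicator_def)
    fix j
    have "L1 (?h j) = (NN y. en (g j) y * indicator ?B y)"
     by (intro nn_integral_cong) (auto simp: indicator_def)
    also have "\<dots> \<le> ennreal (t * \<alpha> j * (4 * sd a L i) ^ ?n)" using near[OF x'(1)] x'(2) by blast
    also have "\<dots> \<le> ennreal (t * \<alpha> j * (7 * sd a L i) ^ ?n)"
     using t al0[of j] sd(2)[of i] by (intro ennreal_leI mult_left_mono power_mono) auto
    finally show "L1 (?h j) \<le> ennreal (t * \<alpha> j * (7 * sd a L i) ^ ?n)" .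
   qed (use sd ah al t in auto)
   also have "1 / (4 * s) * (7 * sd a L i) ^ ?n = (L / 2 ^ i) ^ ?n / 4" unfolding r7 using s by simp
   finally have mY: "lvol ?Y \<le> ennreal ((L / 2 ^ i) ^ ?n / 4)" .
   obtain z where z: "z \<in> dy a L i x" "ennreal (norm (S g z)) = S' z" "z \<notin> ?Y" "z \<notin> X"
     "\<forall>j. maxbd (en (g j)) (t * \<alpha> j) z"
     "z \<in> ball (dlo a L i x) (3 * sd a L i) --> S g z - S ?h z = TI z (off ?B) g"
    using pt[OF i half Ym mY S_local[OF g, of "dlo a L i x" "3 * sd a L i", folded DB_def off_def]] by blast
   have "norm (S g z) \<le> M1 * (PU j. \<alpha> j)"
    using z(2,4) by (simp add: X_def not_less flip: z(2)) (use M1 al0' in \<open>simp add: ennreal_le_iff\<close>)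
   moreover have "norm (S ?h z) \<le> M2 * (t ^ ?m * (PU j. \<alpha> j))" using z(3) unfolding prod_t by simp
   ultimately have "norm (S g z - S ?h z) \<le> M1 * (PU j. \<alpha> j) + M2 * (t ^ ?m * (PU j. \<alpha> j))"
    using norm_triangle_ineq4[of "S g z" "S ?h z"] by linarith
   moreover have "S g z - S ?h z = TI z (off ?B) g" using z(1,6) dy_ball[OF L, of a i x] by auto
   ultimately have 1: "norm (TI z (off ?B) g) \<le> M1 * (PU j. \<alpha> j) + M2 * (t ^ ?m * (PU j. \<alpha> j))" by simp
   have 2: "norm (TI z (off ?B) g - TI \<xi> (off ?B) g) \<le> csm * (PU j. t * \<alpha> j)"
   proof (rule TI_smooth[OF g sd(2)[of i]])
    show "norm (z - \<xi>) \<le> sd a L i" using dist_dy[OF L z(1) xi] by (simp add: dist_norm sd_def)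
    show "\<exists>j. 2 * sd a L i \<le> norm (z - y $ j)" if "y \<in> off ?B" for y using farw[OF z(1) that] less_imp_le by blast
   qed (use t al0 z(5) in auto)
   have "norm (TI \<xi> (off ?B) g) \<le> norm (TI z (off ?B) g) + norm (TI z (off ?B) g - TI \<xi> (off ?B) g)"
    using norm_triangle_ineq4[of "TI z (off ?B) g" "TI z (off ?B) g - TI \<xi> (off ?B) g"] by simp
   then show ?thesis using 1 2 unfolding prod_t M3_def by (simp add: algebra_simps)
  qed
  have "norm (TI \<xi> (TR \<xi> \<delta> \<inter> off (DB a L l x)) g) \<le> (M3 + M4 + A) * (PU j. \<alpha> j)"
   if l: "k \<le> l" "x \<in> dy a L k x0" and half: "half_on F a L k l x"
    and xi: "\<xi> \<in> dy a L l x" and d: "0 < \<delta>" for l x \<xi> \<delta>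
  proof -
   let ?V = "TR \<xi> \<delta> \<inter> off (DB a L l x) :: (real ^ 'n ^ 'm) set"
   have sum: "c \<le> M3 + M4 + A ==> c * (PU j. \<alpha> j) \<le> (M3 + M4 + A) * (PU j. \<alpha> j)" for c
    using al0' by (rule mult_right_mono[rotated])
   have xi': "\<xi> \<in> dy a L i x" if "i \<le> l" for i using xi dy_mono[OF that] by blast
   show ?thesis
   \<comment> \<open>Beyond the top scale \<open>rho\<close> is at least 2 sd, and the size
     condition alone compensates for the masses.\<close>
   proof (cases "2 * sd a L k \<le> \<delta>")
    case True
    have "norm (TI \<xi> ?V g) \<le> A / (2 * sd a L k) ^ (?m * ?n) * (PU j. \<alpha> j * (L / 2 ^ k) ^ ?n)"
     using True TR_rho[OF d, of _ \<xi>] sd(2)[of k] by (intro size) (auto intro: order_trans)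
    also have "\<dots> = A * (PU j. \<alpha> j) * ((L / 2 ^ k) / (2 * sd a L k)) ^ (?m * ?n)"
     unfolding pp by (rule arith)
    also have "\<dots> \<le> A * (PU j. \<alpha> j) * 1"
    proof (intro mult_left_mono power_le_one)
     show "0 \<le> (L / 2 ^ k) / (2 * sd a L k)" using sd[of k] by (intro divide_nonneg_pos[OF less_imp_le]) auto
     show "(L / 2 ^ k) / (2 * sd a L k) \<le> 1" using sd[of k] by (subst divide_le_eq_1_pos) linarith+
    qed (use A al0' in auto)
    finally show ?thesis using sum[of A] M34 by simp
   next
    case False
    show ?thesis
    proof (cases "l = k")
     case True
     have "(PU j. g j (y $ j)) = 0" if "y \<in> ?V" for y
      using that supp unfolding True off_def DB_def dlo_eq[OF l(2)] by (intro prod_zero) auto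
     then have "TI \<xi> ?V g = (\<integral>y. 0 \<partial>(lborel :: (real ^ 'n ^ 'm) measure))"
      unfolding TI_def by (intro Bochner_Integration.integral_cong) (auto simp: indicator_def)
     then show ?thesis using al0' M34 A by simp
    next
     case lk: False
     \<comment> \<open>The last scale whose double exceeds \<delta> is wanted: \<open>TR\<close>
       then contains \<open>off (DB a L i x)\<close>, and on the remaining shell \<open>rho\<close>
       is at least \<open>sd a L i\<close> while all coordinates lie in
       \<open>DB a L i x\<close>.\<close>
     define I where "I = {i. k \<le> i \<and> i < l \<and> \<delta> < 2 * sd a L i}"
     have fI: "finite I" by (rule finite_subset[of _ "{..<l}"]) (auto simp: I_def)
     have "k \<in> I" using False lk l(1) by (auto simp: I_def)
     define i where "i = Max I"
     have iI: "i \<in> I" unfolding i_def using fI \<open>k \<in> I\<close> by (intro Max_in) auto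
     then have i: "k \<le> i" "i < l" "\<delta> < 2 * sd a L i" by (auto simp: I_def)
     have low: "sd a L i \<le> rho \<xi> y" if "y \<in> ?V" for y
     proof (cases "Suc i = l")
      case True
      then show ?thesis using farr[OF xi, of y] that sd_Suc[of a L i] by auto
     next
      case False
      have "Suc i \<notin> I" using Max_ge[OF fI, of "Suc i"] unfolding i_def by auto
      then have "2 * sd a L (Suc i) \<le> \<delta>" using i False unfolding I_def by auto
      then show ?thesis using TR_rho[OF d, of y \<xi>] that by (simp add: sd_Suc)
     qed
     let ?W = "off (DB a L i x) :: (real ^ 'n ^ 'm) set"
     have h: "vol (F \<inter> dy a L i x) \<le> ennreal ((L / 2 ^ i) ^ ?n / 2)" using half i by blast
     obtain x' where x': "x' \<in> dy a L i x" "\<forall>j. maxbd (en (g j)) (t * \<alpha> j) x'"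
      using pt[OF i(1) l(2) h, of "{}" "\<lambda>_. True"] L by auto
     have sub: "?W \<subseteq> ?V"
     proof
      fix y assume y: "y \<in> ?W"
      obtain j where "2 * sd a L i < norm (\<xi> - y $ j)" using farw[OF xi'[of i] y] i by auto
      then have "y \<in> TR \<xi> \<delta>" using i(3) by (intro TR_far[OF d, of _ _ j]) auto
      moreover have "y \<in> off (DB a L l x)" using y DB_mono[OF L, of i l a x] i by (auto simp: off_def)
      ultimately show "y \<in> ?V" by blast
     qed
     have "TI \<xi> (?W \<union> (?V - ?W)) g = TI \<xi> ?W g + TI \<xi> (?V - ?W) g"
      by (rule TI_Un[OF adm_integrable[OF g] _ _ _ sd(2)[of i]]) (use low sub in auto)
     moreover have "?W \<union> (?V - ?W) = ?V" using sub by blast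
     ultimately have e: "TI \<xi> ?V g = TI \<xi> ?W g + TI \<xi> (?V - ?W) g" by simp
     have 1: "norm (TI \<xi> ?W g) \<le> M3 * (PU j. \<alpha> j)" using full[OF i(1) l(2) h] xi' i by auto
     have "norm (TI \<xi> (?V - ?W) g) \<le> A / sd a L i ^ (?m * ?n) * (PU j. t * \<alpha> j * (4 * sd a L i) ^ ?n)"
     proof (rule TI_bound[OF adm_integrable[OF g] _ sd(2)[of i], where E = "DB a L i x"])
      show "sd a L i \<le> rho \<xi> y" if "y \<in> ?V - ?W" for y using low that by blast
      show "y $ j \<in> DB a L i x" if "y \<in> ?V - ?W" for y j using that by (auto simp: off_def)
      show "0 \<le> t * \<alpha> j * (4 * sd a L i) ^ ?n" for j using t al0[of j] sd(2)[of i] by simp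
      show "(NN y. en (g j) y * indicator (DB a L i x) y) \<le> ennreal (t * \<alpha> j * (4 * sd a L i) ^ ?n)" for j
       using near[OF x'(1)] x'(2) by blast
     qed auto
     also have "\<dots> = M4 * (PU j. \<alpha> j) * (sd a L i / sd a L i) ^ (?m * ?n)"
     proof -
      have "(PU j. t * \<alpha> j * (4 * sd a L i) ^ ?n) = (\<Prod>j\<in>(UNIV::'m set). t) * (PU j. \<alpha> j * (4 * sd a L i) ^ ?n)"
       by (simp only: prod.distrib mult.assoc)
      also have "\<dots> = t ^ ?m * ((PU j. \<alpha> j) * (4 ^ (?m * ?n) * sd a L i ^ (?m * ?n)))" unfolding pp by (simp add: power_mult_distrib)
      finally show ?thesis unfolding M4_def power_divide by simp
     qed
     finally have 2: "norm (TI \<xi> (?V - ?W) g) \<le> M4 * (PU j. \<alpha> j)" using sd(2)[of i] by simp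
     have "norm (TI \<xi> ?V g) \<le> (M3 + M4) * (PU j. \<alpha> j)"
      unfolding e using 1 2 norm_triangle_ineq[of "TI \<xi> ?W g" "TI \<xi> (?V - ?W) g"] by (simp add: distrib_right)
     also have "\<dots> \<le> (M3 + M4 + A) * (PU j. \<alpha> j)" using A by (intro sum) simp
     finally show ?thesis .
    qed
   qed
  qed
  then show ?thesis unfolding cM using Fm mF by (intro bexI[of _ F]) (auto simp: F_def)
 qed
qed

end

section \<open>Sparse domination of the truncated commutator\<close>

text \<open>Corner of a cube of side 31 sd that contains the ball of radius 15 sd = 5 (3 sd), the
  Vitali dilate of \<open>DB\<close>; 31 instead of 30 because \<open>hcube\<close> is
  half-open.\<close>

definition bcor :: "real ^ 'n::finite => real => nat => real ^ 'n => real ^ 'n" where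
 "bcor a L k x = dlo a L k x - (\<chi> i. 15 * sd a L k)"

definition cav :: "'n::finite cfun => real ^ 'n => real => nat => 'n cfun" where
 "cav b a L k x = av b (bcor a L k x) (31 * sd a L k)"

text \<open>Normalised by the volume of the dyadic cube rather than of \<open>DB\<close>; the
  passage to reals is justified by \<open>ennreal_alp\<close>, where the integral is finite.\<close>

definition alp :: "'n::finite cfun => 'n cfun => real ^ 'n => real => nat => real ^ 'n => real" where
 "alp b f a L k x =
   enn2real (NN y. ennreal ((1 + norm (b y - cav b a L k x)) * norm (f y)) * indicator (DB a L k x) y) / (L / 2 ^ k) ^ CARD('n)"

context CZ_op
begin

definition CI :: "('m => 'n cfun) => real ^ 'n => (real ^ 'n ^ 'm) set => ('m => 'n cfun) => complex" where
 "CI b x V f = (\<integral>y. indicator V y *\<^sub>R ((PU j. b j x - b j (y $ j)) * K (point x y) * (PU j. f j (y $ j))) \<partial>lborel)"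

text \<open>The input for the term \<open>J\<close> of the expansion: slots in \<open>J\<close> have
  their oscillation at \<open>x\<close>, the others carry it in the integration variable.\<close>

definition mixf :: "('m => 'n cfun) => ('m => complex) => ('m => 'n cfun) => 'm set => 'm => 'n cfun" where
 "mixf b c f J j y = (if j \<in> J then f j y else (c j - b j y) * f j y)"

text \<open>Write b_j(x) - b_j(y_j) as (b_j(x) - c_j) + (c_j - b_j(y_j)) and multiply out over the
  subsets of slots.\<close>

lemma CI_expand:
 assumes f: "\<And>j. integrable lborel (f j)" "\<And>j. integrable lborel (\<lambda>y. b j y * f j y)"
  and V: "V \<in> sets borel" and d: "0 < d" "\<And>y. y \<in> V ==> d \<le> rho x y"
 shows "integrable lborel (\<lambda>y. indicator V y *\<^sub>R ((PU j. b j x - b j (y $ j)) * K (point x y) * (PU j. f j (y $ j))))"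
  and "CI b x V f = (\<Sum>J\<in>UNIV. (\<Prod>j\<in>J. b j x - c j) * TI x V (mixf b c f J))"
proof -
 have g: "integrable lborel (mixf b c f J j)" for J j c
  using f[of j] by (cases "j \<in> J") (simp_all add: mixf_def[abs_def] left_diff_distrib)
 have e: "indicator V y *\<^sub>R ((PU j. b j x - b j (y $ j)) * K (point x y) * (PU j. f j (y $ j)))
   = (\<Sum>J\<in>UNIV. (\<Prod>j\<in>J. b j x - c j) * (indicator V y *\<^sub>R (K (point x y) * (PU j. mixf b c f J j (y $ j)))))" for y c
 proof -
  have 1: "(PU j. mixf b c f J j (y $ j)) = (\<Prod>j\<in>UNIV - J. c j - b j (y $ j)) * (PU j. f j (y $ j))" for J
  proof -
   have "(PU j. mixf b c f J j (y $ j)) = (PU j. (if j \<in> UNIV - J then c j - b j (y $ j) else 1) * f j (y $ j))"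
    by (intro prod.cong) (auto simp: mixf_def)
   also have "\<dots> = (PU j. if j \<in> UNIV - J then c j - b j (y $ j) else 1) * (PU j. f j (y $ j))" by (rule prod.distrib)
   also have "(PU j. if j \<in> UNIV - J then c j - b j (y $ j) else 1) = (\<Prod>j\<in>UNIV - J. c j - b j (y $ j))"
    by (subst prod.If_cases) (auto simp: Compl_eq_Diff_UNIV[symmetric] Compl_eq)
   finally show ?thesis .
  qed
  have "(PU j. b j x - b j (y $ j)) = (PU j. (b j x - c j) + (c j - b j (y $ j)))" by simp
  also have "\<dots> = (\<Sum>J\<in>UNIV. (\<Prod>j\<in>J. b j x - c j) * (\<Prod>j\<in>UNIV - J. c j - b j (y $ j)))"
   by (subst prod_add) auto
  finally show ?thesis unfolding 1 by (simp add: sum_distrib_left sum_distrib_right scaleR_sum_right mult_ac)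
 qed
 have i: "integrable lborel (\<lambda>y. (\<Prod>j\<in>J. b j x - c j) * (indicator V y *\<^sub>R (K (point x y) * (PU j. mixf b c f J j (y $ j)))))" for J c
  by (intro integrable_mult_right TI_integrable[OF g V d])
 show "integrable lborel (\<lambda>y. indicator V y *\<^sub>R ((PU j. b j x - b j (y $ j)) * K (point x y) * (PU j. f j (y $ j))))"
  unfolding e[where c = "\<lambda>_. 0"] by (intro Bochner_Integration.integrable_sum i)
 show "CI b x V f = (\<Sum>J\<in>UNIV. (\<Prod>j\<in>J. b j x - c j) * TI x V (mixf b c f J))"
  unfolding CI_def e[where c = c] TI_def by (simp only: Bochner_Integration.integral_sum[OF i] integral_mult_right_zero)
qed

text \<open>Tuples with all coordinates in \<open>E\<close> see only the input localised to
  \<open>E\<close>; all others lie in \<open>off E\<close>.\<close>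

lemma CI_split:
 assumes f: "\<And>j. integrable lborel (f j)" "\<And>j. integrable lborel (\<lambda>y. b j y * f j y)"
  and V: "V \<in> sets borel" and d: "0 < d" "\<And>y. y \<in> V ==> d \<le> rho x y" and E [measurable]: "E \<in> sets borel"
 shows "CI b x V f = CI b x (V \<inter> off E) f + CI b x V (\<lambda>j y. indicator E y * f j y)"
proof -
 let ?P = "\<lambda>f y. (PU j. b j x - b j (y $ j)) * K (point x y) * (PU j. f j (y $ j))"
 have i: "integrable lborel (\<lambda>y. indicator E y * h y)" if "integrable lborel h" for h :: "'n cfun"
  using integrable_mult_indicator[OF _ that, of E] E by (simp add: scaleR_conv_of_real of_real_indicator)
 have "CI b x V f = (\<integral>y. indicator (V \<inter> off E) y *\<^sub>R ?P f y + indicator V y *\<^sub>R ?P (\<lambda>j y. indicator E y * f j y) y \<partial>lborel)"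
  unfolding CI_def
 proof (rule Bochner_Integration.integral_cong[OF refl])
  fix y :: "real ^ 'n ^ 'm"
  have "(PU j. indicator E (y $ j) * f j (y $ j)) = (if y \<in> off E then 0 else (PU j. f j (y $ j)))"
   by (auto simp: off_def indicator_def intro!: prod_zero prod.cong)
  then show "indicator V y *\<^sub>R ?P f y = indicator (V \<inter> off E) y *\<^sub>R ?P f y + indicator V y *\<^sub>R ?P (\<lambda>j y. indicator E y * f j y) y"
   by (simp add: indicator_def)
 qed
 also have "\<dots> = CI b x (V \<inter> off E) f + CI b x V (\<lambda>j y. indicator E y * f j y)"
  unfolding CI_def
 proof (rule Bochner_Integration.integral_add)
  show "integrable lborel (\<lambda>y. indicator (V \<inter> off E) y *\<^sub>R ?P f y)"
   by (rule CI_expand(1)[OF f _ d(1)]) (use V d(2) in auto)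
  show "integrable lborel (\<lambda>y. indicator V y *\<^sub>R ?P (\<lambda>j y. indicator E y * f j y) y)"
   by (rule CI_expand(1)[OF i[OF f(1)] _ V d]) (use i[OF f(2)] in \<open>simp add: mult_ac\<close>)
 qed
 finally show ?thesis .
qed

text \<open>One use of \<open>truncation_bound\<close> for each of the 2^m subsets of slots, each
  with an equal share of \<eta>.\<close>

definition "csp \<eta> = real CARD('m set) * ctr (\<eta> / real CARD('m set))"

lemma csp_pos: "0 < \<eta> ==> 0 < csp \<eta>" unfolding csp_def by (intro mult_pos_pos ctr_pos divide_pos_pos) auto

text \<open>The union of the exceptional sets of all terms of the expansion serves the commutator: a
  set that fills at most half of a cube has subsets that do.\<close>

lemma sparse_step:
 assumes \<eta>: "0 < \<eta>" and L: "0 < L" and f: "\<And>j. adm (p j) (f j)" "\<And>j. adm (p j) (\<lambda>y. b j y * f j y)" and supp: "\<And>j y. y \<notin> DB a L k x0 ==> f j y = 0"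
  and al: "\<And>j. 0 \<le> \<alpha> j"
  and le: "\<And>j. (NN y. ennreal ((1 + norm (b j y - c j)) * norm (f j y))) \<le> ennreal (\<alpha> j * (L / 2 ^ k) ^ CARD('n))"
 shows "\<exists>F\<in>sets borel. vol F \<le> ennreal (\<eta> * (L / 2 ^ k) ^ CARD('n)) \<and>
   (\<forall>l\<ge>k. \<forall>x\<in>dy a L k x0. half_on F a L k l x -->
     (\<forall>\<delta>>0. norm (CI b x (TR x \<delta> \<inter> off (DB a L l x)) f) \<le> csp \<eta> * ((PU j. 1 + norm (b j x - c j)) * (PU j. \<alpha> j))))"
proof -
 let ?N = "real CARD('m set)"
 have N: "0 < ?N" by simp
 have eN: "0 < \<eta> / ?N" using \<eta> N by (rule divide_pos_pos)
 let ?M = "ctr (\<eta> / ?N)"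
 have M: "0 < ?M" by (rule ctr_pos[OF eN])
 have "\<exists>F\<in>sets borel. F \<subseteq> dy a L k x0 \<and> vol F \<le> ennreal (\<eta> / ?N * (L / 2 ^ k) ^ CARD('n)) \<and>
  (\<forall>l\<ge>k. \<forall>x\<in>dy a L k x0. half_on F a L k l x -->
    (\<forall>\<xi>\<in>dy a L l x. \<forall>\<delta>>0. norm (TI \<xi> (TR \<xi> \<delta> \<inter> off (DB a L l x)) (mixf b c f J)) \<le> ?M * (PU j. \<alpha> j)))" for J
 proof (rule truncation_bound[OF eN L _ _ al])
  fix j
  have "adm (p j) (\<lambda>y. c j * f j y + (- 1) * (b j y * f j y))" by (rule adm_lincomb[OF f p])
  then show "adm (p j) (mixf b c f J j)"
   using f(1) by (cases "j \<in> J") (simp_all add: mixf_def[abs_def] left_diff_distrib)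
  show "mixf b c f J j y = 0" if "y \<notin> DB a L k x0" for y using supp[OF that] by (simp add: mixf_def)
  have "norm (mixf b c f J j y) \<le> (1 + norm (b j y - c j)) * norm (f j y)" for y
   by (auto simp: mixf_def norm_mult norm_minus_commute distrib_right intro!: mult_right_mono)
  then have "L1 (mixf b c f J j) \<le> (NN y. ennreal ((1 + norm (b j y - c j)) * norm (f j y)))"
   by (intro nn_integral_mono ennreal_leI)
  then show "L1 (mixf b c f J j) \<le> ennreal (\<alpha> j * (L / 2 ^ k) ^ CARD('n))" using le by (rule order_trans)
 qed
 then obtain F :: "'m set => (real ^ 'n) set" where F: "\<And>J. F J \<in> sets borel" "\<And>J. vol (F J) \<le> ennreal (\<eta> / ?N * (L / 2 ^ k) ^ CARD('n))"
  "\<And>J l x \<xi> \<delta>. k \<le> l ==> x \<in> dy a L k x0 ==> half_on (F J) a L k l x ==>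
    \<xi>\<in>dy a L l x ==> 0 < \<delta> ==> norm (TI \<xi> (TR \<xi> \<delta> \<inter> off (DB a L l x)) (mixf b c f J)) \<le> ?M * (PU j. \<alpha> j)"
  by metis
 let ?F = "\<Union>J. F J"
 have [measurable]: "?F \<in> sets borel" using F(1) by auto
 have "vol ?F \<le> (\<Sum>J\<in>UNIV. vol (F J))" using F(1) by (intro emeasure_subadditive_finite) auto
 also have "\<dots> \<le> (\<Sum>J\<in>(UNIV :: 'm set set). ennreal (\<eta> / ?N * (L / 2 ^ k) ^ CARD('n)))" by (intro sum_mono F(2))
 also have "\<dots> = ennreal (?N * (\<eta> / ?N * (L / 2 ^ k) ^ CARD('n)))" using \<eta> L by (subst sum_ennreal) (auto simp del: card_UNIV_set)
 also have "?N * (\<eta> / ?N * (L / 2 ^ k) ^ CARD('n)) = \<eta> * (L / 2 ^ k) ^ CARD('n)" using N by (simp del: card_UNIV_set)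
 finally have mF: "vol ?F \<le> ennreal (\<eta> * (L / 2 ^ k) ^ CARD('n))" .
 have "norm (CI b x (TR x \<delta> \<inter> off (DB a L l x)) f) \<le> ?N * ?M * ((PU j. 1 + norm (b j x - c j)) * (PU j. \<alpha> j))"
  if l: "k \<le> l" "x \<in> dy a L k x0" and half: "half_on ?F a L k l x"
   and d: "0 < \<delta>" for l x \<delta>
 proof -
  let ?V = "TR x \<delta> \<inter> off (DB a L l x)" let ?G = "PU j. 1 + norm (b j x - c j)"
  have t: "norm ((\<Prod>j\<in>J. b j x - c j) * TI x ?V (mixf b c f J)) \<le> ?G * (?M * (PU j. \<alpha> j))" for J
  proof -
   have "norm (\<Prod>j\<in>J. b j x - c j) \<le> (\<Prod>j\<in>J. 1 + norm (b j x - c j))"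
    unfolding prod_norm[symmetric] by (intro prod_mono) auto
   also have "\<dots> \<le> ?G" by (rule prod_mono2) auto
   finally have 1: "norm (\<Prod>j\<in>J. b j x - c j) \<le> ?G" .
   have "norm (TI x ?V (mixf b c f J)) \<le> ?M * (PU j. \<alpha> j)"
   proof (rule F(3)[OF l _ dy_self d], intro allI impI)
    fix i assume i: "k \<le> i" "i < l"
    have "vol (F J \<inter> dy a L i x) \<le> vol (?F \<inter> dy a L i x)" by (rule emeasure_mono) auto
    also have "\<dots> \<le> ennreal ((L / 2 ^ i) ^ CARD('n) / 2)" using half i by blast
    finally show "vol (F J \<inter> dy a L i x) \<le> ennreal ((L / 2 ^ i) ^ CARD('n) / 2)" .
   qed
   with 1 show ?thesis unfolding norm_mult by (intro mult_mono) (auto intro!: prod_nonneg)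
  qed
  have "CI b x ?V f = (\<Sum>J\<in>UNIV. (\<Prod>j\<in>J. b j x - c j) * TI x ?V (mixf b c f J))"
   by (rule CI_expand(2)[OF adm_integrable[OF f(1)] adm_integrable[OF f(2)] _ d]) (use TR_rho[OF d, of _ x] in auto)
  also have "norm \<dots> \<le> (\<Sum>J\<in>(UNIV :: 'm set set). ?G * (?M * (PU j. \<alpha> j)))" by (rule order_trans[OF norm_sum sum_mono[OF t]])
  finally show ?thesis by (simp add: mult_ac del: card_UNIV_set)
 qed
 then show ?thesis
  using mF unfolding csp_def by (intro bexI[of _ ?F]) auto
qed

end

text \<open>\<open>lst R l\<close> is the last stopping time up to \<open>l\<close>, where \<open>R k i\<close> means that the selection started at generation \<open>k\<close> stops at \<open>i\<close>.\<close>

fun lst :: "(nat => nat => bool) => nat => nat" where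
 "lst R 0 = 0"
| "lst R (Suc l) = (if R (lst R l) (Suc l) then Suc l else lst R l)"

lemma lst_le: "lst R l \<le> l"
 by (induction l) auto

lemma lst_idem: "lst R (lst R l) = lst R l"
 by (induction l) auto

lemma lst_between: "lst R l < i ==> i \<le> l ==> \<not> R (lst R l) i"
 by (induction l) (auto simp: le_Suc_eq split: if_splits)

lemma lst_stay: "lst R k = k ==> (\<And>i. k < i ==> i \<le> l ==> \<not> R k i) ==> k \<le> l ==> lst R l = k"
 by (induction l) (auto simp: le_Suc_eq)

text \<open>Only stopping data up to generation \<open>l\<close> enter. Hence \<open>lst\<close> at
  \<open>l\<close> depends on a point only through its cube of that generation.\<close>

lemma lst_cong: "(\<And>k i. k \<le> i ==> i \<le> l ==> R k i = R' k i) ==> lst R l = lst R' l"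
proof (induction l)
 case (Suc l)
 then have "lst R l = lst R' l" by simp
 moreover have "R (lst R' l) (Suc l) = R' (lst R' l) (Suc l)" using Suc.prems lst_le le_SucI by blast
 ultimately show ?case by simp
qed simp

section \<open>Pointwise domination by a sparse sum\<close>

lemma cav_eq: "x \<in> dy a L k x0 ==> cav b a L k x = cav b a L k x0"
 by (simp add: cav_def bcor_def dlo_eq)

lemma DB_eq: "x \<in> dy a L k x0 ==> DB a L k x = DB a L k x0"
 by (simp add: DB_def dlo_eq)

lemma alp_eq: "x \<in> dy a L k x0 ==> alp b f a L k x = alp b f a L k x0"
 by (simp add: alp_def cav_eq DB_eq)

lemma alp_nonneg: "0 < L ==> 0 \<le> alp b f a L k x" by (simp add: alp_def)

lemma ennreal_alp:
 fixes a :: "real ^ 'n::finite"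
 assumes L: "0 < L" and f: "integrable lborel f" "integrable lborel (\<lambda>y. b y * f y)"
 shows "(NN y. ennreal ((1 + norm (b y - cav b a L k x)) * norm (f y)) * indicator (DB a L k x) y)
  = ennreal (alp b f a L k x * (L / 2 ^ k) ^ CARD('n))"
proof -
 let ?c = "cav b a L k x"
 have "(NN y. ennreal ((1 + norm (b y - ?c)) * norm (f y)) * indicator (DB a L k x) y)
   \<le> (NN y. ennreal ((1 + norm ?c) * norm (f y) + norm (b y * f y)))"
 proof (rule nn_integral_mono)
  fix y
  have "(1 + norm (b y - ?c)) * norm (f y) \<le> (1 + norm (b y) + norm ?c) * norm (f y)"
   using norm_triangle_ineq4[of "b y" ?c] by (intro mult_right_mono) auto
  also have "\<dots> = (1 + norm ?c) * norm (f y) + norm (b y * f y)" by (simp add: norm_mult algebra_simps)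
  finally show "ennreal ((1 + norm (b y - ?c)) * norm (f y)) * indicator (DB a L k x) y \<le> ennreal ((1 + norm ?c) * norm (f y) + norm (b y * f y))"
   by (auto simp: indicator_def simp del: ennreal_plus intro!: ennreal_leI)
 qed
 also have "\<dots> < \<infinity>"
 proof -
  have "integrable lborel (\<lambda>y. (1 + norm ?c) * norm (f y) + norm (b y * f y))"
   using f by (intro Bochner_Integration.integrable_add integrable_mult_right integrable_norm)
  then have "(NN y. ennreal (norm ((1 + norm ?c) * norm (f y) + norm (b y * f y)))) < \<infinity>" unfolding integrable_iff_bounded by blast
  then show ?thesis by (simp add: abs_of_nonneg add_nonneg_nonneg)
 qed
 finally show ?thesis using L by (simp add: alp_def)
qed

context CZ_op
begin

text \<open>\<open>St k x\<close> marks the cube of generation \<open>k\<close> through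
  \<open>x\<close> as selected. The second condition is sparseness: selected descendants cover at
  most half of a selected cube.\<close>

definition sparse :: "real ^ 'n => real => (nat => real ^ 'n => bool) => bool" where
 "sparse a L St \<longleftrightarrow> (\<forall>k x y. y \<in> dy a L k x --> St k y = St k x) \<and>
   (\<forall>k x. St k x --> vol {y \<in> dy a L k x. \<exists>l>k. St l y} \<le> ennreal ((L / 2 ^ k) ^ CARD('n) / 2))"

abbreviation "Msp \<equiv> csp (1 / 4)"

text \<open>From a selected cube one descends until its exceptional set fills more than half of a
  cube, which is selected next. Between consecutive selected cubes \<open>sparse_step\<close>
  applies, so the commutator telescopes into one term per selected cube through
  \<open>x\<close>.\<close>

lemma sparse_domination:
 assumes L: "0 < L" and f: "\<And>j. adm (p j) (f j)" "\<And>j. adm (p j) (\<lambda>y. b j y * f j y)" and supp: "\<And>j y. y \<notin> hcube a L ==> f j y = 0"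
 shows "\<exists>St. sparse a L St \<and>
   (\<forall>x\<in>hcube a L. \<forall>\<delta>>0. \<exists>l. norm (CI b x (TR x \<delta>) f) \<le> Msp * (\<Sum>k<l. if St k x then
     (PU j. 1 + norm (b j x - cav (b j) a L k x)) * (PU j. alp (b j) (f j) a L k x) else 0))"
proof -
 let ?G = "\<lambda>k x. PU j. 1 + norm (b j x - cav (b j) a L k x)"
 let ?a = "\<lambda>k x. PU j. alp (b j) (f j) a L k x"
 let ?f = "\<lambda>k x j y. indicator (DB a L k x) y * f j y"
 have G0: "0 \<le> ?G k x * ?a k x" for k x using alp_nonneg[OF L] by (intro mult_nonneg_nonneg prod_nonneg) auto
 \<comment> \<open>Exceptional sets of at most a quarter of the volume: the disjoint cubes more than
   half filled by one then have total volume at most one half.\<close>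
 have "\<forall>k z. \<exists>F. F \<in> sets borel \<and> vol F \<le> ennreal (1 / 4 * (L / 2 ^ k) ^ CARD('n)) \<and>
  (\<forall>l\<ge>k. \<forall>x\<in>dy a L k z. half_on F a L k l x -->
    (\<forall>\<delta>>0. norm (CI b x (TR x \<delta> \<inter> off (DB a L l x)) (?f k z)) \<le> Msp * ((PU j. 1 + norm (b j x - cav (b j) a L k z)) * ?a k z)))"
 proof (intro allI sparse_step[OF _ L _ _ _ alp_nonneg[OF L], unfolded Bex_def])
  fix k z j
  show "adm (p j) (?f k z j)" by (rule adm_mult_indicator[OF f(1) p]) simp
  have "adm (p j) (\<lambda>y. indicator (DB a L k z) y * (b j y * f j y))" by (rule adm_mult_indicator[OF f(2) p]) simp
  then show "adm (p j) (\<lambda>y. b j y * ?f k z j y)" by (simp add: mult_ac)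
  show "?f k z j y = 0" if "y \<notin> DB a L k z" for y using that by simp
  have "(NN y. ennreal ((1 + norm (b j y - cav (b j) a L k z)) * norm (?f k z j y)))
   = (NN y. ennreal ((1 + norm (b j y - cav (b j) a L k z)) * norm (f j y)) * indicator (DB a L k z) y)"
   by (intro nn_integral_cong) (auto simp: indicator_def)
  then show "(NN y. ennreal ((1 + norm (b j y - cav (b j) a L k z)) * norm (?f k z j y))) \<le> ennreal (alp (b j) (f j) a L k z * (L / 2 ^ k) ^ CARD('n))"
   using ennreal_alp[OF L adm_integrable[OF f(1)] adm_integrable[OF f(2)]] by simp
 qed simp
 then obtain F where F0: "\<forall>k z. F k z \<in> sets borel \<and> vol (F k z) \<le> ennreal (1 / 4 * (L / 2 ^ k) ^ CARD('n)) \<and>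
  (\<forall>l\<ge>k. \<forall>x\<in>dy a L k z. half_on (F k z) a L k l x -->
    (\<forall>\<delta>>0. norm (CI b x (TR x \<delta> \<inter> off (DB a L l x)) (?f k z)) \<le> Msp * ((PU j. 1 + norm (b j x - cav (b j) a L k z)) * ?a k z)))"
  unfolding choice_iff by blast
 then have F: "\<And>k z. F k z \<in> sets borel" "\<And>k z. vol (F k z) \<le> ennreal (1 / 4 * (L / 2 ^ k) ^ CARD('n))"
  "\<And>k z l x \<delta>. k \<le> l ==> x \<in> dy a L k z ==> (\<And>i. k \<le> i ==> i < l ==> vol (F k z \<inter> dy a L i x) \<le> ennreal ((L / 2 ^ i) ^ CARD('n) / 2)) ==>
    0 < \<delta> ==> norm (CI b x (TR x \<delta> \<inter> off (DB a L l x)) (?f k z)) \<le> Msp * ((PU j. 1 + norm (b j x - cav (b j) a L k z)) * ?a k z)"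
  by (blast, blast, auto)
 \<comment> \<open>Taken for the corner of the cube, the exceptional set depends on the cube and not
   on the point naming it.\<close>
 define FF where "FF k x = F k (dlo a L k x)" for k x
 define R where "R x k l \<longleftrightarrow> ennreal ((L / 2 ^ l) ^ CARD('n) / 2) < vol (FF k x \<inter> dy a L l x)" for x k l
 define St where "St l x \<longleftrightarrow> lst (R x) l = l" for l x
 have mid: "dlo a L k x \<in> dy a L k x" "x \<in> dy a L k (dlo a L k x)" for k x
  using dlo_dy[OF L, of a k x] dy_eq[of "dlo a L k x" a L k x] by auto
 have FFm [measurable]: "FF k x \<in> sets borel" for k x using F(1) by (simp add: FF_def)
 have FF: "norm (CI b x (TR x \<delta> \<inter> off (DB a L l x)) (?f k x)) \<le> Msp * (?G k x * ?a k x)"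
  if "k \<le> l" "\<And>i. k \<le> i ==> i < l ==> vol (FF k x \<inter> dy a L i x) \<le> ennreal ((L / 2 ^ i) ^ CARD('n) / 2)" "0 < \<delta>" for k l x \<delta>
  using F(3)[OF that(1) mid(2) that(2)[unfolded FF_def] that(3)] unfolding DB_eq[OF mid(1)] cav_eq[OF mid(1)] alp_eq[OF mid(1)] .
 have Req: "lst (R y) l = lst (R x) l" if "y \<in> dy a L l x" for x y l
 proof (rule lst_cong)
  fix k i assume ki: "k \<le> i" "i \<le> l"
  then have "y \<in> dy a L k x" "y \<in> dy a L i x" using that dy_mono[of i l a L x] dy_mono[of k l a L x] by auto
  then show "R y k i = R x k i" unfolding R_def FF_def using dlo_eq dy_eq by metis
 qed
 have Steq: "St k y = St k x" if "y \<in> dy a L k x" for k x y using Req[OF that] by (simp add: St_def)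
 have carl: "vol {y \<in> dy a L k x. \<exists>l>k. St l y} \<le> ennreal ((L / 2 ^ k) ^ CARD('n) / 2)" if St: "St k x" for k x
 proof -
  define Bd where "Bd P \<longleftrightarrow> vol P \<le> 2 * vol (FF k x \<inter> P)" for P
  let ?U = "\<Union>(stopfam a L k (dy a L k x) Bd)"
  have "{y \<in> dy a L k x. \<exists>l>k. St l y} \<subseteq> ?U"
  proof
   fix y assume "y \<in> {y \<in> dy a L k x. \<exists>l>k. St l y}"
   then obtain l where y: "y \<in> dy a L k x" and l: "k < l" "St l y" by blast
   have ky: "lst (R y) k = k" using St Steq[OF y] by (simp add: St_def)
   have "\<exists>i>k. R y k i"
    using lst_stay[OF ky, of l] l by (auto simp: St_def)
   then obtain i where i: "k < i" "R y k i" by blast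
   have "FF k y = FF k x" using dlo_eq[OF y] by (simp add: FF_def)
   then have h: "ennreal ((L / 2 ^ i) ^ CARD('n) / 2) < vol (FF k x \<inter> dy a L i y)" using i(2) by (simp add: R_def)
   have "vol (dy a L i y) = 2 * ennreal ((L / 2 ^ i) ^ CARD('n) / 2)"
    using emeasure_dy[OF L, of a i y] by (simp add: ennreal_mult[symmetric] L less_imp_le flip: ennreal_numeral)
   also have "\<dots> \<le> 2 * vol (FF k x \<inter> dy a L i y)" using h by (intro mult_left_mono) auto
   finally have "Bd (dy a L i y)" by (simp add: Bd_def)
   then show "y \<in> ?U" unfolding Union_stopfam using y i(1) by blast
  qed
  then have "vol {y \<in> dy a L k x. \<exists>l>k. St l y} \<le> vol ?U" by (intro emeasure_mono) auto
  also have "\<dots> \<le> 2 * emeasure (density lborel (indicator (FF k x))) ?U"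
  proof (rule emeasure_Union_le[OF countable_stopfam stopfam_disjoint stopfam_borel])
   fix P assume P: "P \<in> stopfam a L k (dy a L k x) Bd"
   then have "Bd P" by (auto simp: stopfam_def)
   then show "vol P \<le> 2 * emeasure (density lborel (indicator (FF k x))) P"
    using stopfam_borel[OF P] by (simp add: emeasure_restricted Bd_def)
  qed auto
  also have "\<dots> \<le> 2 * vol (FF k x)"
   by (subst emeasure_restricted) (auto intro!: mult_left_mono emeasure_mono)
  also have "\<dots> \<le> 2 * ennreal (1 / 4 * (L / 2 ^ k) ^ CARD('n))" unfolding FF_def by (intro mult_left_mono F(2)) simp
  also have "\<dots> = ennreal ((L / 2 ^ k) ^ CARD('n) / 2)"
   using L by (simp add: ennreal_mult[symmetric] flip: ennreal_numeral)
  finally show ?thesis .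
 qed
 have dom: "\<exists>l. norm (CI b x (TR x \<delta>) f) \<le> Msp * (\<Sum>k<l. if St k x then ?G k x * ?a k x else 0)" if x: "x \<in> hcube a L" and d: "0 < \<delta>" for x \<delta>
 proof -
  let ?V = "\<lambda>l. TR x \<delta> \<inter> off (DB a L l x) :: (real ^ 'n ^ 'm) set"
  \<comment> \<open>Strong induction. With \<open>k\<close> the last selected generation before
    \<open>l\<close>, the part off \<open>DB\<close> at \<open>k\<close> is the claim for
    \<open>k\<close>; the rest involves only the input localised to that \<open>DB\<close> and
    contributes one new term.\<close>
  have step: "norm (CI b x (?V l) f) \<le> Msp * (\<Sum>k<l. if St k x then ?G k x * ?a k x else 0)" for l
  proof (induction l rule: less_induct)
   case (less l)
   show ?case
   proof (cases l)
    \<comment> \<open>The inputs live in the top cube, which \<open>DB\<close> at generation 0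
      contains, so nothing is left outside.\<close>
    case 0
    have "x \<in> dy a L 0 a" using x dy_top[OF L] by blast
    then have "hcube a L \<subseteq> DB a L 0 x"
     using dy_ball[OF L, of a 0 x] dy_eq[of x a L 0 a] dy_top[OF L, of a] by (auto simp: DB_def)
    then have "(PU j. f j (y $ j)) = 0" if "y \<in> ?V 0" for y
     using that supp by (intro prod_zero) (auto simp: off_def)
    then have "CI b x (?V 0) f = (\<integral>y. 0 \<partial>(lborel :: (real ^ 'n ^ 'm) measure))"
     unfolding CI_def by (intro Bochner_Integration.integral_cong) (auto simp: indicator_def)
    then show ?thesis using 0 by simp
   next
    case (Suc l')
    define k where "k = lst (R x) l'"
    have k: "k \<le> l'" "k < l" "St k x" using lst_le[of "R x" l'] lst_idem[of "R x" l'] Suc by (auto simp: k_def St_def)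
    have sub: "off (DB a L k x) \<subseteq> (off (DB a L l x) :: (real ^ 'n ^ 'm) set)" using DB_mono[OF L, of k l a x] k by (auto simp: off_def)
    have "CI b x (?V l) f = CI b x (?V l \<inter> off (DB a L k x)) f + CI b x (?V l) (?f k x)"
     by (rule CI_split[OF adm_integrable[OF f(1)] adm_integrable[OF f(2)] _ d]) (use TR_rho[OF d, of _ x] in auto)
    also have "?V l \<inter> off (DB a L k x) = ?V k" using sub by blast
    finally have "norm (CI b x (?V l) f) \<le> norm (CI b x (?V k) f) + norm (CI b x (?V l) (?f k x))" by (simp add: norm_triangle_ineq)
    also have "norm (CI b x (?V l) (?f k x)) \<le> Msp * (?G k x * ?a k x)"
    proof (rule FF[OF _ _ d])
     fix i assume i: "k \<le> i" "i < l"
     show "vol (FF k x \<inter> dy a L i x) \<le> ennreal ((L / 2 ^ i) ^ CARD('n) / 2)"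
     proof (cases "i = k")
      case True
      have "vol (FF k x \<inter> dy a L i x) \<le> vol (FF k x)" by (rule emeasure_mono) auto
      also have "\<dots> \<le> ennreal (1 / 4 * (L / 2 ^ k) ^ CARD('n))" unfolding FF_def by (rule F(2))
      also have "\<dots> \<le> ennreal ((L / 2 ^ k) ^ CARD('n) / 2)" using zero_le_power[of "L / 2 ^ k"] L by (intro ennreal_leI) auto
      finally show ?thesis using True by simp
     next
      case False
      then have "\<not> R x k i" using lst_between[of "R x" l' i] i Suc unfolding k_def by auto
      then show ?thesis by (simp add: R_def not_less)
     qed
    qed (use k in simp)
    also have "norm (CI b x (?V k) f) \<le> Msp * (\<Sum>k<k. if St k x then ?G k x * ?a k x else 0)" using less k by blast
    finally have "norm (CI b x (?V l) f) \<le> Msp * (\<Sum>i<Suc k. if St i x then ?G i x * ?a i x else 0)"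
     using k(3) by (simp add: distrib_left)
    also have "\<dots> \<le> Msp * (\<Sum>i<l. if St i x then ?G i x * ?a i x else 0)"
     using csp_pos[of "1 / 4"] k(2) G0 by (intro mult_left_mono sum_mono2) auto
    finally show ?thesis .
   qed
  qed
  let ?m = "real CARD('m)"
  have m1: "1 \<le> ?m" by (simp add: Suc_leI)
  \<comment> \<open>Deep enough that every coordinate inside \<open>DB\<close> is within \<delta>/m
    of \<open>x\<close>; \<open>m\<close> such coordinates cannot satisfy the truncation, so
    \<open>TR\<close> lies in \<open>off\<close>.\<close>
  obtain l :: nat where l: "4 * real CARD('n) * L * ?m / \<delta> < 2 ^ l" using real_arch_pow[of 2] by auto
  then have l': "4 * sd a L l \<le> \<delta> / ?m" using d m1 by (simp add: sd_def field_simps)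
  have "TR x \<delta> \<subseteq> (off (DB a L l x) :: (real ^ 'n ^ 'm) set)"
  proof
   fix y :: "real ^ 'n ^ 'm" assume y: "y \<in> TR x \<delta>"
   show "y \<in> off (DB a L l x)"
   proof (rule ccontr)
    assume "y \<notin> off (DB a L l x)"
    then have "y $ j \<in> cball x (4 * sd a L l)" for j using DB_near[OF L dy_self[of x a L l]] by (auto simp: off_def)
    then have "norm (x - y $ j) \<le> \<delta> / ?m" for j using l' unfolding mem_cball dist_norm by (rule order_trans)
    then have "(\<Sum>j\<in>UNIV. (norm (x - y $ j))\<^sup>2) \<le> (\<Sum>j\<in>(UNIV :: 'm set). (\<delta> / ?m)\<^sup>2)" by (intro sum_mono power_mono) auto
    also have "\<dots> = \<delta>\<^sup>2 / ?m" by (simp add: power_divide power2_eq_square)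
    also have "\<dots> \<le> \<delta>\<^sup>2 / 1" using m1 by (intro divide_left_mono) auto
    finally show False using y by (simp add: TR_def)
   qed
  qed
  then have "TR x \<delta> = ?V l" by blast
  then show ?thesis using step[of l] by (intro exI[of _ l]) simp
 qed
 show ?thesis
  using Steq carl dom unfolding sparse_def by (intro exI[of _ St]) blast
qed

end

section \<open>Summation over a sparse family\<close>

text \<open>There are only countably many cubes in each generation, so the set is a countable union
  of them.\<close>

lemma dy_pred_borel:
 fixes a :: "real ^ 'n::finite"
 assumes "\<And>x y. y \<in> dy a L l x ==> P y = P x"
 shows "{y. P y} \<in> sets borel"
proof -
 have "{y. P y} = \<Union>(dy a L l ` {y. P y})" using assms by auto
 also have "\<dots> \<in> sets borel"
  by (rule Union_borel) (use countable_subset[OF image_mono[OF subset_UNIV] countable_dy] in auto)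
 finally show ?thesis .
qed

lemma emeasure_UN_geometric:
 assumes "\<And>i::nat. E i \<in> sets N" "\<And>i. emeasure N (E i) \<le> ennreal (X * u ^ i)" "0 \<le> X" "0 \<le> u" "u < 1"
 shows "emeasure N (\<Union>i. E i) \<le> ennreal (X / (1 - u))"
proof -
 have "emeasure N (\<Union>i. E i) \<le> (\<Sum>i. emeasure N (E i))" using assms(1) by (intro emeasure_subadditive_countably) auto
 also have "\<dots> \<le> (\<Sum>i. ennreal (X * u ^ i))" using assms(2) by (intro suminf_le) auto
 also have "\<dots> = ennreal (X / (1 - u))"
  using sums_mult[OF geometric_sums[of u], of X] assms(3-5) by (intro suminf_ennreal_eq) auto
 finally show ?thesis .
qed

lemma emeasure_density_indicator:
 assumes [measurable]: "w \<in> borel_fun" "E \<in> sets borel" "X \<in> sets borel"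
 shows "emeasure (density lborel (\<lambda>x. w x * indicator E x)) X = wm w (E \<inter> X)"
 by (subst (1 2) emeasure_density) (auto intro!: nn_integral_cong simp: indicator_def)

text \<open>\<open>x\<close> lies in a cube of generation \<open>l\<close> belonging to the \<open>i\<close>-th layer of the family \<open>P\<close>.\<close>

definition nth_at :: "(nat => 'a => bool) => nat => nat => 'a => bool" where
 "nth_at P i l x \<longleftrightarrow> P l x \<and> card {k. k < l \<and> P k x} = i"

lemma nth_at_less: "nth_at P i l x ==> nth_at P j l' x ==> l < l' ==> i < j"
proof -
 assume n: "nth_at P i l x" "nth_at P j l' x" "l < l'"
 then have "card (insert l {k. k < l \<and> P k x}) \<le> card {k. k < l' \<and> P k x}"
  by (intro card_mono) (auto simp: nth_at_def)
 then show ?thesis using n by (simp add: nth_at_def)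
qed

lemma nth_at_unique: "nth_at P i l x ==> nth_at P i l' x ==> l = l'"
 using nth_at_less by (metis less_irrefl nat_neq_iff)

lemma nth_at_pred:
 assumes "nth_at P (Suc i) l x" shows "\<exists>k<l. nth_at P i k x"
proof -
 let ?A = "{k. k < l \<and> P k x}"
 have A: "finite ?A" "card ?A = Suc i" using assms by (auto simp: nth_at_def)
 have "?A \<noteq> {}"
 proof
  assume "?A = {}"
  with A(2) show False by (simp only: card.empty)
 qed
 then have M: "Max ?A \<in> ?A" using A(1) by (intro Max_in)
 have "k < Max ?A" if "k \<in> ?A" "k \<noteq> Max ?A" for k using Max_ge[OF A(1) that(1)] that(2) by simp
 then have "{k. k < Max ?A \<and> P k x} = ?A - {Max ?A}" using M by auto
 then have "card {k. k < Max ?A \<and> P k x} = i" using M A by simp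
 then show ?thesis using M unfolding nth_at_def by blast
qed

context
 fixes a :: "real ^ 'n::finite" and L :: real and P :: "nat => real ^ 'n => bool"
 assumes L: "0 < L" and P: "\<And>l x y. y \<in> dy a L l x ==> P l y = P l x"
begin

lemma nth_at_eq: "y \<in> dy a L l x ==> nth_at P i l y = nth_at P i l x"
proof -
 assume y: "y \<in> dy a L l x"
 have "P k y = P k x" if "k < l" for k using P[of y k x] dy_mono[of k l a L x] y that by auto
 then have "{k. k < l \<and> P k y} = {k. k < l \<and> P k x}" by auto
 then show ?thesis using P[OF y] by (simp add: nth_at_def)
qed

lemma nth_at_borel: "{x. nth_at P i l x} \<in> sets borel"
 using nth_at_eq by (rule dy_pred_borel)

lemma ex_nth_at_borel: "{x. \<exists>l. nth_at P i l x} \<in> sets borel"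
 using nth_at_borel by (simp add: Collect_ex_eq sets.countable_UN')

text \<open>A point meets layer \<open>i\<close> in at most one generation
  (\<open>nth_at_unique\<close>), so the cubes of one layer are disjoint and local comparisons add
  up.\<close>

lemma nth_at_emeasure:
 assumes M: "sets M = sets borel" and N: "sets N = sets borel"
  and le: "\<And>l x. nth_at P i l x ==> emeasure M (dy a L l x) \<le> c * emeasure N (dy a L l x)"
 shows "emeasure M {x. \<exists>l. nth_at P i l x} \<le> c * emeasure N {x. \<exists>l. nth_at P i l x}"
proof -
 define F where "F = {dy a L l x | l x. nth_at P i l x}"
 have u: "{x. \<exists>l. nth_at P i l x} = \<Union>F"
 proof
  show "{x. \<exists>l. nth_at P i l x} \<subseteq> \<Union>F"
  proof
   fix x assume "x \<in> {x. \<exists>l. nth_at P i l x}"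
   then obtain l where "nth_at P i l x" by blast
   then show "x \<in> \<Union>F" unfolding F_def using dy_self[of x a L l] by blast
  qed
  show "\<Union>F \<subseteq> {x. \<exists>l. nth_at P i l x}" unfolding F_def using nth_at_eq by blast
 qed
 have "F \<subseteq> {dy a L k x | k x. True}" unfolding F_def by blast
 then have c: "countable F" using countable_dy_all countable_subset by blast
 have d: "disjoint F"
 proof (rule disjointI)
  fix Q Q' assume Q: "Q \<in> F" "Q' \<in> F" "Q \<noteq> Q'"
  obtain l x l' x' where e: "Q = dy a L l x" "nth_at P i l x" "Q' = dy a L l' x'" "nth_at P i l' x'" using Q unfolding F_def by blast
  show "Q \<inter> Q' = {}"
  proof (rule ccontr)
   assume "Q \<inter> Q' \<noteq> {}"
   then obtain y where y: "y \<in> dy a L l x" "y \<in> dy a L l' x'" using e by blast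
   then have "l = l'" using nth_at_unique[of P i l y l'] nth_at_eq[of y l x i] nth_at_eq[of y l' x' i] e by blast
   then show False using dy_eq[OF y(1)] dy_eq[OF y(2)] e Q(3) by simp
  qed
 qed
 show ?thesis unfolding u
  by (rule emeasure_Union_le[OF c d _ M N]) (use le in \<open>auto simp: F_def\<close>)
qed

text \<open>A point of layer \<open>i + 1\<close> lies in a cube of layer \<open>i\<close>, in the
  part covered by descendants in \<open>P\<close>, which has at most half of the volume;
  \<open>A1m_half\<close> turns this into a factor for the weight.\<close>

lemma nth_at_decay:
 assumes w: "A1m D w" and carl: "\<And>k x. P k x ==> vol {y \<in> dy a L k x. \<exists>l>k. P l y} \<le> ennreal ((L / 2 ^ k) ^ CARD('n) / 2)"
 shows "wm w {x. \<exists>l. nth_at P i l x} \<le> ennreal ((1 - 1 / (2 * D)) ^ i) * wm w {x. \<exists>l. nth_at P 0 l x}"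
proof (induction i)
 case (Suc i)
 let ?\<nu> = "density lborel w" let ?q = "1 - 1 / (2 * D)"
 have D: "1 \<le> D" and wm [measurable]: "w \<in> borel_fun" using w by (auto simp: A1m_def)
 define E where "E = {x. \<exists>l. nth_at P (Suc i) l x}"
 have E [measurable]: "E \<in> sets borel" unfolding E_def by (rule ex_nth_at_borel)
 note ind = emeasure_density_indicator[OF wm E]
 have "E \<inter> {x. \<exists>l. nth_at P i l x} = E" unfolding E_def using nth_at_pred[of P i] by fast
 \<comment> \<open>Restricting the weight to \<open>E\<close> turns the local statement about
   \<open>E\<close> inside one cube into a comparison of measures.\<close>
 then have "emeasure ?\<nu> E = emeasure (density lborel (\<lambda>x. w x * indicator E x)) {x. \<exists>l. nth_at P i l x}"
  using ind[OF ex_nth_at_borel[of i]] by simp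
 also have "\<dots> \<le> ennreal ?q * emeasure ?\<nu> {x. \<exists>l. nth_at P i l x}"
 proof (rule nth_at_emeasure)
  fix l x assume lx: "nth_at P i l x"
  let ?X = "{y \<in> dy a L l x. \<exists>k>l. P k y}"
  have X: "?X \<in> sets borel"
  proof -
   have "?X = dy a L l x \<inter> (\<Union>k\<in>{l<..}. {y. P k y})" by auto
   also have "\<dots> \<in> sets borel" by (intro sets.Int sets.countable_UN'' dy_pred_borel[OF P] dy_borel) auto
   finally show ?thesis .
  qed
  have "E \<inter> dy a L l x \<subseteq> ?X"
  proof
   fix y assume y: "y \<in> E \<inter> dy a L l x"
   then obtain k where k: "nth_at P (Suc i) k y" unfolding E_def by blast
   have ly: "nth_at P i l y" using nth_at_eq lx y by blast
   have "k \<noteq> l" using k ly by (auto simp: nth_at_def)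
   then have "l < k" using nth_at_less[OF k ly] by linarith
   then show "y \<in> ?X" using k y by (auto simp: nth_at_def)
  qed
  then have "emeasure ?\<nu> (E \<inter> dy a L l x) \<le> emeasure ?\<nu> ?X" by (rule emeasure_mono) (use X in \<open>simp only: sets_density sets_lborel\<close>)
  also have "\<dots> \<le> ennreal ?q * emeasure ?\<nu> (hcube (dlo a L l x) (L / 2 ^ l))"
  proof (rule A1m_half[OF w _ X])
   show "?X \<subseteq> hcube (dlo a L l x) (L / 2 ^ l)" unfolding dy_hcube[OF L, symmetric] by blast
   show "vol ?X \<le> ennreal ((L / 2 ^ l) ^ CARD('n) / 2)" using lx by (intro carl) (simp add: nth_at_def)
  qed (use L in simp)
  finally show "emeasure (density lborel (\<lambda>x. w x * indicator E x)) (dy a L l x) \<le> ennreal ?q * emeasure ?\<nu> (dy a L l x)"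
   by (simp add: ind dy_hcube[OF L, symmetric])
 qed auto
 also have "\<dots> \<le> ennreal ?q * (ennreal (?q ^ i) * emeasure ?\<nu> {x. \<exists>l. nth_at P 0 l x})" by (intro mult_left_mono Suc.IH) simp
 also have "\<dots> = ennreal (?q ^ Suc i) * emeasure ?\<nu> {x. \<exists>l. nth_at P 0 l x}"
  using D by (subst mult.assoc[symmetric], subst ennreal_mult[symmetric]) (auto simp: field_simps)
 finally show ?case unfolding E_def .
qed simp

end

text \<open>The square root splits the geometric decay of the layers: one half sums the measures,
  the other is traded for thresholds that decrease with the layer.\<close>

definition cgq :: "real => real" where "cgq D = sqrt (1 - 1 / (2 * D))"

definition cgs :: "real => real => real => real" where "cgs D Cg \<kappa> = 1 + 2 * (16 * Cg / (\<kappa> * (1 - root 5 (cgq D)) / 2) ^ 5) / (1 - cgq D)"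

lemma cgq: assumes "1 \<le> D" shows "0 < cgq D" "cgq D < 1" "cgq D * cgq D = 1 - 1 / (2 * D)"
proof -
 have "0 < 1 - 1 / (2 * D)" "1 - 1 / (2 * D) < 1" using assms by (auto simp: field_simps)
 then show "0 < cgq D" "cgq D < 1" "cgq D * cgq D = 1 - 1 / (2 * D)" by (auto simp: cgq_def)
qed

lemma cgs_pos: assumes "1 \<le> D" "0 \<le> Cg" "0 < \<kappa>" shows "0 < cgs D Cg \<kappa>"
 unfolding cgs_def using assms cgq[OF assms(1)] by (intro add_pos_nonneg) auto

text \<open>Selected cubes are sorted by level, \<open>al\<close> of size 4^-r, and by layer
  \<open>i\<close> within a level. \<open>G\<close> exceeds the threshold c 2^r \<zeta>^i on sets
  whose measures sum to a multiple of \<open>N\<close>; elsewhere the sum is at most c times the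
  double series of 2^-r \<zeta>^i.\<close>

lemma sparse_sum_bound:
 fixes a :: "real ^ 'n::finite" and G al :: "nat => real ^ 'n => real"
 assumes D: "1 \<le> D" and Cg: "0 \<le> Cg" and \<kappa>: "0 < \<kappa>" and L: "0 < L" and w: "A1m D w" and St: "\<And>l x y. y \<in> dy a L l x ==> St l y = St l x"
   and al: "\<And>l x y. y \<in> dy a L l x ==> al l y = al l x"
   and carl: "\<And>k x. St k x ==> vol {y \<in> dy a L k x. \<exists>l>k. St l y} \<le> ennreal ((L / 2 ^ k) ^ CARD('n) / 2)"
   and Gm [measurable]: "\<And>l. G l \<in> borel_fun" and al0: "\<And>l x. 0 \<le> al l x" and N: "0 \<le> N"
   and Gd: "\<And>l x t. 0 < t ==> wm w {y \<in> dy a L l x. t < G l y} \<le> ennreal (Cg / t ^ 5) * wm w (dy a L l x)"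
   and wk: "\<And>s. 0 < s ==> s \<le> 1 ==> wm w {x \<in> hcube a L. \<exists>l. s < al l x} \<le> ennreal (N / s\<^sup>2)"
 shows "\<exists>E\<in>sets borel. wm w E \<le> ennreal (cgs D Cg \<kappa> * N) \<and>
   (\<forall>x\<in>hcube a L - E. \<forall>l. (\<Sum>k<l. if St k x then G k x * al k x else 0) \<le> \<kappa>)"
proof -
 let ?q = "1 - 1 / (2 * D)"
 define u where "u = cgq D"
 have q: "0 < ?q" "?q < 1" using D by (auto simp: field_simps)
 have u: "0 < u" "u < 1" "u * u = ?q" using cgq[OF D] by (auto simp: u_def)
 \<comment> \<open>The fifth root undoes the power 5 in \<open>Gd\<close>: thresholds decaying like
   \<zeta>^i cost the factor u^-i, which leaves u^i of the decay u^(2 i).\<close>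
 define \<zeta> where "\<zeta> = root 5 u"
 have z: "0 < \<zeta>" "\<zeta> < 1" "\<zeta> ^ 5 = u" using u by (auto simp: \<zeta>_def)
 \<comment> \<open>The two geometric series sum to 2 and 1 / (1 - \<zeta>), so the total becomes
   \<kappa>.\<close>
 define c where "c = \<kappa> * (1 - \<zeta>) / 2"
 have c: "0 < c" using \<kappa> z by (simp add: c_def)
 define X where "X = 16 * Cg / c ^ 5"
 have X: "0 \<le> X" using Cg c by (simp add: X_def)
 let ?\<nu> = "density lborel w"
 have wm [measurable]: "w \<in> borel_fun" using w by (auto simp: A1m_def)
 define P where "P r l x \<longleftrightarrow> x \<in> hcube a L \<and> St l x \<and> (1 / 4) ^ Suc r < al l x \<and> al l x \<le> (1 / 4) ^ r" for r l x
 have P: "P r l y = P r l x" if "y \<in> dy a L l x" for r l x y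
 proof -
  have "y \<in> dy a L 0 x" using dy_mono[of 0 l a L x] that by auto
  then have "y \<in> dy a L 0 a \<longleftrightarrow> x \<in> dy a L 0 a" using dy_eq dy_self by metis
  then show ?thesis using St[OF that] al[OF that] by (simp add: P_def dy_top[OF L])
 qed
 have alm: "{x. s < al l x} \<in> sets borel" for s l
  by (rule dy_pred_borel[of a L l]) (metis al)
 have em: "{x \<in> hcube a L. \<exists>l. s < al l x} \<in> sets borel" for s
 proof -
  have "{x \<in> hcube a L. \<exists>l. s < al l x} = hcube a L \<inter> (\<Union>l. {x. s < al l x})" by auto
  also have "\<dots> \<in> sets borel" by (intro sets.Int sets.countable_UN'' hcube_borel alm) auto
  finally show ?thesis .
 qed
 have carlP: "vol {y \<in> dy a L k x. \<exists>l>k. P r l y} \<le> ennreal ((L / 2 ^ k) ^ CARD('n) / 2)" if "P r k x" for r k x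
 proof -
  have "{y \<in> dy a L k x. \<exists>l>k. St l y} = dy a L k x \<inter> (\<Union>l\<in>{k<..}. {y. St l y})" by auto
  also have "\<dots> \<in> sets borel" by (intro sets.Int sets.countable_UN'' dy_pred_borel[OF St] dy_borel) auto
  finally have "{y \<in> dy a L k x. \<exists>l>k. St l y} \<in> sets lborel" by (simp only: sets_lborel)
  moreover have "{y \<in> dy a L k x. \<exists>l>k. P r l y} \<subseteq> {y \<in> dy a L k x. \<exists>l>k. St l y}" unfolding P_def by fast
  ultimately have "vol {y \<in> dy a L k x. \<exists>l>k. P r l y} \<le> vol {y \<in> dy a L k x. \<exists>l>k. St l y}"
   by (rule emeasure_mono[rotated])
  also have "\<dots> \<le> ennreal ((L / 2 ^ k) ^ CARD('n) / 2)" using that by (intro carl) (simp add: P_def)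
  finally show ?thesis .
 qed
 define th where "th r i = c * 2 ^ r * \<zeta> ^ i" for r i
 have th: "0 < th r i" for r i using c z by (simp add: th_def)
 define Bd where "Bd r i = {x. \<exists>l. nth_at (P r) i l x \<and> th r i < G l x}" for r i
 have Bm [measurable]: "Bd r i \<in> sets borel" for r i
 proof -
  have "Bd r i = (\<Union>l. {x. nth_at (P r) i l x} \<inter> {x. th r i < G l x})" by (auto simp: Bd_def)
  also have "\<dots> \<in> sets borel" using nth_at_borel[OF L P] by (intro sets.countable_UN'' sets.Int) auto
  finally show ?thesis .
 qed
 have Bd: "emeasure ?\<nu> (Bd r i) \<le> ennreal (X * N * (1 / 2) ^ r * u ^ i)" for r i
 proof -
  note ind = emeasure_density_indicator[OF wm Bm[of r i]]
  have "Bd r i \<inter> {x. \<exists>l. nth_at (P r) i l x} = Bd r i" by (auto simp: Bd_def)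
  then have "emeasure ?\<nu> (Bd r i) = emeasure (density lborel (\<lambda>x. w x * indicator (Bd r i) x)) {x. \<exists>l. nth_at (P r) i l x}"
   by (simp only: ind[OF ex_nth_at_borel[OF L P]])
  also have "\<dots> \<le> ennreal (Cg / th r i ^ 5) * emeasure ?\<nu> {x. \<exists>l. nth_at (P r) i l x}"
  proof (rule nth_at_emeasure[OF L P])
   fix l x assume lx: "nth_at (P r) i l x"
   have "Bd r i \<inter> dy a L l x \<subseteq> {y \<in> dy a L l x. th r i < G l y}"
   proof
    fix y assume y: "y \<in> Bd r i \<inter> dy a L l x"
    then obtain l' where l': "nth_at (P r) i l' y" "th r i < G l' y" by (auto simp: Bd_def)
    have "nth_at (P r) i l y" using nth_at_eq[where P = "P r", OF L P] y lx by blast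
    then show "y \<in> {y \<in> dy a L l x. th r i < G l y}" using nth_at_unique[OF l'(1)] l'(2) y by auto
   qed
   then have "emeasure ?\<nu> (Bd r i \<inter> dy a L l x) \<le> emeasure ?\<nu> {y \<in> dy a L l x. th r i < G l y}" by (intro emeasure_mono) auto
   also have "\<dots> \<le> ennreal (Cg / th r i ^ 5) * emeasure ?\<nu> (dy a L l x)" by (rule Gd[OF th])
   finally show "emeasure (density lborel (\<lambda>x. w x * indicator (Bd r i) x)) (dy a L l x) \<le> ennreal (Cg / th r i ^ 5) * emeasure ?\<nu> (dy a L l x)"
    by (simp add: ind)
  qed auto
  also have "emeasure ?\<nu> {x. \<exists>l. nth_at (P r) i l x} \<le> ennreal (?q ^ i) * emeasure ?\<nu> {x. \<exists>l. nth_at (P r) 0 l x}"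
   by (rule nth_at_decay[OF L P w carlP])
  also have "emeasure ?\<nu> {x. \<exists>l. nth_at (P r) 0 l x} \<le> emeasure ?\<nu> {x \<in> hcube a L. \<exists>l. (1 / 4) ^ Suc r < al l x}"
   using em[of "(1 / 4) ^ Suc r"] by (intro emeasure_mono) (auto simp del: power_Suc simp: P_def nth_at_def)
  also have "\<dots> \<le> ennreal (N / ((1 / 4) ^ Suc r)\<^sup>2)" by (rule wk[OF _ power_le_one]) auto
  finally have "emeasure ?\<nu> (Bd r i) \<le> ennreal (Cg / th r i ^ 5) * (ennreal (?q ^ i) * ennreal (N / ((1 / 4) ^ Suc r)\<^sup>2))"
   by (simp add: mult_left_mono)
  also have "\<dots> = ennreal (Cg / th r i ^ 5 * (?q ^ i * (N / ((1 / 4) ^ Suc r)\<^sup>2)))"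
  proof -
   have "0 \<le> Cg / th r i ^ 5" "0 \<le> ?q ^ i" "0 \<le> N / ((1 / 4) ^ Suc r)\<^sup>2" using Cg th[of r i] q N by auto
   then show ?thesis by (simp only: ennreal_mult mult_nonneg_nonneg)
  qed
  \<comment> \<open>The fifth power of 2^r gives 32^-r, the squared level 4^-(r+1) gives 16 times
    16^r; the surplus 2^-r makes the sum over \<open>r\<close> finite.\<close>
  also have "Cg / th r i ^ 5 * (?q ^ i * (N / ((1 / 4) ^ Suc r)\<^sup>2)) = X * N * (1 / 2) ^ r * u ^ i"
  proof -
   have 1: "th r i ^ 5 = c ^ 5 * 32 ^ r * u ^ i"
   proof -
    have "(2 ^ r) ^ 5 = (32 :: real) ^ r" by (simp add: power_mult[symmetric] mult.commute[of r] power_mult)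
    moreover have "(\<zeta> ^ i) ^ 5 = u ^ i" using z(3) by (metis power_mult mult.commute)
    ultimately show ?thesis by (simp add: th_def power_mult_distrib)
   qed
   have 2: "((1 / 4) ^ Suc r)\<^sup>2 = (1 / 16 :: real) * (1 / 16) ^ r"
    by (simp add: power_mult_distrib power_mult[symmetric] mult.commute[of r] power_mult power_divide)
   have 3: "(32 :: real) ^ r = 16 ^ r * 2 ^ r" by (simp add: power_mult_distrib[symmetric])
   show ?thesis unfolding 1 2 3 u(3)[symmetric] power_mult_distrib X_def using c u(1) by (simp add: field_simps power_divide)
  qed
  finally show ?thesis .
 qed
 define E where "E = {x \<in> hcube a L. \<exists>l. 1 < al l x} \<union> (\<Union>r. \<Union>i. Bd r i)"
 have Em: "E \<in> sets borel" unfolding E_def using em[of 1] by auto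
 have "emeasure ?\<nu> (\<Union>i. Bd r i) \<le> ennreal (X * N / (1 - u) * (1 / 2) ^ r)" for r
  using emeasure_UN_geometric[of "Bd r" ?\<nu> "X * N * (1 / 2) ^ r" u] Bd u X N by (simp add: mult_ac)
 then have "emeasure ?\<nu> (\<Union>r. \<Union>i. Bd r i) \<le> ennreal (X * N / (1 - u) / (1 - 1 / 2))"
  using X N u by (intro emeasure_UN_geometric) auto
 moreover have "emeasure ?\<nu> {x \<in> hcube a L. \<exists>l. 1 < al l x} \<le> ennreal N" using wk[of 1] by simp
 ultimately have "emeasure ?\<nu> E \<le> ennreal N + ennreal (X * N / (1 - u) / (1 - 1 / 2))"
  unfolding E_def using em[of 1] by (intro order_trans[OF emeasure_subadditive] add_mono) auto
 also have "\<dots> = ennreal ((1 + 2 * X / (1 - u)) * N)"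
  using N X u by (subst ennreal_plus[symmetric]) (auto simp: field_simps)
 finally have mE: "emeasure ?\<nu> E \<le> ennreal ((1 + 2 * X / (1 - u)) * N)" .
 have "(\<Sum>k<l. if St k x then G k x * al k x else 0) \<le> \<kappa>" if x: "x \<in> hcube a L" "x \<notin> E" for x l
 proof -
  let ?S = "{k. k < l \<and> St k x \<and> 0 < al k x}"
  have "\<exists>r. P r k x" if "k \<in> ?S" for k
  proof -
   have a1: "al k x \<le> 1" "0 < al k x" using x that by (auto simp: E_def not_less)
   define r where "r = (LEAST r. (1 / 4) ^ Suc r < al k x)"
   obtain r0 where "(1 / 4) ^ r0 < al k x" using real_arch_pow_inv[of "al k x" "1 / 4"] a1 by auto
   moreover have "(1 / 4 :: real) ^ Suc r0 \<le> (1 / 4) ^ r0" by simp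
   ultimately have "(1 / 4) ^ Suc r0 < al k x" by linarith
   then have r: "(1 / 4) ^ Suc r < al k x" unfolding r_def by (rule LeastI)
   moreover have "al k x \<le> (1 / 4) ^ r"
   proof (cases r)
    case (Suc r')
    then have "\<not> (1 / 4) ^ Suc r' < al k x" unfolding r_def using not_less_Least by (metis lessI)
    then show ?thesis using Suc by simp
   qed (use a1 in simp)
   ultimately show ?thesis using that x by (auto simp: P_def)
  qed
  then obtain r where r: "\<And>k. k \<in> ?S ==> P (r k) k x" by metis
  define i where "i k = card {k'. k' < k \<and> P (r k) k' x}" for k
  have n: "nth_at (P (r k)) (i k) k x" if "k \<in> ?S" for k using r[OF that] by (simp add: nth_at_def i_def)
  \<comment> \<open>Level and layer determine the generation, so distinct terms of the sum are
    matched with distinct terms of the double series.\<close>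
  have inj: "inj_on (\<lambda>k. (r k, i k)) ?S"
  proof (rule inj_onI)
   fix k k' assume k: "k \<in> ?S" "k' \<in> ?S" and e: "(r k, i k) = (r k', i k')"
   have "nth_at (P (r k)) (i k) k' x" using n[OF k(2)] e by simp
   then show "k = k'" by (rule nth_at_unique[OF n[OF k(1)]])
  qed
  have trm: "G k x * al k x \<le> c * ((1 / 2) ^ r k * \<zeta> ^ i k)" if "k \<in> ?S" for k
  proof -
   have "x \<notin> Bd (r k) (i k)" using x(2) by (auto simp: E_def)
   then have "G k x \<le> th (r k) (i k)" using n[OF that] by (auto simp: Bd_def not_less)
   then have "G k x * al k x \<le> th (r k) (i k) * al k x" using al0 by (rule mult_right_mono)
   also have "\<dots> \<le> th (r k) (i k) * (1 / 4) ^ r k" using r[OF that] th[of "r k" "i k"] by (intro mult_left_mono) (auto simp: P_def)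
   also have "\<dots> = c * ((1 / 2) ^ r k * \<zeta> ^ i k)"
   proof -
    have "2 ^ r k * (1 / 4) ^ r k = (1 / 2 :: real) ^ r k" by (simp add: power_mult_distrib[symmetric])
    then show ?thesis by (simp add: th_def)
   qed
   finally show ?thesis .
  qed
  have fS: "finite ?S" by simp
  have "(\<Sum>k<l. if St k x then G k x * al k x else 0) = (\<Sum>k\<in>?S. G k x * al k x)"
   using al0 by (intro sum.mono_neutral_cong_right) (auto simp: less_le)
  also have "\<dots> \<le> (\<Sum>k\<in>?S. c * ((1 / 2) ^ r k * \<zeta> ^ i k))" by (intro sum_mono trm)
  also have "\<dots> = c * (\<Sum>k\<in>?S. (\<lambda>(r, i). (1 / 2) ^ r * \<zeta> ^ i) (r k, i k))" by (simp add: sum_distrib_left)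
  also have "(\<Sum>k\<in>?S. (\<lambda>(r, i). (1 / 2) ^ r * \<zeta> ^ i) (r k, i k)) = (\<Sum>(r, i)\<in>(\<lambda>k. (r k, i k)) ` ?S. (1 / 2) ^ r * \<zeta> ^ i)"
   using inj by (simp add: sum.reindex)
  also have "\<dots> \<le> (\<Sum>(r, i)\<in>r ` ?S \<times> i ` ?S. (1 / 2) ^ r * \<zeta> ^ i)" using z by (intro sum_mono2) auto
  also have "\<dots> = (\<Sum>r\<in>r ` ?S. (1 / 2) ^ r) * (\<Sum>i\<in>i ` ?S. \<zeta> ^ i)" by (simp add: sum_product sum.cartesian_product)
  also have "\<dots> \<le> 2 * (1 / (1 - \<zeta>))"
  proof (intro mult_mono)
   show "(\<Sum>r\<in>r ` ?S. (1 / 2) ^ r) \<le> (2 :: real)"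
    using sum_le_suminf[OF summable_geometric[of "1 / 2 :: real"], of "r ` ?S"] suminf_geometric[of "1 / 2 :: real"] by simp
   show "(\<Sum>i\<in>i ` ?S. \<zeta> ^ i) \<le> 1 / (1 - \<zeta>)"
    using sum_le_suminf[OF summable_geometric[of \<zeta>], of "i ` ?S"] suminf_geometric[of \<zeta>] z by simp
  qed (use z in \<open>auto intro: sum_nonneg\<close>)
  finally have "(\<Sum>k<l. if St k x then G k x * al k x else 0) \<le> c * (2 * (1 / (1 - \<zeta>)))" using c by simp
  also have "\<dots> = \<kappa>" using z by (simp add: c_def)
  finally show ?thesis .
 qed
 then show ?thesis
  using Em mE unfolding cgs_def u_def X_def c_def \<zeta>_def by blast
qed

section \<open>The L log L maximal function\<close>

lemma log_plus_nonneg: "0 \<le> log_plus s" by (simp add: log_plus_def)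

lemma log_plus_mono: "s \<le> t ==> log_plus s \<le> log_plus t" by (auto simp: log_plus_def)

lemma Phi_ge: "0 \<le> s ==> s \<le> Phi s"
 using mult_left_mono[of 1 "1 + log_plus s" s] log_plus_nonneg[of s] by (simp add: Phi_def)

lemma Phi_borel [measurable]: "Phi \<in> borel_fun"
proof -
 have "Phi = (\<lambda>s. s * (1 + (if s \<le> 1 then 0 else ln s)))" by (auto simp: Phi_def log_plus_def)
 also have "\<dots> \<in> borel_fun" by measurable
 finally show ?thesis .
qed

lemma Phi_funpow_borel [measurable]: "(Phi ^^ k) \<in> borel_fun"
 by (induction k) (auto simp: o_def intro: measurable_compose[OF _ Phi_borel])

lemma Phi_mono: "0 \<le> s ==> s \<le> t ==> Phi s \<le> Phi t"
 unfolding Phi_def using log_plus_mono log_plus_nonneg by (intro mult_mono add_mono) (auto simp: add_nonneg_nonneg)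

lemma Phi_funpow_mono: "0 \<le> s ==> s \<le> t ==> 0 \<le> (Phi ^^ k) s \<and> (Phi ^^ k) s \<le> (Phi ^^ k) t"
proof (induction k)
 case (Suc k)
 then show ?case using Phi_ge[of "(Phi ^^ k) s"] Phi_mono[of "(Phi ^^ k) s" "(Phi ^^ k) t"] by auto
qed simp

lemma Phi_funpow_ge: "0 \<le> s ==> s * (1 + log_plus s) ^ k \<le> (Phi ^^ k) s"
proof (induction k)
 case (Suc k)
 let ?v = "(Phi ^^ k) s"
 have "s * 1 \<le> s * (1 + log_plus s) ^ k" using Suc.prems log_plus_nonneg[of s] by (intro mult_left_mono one_le_power) auto
 then have v: "s \<le> ?v" using Suc by simp
 have "s * (1 + log_plus s) ^ Suc k = s * (1 + log_plus s) ^ k * (1 + log_plus s)" by simp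
 also have "\<dots> \<le> ?v * (1 + log_plus ?v)"
  using Suc v log_plus_mono[OF v] log_plus_nonneg[of s] by (intro mult_mono) auto
 finally show ?case by (simp add: Phi_def[of ?v])
qed simp

text \<open>Young's inequality for L log L and exp; for u > 1 it is 1 + x \<le> exp x at x = t - ln
  u.\<close>

lemma Phi_young:
 assumes "0 \<le> u" "0 \<le> t" shows "t * u \<le> Phi u + exp t"
proof (cases "u \<le> 1")
 case True
 have "t * u \<le> t * 1" using True assms by (intro mult_left_mono) auto
 also have "\<dots> \<le> exp t" using exp_ge_add_one_self[of t] by linarith
 finally show ?thesis using Phi_ge[OF assms(1)] assms by simp
next
 case False
 have "u * (t - ln u) \<le> u * exp (t - ln u)" using False exp_ge_add_one_self[of "t - ln u"] by (intro mult_left_mono) linarith+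
 also have "\<dots> = exp t" using False by (simp add: exp_diff)
 finally show ?thesis using False by (simp add: Phi_def log_plus_def algebra_simps)
qed

text \<open>Lower bound for the quotient of \<open>(Phi ^^ k) u\<close> and \<open>Phi (u / t)\<close>. With as many factors as slots, the product of the bounds
 dominates a power of \<open>\<Prod>j. t j\<close> near 0; this turns the product of L log L averages into the right hand side of the theorem.\<close>

definition hh :: "nat => real => real" where
 "hh k t = t * (1 + log_plus t) ^ (k - 1) / (1 + log_plus (1 / t))"

lemma hh_pos: "0 < t ==> 0 < hh k t"
 unfolding hh_def using log_plus_nonneg[of t] log_plus_nonneg[of "1 / t"] by (intro divide_pos_pos mult_pos_pos zero_less_power) auto

text \<open>log(u/t) \<le> log+ u + log+ (1/t), and 1 + a + b \<le> (1 + a)(1 + b). One of the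
  \<open>k\<close> logarithms of \<open>u\<close> is spent here; the other k - 1 are bounded below
  by those of \<open>t\<close>.\<close>

lemma hh_Phi:
 assumes t: "0 < t" "t < u" and k: "0 < k" shows "hh k t * Phi (u / t) \<le> (Phi ^^ k) u"
proof -
 have l: "ln (u / t) \<le> log_plus u + log_plus (1 / t)"
  using t ln_div[of u t] ln_div[of 1 t] ln_le_zero_iff[of u] by (auto simp: log_plus_def)
 have "1 + ln (u / t) \<le> (1 + log_plus u) * (1 + log_plus (1 / t))"
  using l mult_nonneg_nonneg[OF log_plus_nonneg[of u] log_plus_nonneg[of "1 / t"]] by (simp add: algebra_simps)
 then have "(1 + ln (u / t)) / (1 + log_plus (1 / t)) \<le> 1 + log_plus u"
  using log_plus_nonneg[of "1 / t"] by (subst pos_divide_le_eq) auto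
 moreover have "(1 + log_plus t) ^ (k - 1) \<le> (1 + log_plus u) ^ (k - 1)"
  using t log_plus_mono[of t u] log_plus_nonneg[of t] by (intro power_mono) auto
 moreover have "0 \<le> ln (u / t)" using t by simp
 ultimately have "u * ((1 + log_plus t) ^ (k - 1) * ((1 + ln (u / t)) / (1 + log_plus (1 / t)))) \<le> u * ((1 + log_plus u) ^ (k - 1) * (1 + log_plus u))"
  using t log_plus_nonneg[of u] log_plus_nonneg[of "1 / t"] by (intro mult_left_mono mult_mono) auto
 also have "\<dots> = u * (1 + log_plus u) ^ k" using k by (cases k) auto
 also have "\<dots> \<le> (Phi ^^ k) u" using t by (intro Phi_funpow_ge) auto
 also have "u * ((1 + log_plus t) ^ (k - 1) * ((1 + ln (u / t)) / (1 + log_plus (1 / t)))) = hh k t * Phi (u / t)"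
  using t by (simp add: hh_def Phi_def log_plus_def)
 finally show ?thesis .
qed

text \<open>With c the sum of the positive logarithms, each denominator is at most (1 + c)/s. If
  some t_j \<ge> 1, its denominator is 1, so only m - 1 factors 1 + c arise, and the numerators pay
  for them since 1 + c is at most the product of the 1 + log+ t_j. If all t_j < 1, then c =
  0.\<close>

lemma hh_prod:
 fixes t :: "'m::finite => real"
 assumes t: "\<And>j. 0 < t j" and s: "0 < s" "s \<le> 1" "s \<le> (PU j. t j)"
 shows "s ^ Suc CARD('m) \<le> (PU j. hh CARD('m) (t j))"
proof -
 let ?m = "CARD('m)"
 define c where "c = (\<Sum>j\<in>UNIV. log_plus (t j))"
 have c: "0 \<le> c" by (simp add: c_def sum_nonneg log_plus_nonneg)
 have lt: "log_plus (1 / t j) = log_plus (t j) - ln (t j)" for j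
  using t[of j] by (auto simp: log_plus_def ln_div)
 have b: "1 + log_plus (1 / t j) \<le> (1 + c) / s" for j
 proof -
  have "log_plus (1 / t j) \<le> (\<Sum>j\<in>UNIV. log_plus (1 / t j))" by (rule member_le_sum) (auto simp: log_plus_nonneg)
  also have "\<dots> = c - ln (PU j. t j)" unfolding lt c_def using ln_prod[of UNIV t] less_imp_neq[OF t] by (simp add: sum_subtractf)
  also have "\<dots> \<le> c - ln s" using s t by (simp add: prod_pos)
  finally have "log_plus (1 / t j) \<le> c - ln s" .
  moreover have "- ln s \<le> 1 / s - 1" using ln_le_minus_one[of "1 / s"] s by (simp add: ln_div)
  ultimately have "1 + log_plus (1 / t j) \<le> 1 / s + c" by simp
  also have "\<dots> \<le> 1 / s + c / s" using s c by (simp add: pos_le_divide_eq mult_left_le)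
  finally show ?thesis by (simp add: add_divide_distrib)
 qed
 have P: "1 + c \<le> (PU j. 1 + log_plus (t j))"
 proof -
  have "1 + (\<Sum>j\<in>J. log_plus (t j)) \<le> (\<Prod>j\<in>J. 1 + log_plus (t j))" if "finite J" for J
   using that
  proof induction
   case (insert j J)
   have "0 \<le> log_plus (t j) * (\<Sum>j\<in>J. log_plus (t j))" by (intro mult_nonneg_nonneg sum_nonneg log_plus_nonneg)
   then have "1 + (\<Sum>i\<in>insert j J. log_plus (t i)) \<le> (1 + log_plus (t j)) * (1 + (\<Sum>j\<in>J. log_plus (t j)))"
    using insert by (simp add: algebra_simps)
   also have "\<dots> \<le> (1 + log_plus (t j)) * (\<Prod>j\<in>J. 1 + log_plus (t j))"
    using insert log_plus_nonneg[of "t j"] by (intro mult_left_mono) auto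
   finally show ?case using insert by simp
  qed simp
  then show ?thesis by (simp add: c_def)
 qed
 have N: "(PU j. 1 + log_plus (1 / t j)) \<le> (1 + c) ^ (?m - 1) / s ^ ?m"
 proof (cases "\<exists>j. 1 \<le> t j")
  case True
  then obtain j where j: "1 \<le> t j" by blast
  have "(PU j. 1 + log_plus (1 / t j)) = (1 + log_plus (1 / t j)) * (\<Prod>i\<in>UNIV - {j}. 1 + log_plus (1 / t i))" by (rule prod.remove) auto
  also have "log_plus (1 / t j) = 0" using j by (simp add: log_plus_def)
  also have "(\<Prod>i\<in>UNIV - {j}. 1 + log_plus (1 / t i)) \<le> (\<Prod>i\<in>UNIV - {j}. (1 + c) / s)"
   using b log_plus_nonneg by (intro prod_mono) auto
  finally have "(PU j. 1 + log_plus (1 / t j)) \<le> ((1 + c) / s) ^ (?m - 1)" by (simp add: card_Diff_singleton)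
  also have "\<dots> = (1 + c) ^ (?m - 1) / s ^ (?m - 1)" by (simp add: power_divide)
  also have "\<dots> \<le> (1 + c) ^ (?m - 1) / s ^ ?m" using s c by (intro divide_left_mono power_decreasing) auto
  finally show ?thesis .
 next
  case False
  then have "c = 0" by (simp add: c_def log_plus_def not_le less_imp_le)
  have "(PU j. 1 + log_plus (1 / t j)) \<le> (\<Prod>j\<in>(UNIV :: 'm set). (1 + c) / s)" using b log_plus_nonneg by (intro prod_mono) auto
  then show ?thesis by (simp add: \<open>c = 0\<close> power_divide)
 qed
 have N0: "0 < (PU j. 1 + log_plus (1 / t j))" by (intro prod_pos) (simp add: add_pos_nonneg log_plus_nonneg)
 have "s ^ Suc ?m = s * (1 + c) ^ (?m - 1) / ((1 + c) ^ (?m - 1) / s ^ ?m)" using s c by simp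
 also have "\<dots> \<le> s * (1 + c) ^ (?m - 1) / (PU j. 1 + log_plus (1 / t j))"
  using N N0 s c by (intro divide_left_mono mult_pos_pos divide_pos_pos mult_nonneg_nonneg) auto
 also have "\<dots> \<le> (PU j. t j) * (PU j. 1 + log_plus (t j)) ^ (?m - 1) / (PU j. 1 + log_plus (1 / t j))"
  using P c s N0 t by (intro divide_right_mono mult_mono power_mono) (auto intro!: prod_nonneg less_imp_le)
 also have "\<dots> = (PU j. hh ?m (t j))" by (simp add: hh_def prod.distrib prod_dividef prod_power_distrib)
 finally show ?thesis .
qed

text \<open>Chosen so that a weighted average equal to \<open>Lam\<close> forces the integral of
  \<open>Phi\<close>, relative to the dyadic cube, to be at least twice the volume ratio (31 n)^n of
  the enlarged cube.\<close>

definition Lam :: "nat => real => real" where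
 "Lam n \<theta> = (1 + 1 / \<theta>) * (2 * (31 * real n) ^ n) + 7 / \<theta> * (31 * real n) ^ n"

lemma Lam_ge: "0 < \<theta> ==> 0 < n ==> 1 \<le> Lam n \<theta>"
proof -
 assume *: "0 < \<theta>" "0 < n"
 have "1 \<le> (31 * real n) ^ n" using * by (intro one_le_power) linarith
 then have "1 * 1 \<le> (1 + 1 / \<theta>) * (2 * (31 * real n) ^ n)" using * by (intro mult_mono) auto
 moreover have "0 \<le> 7 / \<theta> * (31 * real n) ^ n" using * by simp
 ultimately show ?thesis by (simp add: Lam_def)
qed

lemma DB_subset_big:
 assumes L: "0 < L" and y: "dist (dlo a L k x) y \<le> 15 * sd a L k"
 shows "y \<in> hcube (bcor a L k x) (31 * sd a L k)"
proof -
 have "norm (y - dlo a L k x) \<le> 15 * sd a L k" using y by (simp add: dist_norm norm_minus_commute)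
 then have "\<bar>y $ i - dlo a L k x $ i\<bar> \<le> 15 * sd a L k" for i
  using component_le_norm_cart[of "y - dlo a L k x" i] by simp
 then have "dlo a L k x $ i - 15 * sd a L k \<le> y $ i \<and> y $ i \<le> dlo a L k x $ i + 15 * sd a L k" for i
  by (auto simp: abs_le_iff algebra_simps)
 moreover have "bcor a L k x $ i = dlo a L k x $ i - 15 * sd a L k" for i by (simp add: bcor_def)
 ultimately have "bcor a L k x $ i \<le> y $ i" "y $ i < bcor a L k x $ i + 31 * sd a L k" for i
  using sd_pos[OF L, of a k] by (simp_all add: order_le_less_trans[of _ "dlo a L k x $ i + 15 * sd a L k"])
 then show ?thesis by (simp add: hcube_def)
qed

lemma big_measure:
 fixes a :: "real ^ 'n::finite"
 shows "(31 * sd a L k) ^ CARD('n) = (31 * real CARD('n)) ^ CARD('n) * (L / 2 ^ k) ^ CARD('n)"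
 by (simp only: sd_def power_mult_distrib mult.assoc)

text \<open>Scale so that the weighted average is \<open>Lam\<close>. Young's inequality moves the
  factor |b - c| into an exponential integral bounded by \<open>expint\<close>; the rest bounds the
  integral of \<open>Phi\<close> of the rescaled function from below, and \<open>hh_Phi\<close>
  converts it to \<open>Phi ^^ N\<close>.\<close>

lemma alp_Phi_lower:
 fixes b f :: "'n::finite cfun"
 assumes L: "0 < L" and [measurable]: "b \<in> borel_fun" and f: "integrable lborel f" "integrable lborel (\<lambda>y. b y * f y)"
  and \<theta>: "0 < \<theta>" and JN: "expint \<theta> b"
  and al: "0 < alp b f a L k x" and N: "0 < N"
 shows "ennreal (hh N (alp b f a L k x / Lam CARD('n) \<theta>) * (L / 2 ^ k) ^ CARD('n))
  \<le> (NN y. ennreal ((Phi ^^ N) (norm (f y))) * indicator (DB a L k x) y)"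
proof -
 have [measurable]: "f \<in> borel_fun" using borel_measurable_integrable[OF f(1)] by simp
 let ?l = "(L / 2 ^ k) ^ CARD('n)" let ?\<Lambda> = "Lam CARD('n) \<theta>" let ?c = "cav b a L k x" let ?D = "DB a L k x"
 let ?H = "hcube (bcor a L k x) (31 * sd a L k)"
 define V where "V = (31 * real CARD('n)) ^ CARD('n)"
 have V: "1 \<le> V" unfolding V_def by (intro one_le_power) (use zero_less_card_finite[where 'a = 'n] in linarith)
 have \<Lambda>: "1 \<le> ?\<Lambda>" using Lam_ge[OF \<theta>] by simp
 define t where "t = alp b f a L k x / ?\<Lambda>"
 have t: "0 < t" using al \<Lambda> by (simp add: t_def)
 have l: "0 < ?l" using L by simp
 have s: "0 < 31 * sd a L k" using sd_pos[OF L] by simp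
 have DH: "y \<in> ?H" if "y \<in> ?D" for y
  using that sd_pos[OF L, of a k] by (intro DB_subset_big[OF L]) (auto simp: DB_def)
 let ?u = "\<lambda>y. norm (f y) / t"
 let ?I = "NN y. ennreal (Phi (?u y)) * indicator ?D y"
 let ?J = "NN y. ennreal (Phi (?u y)) * indicator (?D \<inter> {y. t < norm (f y)}) y"
 have P0: "0 \<le> Phi (?u y)" for y using Phi_ge[of "?u y"] t by (simp add: order_trans[rotated])
 have "ennreal (?\<Lambda> * ?l) = ennreal (1 / t * (alp b f a L k x * ?l))" using al by (simp add: t_def)
 also have "\<dots> = ennreal (1 / t) * ennreal (alp b f a L k x * ?l)" using t al l by (intro ennreal_mult) (auto simp: less_imp_le)
 also have "\<dots> = (NN y. ennreal (1 / t) * (ennreal ((1 + norm (b y - ?c)) * norm (f y)) * indicator ?D y))"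
  by (subst nn_integral_cmult) (measurable, simp add: ennreal_alp[OF L f])
 also have "\<dots> \<le> (NN y. ennreal (1 + 1 / \<theta>) * (ennreal (Phi (?u y)) * indicator ?D y) + ennreal (1 / \<theta>) * (ennreal (exp (\<theta> * norm (b y - ?c))) * indicator ?H y))"
 proof (rule nn_integral_mono)
  fix y
  have "(1 + norm (b y - ?c)) * ?u y = ?u y + 1 / \<theta> * (\<theta> * norm (b y - ?c) * ?u y)" using \<theta> by (simp add: distrib_right add_divide_distrib)
  also have "\<dots> \<le> Phi (?u y) + 1 / \<theta> * (Phi (?u y) + exp (\<theta> * norm (b y - ?c)))"
   using \<theta> t by (intro add_mono Phi_ge mult_left_mono Phi_young) auto
  finally have "1 / t * ((1 + norm (b y - ?c)) * norm (f y)) \<le> (1 + 1 / \<theta>) * Phi (?u y) + 1 / \<theta> * exp (\<theta> * norm (b y - ?c))"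
   by (simp add: algebra_simps)
  then have "ennreal (1 / t * ((1 + norm (b y - ?c)) * norm (f y))) \<le> ennreal ((1 + 1 / \<theta>) * Phi (?u y) + 1 / \<theta> * exp (\<theta> * norm (b y - ?c)))"
   by (rule ennreal_leI)
  also have "\<dots> = ennreal (1 + 1 / \<theta>) * ennreal (Phi (?u y)) + ennreal (1 / \<theta>) * ennreal (exp (\<theta> * norm (b y - ?c)))"
  proof -
   have "ennreal ((1 + 1 / \<theta>) * Phi (?u y)) = ennreal (1 + 1 / \<theta>) * ennreal (Phi (?u y))" using \<theta> P0 by (intro ennreal_mult) auto
   moreover have "ennreal (1 / \<theta> * exp (\<theta> * norm (b y - ?c))) = ennreal (1 / \<theta>) * ennreal (exp (\<theta> * norm (b y - ?c)))" using \<theta> by (intro ennreal_mult) auto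
   ultimately show ?thesis using \<theta> P0[of y] by (subst ennreal_plus) (auto simp del: ennreal_plus)
  qed
  finally show "ennreal (1 / t) * (ennreal ((1 + norm (b y - ?c)) * norm (f y)) * indicator ?D y)
   \<le> ennreal (1 + 1 / \<theta>) * (ennreal (Phi (?u y)) * indicator ?D y) + ennreal (1 / \<theta>) * (ennreal (exp (\<theta> * norm (b y - ?c))) * indicator ?H y)"
   using DH[of y] t by (cases "y \<in> ?D") (auto simp: ennreal_mult[symmetric] simp del: ennreal_plus)
 qed
 also have "\<dots> = ennreal (1 + 1 / \<theta>) * ?I + ennreal (1 / \<theta>) * (NN y. ennreal (exp (\<theta> * norm (b y - ?c))) * indicator ?H y)"
  by (subst nn_integral_add) (measurable, simp add: nn_integral_cmult)
 also have "\<dots> \<le> ennreal (1 + 1 / \<theta>) * ?I + ennreal (1 / \<theta>) * ennreal (7 * (31 * sd a L k) ^ CARD('n))"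
  unfolding cav_def by (intro add_left_mono mult_left_mono JN[unfolded expint_def, rule_format] s) simp
 also have "\<dots> = ennreal (1 + 1 / \<theta>) * ?I + ennreal (7 / \<theta> * V * ?l)"
  unfolding big_measure V_def[symmetric] using \<theta> V l by (simp add: ennreal_mult[symmetric] mult.assoc)
 finally have I1: "ennreal (?\<Lambda> * ?l) \<le> ennreal (1 + 1 / \<theta>) * ?I + ennreal (7 / \<theta> * V * ?l)" .
 have I: "ennreal (2 * V * ?l) \<le> ?I"
 proof (rule ccontr)
  assume "\<not> ?thesis"
  then have lt: "?I < ennreal (2 * V * ?l)" by simp
  then obtain i where i: "?I = ennreal i" "0 \<le> i" by (cases ?I) auto
  then have "i < 2 * V * ?l" using lt by (simp add: ennreal_less_iff)
  then have "(1 + 1 / \<theta>) * i < (1 + 1 / \<theta>) * (2 * V * ?l)" using \<theta> by (intro mult_strict_left_mono) (auto simp: add_pos_pos)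
  moreover have "?\<Lambda> * ?l \<le> (1 + 1 / \<theta>) * i + 7 / \<theta> * V * ?l"
  proof -
   have "0 \<le> (1 + 1 / \<theta>) * i" "0 \<le> 7 / \<theta> * V * ?l" using i(2) \<theta> V l by auto
   then show ?thesis using I1 unfolding i(1) using \<theta> i(2) by (subst (asm) ennreal_mult[symmetric]) (auto simp flip: ennreal_plus)
  qed
  moreover have "?\<Lambda> * ?l = (1 + 1 / \<theta>) * (2 * V * ?l) + 7 / \<theta> * V * ?l" by (simp add: Lam_def V_def algebra_simps)
  ultimately show False by linarith
 qed
 \<comment> \<open>Where |f| \<le> t the rescaled \<open>Phi\<close> is at most 1, so these points
   take away at most the volume of the enlarged cube, half of the lower bound for \<open>?I\<close>.
   \<open>hh_Phi\<close> asks for |f| > t.\<close>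
 have "?I \<le> (NN y. ennreal (Phi (?u y)) * indicator (?D \<inter> {y. t < norm (f y)}) y + indicator ?H y)"
 proof (rule nn_integral_mono)
  fix y
  have "ennreal (Phi (?u y)) \<le> 1" if "norm (f y) \<le> t" using that t by (simp add: Phi_def log_plus_def)
  then show "ennreal (Phi (?u y)) * indicator ?D y \<le> ennreal (Phi (?u y)) * indicator (?D \<inter> {y. t < norm (f y)}) y + indicator ?H y"
   using DH[of y] by (cases "y \<in> ?D"; cases "norm (f y) \<le> t") auto
 qed
 also have "\<dots> = ?J + ennreal (V * ?l)"
 proof (subst nn_integral_add)
  have "vol ?H = ennreal (V * ?l)" by (rule emeasure_hcube[OF less_imp_le[OF s], of "bcor a L k x", unfolded big_measure, folded V_def])
  then show "?J + (NN y. indicator ?H y) = ?J + ennreal (V * ?l)" by (simp only: nn_integral_indicator hcube_borel sets_lborel)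
 qed measurable
 finally have IJ: "?I \<le> ?J + ennreal (V * ?l)" .
 have J: "ennreal ?l \<le> ?J"
 proof (rule ccontr)
  assume "\<not> ?thesis"
  then have "?J < ennreal ?l" by (simp only: not_le)
  also have "ennreal ?l \<le> ennreal (V * ?l)" using V l by (intro ennreal_leI) simp
  finally have "?J < ennreal (V * ?l)" .
  then have "?J + ennreal (V * ?l) < ennreal (V * ?l) + ennreal (V * ?l)" by (rule ennreal_add_less_le) (simp_all add: ennreal_less_top)
  also have "\<dots> = ennreal (2 * V * ?l)" using V l by (subst ennreal_plus[symmetric]) auto
  finally have "?J + ennreal (V * ?l) < ennreal (2 * V * ?l)" .
  with leD[OF order_trans[OF I IJ]] show False by (rule notE)
 qed
 have "ennreal (hh N t * ?l) = ennreal (hh N t) * ennreal ?l" using hh_pos[OF t] l by (intro ennreal_mult) (auto simp: less_imp_le)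
 also have "\<dots> \<le> ennreal (hh N t) * ?J" by (intro mult_left_mono J) simp
 also have "\<dots> = (NN y. ennreal (hh N t) * (ennreal (Phi (?u y)) * indicator (?D \<inter> {y. t < norm (f y)}) y))"
  by (rule nn_integral_cmult[symmetric]) measurable
 also have "\<dots> \<le> (NN y. ennreal ((Phi ^^ N) (norm (f y))) * indicator ?D y)"
 proof (rule nn_integral_mono)
  fix y
  show "ennreal (hh N t) * (ennreal (Phi (?u y)) * indicator (?D \<inter> {y. t < norm (f y)}) y) \<le> ennreal ((Phi ^^ N) (norm (f y))) * indicator ?D y"
   using hh_Phi[OF t _ N, of "norm (f y)"] hh_pos[OF t, of N] P0[of y]
   by (auto simp: indicator_def ennreal_mult[symmetric] less_imp_le intro!: ennreal_leI)
 qed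
 finally show ?thesis by (simp add: t_def)
qed

text \<open>Each g_j is at most N_j times the sum of all quotients. The product over slots becomes a
  sum of measures, which is additive over disjoint balls.\<close>

lemma geo_mean_le:
 fixes g N :: "'m::finite => real"
 assumes g: "\<And>j. 0 \<le> g j" and N: "\<And>j. 0 < N j"
 shows "(PU j. g j) powr (1 / CARD('m)) \<le> (PU j. N j) powr (1 / CARD('m)) * (\<Sum>j\<in>UNIV. g j / N j)"
proof -
 let ?s = "\<Sum>j\<in>UNIV. g j / N j"
 have s: "0 \<le> ?s" using g N by (intro sum_nonneg) (simp add: less_imp_le)
 have "g j \<le> N j * ?s" for j
 proof -
  have "g j / N j \<le> ?s" by (rule member_le_sum) (use g N in \<open>auto simp: less_imp_le\<close>)
  then show ?thesis using N[of j] by (simp add: field_simps)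
 qed
 then have "(PU j. g j) \<le> (PU j. N j * ?s)" using g by (intro prod_mono) auto
 then have "(PU j. g j) powr (1 / CARD('m)) \<le> (PU j. N j * ?s) powr (1 / CARD('m))"
  using g by (intro powr_mono2 prod_nonneg) auto
 also have "(PU j. N j * ?s) = (PU j. N j) * ?s ^ CARD('m)" by (simp add: prod.distrib)
 also have "\<dots> powr (1 / CARD('m)) = (PU j. N j) powr (1 / CARD('m)) * (?s ^ CARD('m)) powr (1 / CARD('m))"
  by (rule powr_mult)
 also have "(?s ^ CARD('m)) powr (1 / CARD('m)) = ?s"
  using s by (cases "?s = 0") (auto simp: powr_realpow[symmetric] powr_powr)
 finally show ?thesis .
qed

text \<open>The A(1,...,1) condition for Borel data: the positive lower bounds \<open>e\<close>
  replace the essential infima and \<open>w\<close> stands for \<nu>. The lower bound for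
  \<open>w\<close> is listed because the definition does not otherwise relate \<open>w\<close> to
  \<open>\<omega>\<close>.\<close>

definition Avec :: "real => ('m::finite => real ^ 'n::finite => ennreal) => (real ^ 'n => ennreal) => bool" where
 "Avec D \<omega> w \<longleftrightarrow> 1 \<le> D \<and> w \<in> borel_fun \<and> (\<forall>j. \<omega> j \<in> borel_fun) \<and> (\<forall>c r. 0 < r -->
   (\<exists>e. (\<forall>j. 0 < e j) \<and> (\<forall>j. AE y in lborel. y \<in> hcube c r --> ennreal (e j) \<le> \<omega> j y) \<and>
    (AE y in lborel. y \<in> hcube c r --> ennreal ((PU j. e j) powr (1 / CARD('m))) \<le> w y) \<and>
    wm w (hcube c r) \<le> ennreal (D * r ^ CARD('n) * (PU j. e j) powr (1 / CARD('m)))))"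

text \<open>On a cube \<open>w\<close> is at least the geometric mean of the e_j, and its mean is at
  most \<open>D\<close> times that number.\<close>

lemma Avec_A1m:
 fixes \<omega> :: "'m::finite => real ^ 'n::finite => ennreal"
 assumes "Avec D \<omega> w" shows "A1m D w"
 unfolding A1m_def
proof (intro conjI allI impI ballI)
 have D: "1 \<le> D" and wm [measurable]: "w \<in> borel_fun" using assms by (auto simp: Avec_def)
 then show "1 \<le> D" "w \<in> borel_fun" by auto
 fix c :: "real ^ 'n" and r :: real assume r: "0 < r"
 obtain e :: "'m => real" where ae: "AE y in lborel. y \<in> hcube c r --> ennreal ((PU j. e j) powr (1 / CARD('m))) \<le> w y"
  and le: "wm w (hcube c r) \<le> ennreal (D * r ^ CARD('n) * (PU j. e j) powr (1 / CARD('m)))"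
  using assms r unfolding Avec_def by meson
 let ?e = "(PU j. e j) powr (1 / CARD('m))"
 show "wm w (hcube c r) < \<infinity>" using le by (rule le_less_trans) simp
 fix E assume [measurable]: "E \<in> sets borel" and E: "E \<subseteq> hcube c r"
 have "wm w (hcube c r) * vol E \<le> ennreal (D * r ^ CARD('n) * ?e) * vol E"
  by (intro mult_right_mono le) simp
 also have "\<dots> = ennreal (D * r ^ CARD('n)) * (NN y. ennreal ?e * indicator E y)"
  using D r by (subst ennreal_mult) (auto simp: nn_integral_cmult_indicator mult.assoc)
 also have "(NN y. ennreal ?e * indicator E y) \<le> (NN y. w y * indicator E y)"
  using ae by (intro nn_integral_mono_AE) (elim eventually_mono, use E in \<open>auto simp: indicator_def\<close>)
 also have "\<dots> = wm w E" by (subst emeasure_density) auto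
 finally show "wm w (hcube c r) * vol E \<le> ennreal (D * r ^ CARD('n)) * wm w E"
  by (simp add: mult_left_mono)
qed

text \<open>Vitali selects disjoint balls \<open>DB\<close>. For each, \<open>alp_Phi_lower\<close>
  and \<open>hh_prod\<close> bound the weight of the enlarged cube by the masses of the slots in the
  ball; \<open>geo_mean_le\<close> makes the bound linear in these masses, so it can be
  summed.\<close>

lemma maximal_weak_type:
 fixes \<omega> :: "'m::finite => real ^ 'n::finite => ennreal" and b f :: "'m => 'n cfun" and \<theta> :: real
 defines "C \<equiv> real CARD('m) * (31 * real CARD('n)) ^ CARD('n) * Lam CARD('n) \<theta> ^ (2 * CARD('m))"
 assumes A: "Avec D \<omega> w" and L: "0 < L" and bm: "\<And>j. b j \<in> borel_fun"
  and f: "\<And>j. integrable lborel (f j)" "\<And>j. integrable lborel (\<lambda>y. b j y * f j y)"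
  and \<theta>: "0 < \<theta>" and JN: "\<And>j. expint \<theta> (b j)"
  and N: "\<And>j. 0 < N j" "\<And>j. (NN y. ennreal ((Phi ^^ CARD('m)) (norm (f j y))) * \<omega> j y) \<le> ennreal (N j)"
  and s: "0 < s" "s \<le> 1"
 shows "wm w {x \<in> hcube a L. \<exists>l. s < (PU j. alp (b j) (f j) a L l x)}
   \<le> ennreal (C * D * (PU j. N j) powr (1 / CARD('m)) / s\<^sup>2)"
proof -
 let ?m = "CARD('m)" let ?n = "CARD('n)" let ?\<Lambda> = "Lam ?n \<theta>"
 define V where "V = (31 * real ?n) ^ ?n"
 define P where "P = (PU j. N j) powr (1 / ?m)"
 define \<kappa> where "\<kappa> = D * V * P * ?\<Lambda> ^ (2 * ?m) / s\<^sup>2"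
 have D: "1 \<le> D" and wm [measurable]: "w \<in> borel_fun" and om [measurable]: "\<omega> j \<in> borel_fun" for j using A by (auto simp: Avec_def)
 have [measurable]: "f j \<in> borel_fun" for j using borel_measurable_integrable[OF f(1)] by simp
 have \<Lambda>: "1 \<le> ?\<Lambda>" using Lam_ge[OF \<theta>] by simp
 have V0: "0 \<le> V" by (simp add: V_def)
 have \<kappa>: "0 \<le> \<kappa>" using D V0 \<Lambda> by (simp add: \<kappa>_def P_def)
 let ?F = "\<lambda>j y. ennreal ((Phi ^^ ?m) (norm (f j y))) * \<omega> j y"
 let ?H = "\<lambda>k x. hcube (bcor a L k x) (31 * sd a L k)"
 have cube: "wm w (?H k x) \<le> (\<Sum>j\<in>UNIV. ennreal (\<kappa> / N j) * emeasure (density lborel (?F j)) (DB a L k x))"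
  if big: "s < (PU j. alp (b j) (f j) a L k x)" for k x
 proof -
  let ?l = "(L / 2 ^ k) ^ ?n" let ?X = "\<lambda>j. emeasure (density lborel (?F j)) (DB a L k x)"
  define t where "t j = alp (b j) (f j) a L k x / ?\<Lambda>" for j
  have l: "0 < ?l" using L by simp
  have al: "0 < alp (b j) (f j) a L k x" for j
  proof -
   have "(PU j. alp (b j) (f j) a L k x) \<noteq> 0" using big s by linarith
   then show ?thesis using alp_nonneg[OF L, of "b j" "f j" a k x] by (auto simp: less_le)
  qed
  then have t: "0 < t j" for j using \<Lambda> by (simp add: t_def)
  obtain e :: "'m => real" where e: "\<And>j. 0 < e j" "\<And>j. AE y in lborel. y \<in> ?H k x --> ennreal (e j) \<le> \<omega> j y"
   "wm w (?H k x) \<le> ennreal (D * (31 * sd a L k) ^ ?n * (PU j. e j) powr (1 / ?m))"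
  proof -
   have "0 < 31 * sd a L k" using sd_pos[OF L] by simp
   from A[unfolded Avec_def, THEN conjunct2, THEN conjunct2, THEN conjunct2, rule_format, OF this, of "bcor a L k x"] show thesis by (elim exE conjE, intro that) (erule spec, erule spec, assumption)
  qed
  have DH: "y \<in> ?H k x" if "y \<in> DB a L k x" for y
   using that sd_pos[OF L, of a k] by (intro DB_subset_big[OF L]) (auto simp: DB_def)
  have X: "ennreal (e j * (hh ?m (t j) * ?l)) \<le> ?X j" for j
  proof -
   have "ennreal (e j * (hh ?m (t j) * ?l)) = ennreal (e j) * ennreal (hh ?m (t j) * ?l)"
    using e(1)[of j] hh_pos[OF t, of ?m j] l by (intro ennreal_mult) (auto simp: less_imp_le)
   also have "\<dots> \<le> ennreal (e j) * (NN y. ennreal ((Phi ^^ ?m) (norm (f j y))) * indicator (DB a L k x) y)"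
    unfolding t_def by (intro mult_left_mono alp_Phi_lower[OF L bm f \<theta> JN al]) auto
   also have "\<dots> = (NN y. ennreal (e j) * (ennreal ((Phi ^^ ?m) (norm (f j y))) * indicator (DB a L k x) y))"
    by (rule nn_integral_cmult[symmetric]) measurable
   also have "\<dots> \<le> (NN y. ?F j y * indicator (DB a L k x) y)"
    using e(2)[of j] by (intro nn_integral_mono_AE) (elim eventually_mono, use DH in \<open>auto simp: indicator_def mult.commute mult_right_mono\<close>)
   also have "\<dots> = ?X j" by (subst emeasure_density) auto
   finally show ?thesis .
  qed
  have XN: "?X j \<le> ennreal (N j)" for j
  proof -
   have "?X j \<le> emeasure (density lborel (?F j)) (space (density lborel (?F j)))" by (rule emeasure_space)
   also have "\<dots> = (NN y. ?F j y)" by (subst emeasure_density) simp_all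
   finally show ?thesis using N(2)[of j] by simp
  qed
  define g where "g j = enn2real (?X j)" for j
  have g: "?X j = ennreal (g j)" "0 \<le> g j" for j using XN[of j] by (auto simp: g_def ennreal_enn2real le_less_trans[of _ "ennreal (N j)"])
  have ge: "e j * (hh ?m (t j) * ?l) \<le> g j" for j using X[of j] g by simp
  \<comment> \<open>The averages were divided by \<open>Lam\<close> in each of the \<open>m\<close>
    slots, and so the level of the product by its \<open>m\<close>-th power.\<close>
  define s' where "s' = s / ?\<Lambda> ^ ?m"
  have L1: "1 \<le> ?\<Lambda> ^ ?m" using \<Lambda> by (rule one_le_power)
  have s': "0 < s'" "s' \<le> 1" using s L1 by (simp_all add: s'_def)
  have "s' \<le> (PU j. t j)" using big L1 by (simp add: s'_def t_def prod_dividef divide_right_mono)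
  then have hp: "s' ^ Suc ?m \<le> (PU j. hh ?m (t j))" using hh_prod[of t] t s' by blast
  have e0: "0 \<le> (PU j. e j)" using e(1) by (simp add: prod_nonneg less_imp_le)
  have "(PU j. e j) * (s' ^ Suc ?m * ?l ^ ?m) \<le> (PU j. e j) * ((PU j. hh ?m (t j)) * ?l ^ ?m)"
   using e0 hp l by (intro mult_left_mono mult_right_mono) auto
  also have "\<dots> = (PU j. e j * (hh ?m (t j) * ?l))" by (simp only: prod.distrib prod_constant)
  also have "\<dots> \<le> (PU j. g j)"
   using ge e(1) hh_pos[OF t, of ?m] l by (intro prod_mono) (auto intro!: mult_nonneg_nonneg simp: less_imp_le)
  finally have "((PU j. e j) * (s' ^ Suc ?m * ?l ^ ?m)) powr (1 / ?m) \<le> (PU j. g j) powr (1 / ?m)"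
   using e0 s' l by (intro powr_mono2) auto
  also have "\<dots> \<le> P * (\<Sum>j\<in>UNIV. g j / N j)" unfolding P_def by (rule geo_mean_le[OF g(2) N(1)])
  also have "((PU j. e j) * (s' ^ Suc ?m * ?l ^ ?m)) powr (1 / ?m) = (PU j. e j) powr (1 / ?m) * (s' powr (real (Suc ?m) / ?m) * ?l)"
   using e0 s' l by (simp add: powr_mult powr_realpow[symmetric] powr_powr del: power_Suc of_nat_Suc)
  finally have 1: "(PU j. e j) powr (1 / ?m) * (s' powr (real (Suc ?m) / ?m) * ?l) \<le> P * (\<Sum>j\<in>UNIV. g j / N j)" .
  \<comment> \<open>The m-th root leaves the exponent (m + 1)/m, which is at most 2; as s' \<le> 1,
    the square is smaller.\<close>
  have "s'\<^sup>2 \<le> s' powr (real (Suc ?m) / ?m)"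
  proof -
   have "1 \<le> real ?m" by (simp add: Suc_leI)
   then have "real (Suc ?m) / ?m \<le> 2" by (subst pos_divide_le_eq) auto
   then have "s' powr 2 \<le> s' powr (real (Suc ?m) / ?m)" using s' by (intro powr_mono') auto
   then show ?thesis using s' by (simp add: powr_numeral)
  qed
  then have "(PU j. e j) powr (1 / ?m) * (s'\<^sup>2 * ?l) \<le> P * (\<Sum>j\<in>UNIV. g j / N j)"
   using l by (intro order_trans[OF _ 1] mult_left_mono mult_right_mono) auto
  then have "(PU j. e j) powr (1 / ?m) * ?l \<le> P * (\<Sum>j\<in>UNIV. g j / N j) / s'\<^sup>2"
   using s' by (subst pos_le_divide_eq) (auto simp: mult_ac)
  then have "D * V * ((PU j. e j) powr (1 / ?m) * ?l) \<le> D * V * (P * (\<Sum>j\<in>UNIV. g j / N j) / s'\<^sup>2)"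
   using D V0 by (intro mult_left_mono) auto
  also have "\<dots> = (\<Sum>j\<in>UNIV. \<kappa> / N j * g j)"
  proof -
   have "s'\<^sup>2 = s\<^sup>2 / ?\<Lambda> ^ (2 * ?m)" by (simp add: s'_def power_divide power_mult[symmetric] mult.commute)
   then show ?thesis by (simp add: \<kappa>_def sum_distrib_left sum_distrib_right sum_divide_distrib mult_ac)
  qed
  finally have 2: "D * (31 * sd a L k) ^ ?n * (PU j. e j) powr (1 / ?m) \<le> (\<Sum>j\<in>UNIV. \<kappa> / N j * g j)"
   unfolding big_measure V_def[symmetric] by (simp add: mult_ac)
  have kg: "0 \<le> \<kappa> / N j" for j using \<kappa> N(1)[of j] by simp
  have "wm w (?H k x) \<le> ennreal (\<Sum>j\<in>UNIV. \<kappa> / N j * g j)"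
   by (rule order_trans[OF e(3) ennreal_leI[OF 2]])
  also have "\<dots> = (\<Sum>j\<in>UNIV. ennreal (\<kappa> / N j * g j))" using kg g(2) by (intro sum_ennreal[symmetric]) (simp del: times_divide_eq_left)
  also have "\<dots> = (\<Sum>j\<in>UNIV. ennreal (\<kappa> / N j) * ?X j)" unfolding g(1) using kg g(2) by (intro sum.cong ennreal_mult refl)
  finally show ?thesis .
 qed
 define E where "E = {x \<in> hcube a L. \<exists>l. s < (PU j. alp (b j) (f j) a L l x)}"
 define k where "k x = (SOME l. s < (PU j. alp (b j) (f j) a L l x))" for x
 have k: "s < (PU j. alp (b j) (f j) a L (k x) x)" if "x \<in> E" for x
  using that unfolding E_def k_def by (auto intro: someI_ex)
 obtain I where I: "countable I" "I \<subseteq> E"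
   "pairwise (\<lambda>i j. disjnt (cball (dlo a L (k i) i) (3 * sd a L (k i))) (cball (dlo a L (k j) j) (3 * sd a L (k j)))) I"
   "E \<subseteq> (\<Union>i\<in>I. cball (dlo a L (k i) i) (5 * (3 * sd a L (k i))))"
 proof (rule Vitali_covering_lemma_cballs[where S = E and K = E and a = "\<lambda>x. dlo a L (k x) x" and r = "\<lambda>x. 3 * sd a L (k x)" and B = "3 * sd a L 0"])
  show "E \<subseteq> (\<Union>i\<in>E. cball (dlo a L (k i) i) (3 * sd a L (k i)))"
  proof
   fix i assume "i \<in> E"
   moreover have "i \<in> cball (dlo a L (k i) i) (3 * sd a L (k i))"
    using dist_dlo[OF L dy_self[of i a L "k i"]] sd_pos[OF L, of a "k i"] by simp
   ultimately show "i \<in> (\<Union>i\<in>E. cball (dlo a L (k i) i) (3 * sd a L (k i)))" by blast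
  qed
  show "0 < 3 * sd a L (k i) \<and> 3 * sd a L (k i) \<le> 3 * sd a L 0" for i
   using sd_pos[OF L, of a "k i"] sd_mono[OF L, of 0 "k i" a] by simp
 qed
 have disj: "disjoint_family_on (\<lambda>i. DB a L (k i) i) I"
  using I(3) by (auto simp: disjoint_family_on_def pairwise_def disjnt_def DB_def)
 have "wm w E \<le> wm w (\<Union>i\<in>I. ?H (k i) i)"
 proof (rule emeasure_mono)
  show "E \<subseteq> (\<Union>i\<in>I. ?H (k i) i)"
  proof
   fix x assume "x \<in> E"
   then obtain i where "i \<in> I" "x \<in> cball (dlo a L (k i) i) (5 * (3 * sd a L (k i)))" using I(4) by blast
   then show "x \<in> (\<Union>i\<in>I. ?H (k i) i)" using DB_subset_big[OF L, of a "k i" i x] by auto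
  qed
  show "(\<Union>i\<in>I. ?H (k i) i) \<in> sets (density lborel w)" using I(1) by (auto intro!: sets.countable_UN'')
 qed
 also have "\<dots> \<le> (\<integral>\<^sup>+i. wm w (?H (k i) i) \<partial>count_space I)" by (rule emeasure_UN_countable_le[OF I(1)]) simp
 also have "\<dots> \<le> (\<integral>\<^sup>+i. (\<Sum>j\<in>UNIV. ennreal (\<kappa> / N j) * emeasure (density lborel (?F j)) (DB a L (k i) i)) \<partial>count_space I)"
  using I(2) by (intro nn_integral_mono cube k) auto
 also have "\<dots> = (\<Sum>j\<in>UNIV. ennreal (\<kappa> / N j) * (\<integral>\<^sup>+i. emeasure (density lborel (?F j)) (DB a L (k i) i) \<partial>count_space I))"
  by (simp add: nn_integral_sum nn_integral_cmult)
 also have "\<dots> \<le> (\<Sum>j\<in>(UNIV :: 'm set). ennreal \<kappa>)"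
 proof (rule sum_mono)
  fix j
  have "(\<integral>\<^sup>+i. emeasure (density lborel (?F j)) (DB a L (k i) i) \<partial>count_space I) = emeasure (density lborel (?F j)) (\<Union>i\<in>I. DB a L (k i) i)"
   by (intro emeasure_UN_countable[symmetric] I(1) disj) simp
  also have "\<dots> \<le> emeasure (density lborel (?F j)) (space (density lborel (?F j)))" by (rule emeasure_space)
  also have "\<dots> = (NN y. ?F j y)" by (subst emeasure_density) simp_all
  finally have "ennreal (\<kappa> / N j) * (\<integral>\<^sup>+i. emeasure (density lborel (?F j)) (DB a L (k i) i) \<partial>count_space I) \<le> ennreal (\<kappa> / N j) * ennreal (N j)"
   using N(2)[of j] by (intro mult_left_mono) auto
  also have "\<dots> = ennreal \<kappa>" using \<kappa> N(1)[of j] by (simp add: ennreal_mult[symmetric])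
  finally show "ennreal (\<kappa> / N j) * (\<integral>\<^sup>+i. emeasure (density lborel (?F j)) (DB a L (k i) i) \<partial>count_space I) \<le> ennreal \<kappa>" .
 qed
 also have "\<dots> = ennreal (real ?m * \<kappa>)" using \<kappa> by (subst sum_ennreal) auto
 also have "real ?m * \<kappa> = C * D * P / s\<^sup>2" by (simp add: C_def \<kappa>_def V_def mult_ac)
 finally show ?thesis by (simp only: P_def E_def)
qed

text \<open>Exponential decay with ratio q beats any power: with v^N = 1/q, Bernoulli bounds 1 + k
  by a multiple of v^k, and q^k compensates its N-th power.\<close>

lemma JN_power:
 fixes b :: "'n::finite cfun" and N :: nat
 assumes w: "A1m D w" and b: "bmo b M" and N: "0 < N"
 shows "\<exists>C\<ge>1. \<forall>c r t. 0 < r --> 0 < t -->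
  wm w {y \<in> hcube c r. t < 1 + norm (b y - av b c r)} \<le> ennreal (C / t ^ N) * wm w (hcube c r)"
proof -
 define q where "q = 1 - 1 / (2 * D)"
 have D: "1 \<le> D" using w by (auto simp: A1m_def)
 have q: "0 < q" "q < 1" using D by (auto simp: q_def field_simps)
 define B where "B = 2 ^ (CARD('n) + 1) * M"
 have B: "0 < B" using b by (simp add: B_def bmo_def)
 define v where "v = (1 / q) powr (1 / N)"
 have "1 < v" using q N by (simp add: v_def gr_one_powr)
 \<comment> \<open>As d \<le> 1 and d \<le> v - 1, the Bernoulli bound 1 + k (v - 1) is at least d
   (1 + k).\<close>
 define d where "d = min 1 (v - 1)"
 have d: "0 < d" "d \<le> 1" "d \<le> v - 1" using \<open>1 < v\<close> by (auto simp: d_def)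
 define C where "C = ((1 + B) / d) ^ N"
 have C: "1 \<le> C" unfolding C_def using B d by (intro one_le_power) simp
 have vN: "(v ^ k) ^ N * q ^ k = 1" for k
 proof -
  have "v ^ N = 1 / q" using q N by (simp add: v_def powr_realpow[symmetric] powr_powr)
  then have "(v ^ k) ^ N = (1 / q) ^ k" by (metis mult.commute power_mult)
  then show ?thesis using q by (simp add: power_divide)
 qed
 show ?thesis
 proof (intro exI[of _ C] conjI allI impI C)
  fix c :: "real ^ 'n" and r t :: real assume r: "0 < r" and t: "0 < t"
  let ?E = "{y \<in> hcube c r. t < 1 + norm (b y - av b c r)}" let ?\<nu> = "density lborel w"
  show "emeasure ?\<nu> ?E \<le> ennreal (C / t ^ N) * emeasure ?\<nu> (hcube c r)"
  proof (cases "t \<le> 1")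
   case True
   then have "1 \<le> C / t ^ N" using C t power_le_one[of t N] by (simp add: pos_le_divide_eq)
   then have "1 * emeasure ?\<nu> (hcube c r) \<le> ennreal (C / t ^ N) * emeasure ?\<nu> (hcube c r)" by (intro mult_right_mono) auto
   moreover have "emeasure ?\<nu> ?E \<le> emeasure ?\<nu> (hcube c r)" by (rule emeasure_mono) auto
   ultimately show ?thesis by simp
  next
   case False
   define k where "k = nat \<lfloor>(t - 1) / B\<rfloor>"
   have "0 \<le> (t - 1) / B" using False B by simp
   then have k: "real k \<le> (t - 1) / B" "(t - 1) / B \<le> real k + 1" unfolding k_def by linarith+
   then have kB: "real k * B \<le> t - 1" "t \<le> 1 + B * (real k + 1)" using B by (simp_all add: pos_le_divide_eq pos_divide_le_eq mult.commute)
   have bm: "b \<in> borel_fun" and wm: "w \<in> borel_fun" using b w by (auto simp: bmo_def A1m_def)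
   note [measurable] = this
   have "emeasure ?\<nu> ?E \<le> emeasure ?\<nu> {y \<in> hcube c r. norm (b y - av b c r) > real k * (2 ^ (CARD('n) + 1) * M)}"
   proof (rule emeasure_mono)
    show "?E \<subseteq> {y \<in> hcube c r. norm (b y - av b c r) > real k * (2 ^ (CARD('n) + 1) * M)}"
     using kB(1) unfolding B_def[symmetric] by auto
    have "{y \<in> hcube c r. norm (b y - av b c r) > real k * (2 ^ (CARD('n) + 1) * M)} = hcube c r \<inter> {y. norm (b y - av b c r) > real k * (2 ^ (CARD('n) + 1) * M)}" by auto
    also have "\<dots> \<in> sets borel" by measurable
    finally show "{y \<in> hcube c r. norm (b y - av b c r) > real k * (2 ^ (CARD('n) + 1) * M)} \<in> sets ?\<nu>" by simp
   qed
   also have "\<dots> \<le> ennreal (q ^ k) * emeasure ?\<nu> (hcube c r)" unfolding q_def by (rule John_Nirenberg[OF w b r])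
   also have "q ^ k \<le> C / t ^ N"
   proof -
    have "(1 + real k) * d \<le> 1 + real k * (v - 1)" using d mult_left_mono[of d "v - 1" "real k"] by (simp add: algebra_simps)
    also have "\<dots> \<le> v ^ k" using Bernoulli_inequality[of "v - 1" k] \<open>1 < v\<close> by simp
    finally have kd: "(1 + real k) * d \<le> v ^ k" .
    have "t \<le> (1 + B) * (1 + real k)" using kB(2) B by (simp add: algebra_simps)
    also have "\<dots> = (1 + B) / d * ((1 + real k) * d)" using d by simp
    also have "\<dots> \<le> (1 + B) / d * v ^ k" using B d kd by (intro mult_left_mono) auto
    finally have "t ^ N \<le> ((1 + B) / d * v ^ k) ^ N" using t by (intro power_mono) auto
    then have "q ^ k * t ^ N \<le> q ^ k * (C * (v ^ k) ^ N)" using q unfolding C_def power_mult_distrib[symmetric] by (intro mult_left_mono) auto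
    also have "\<dots> = C" using vN[of k] by (simp add: mult_ac)
    finally show ?thesis using t by (simp add: pos_le_divide_eq)
   qed
   finally show ?thesis by (simp add: ennreal_leI mult_right_mono)
  qed
 qed
qed

section \<open>Distribution and integrability of the oscillation factors\<close>

lemma cav_borel [measurable]: "(\<lambda>x. cav b a L l x) \<in> borel_fun"
proof (rule measurableI)
 fix X :: "complex set"
 have "{x. cav b a L l x \<in> X} \<in> sets borel"
 proof (rule dy_pred_borel[of a L l])
  fix x y assume "y \<in> dy a L l x"
  then show "(cav b a L l y \<in> X) = (cav b a L l x \<in> X)" using cav_eq[of y a L l x b] by simp
 qed
 then show "(\<lambda>x. cav b a L l x) -` X \<inter> space borel \<in> sets borel" by (simp add: vimage_def)
qed simp

text \<open>If the product exceeds t, some factor exceeds t^(1/m), hence \<open>JN_power\<close>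
  with the power 5 m. The averages belong to the enlarged cube, and doubling returns to the dyadic
  one.\<close>

lemma G_dist:
 fixes b :: "'m::finite => 'n::finite cfun"
 assumes w: "A1m D w" and b: "\<And>j. bmo (b j) (M j)"
 obtains C where "0 \<le> C" "\<And>a L l x t. 0 < L ==> 0 < t ==>
  wm w {y \<in> dy a L l x. t < (PU j. 1 + norm (b j y - cav (b j) a L l y))}
   \<le> ennreal (C / t ^ 5) * wm w (dy a L l x)"
proof -
 let ?m = "CARD('m)" let ?n = "CARD('n)" let ?\<nu> = "density lborel w"
 have "\<forall>j. \<exists>C\<ge>1. \<forall>c r t. 0 < r --> 0 < t -->
  emeasure ?\<nu> {y \<in> hcube c r. t < 1 + norm (b j y - av (b j) c r)} \<le> ennreal (C / t ^ (5 * ?m)) * emeasure ?\<nu> (hcube c r)"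
  by (intro allI JN_power[OF w b]) simp
 then obtain C where C: "\<And>j. 1 \<le> C j" "\<And>j c r t. 0 < r ==> 0 < t ==>
  emeasure ?\<nu> {y \<in> hcube c r. t < 1 + norm (b j y - av (b j) c r)} \<le> ennreal (C j / t ^ (5 * ?m)) * emeasure ?\<nu> (hcube c r)"
  unfolding choice_iff by blast
 have D: "1 \<le> D" and wm [measurable]: "w \<in> borel_fun" using w by (auto simp: A1m_def)
 have [measurable]: "b j \<in> borel_fun" for j using b by (simp add: bmo_def)
 let ?V = "D * (31 * real ?n) ^ ?n"
 show thesis
 proof (rule that[of "(\<Sum>j\<in>UNIV. C j) * ?V"])
  have C0: "0 \<le> C j" for j using C(1)[of j] by simp
  then show "0 \<le> (\<Sum>j\<in>UNIV. C j) * ?V" using D by (intro mult_nonneg_nonneg sum_nonneg) auto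
  fix a :: "real ^ 'n" and l x and L t :: real assume L: "0 < L" and t: "0 < t"
  let ?H = "hcube (bcor a L l x) (31 * sd a L l)" let ?Q = "dy a L l x"
  have s: "0 < 31 * sd a L l" using sd_pos[OF L] by simp
  define u where "u = t powr (1 / ?m)"
  have u: "0 < u" "u ^ ?m = t" using t by (auto simp: u_def powr_realpow[symmetric] powr_powr)
  have sub: "?Q \<subseteq> ?H"
  proof
   fix y assume y: "y \<in> ?Q"
   show "y \<in> ?H" using dist_dlo[OF L y] sd_pos[OF L, of a l] by (intro DB_subset_big[OF L]) linarith
  qed
  let ?E = "\<lambda>j. {y \<in> ?H. u < 1 + norm (b j y - av (b j) (bcor a L l x) (31 * sd a L l))}"
  have Em: "?E j \<in> sets borel" for j
  proof -
   have "?E j = ?H \<inter> {y. u < 1 + norm (b j y - av (b j) (bcor a L l x) (31 * sd a L l))}" by auto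
   also have "\<dots> \<in> sets borel" by measurable
   finally show ?thesis .
  qed
  have "{y \<in> ?Q. t < (PU j. 1 + norm (b j y - cav (b j) a L l y))} \<subseteq> (\<Union>j. ?E j)"
  proof
   fix y assume y: "y \<in> {y \<in> ?Q. t < (PU j. 1 + norm (b j y - cav (b j) a L l y))}"
   have "\<exists>j. u < 1 + norm (b j y - cav (b j) a L l y)"
   proof (rule ccontr)
    assume "\<not> ?thesis"
    then have "(PU j. 1 + norm (b j y - cav (b j) a L l y)) \<le> (\<Prod>j\<in>(UNIV :: 'm set). u)" by (intro prod_mono) (auto simp: not_less)
    then show False using y u by simp
   qed
   moreover have "cav (b j) a L l y = av (b j) (bcor a L l x) (31 * sd a L l)" for j using cav_eq[of y a L l x] y by (simp add: cav_def)
   ultimately show "y \<in> (\<Union>j. ?E j)" using y sub by auto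
  qed
  then have "emeasure ?\<nu> {y \<in> ?Q. t < (PU j. 1 + norm (b j y - cav (b j) a L l y))} \<le> emeasure ?\<nu> (\<Union>j. ?E j)"
   using Em by (intro emeasure_mono sets.countable_UN'') auto
  also have "\<dots> \<le> (\<Sum>j\<in>UNIV. emeasure ?\<nu> (?E j))" using Em by (intro emeasure_subadditive_finite) auto
  also have "\<dots> \<le> (\<Sum>j\<in>UNIV. ennreal (C j / u ^ (5 * ?m)) * emeasure ?\<nu> ?H)" by (intro sum_mono C(2) s u)
  also have "\<dots> = ennreal (\<Sum>j\<in>UNIV. C j / u ^ (5 * ?m)) * emeasure ?\<nu> ?H"
   unfolding sum_distrib_right[symmetric] using C0 u by (subst sum_ennreal) auto
  also have "\<dots> \<le> ennreal (\<Sum>j\<in>UNIV. C j / u ^ (5 * ?m)) * (ennreal ?V * emeasure ?\<nu> ?Q)"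
  proof (intro mult_left_mono)
   have "emeasure ?\<nu> ?H \<le> ennreal (D * (31 * sd a L l / (L / 2 ^ l)) ^ ?n) * emeasure ?\<nu> (hcube (dlo a L l x) (L / 2 ^ l))"
    using L s sub unfolding dy_hcube[OF L] by (intro A1m_doubling[OF w]) auto
   also have "31 * sd a L l / (L / 2 ^ l) = 31 * real ?n" using L by (simp add: sd_def)
   finally show "emeasure ?\<nu> ?H \<le> ennreal ?V * emeasure ?\<nu> ?Q" unfolding dy_hcube[OF L] .
  qed simp
  also have "\<dots> = ennreal ((\<Sum>j\<in>UNIV. C j / u ^ (5 * ?m)) * ?V) * emeasure ?\<nu> ?Q"
   using C0 u D by (subst ennreal_mult) (auto intro!: sum_nonneg simp: mult.assoc)
  also have "(\<Sum>j\<in>UNIV. C j / u ^ (5 * ?m)) * ?V = (\<Sum>j\<in>UNIV. C j) * ?V / t ^ 5"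
   using u(2) by (simp add: sum_divide_distrib[symmetric] power_mult mult.commute[of 5])
  finally show "emeasure ?\<nu> {y \<in> ?Q. t < (PU j. 1 + norm (b j y - cav (b j) a L l y))} \<le> ennreal ((\<Sum>j\<in>UNIV. C j) * ?V / t ^ 5) * emeasure ?\<nu> ?Q" .
 qed
qed

text \<open>Exponential integrability dominates every power. It puts b_j f_j into L^(p_j) for
  bounded f_j supported in a cube.\<close>

lemma bmo_adm:
 fixes b :: "'n::finite cfun"
 assumes b: "bmo b M" and r: "1 \<le> r" and L: "0 < L"
 shows "adm r (\<lambda>y. indicator (hcube a L) y * b y)"
proof -
 obtain \<theta> where \<theta>: "0 < \<theta>" "expint \<theta> b"
  by (rule John_Nirenberg_exp[OF b]) blast
 have [measurable]: "b \<in> borel_fun" using b by (simp add: bmo_def)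
 let ?c = "av b a L" let ?Q = "hcube a L"
 define k where "k = (r / \<theta>) powr r * exp (\<theta> * norm ?c)"
 have k: "norm (b y) powr r \<le> k * exp (\<theta> * norm (b y - ?c))" for y
 proof -
  let ?x = "norm (b y - ?c) + norm ?c"
  have "norm (b y) \<le> ?x" using norm_triangle_ineq[of "b y - ?c" ?c] by simp
  also have "?x = r / \<theta> * (\<theta> / r * ?x)" using r \<theta>(1) by simp
  also have "\<dots> \<le> r / \<theta> * exp (\<theta> / r * ?x)"
   using r \<theta>(1) exp_ge_add_one_self[of "\<theta> / r * ?x"] by (intro mult_left_mono) (linarith, simp)
  finally have "norm (b y) powr r \<le> (r / \<theta> * exp (\<theta> / r * ?x)) powr r" using r by (intro powr_mono2) auto
  also have "\<dots> = (r / \<theta>) powr r * exp (\<theta> * ?x)" unfolding powr_mult exp_powr_real using r by simp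
  finally show ?thesis by (simp add: k_def distrib_left exp_add mult_ac)
 qed
 have "(NN y. ennreal (norm (norm (indicator ?Q y * b y) powr r)))
   \<le> (NN y. ennreal k * (ennreal (exp (\<theta> * norm (b y - ?c))) * indicator ?Q y))"
 proof (rule nn_integral_mono)
  fix y
  show "ennreal (norm (norm (indicator ?Q y * b y) powr r)) \<le> ennreal k * (ennreal (exp (\<theta> * norm (b y - ?c))) * indicator ?Q y)"
   using k[of y] by (cases "y \<in> ?Q") (auto simp: ennreal_mult[symmetric] k_def intro!: ennreal_leI)
 qed
 also have "\<dots> \<le> ennreal k * ennreal (7 * L ^ CARD('n))"
  by (subst nn_integral_cmult) (measurable, intro mult_left_mono \<theta>(2)[unfolded expint_def, rule_format] L, simp)
 also have "\<dots> < \<infinity>" by (simp add: ennreal_mult_less_top)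
 finally have "integrable lborel (\<lambda>y. norm (indicator ?Q y * b y) powr r)" by (intro integrableI_bounded) measurable
 moreover have "integrable lborel (\<lambda>y. indicator ?Q y * b y)"
  using b L by (auto simp: bmo_def set_integrable_def scaleR_conv_of_real of_real_indicator)
 ultimately show ?thesis by (simp add: adm_def)
qed

section \<open>The estimate for bounded inputs supported in a cube\<close>

context CZ_op
begin

text \<open>The constant is uniform in the cube and in the bound \<open>R\<close>, which keep the
  inputs admissible; the truncations of a general input rely on this.\<close>

definition best :: "('m => 'n cfun) => ('m => real ^ 'n => ennreal) => (real ^ 'n => ennreal) => real => bool" where
 "best b \<omega> w C \<longleftrightarrow> (\<forall>a L f N R. 0 < L --> (\<forall>j. f j \<in> borel_fun) --> (\<forall>j y. norm (f j y) \<le> R) -->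
  (\<forall>j y. y \<notin> hcube a L --> f j y = 0) --> (\<forall>j. 0 < N j) -->
  (\<forall>j. (NN y. ennreal ((Phi ^^ CARD('m)) (norm (f j y))) * \<omega> j y) \<le> ennreal (N j)) -->
  (\<exists>E\<in>sets borel. wm w E \<le> ennreal (C * (PU j. N j) powr (1 / CARD('m))) \<and>
   (\<forall>x\<in>hcube a L - E. \<forall>\<delta>>0. norm (CI b x (TR x \<delta>) f) \<le> 1)))"

text \<open>The sparse sum is kept below 1 / Msp, so that the commutator is at most 1 off the
  exceptional set.\<close>

lemma bounded_estimate:
 fixes \<omega> :: "'m => real ^ 'n => ennreal"
 assumes A: "Avec D \<omega> w" and b: "\<And>j. bmo (b j) (M j)"
 obtains C where "0 < C" "best b \<omega> w C"
proof -
 have w: "A1m D w" by (rule Avec_A1m[OF A])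
 have D: "1 \<le> D" using A by (simp add: Avec_def)
 have bm [measurable]: "b j \<in> borel_fun" for j using b by (simp add: bmo_def)
 have "\<forall>j. \<exists>\<theta>>0. expint \<theta> (b j)" by (metis John_Nirenberg_exp[OF b])
 then obtain \<theta> where \<theta>: "\<And>j. 0 < \<theta> j" "\<And>j. expint (\<theta> j) (b j)" unfolding choice_iff by blast
 \<comment> \<open>A common exponent for all slots: \<open>expint\<close> persists when \<theta> is
   lowered.\<close>
 define th where "th = Min (range \<theta>)"
 have th: "0 < th" "th \<le> \<theta> j" for j using \<theta>(1) by (auto simp: th_def)
 have JN: "expint th (b j)" for j
  unfolding expint_def
 proof (intro allI impI)
  fix c r assume "0 < (r :: real)"
  show "(NN y. ennreal (exp (th * norm (b j y - av (b j) c r))) * indicator (hcube c r) y) \<le> ennreal (7 * r ^ CARD('n))"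
   by (rule order_trans[OF nn_integral_mono \<theta>(2)[unfolded expint_def, rule_format, OF \<open>0 < r\<close>, of j c]]) (auto intro!: mult_right_mono ennreal_leI th)
 qed
 obtain Cg where Cg: "0 \<le> Cg" "\<And>a L l x t. 0 < L ==> 0 < t ==>
  wm w {y \<in> dy a L l x. t < (PU j. 1 + norm (b j y - cav (b j) a L l y))}
   \<le> ennreal (Cg / t ^ 5) * wm w (dy a L l x)"
  by (rule G_dist[of D w b M, OF w b]) blast
 have M': "0 < Msp" by (rule csp_pos) simp
 define C1 where "C1 = cgs D Cg (1 / Msp)"
 have C1: "0 < C1" unfolding C1_def using D Cg(1) M' by (intro cgs_pos) auto
 define C2 where "C2 = real CARD('m) * (31 * real CARD('n)) ^ CARD('n) * Lam CARD('n) th ^ (2 * CARD('m)) * D"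
 have C2: "0 < C2" using D Lam_ge[OF th(1), of "CARD('n)"] unfolding C2_def by (intro mult_pos_pos zero_less_power) auto
 show thesis
 proof (rule that[of "C1 * C2"])
  show "0 < C1 * C2" using C1 C2 by simp
  show "best b \<omega> w (C1 * C2)"
   unfolding best_def
  proof (intro allI impI)
  fix a :: "real ^ 'n" and L and f :: "'m => 'n cfun" and N R
  assume L: "0 < L" and "\<forall>j. f j \<in> borel_fun" "\<forall>j y. norm (f j y) \<le> R"
   "\<forall>j y. y \<notin> hcube a L --> f j y = 0" "\<forall>j. 0 < N j"
   "\<forall>j. (NN y. ennreal ((Phi ^^ CARD('m)) (norm (f j y))) * \<omega> j y) \<le> ennreal (N j)"
  note [measurable] = this(2)[rule_format] and R = this(3)[rule_format] and supp = this(4)[rule_format] and N = this(5)[rule_format] and le = this(6)[rule_format]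
  have R0: "0 \<le> R" using R order_trans[OF norm_ge_zero] by blast
  have af: "adm (p j) (f j)" for j
   by (rule adm_dominated[OF adm_indicator[of "hcube a L"] p _ R0])
    (use R supp L in \<open>auto simp: indicator_def emeasure_hcube less_imp_le\<close>)
  have abf: "adm (p j) (\<lambda>y. b j y * f j y)" for j
  proof (rule adm_dominated[OF bmo_adm[OF b p L] p _ R0])
   show "norm (b j y * f j y) \<le> R * norm (indicator (hcube a L) y * b j y)" for y
    using R[of j y] supp[of y j] by (cases "y \<in> hcube a L") (auto simp: norm_mult mult.commute[of "norm (b j y)"] mult_right_mono)
  qed measurable
  let ?G = "\<lambda>k x. PU j. 1 + norm (b j x - cav (b j) a L k x)"
  let ?al = "\<lambda>k x. PU j. alp (b j) (f j) a L k x"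
  obtain St where St0: "sparse a L St"
   "\<And>x \<delta>. x \<in> hcube a L ==> 0 < \<delta> ==> \<exists>l. norm (CI b x (TR x \<delta>) f) \<le> Msp * (\<Sum>k<l. if St k x then ?G k x * ?al k x else 0)"
   using sparse_domination[OF L af abf supp] by blast
  note St = St0(1)[unfolded sparse_def, THEN conjunct1, rule_format] St0(1)[unfolded sparse_def, THEN conjunct2, rule_format] St0(2)
  let ?P = "(PU j. N j) powr (1 / CARD('m))"
  have "\<exists>E\<in>sets borel. wm w E \<le> ennreal (C1 * (C2 * ?P)) \<and>
   (\<forall>x\<in>hcube a L - E. \<forall>l. (\<Sum>k<l. if St k x then ?G k x * ?al k x else 0) \<le> 1 / Msp)"
  unfolding C1_def
  proof (rule sparse_sum_bound[OF D Cg(1) _ L w St(1)])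
   show "?al l y = ?al l x" if "y \<in> dy a L l x" for l x y using alp_eq[OF that] by simp
   show "0 \<le> ?al l x" for l x by (intro prod_nonneg ballI alp_nonneg L)
   show "wm w {x \<in> hcube a L. \<exists>l. s < ?al l x} \<le> ennreal (C2 * ?P / s\<^sup>2)" if "0 < s" "s \<le> 1" for s
    unfolding C2_def by (rule maximal_weak_type[OF A L bm adm_integrable[OF af] adm_integrable[OF abf] th(1) JN N le that])
  qed (use St(2) Cg(2)[OF L] C2 M' in auto)
  then obtain E where E: "E \<in> sets borel" "wm w E \<le> ennreal (C1 * (C2 * ?P))"
   "\<And>x l. x \<in> hcube a L ==> x \<notin> E ==> (\<Sum>k<l. if St k x then ?G k x * ?al k x else 0) \<le> 1 / Msp" by blast
  have "norm (CI b x (TR x \<delta>) f) \<le> 1" if x: "x \<in> hcube a L" "x \<notin> E" and d: "0 < \<delta>" for x \<delta>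
  proof -
   obtain l where "norm (CI b x (TR x \<delta>) f) \<le> Msp * (\<Sum>k<l. if St k x then ?G k x * ?al k x else 0)" using St(3)[OF x(1) d] by blast
   also have "\<dots> \<le> Msp * (1 / Msp)" using M' by (intro mult_left_mono E(3) x) simp
   finally show ?thesis using M' by simp
  qed
  then show "\<exists>E\<in>sets borel. wm w E \<le> ennreal (C1 * C2 * ?P) \<and>
   (\<forall>x\<in>hcube a L - E. \<forall>\<delta>>0. norm (CI b x (TR x \<delta>) f) \<le> 1)"
   using E(1,2) by (intro bexI[of _ E]) (auto simp: mult.assoc)
  qed
 qed
qed

end

section \<open>Passage to Borel representatives\<close>

text \<open>The measure of a cylinder over a null set is a product with one factor 0, and 0 times
  infinity is 0.\<close>

lemma AE_slot:
 assumes "AE y in (lborel :: 'a::euclidean_space measure). P y"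
 shows "AE y in (lborel :: ('a ^ 'm::finite) measure). P (y $ j)"
proof -
 obtain N where N: "{y. \<not> P y} \<subseteq> N" "vol N = 0" "N \<in> sets borel" using AE_E[OF assms] by auto
 have [measurable]: "N \<in> sets borel" by (rule N)
 let ?F = "\<lambda>i. if i = j then indicator N else (\<lambda>_. 1 :: ennreal)"
 have "vol {y :: 'a ^ 'm. y $ j \<in> N} = (NN y. (PU i. ?F i (y $ i)))"
 proof -
  have "{y :: 'a ^ 'm. y $ j \<in> N} \<in> sets borel"
   using measurable_sets[OF measurable_vec_nth N(3), of j] by (simp add: vimage_def)
  then have "vol {y :: 'a ^ 'm. y $ j \<in> N} = (NN y. indicator {y :: 'a ^ 'm. y $ j \<in> N} y)" by simp
  also have "\<dots> = (NN y. (PU i. ?F i (y $ i)))"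
  proof (rule nn_integral_cong)
   fix y :: "'a ^ 'm"
   have "(PU i. ?F i (y $ i)) = ?F j (y $ j) * (\<Prod>i\<in>UNIV - {j}. ?F i (y $ i))" by (rule prod.remove) auto
   also have "(\<Prod>i\<in>UNIV - {j}. ?F i (y $ i)) = 1" by (rule prod.neutral) auto
   finally show "indicator {y :: 'a ^ 'm. y $ j \<in> N} y = (PU i. ?F i (y $ i))" by (simp add: indicator_def)
  qed
  finally show ?thesis .
 qed
 also have "\<dots> = (PU i. NN x. ?F i x)" by (rule nn_integral_prod_vec) simp
 also have "\<dots> = 0" using N by (intro prod_zero bexI[of _ j]) auto
 finally show ?thesis
  by (rule AE_I[rotated]) (use N(1) measurable_sets[OF measurable_vec_nth N(3), of j] in \<open>auto simp: vimage_def\<close>)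
qed

lemma cube_lebesgue:
 fixes c :: "real ^ 'n::finite"
 assumes r: "0 < r"
 shows "cbox c (\<chi> i. c $ i + r) \<in> cubes" "lvol (cbox c (\<chi> i. c $ i + r)) = ennreal (r ^ CARD('n))"
  "measure lebesgue (cbox c (\<chi> i. c $ i + r)) = r ^ CARD('n)"
proof -
 show "cbox c (\<chi> i. c $ i + r) \<in> cubes" using r by (auto simp: cubes_def)
 show e: "lvol (cbox c (\<chi> i. c $ i + r)) = ennreal (r ^ CARD('n))" using r emeasure_cbox_cube(1)[of r c] by simp
 show "measure lebesgue (cbox c (\<chi> i. c $ i + r)) = r ^ CARD('n)" using r e by (simp add: measure_def)
qed

text \<open>A Borel representative exists since \<open>b\<close> is the limit of its integrable
  restrictions to balls; null sets also absorb the change from closed to half-open cubes.\<close>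

lemma BMO_bmo:
 fixes b :: "'n::finite cfun"
 assumes b: "b \<in> BMO"
 obtains b' M where "bmo b' M" "AE x in lborel. b x = b' x"
proof -
 let ?Q = "\<lambda>c r. cbox c (\<chi> i. c $ i + r) :: (real ^ 'n) set"
 have int: "integrable lebesgue (\<lambda>x. indicator X x *\<^sub>R b x)" if "compact X" for X
  using b that by (auto simp: BMO_def set_integrable_def)
 have "b \<in> leb_fun"
 proof (rule borel_measurable_LIMSEQ_metric)
  show "(\<lambda>x. indicator (cball 0 (real k)) x *\<^sub>R b x) \<in> leb_fun" for k by (rule borel_measurable_integrable[OF int]) simp
  fix x :: "real ^ 'n"
  obtain k :: nat where "norm x \<le> real k" using real_arch_simple by blast
  then have "\<forall>\<^sub>F k in sequentially. indicator (cball 0 (real k)) x *\<^sub>R b x = b x"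
   by (intro eventually_sequentiallyI[of k]) (auto simp: indicator_def)
  then show "(\<lambda>k. indicator (cball 0 (real k)) x *\<^sub>R b x) \<longlonglongrightarrow> b x" by (rule tendsto_eventually)
 qed
 then obtain b' where b' [measurable]: "b' \<in> borel_fun" and ae: "AE x in lborel. b x = b' x" by (rule borel_version)
 define s where "s = (SUP Q\<in>cubes. (\<integral>\<^sup>+x\<in>Q. ennreal (norm (b x - average Q b)) \<partial>lebesgue) / lvol Q)"
 have s: "s < \<infinity>" using b by (simp add: BMO_def s_def)
 \<comment> \<open>Adding 1 makes the bound positive, as \<open>bmo\<close> demands, also when the
   seminorm is 0.\<close>
 have "bmo b' (enn2real s + 1)"
  unfolding bmo_def
 proof (intro conjI allI impI)
  fix c :: "real ^ 'n" and r :: real assume r: "0 < r"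
  have ae': "AE y in lebesgue. (y \<in> hcube c r \<longleftrightarrow> y \<in> ?Q c r) \<and> b y = b' y" using AE_hcube_cbox[of r c] r ae by (auto intro!: AE_completion)
  have e: "AE y in lebesgue. indicator (?Q c r) y *\<^sub>R b y = indicator (hcube c r) y *\<^sub>R b' y"
   using ae' by eventually_elim (auto simp: indicator_def)
  have i: "integrable lebesgue (\<lambda>y. indicator (?Q c r) y *\<^sub>R b y)" by (rule int) simp
  have m: "(\<lambda>y. indicator (hcube c r) y *\<^sub>R b' y) \<in> borel_measurable lborel" by measurable
  then have m': "(\<lambda>y. indicator (hcube c r) y *\<^sub>R b' y) \<in> leb_fun" by (rule measurable_completion)
  have "integrable lebesgue (\<lambda>y. indicator (hcube c r) y *\<^sub>R b' y)" using integrable_cong_AE_imp[OF i m' e] .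
  then show "set_integrable lborel (hcube c r) b'" unfolding set_integrable_def integrable_completion[OF m] .
  have "average (?Q c r) b = av b' c r"
   unfolding average_def av_def set_lebesgue_integral_def cube_lebesgue(3)[OF r]
   using integral_cong_AE[OF borel_measurable_integrable[OF i] m' e] integral_completion[OF m] by simp
  then have "(NN y. ennreal (norm (b' y - av b' c r)) * indicator (hcube c r) y) = (\<integral>\<^sup>+y\<in>?Q c r. ennreal (norm (b y - average (?Q c r) b)) \<partial>lebesgue)"
   using ae' by (subst nn_integral_completion[symmetric], intro nn_integral_cong_AE) (elim eventually_mono, auto simp: indicator_def)
  also have "\<dots> \<le> s * lvol (?Q c r)"
  proof -
   let ?X = "\<integral>\<^sup>+y\<in>?Q c r. ennreal (norm (b y - average (?Q c r) b)) \<partial>lebesgue" let ?e = "lvol (?Q c r)"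
   have "?e \<noteq> 0" "?e < top" using cube_lebesgue(2)[OF r, of c] r by auto
   then have "?X = ?X / ?e * ?e" by (simp add: ennreal_divide_times ennreal_divide_self)
   also have "\<dots> \<le> s * ?e" unfolding s_def using cube_lebesgue(1)[OF r] by (intro mult_right_mono SUP_upper) auto
   finally show ?thesis .
  qed
  also have "\<dots> = ennreal (enn2real s * r ^ CARD('n))" unfolding cube_lebesgue(2)[OF r] using s r by (simp add: ennreal_mult)
  also have "\<dots> \<le> ennreal ((enn2real s + 1) * r ^ CARD('n))" using r by (intro ennreal_leI mult_right_mono) auto
  finally show "(NN y. ennreal (norm (b' y - av b' c r)) * indicator (hcube c r) y) \<le> ennreal ((enn2real s + 1) * r ^ CARD('n))" .
 qed (use b' in \<open>auto simp: add_nonneg_pos\<close>)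
 then show thesis using ae by (rule that)
qed

lemma cball_cube: "cball 0 R \<subseteq> cbox (\<chi> i. - R) (\<chi> i. ((\<chi> i. - R) :: real ^ 'n::finite) $ i + 2 * R)"
proof
 fix x :: "real ^ 'n" assume "x \<in> cball 0 R"
 then have "\<bar>x $ i\<bar> \<le> R" for i using component_le_norm_cart[of x i] by (simp add: dist_norm)
 then show "x \<in> cbox (\<chi> i. - R) (\<chi> i. ((\<chi> i. - R) :: real ^ 'n) $ i + 2 * R)" by (simp add: mem_box_cart abs_le_iff minus_le_iff)
qed

lemma less_ess_inf:
 assumes "e < ess_inf_on Q u" shows "AE x in lebesgue. x \<in> Q --> e \<le> ennreal (u x)"
proof -
 obtain c where "AE x in lebesgue. x \<in> Q --> c \<le> ennreal (u x)" "e < c" using assms by (auto simp: ess_inf_on_def less_Sup_iff)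
 then show ?thesis by (auto elim!: eventually_mono intro: order_trans)
qed

lemma ess_inf_finite:
 assumes "Q \<in> sets lebesgue" "lvol Q \<noteq> 0" shows "ess_inf_on Q u < \<infinity>"
proof (rule ccontr)
 assume "\<not> ?thesis"
 then have "AE x in lebesgue. x \<in> Q --> of_nat k \<le> ennreal (u x)" for k
  by (intro less_ess_inf) (simp add: less_top[symmetric] of_nat_less_top not_less top_unique)
 then have "AE x in lebesgue. \<forall>k. x \<in> Q --> of_nat k \<le> ennreal (u x)" unfolding AE_all_countable by blast
 then have "AE x in lebesgue. x \<notin> Q"
 proof eventually_elim
  case (elim x)
  obtain k :: nat where "max 0 (u x) < of_nat k" using reals_Archimedean2 by blast
  then have "ennreal (u x) < of_nat k" unfolding ennreal_of_nat_eq_real_of_nat by (intro ennreal_lessI) auto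
  then show ?case using elim leD by blast
 qed
 then show False using assms AE_iff_measurable[of Q lebesgue "\<lambda>x. x \<notin> Q"] by (simp add: sets.sets_into_space)
qed

lemma ess_inf_mono: "Q \<subseteq> Q' ==> ess_inf_on Q' u \<le> ess_inf_on Q u"
 unfolding ess_inf_on_def by (intro Sup_subset_mono) (auto elim!: eventually_mono)

text \<open>With inverse 0 = infinity and 0 times infinity = 0, weights with \<nu> = 0 satisfy the
  defining condition trivially; they are excluded by \<open>nz\<close>. Otherwise some cube has
  positive \<nu>-measure, which forces positive essential infima on every cube containing it, and
  hence on all cubes.\<close>

lemma A_ones_Avec:
 fixes \<omega> :: "'m::finite => real ^ 'n::finite => real"
 assumes om: "\<omega> \<in> A_ones" and nz: "\<not> (AE x in lborel. nu \<omega> x = 0)"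
 obtains D \<omega>' w where "Avec D \<omega>' w" "\<And>j. AE x in lborel. ennreal (\<omega> j x) = \<omega>' j x" "AE x in lborel. ennreal (nu \<omega> x) = w x"
proof -
 let ?m = "CARD('m)" let ?n = "CARD('n)" let ?Q = "\<lambda>c r. cbox c (\<chi> i. c $ i + r) :: (real ^ 'n) set"
 have wt [measurable]: "\<omega> j \<in> leb_fun" and pos: "0 \<le> \<omega> j x" for j x using om by (auto simp: A_ones_def weight_def)
 have "\<forall>j. \<exists>u\<in>borel_measurable lborel. AE x in lborel. ennreal (\<omega> j x) = u x" using wt by (intro allI completion_ex_borel_measurable) measurable
 then obtain \<omega>' where om': "\<And>j. \<omega>' j \<in> borel_fun" "\<And>j. AE x in lborel. ennreal (\<omega> j x) = \<omega>' j x"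
  unfolding Bex_def choice_iff by auto
 have "nu \<omega> \<in> leb_fun" unfolding nu_def[abs_def] by measurable
 then have "(\<lambda>x. ennreal (nu \<omega> x)) \<in> leb_fun" by measurable
 then obtain w where w [measurable]: "w \<in> borel_fun" and wae: "AE x in lborel. ennreal (nu \<omega> x) = w x"
  using completion_ex_borel_measurable[of _ lborel] by auto
 have nu_w: "weighted_measure (nu \<omega>) X = wm w X" if [measurable]: "X \<in> sets borel" for X
 proof -
  have "weighted_measure (nu \<omega>) X = (\<integral>\<^sup>+x. w x * indicator X x \<partial>lebesgue)"
   unfolding weighted_measure_def using AE_completion[OF wae] by (intro nn_integral_cong_AE) (elim eventually_mono, simp)
  then show ?thesis by (simp add: nn_integral_completion emeasure_density)
 qed
 let ?\<nu> = "density lborel w"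
 define s where "s = (SUP Q\<in>cubes. (weighted_measure (nu \<omega>) Q / lvol Q) ^ ?m * (PU i. inverse (ess_inf_on Q (\<omega> i))))"
 have s: "s < \<infinity>" using om by (simp add: A_ones_def s_def)
 have le: "(emeasure ?\<nu> (?Q c r) / ennreal (r ^ ?n)) ^ ?m * (PU i. inverse (ess_inf_on (?Q c r) (\<omega> i))) \<le> s" if r: "0 < r" for c r
  unfolding s_def cube_lebesgue(2)[OF r, of c, symmetric] nu_w[OF borel_closed[OF closed_cbox], symmetric]
  by (rule SUP_upper[OF cube_lebesgue(1)[OF r]])
 have fin: "ess_inf_on (?Q c r) (\<omega> i) < \<infinity>" if r: "0 < r" for c r i
  using cube_lebesgue(2)[OF r, of c] r by (intro ess_inf_finite) auto
 have ei: "ess_inf_on (?Q c r) (\<omega> j) \<noteq> 0" if r: "0 < r" and nz: "emeasure ?\<nu> (?Q c r) \<noteq> 0" for c r j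
 proof
  assume z: "ess_inf_on (?Q c r) (\<omega> j) = 0"
  have "(\<Prod>i\<in>UNIV - {j}. inverse (ess_inf_on (?Q c r) (\<omega> i))) \<noteq> 0" using fin[OF r] by (auto simp: less_top)
  then have "(PU i. inverse (ess_inf_on (?Q c r) (\<omega> i))) = top"
   by (subst prod.remove[of _ j]) (auto simp: z ennreal_top_mult)
  moreover have "(emeasure ?\<nu> (?Q c r) / ennreal (r ^ ?n)) ^ ?m \<noteq> 0" using nz r by (simp add: ennreal_divide_eq_0_iff)
  ultimately show False using le[OF r, of c] s by (simp add: ennreal_mult_top top_unique)
 qed
 obtain c0 r0 where c0: "0 < r0" "emeasure ?\<nu> (?Q c0 r0) \<noteq> 0"
 proof (rule ccontr)
  assume "\<not> thesis"
  then have z: "emeasure ?\<nu> (?Q c r) = 0" if "0 < r" for c r using that \<open>\<And>r0 c0. [|0 < r0; emeasure ?\<nu> (?Q c0 r0) \<noteq> 0|] ==> thesis\<close> by blast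
  have "AE x in lborel. x \<in> ?Q (\<chi> i. - real (Suc k)) (2 * real (Suc k)) --> w x = 0" for k
  proof -
   have "(NN x. w x * indicator (?Q (\<chi> i. - real (Suc k)) (2 * real (Suc k))) x) = 0"
    using z[of "2 * real (Suc k)" "\<chi> i. - real (Suc k)"] by (subst emeasure_density[symmetric]) auto
   then have "AE x in lborel. w x * indicator (?Q (\<chi> i. - real (Suc k)) (2 * real (Suc k))) x = 0" by (subst (asm) nn_integral_0_iff_AE) auto
   then show ?thesis by eventually_elim (auto simp: indicator_def)
  qed
  then have "AE x in lborel. \<forall>k. x \<in> ?Q (\<chi> i. - real (Suc k)) (2 * real (Suc k)) --> w x = 0" unfolding AE_all_countable by blast
  with wae have "AE x in lborel. nu \<omega> x = 0"
  proof eventually_elim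
   case (elim x)
   obtain k :: nat where "norm x \<le> real k" using real_arch_simple by blast
   then have "x \<in> cball 0 (real (Suc k))" by simp
   then have "x \<in> ?Q (\<chi> i. - real (Suc k)) (2 * real (Suc k))" using cball_cube by blast
   moreover have "0 \<le> nu \<omega> x" by (simp add: nu_def prod_nonneg)
   ultimately show ?case using elim by simp
  qed
  then show False using nz by blast
 qed
 \<comment> \<open>The factor 2 pays for halving the essential infima in \<open>e\<close>.\<close>
 define D where "D = max 1 (2 * enn2real s powr (1 / ?m))"
 have "Avec D \<omega>' w"
  unfolding Avec_def
 proof (intro conjI allI impI om' w)
  show "1 \<le> D" by (simp add: D_def)
  fix c :: "real ^ 'n" and r :: real assume r: "0 < r"
  have ae: "AE y in lborel. y \<in> hcube c r \<longleftrightarrow> y \<in> ?Q c r" using r by (intro AE_hcube_cbox) simp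
  define g where "g j = enn2real (ess_inf_on (?Q c r) (\<omega> j))" for j
  have g: "ess_inf_on (?Q c r) (\<omega> j) = ennreal (g j)" for j using fin[OF r] by (simp add: g_def ennreal_enn2real)
  \<comment> \<open>The given cube and the one of positive measure lie in a common large cube, and
    the essential infimum does not decrease on subsets.\<close>
  have g0: "0 < g j" for j
  proof -
   obtain R where R: "0 < R" "?Q c r \<union> ?Q c0 r0 \<subseteq> cball 0 R"
    using bounded_Un[of "?Q c r" "?Q c0 r0"] bounded_cbox bounded_pos[of "?Q c r \<union> ?Q c0 r0"] by (fastforce simp: subset_iff)
   note sub = cball_cube[of R]
   have "emeasure ?\<nu> (?Q c0 r0) \<le> emeasure ?\<nu> (?Q (\<chi> i. - R) (2 * R))" using R(2) sub by (intro emeasure_mono) auto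
   then have "ess_inf_on (?Q (\<chi> i. - R) (2 * R)) (\<omega> j) \<noteq> 0" using c0(2) R(1) by (intro ei) auto
   moreover have "ess_inf_on (?Q (\<chi> i. - R) (2 * R)) (\<omega> j) \<le> ess_inf_on (?Q c r) (\<omega> j)" using R(2) sub by (intro ess_inf_mono) blast
   ultimately have "ennreal (g j) \<noteq> 0" unfolding g by (metis le_zero_eq)
   then show ?thesis using ennreal_eq_0_iff[of "g j"] by linarith
  qed
  \<comment> \<open>Strictly below the essential infimum, so that \<open>less_ess_inf\<close> makes
    it a lower bound almost everywhere.\<close>
  define e where "e j = g j / 2" for j
  have e0: "0 < e j" for j using g0 by (simp add: e_def)
  have eo: "AE y in lborel. y \<in> hcube c r --> ennreal (e j) \<le> ennreal (\<omega> j y)" for j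
  proof -
   have "ennreal (e j) < ess_inf_on (?Q c r) (\<omega> j)" using g0[of j] unfolding g by (simp add: e_def ennreal_less_iff)
   then have "AE y in lborel. y \<in> ?Q c r --> ennreal (e j) \<le> ennreal (\<omega> j y)" using less_ess_inf by (subst AE_completion_iff[symmetric])
   with ae show ?thesis by eventually_elim blast
  qed
  show "\<exists>e. (\<forall>j. 0 < e j) \<and> (\<forall>j. AE y in lborel. y \<in> hcube c r --> ennreal (e j) \<le> \<omega>' j y) \<and>
    (AE y in lborel. y \<in> hcube c r --> ennreal ((PU j. e j) powr (1 / ?m)) \<le> w y) \<and>
    emeasure ?\<nu> (hcube c r) \<le> ennreal (D * r ^ ?n * (PU j. e j) powr (1 / ?m))"
  proof (intro exI[of _ e] conjI allI e0)
   show "AE y in lborel. y \<in> hcube c r --> ennreal (e j) \<le> \<omega>' j y" for j using eo[of j] om'(2)[of j] by eventually_elim simp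
   have "AE y in lborel. \<forall>j. y \<in> hcube c r --> ennreal (e j) \<le> ennreal (\<omega> j y)" unfolding AE_all_countable using eo by blast
   with wae show "AE y in lborel. y \<in> hcube c r --> ennreal ((PU j. e j) powr (1 / ?m)) \<le> w y"
   proof eventually_elim
    case (elim y)
    show ?case
    proof
     assume "y \<in> hcube c r"
     then have "ennreal (e j) \<le> ennreal (\<omega> j y)" for j using elim(2) by blast
     then have "e j \<le> \<omega> j y" for j using pos by (simp only: ennreal_le_iff)
     then have "(PU j. e j powr (1 / ?m)) \<le> (PU j. \<omega> j y powr (1 / ?m))"
      using e0 by (intro prod_mono) (auto intro!: powr_mono2 simp: less_imp_le)
     then show "ennreal ((PU j. e j) powr (1 / ?m)) \<le> w y"
      unfolding elim(1)[symmetric] nu_def using e0 by (simp add: prod_powr_distrib less_imp_le ennreal_leI)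
    qed
   qed
   have P0: "0 < (PU j. e j)" using e0 by (simp add: prod_pos)
   have "emeasure ?\<nu> (hcube c r) \<le> emeasure ?\<nu> (?Q c r)" using hcube_subset_cbox by (intro emeasure_mono) auto
   also have "\<dots> \<le> ennreal (D * r ^ ?n * (PU j. e j) powr (1 / ?m))"
   proof -
    let ?v = "emeasure ?\<nu> (?Q c r)"
    define G where "G = (PU i. inverse (g i))"
    have inv: "(PU i. inverse (ess_inf_on (?Q c r) (\<omega> i))) = ennreal G"
     unfolding g G_def using g0 by (simp add: inverse_ennreal prod_ennreal less_imp_le)
    have G0: "0 < G" using g0 by (simp add: G_def prod_pos)
    have vf: "?v < top"
    proof (rule ccontr)
     assume "\<not> ?thesis"
     then have "?v = top" using top.not_eq_extremum by blast
     then have "(?v / ennreal (r ^ ?n)) ^ ?m = top" using r by (simp add: ennreal_top_divide)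
     then show False using le[OF r, of c] s G0 unfolding inv by (simp add: ennreal_top_mult top_unique)
    qed
    define v where "v = enn2real ?v"
    have v: "?v = ennreal v" "0 \<le> v" using vf by (auto simp: v_def ennreal_enn2real)
    have "ennreal ((v / r ^ ?n) ^ ?m * G) \<le> ennreal (enn2real s)"
     using le[OF r, of c] s r v(2) G0 unfolding inv v(1) by (simp add: divide_ennreal ennreal_power ennreal_mult less_imp_le)
    then have "(v / r ^ ?n) ^ ?m * G \<le> enn2real s" by simp
    moreover have "G = 1 / (2 ^ ?m * (PU j. e j))" by (simp add: G_def e_def prod_dividef prod_inversef[symmetric] field_simps)
    ultimately have "(v / r ^ ?n) ^ ?m \<le> enn2real s * 2 ^ ?m * (PU j. e j)" using P0 by (simp add: pos_divide_le_eq mult.assoc)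
    then have "((v / r ^ ?n) ^ ?m) powr (1 / ?m) \<le> (enn2real s * 2 ^ ?m * (PU j. e j)) powr (1 / ?m)"
     using v(2) r by (intro powr_mono2) auto
    also have "((v / r ^ ?n) ^ ?m) powr (1 / ?m) = v / r ^ ?n"
     using v(2) r by (cases "v = 0") (auto simp: powr_realpow[symmetric] powr_powr)
    also have "(enn2real s * 2 ^ ?m * (PU j. e j)) powr (1 / ?m) = 2 * enn2real s powr (1 / ?m) * (PU j. e j) powr (1 / ?m)"
     by (simp add: powr_mult powr_realpow[symmetric] powr_powr)
    also have "\<dots> \<le> D * (PU j. e j) powr (1 / ?m)" by (intro mult_right_mono) (auto simp: D_def)
    finally have "v \<le> D * r ^ ?n * (PU j. e j) powr (1 / ?m)" using r by (simp add: pos_divide_le_eq mult_ac)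
    then show ?thesis unfolding v(1) by (rule ennreal_leI)
   qed
   finally show "emeasure ?\<nu> (hcube c r) \<le> ennreal (D * r ^ ?n * (PU j. e j) powr (1 / ?m))" .
  qed
 qed
 then show thesis using om'(2) wae by (rule that)
qed

section \<open>General inputs and the maximal commutator\<close>

context CZ_op
begin

text \<open>Null sets do not affect the integral over \<open>y\<close>, but the values b_j(x) enter
  pointwise, hence the assumption at \<open>x\<close>.\<close>

lemma commutator_CI:
 assumes b: "\<And>j. AE x in lborel. b j x = b' j x" "\<And>j. b' j \<in> borel_fun"
  and f: "\<And>j. AE x in lborel. f j x = f' j x" "\<And>j. f' j \<in> borel_fun" and x: "\<And>j. b j x = b' j x"
 shows "(LINT y:TR x \<delta>|lebesgue. (PU j. b j x - b j (y $ j)) * K (point x y) * (PU j. f j (y $ j))) = CI b' x (TR x \<delta>) f'"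
proof -
 note [measurable] = b(2) f(2)
 let ?F = "\<lambda>b f y. indicator (TR x \<delta>) y *\<^sub>R ((PU j. b j x - b j (y $ j)) * K (point x y) * (PU j. f j (y $ j)))"
 have m: "?F b' f' \<in> borel_measurable lborel" using prod_borel[of f'] by measurable
 have "AE y in lborel. \<forall>j. b j (y $ j) = b' j (y $ j)" "AE y in lborel. \<forall>j. f j (y $ j) = f' j (y $ j)"
  unfolding AE_all_countable using AE_slot[OF b(1)] AE_slot[OF f(1)] by blast+
 then have "AE y in lborel. ?F b' f' y = ?F b f y"
  by eventually_elim (simp add: x)
 then have e: "AE y in lebesgue. ?F b' f' y = ?F b f y" by (rule AE_completion)
 have m': "?F b' f' \<in> leb_fun" using m by (rule measurable_completion)
 have "(\<integral>y. ?F b f y \<partial>lebesgue) = (\<integral>y. ?F b' f' y \<partial>lebesgue)"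
  by (rule integral_cong_AE[OF m' borel_measurable_AE[OF m' e] e, symmetric])
 then show ?thesis unfolding set_lebesgue_integral_def CI_def using integral_completion[OF m] by simp
qed

lemma CI_zero:
 assumes "AE y in lborel. f i y = 0" shows "CI b x V f = 0"
 unfolding CI_def
proof (rule integral_eq_zero_AE)
 show "AE y in lborel. indicator V y *\<^sub>R ((PU j. b j x - b j (y $ j)) * K (point x y) * (PU j. f j (y $ j))) = 0"
  using AE_slot[OF assms, of i] by eventually_elim (auto simp: prod_zero_iff)
qed

text \<open>A non-integrable integrand has integral 0 by convention; a value above 1 therefore means
  that the integrand is integrable, and it dominates those of the truncations.\<close>

lemma CI_truncate:
 assumes b: "\<And>j. b j \<in> borel_fun" and g: "\<And>j. g j \<in> borel_fun" and V: "V \<in> sets borel"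
  and h: "\<And>k j. h k j \<in> borel_fun" "\<And>k j y. h k j y = g j y \<or> h k j y = 0" "\<And>j y. \<forall>\<^sub>F k in sequentially. h k j y = g j y"
  and 1: "1 < norm (CI b x V g)"
 shows "\<forall>\<^sub>F k in sequentially. 1 < norm (CI b x V (h k))"
proof -
 note [measurable] = b g h(1) V
 let ?F = "\<lambda>f y. indicator V y *\<^sub>R ((PU j. b j x - b j (y $ j)) * K (point x y) * (PU j. f j (y $ j)))"
 have m: "?F f \<in> borel_measurable lborel" if "\<And>j. f j \<in> borel_fun" for f using prod_borel[of f, OF that] by measurable
 have i: "integrable lborel (?F g)" using 1 not_integrable_integral_eq[of lborel "?F g"] by (fastforce simp: CI_def)
 have "(\<lambda>k. CI b x V (h k)) \<longlonglongrightarrow> CI b x V g"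
  unfolding CI_def
 proof (rule integral_dominated_convergence[OF m[OF g] m[OF h(1)] integrable_norm[OF i]])
  show "AE y in lborel. (\<lambda>k. ?F (h k) y) \<longlonglongrightarrow> ?F g y"
  proof (rule AE_I2, rule tendsto_eventually)
   fix y
   have "\<forall>\<^sub>F k in sequentially. \<forall>j. h k j (y $ j) = g j (y $ j)" using h(3) by (simp add: eventually_all_finite)
   then show "\<forall>\<^sub>F k in sequentially. ?F (h k) y = ?F g y" by eventually_elim simp
  qed
  show "AE y in lborel. norm (?F (h k) y) \<le> norm (?F g y)" for k
  proof (rule AE_I2)
   fix y
   have "(PU j. norm (h k j (y $ j))) \<le> (PU j. norm (g j (y $ j)))"
   proof (intro prod_mono conjI norm_ge_zero)
    show "norm (h k j (y $ j)) \<le> norm (g j (y $ j))" for j using h(2)[of k j "y $ j"] by auto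
   qed
   then show "norm (?F (h k) y) \<le> norm (?F g y)" by (simp add: norm_mult prod_norm mult_left_mono)
  qed
 qed
 then have "(\<lambda>k. norm (CI b x V (h k))) \<longlonglongrightarrow> norm (CI b x V g)" by (rule tendsto_norm)
 then show ?thesis using 1 by (rule order_tendstoD)
qed

text \<open>One Borel set catches the large values for all \<delta>, hence those of the supremum,
  whose measurability does not come up.\<close>

definition uest :: "('m => 'n cfun) => ('m => real ^ 'n => ennreal) => (real ^ 'n => ennreal) => real => bool" where
 "uest b \<omega> w C \<longleftrightarrow> (\<forall>g. (\<forall>j. g j \<in> borel_fun) --> (\<exists>E\<in>sets borel. wm w E \<le>
    ennreal C * ennreal_powr (PU j. NN y. ennreal ((Phi ^^ CARD('m)) (norm (g j y))) * \<omega> j y) (1 / CARD('m)) \<and>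
   (\<forall>x \<delta>. 0 < \<delta> --> 1 < norm (CI b x (TR x \<delta>) g) --> x \<in> E)))"

text \<open>Inputs are truncated in size and support. By \<open>CI_truncate\<close> a point with a
  large value lies in the exceptional sets of all late truncations, hence in their lower limit,
  whose measure obeys the common bound.\<close>

lemma unbounded_estimate:
 fixes \<omega> :: "'m => real ^ 'n => ennreal"
 assumes A: "Avec D \<omega> w" and b: "\<And>j. bmo (b j) (M j)"
 obtains C where "0 < C" "uest b \<omega> w C"
proof -
 obtain C where C: "0 < C" "best b \<omega> w C"
  by (rule bounded_estimate[where b = b, OF A b]) blast
 have wm [measurable]: "w \<in> borel_fun" and om [measurable]: "\<omega> j \<in> borel_fun" for j using A by (auto simp: Avec_def)
 have bm: "b j \<in> borel_fun" for j using b by (simp add: bmo_def)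
 let ?H = "\<lambda>k. hcube (\<chi> i. - real (Suc k)) (2 * real (Suc k)) :: (real ^ 'n) set"
 have H: "\<forall>\<^sub>F k in sequentially. x \<in> ?H k" for x
 proof -
  obtain k0 :: nat where k0: "norm x \<le> real k0" using real_arch_simple by blast
  have "x \<in> ?H k" if "k0 \<le> k" for k
  proof -
   have "- real (Suc k) \<le> x $ i \<and> x $ i < - real (Suc k) + 2 * real (Suc k)" for i
    using component_le_norm_cart[of x i] k0 that by (simp add: abs_le_iff)
   then show ?thesis by (simp add: hcube_def)
  qed
  then show ?thesis by (rule eventually_sequentiallyI)
 qed
 \<comment> \<open>Lower bounds on an exhausting sequence of cubes; positivity allows g_i = 0 to be
   inferred from a vanishing integral.\<close>
 have opos: "AE y in lborel. 0 < \<omega> j y" for j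
 proof -
  have "AE y in lborel. y \<in> ?H k --> 0 < \<omega> j y" for k
  proof -
   have "0 < 2 * real (Suc k)" by simp
   then obtain e :: "'m => real" where e: "\<forall>j. 0 < e j" "\<forall>j. AE y in lborel. y \<in> ?H k --> ennreal (e j) \<le> \<omega> j y"
    using A unfolding Avec_def by meson
   have "AE y in lborel. y \<in> ?H k --> ennreal (e j) \<le> \<omega> j y" using e by blast
   then show ?thesis
   proof eventually_elim
    case (elim y)
    have "0 < ennreal (e j)" using e by simp
    then show ?case using elim less_le_trans by blast
   qed
  qed
  then have "AE y in lborel. \<forall>k. y \<in> ?H k --> 0 < \<omega> j y" unfolding AE_all_countable by blast
  then show ?thesis
  proof eventually_elim
   case (elim y)
   then show ?case using H[of y] unfolding eventually_sequentially by blast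
  qed
 qed
 show thesis
 proof (rule that[OF C(1)], unfold uest_def, intro allI impI)
  fix g :: "'m => 'n cfun"
  assume "\<forall>j. g j \<in> borel_fun"
  then have g [measurable]: "\<And>j. g j \<in> borel_fun" by blast
  let ?Ph = "Phi ^^ CARD('m)"
  define N where "N j = (NN y. ennreal (?Ph (norm (g j y))) * \<omega> j y)" for j
  have Ph: "s \<le> ?Ph s" if "0 \<le> s" for s
  proof -
   have "s * 1 \<le> s * (1 + log_plus s) ^ CARD('m)" using that log_plus_nonneg[of s] by (intro mult_left_mono one_le_power) auto
   then show ?thesis using Phi_funpow_ge[OF that, of "CARD('m)"] by simp
  qed
  let ?R = "ennreal C * ennreal_powr (PU j. N j) (1 / CARD('m))"
  have "\<exists>E\<in>sets borel. wm w E \<le> ?R \<and> (\<forall>x \<delta>. 0 < \<delta> --> 1 < norm (CI b x (TR x \<delta>) g) --> x \<in> E)"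
  \<comment> \<open>The bounded estimate asks for finite positive \<open>N j\<close>. If one
    vanishes, so does the commutator; if none vanishes and one is infinite, the right-hand side is
    infinite.\<close>
  proof (cases "\<exists>i. N i = 0")
   case True
   then obtain i where "N i = 0" by blast
   then have "AE y in lborel. ennreal (?Ph (norm (g i y))) * \<omega> i y = 0" unfolding N_def by (subst (asm) nn_integral_0_iff_AE) auto
   with opos[of i] have "AE y in lborel. g i y = 0"
   proof eventually_elim
    case (elim y)
    then have "?Ph (norm (g i y)) \<le> 0" by (auto simp: ennreal_eq_0_iff)
    then have "norm (g i y) \<le> 0" using Ph[OF norm_ge_zero] order_trans by blast
    then show ?case by simp
   qed
   then show ?thesis by (intro bexI[of _ "{}"]) (auto simp: CI_zero)
  next
   case N0: False
   show ?thesis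
   proof (cases "\<exists>i. N i = top")
    case True
    then obtain i where i: "N i = top" by blast
    have "(PU j. N j) = N i * (\<Prod>j\<in>UNIV - {i}. N j)" by (rule prod.remove) auto
    also have "\<dots> = top" using N0 i by (simp add: ennreal_top_mult)
    finally show ?thesis using C(1) by (intro bexI[of _ UNIV]) (auto simp: ennreal_powr_def ennreal_mult_top)
   next
    case False
    define n where "n j = enn2real (N j)" for j
    have n: "N j = ennreal (n j)" "0 < n j" for j
     using False N0 by (auto simp: n_def ennreal_enn2real less_top enn2real_positive_iff zero_less_iff_neq_zero)
    have R: "?R = ennreal (C * (PU j. n j) powr (1 / CARD('m)))"
     unfolding n(1) using n(2) C(1) by (simp add: prod_ennreal less_imp_le prod_nonneg ennreal_powr_def ennreal_mult)
    define h where "h k j y = (if y \<in> ?H k \<and> norm (g j y) \<le> real k then g j y else 0)" for k j y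
    have hm: "h k j \<in> borel_fun" for k j unfolding h_def[abs_def] by measurable
    have "\<exists>E\<in>sets borel. wm w E \<le> ?R \<and> (\<forall>x\<in>?H k - E. \<forall>\<delta>>0. norm (CI b x (TR x \<delta>) (h k)) \<le> 1)" for k
     unfolding R
    proof (rule C(2)[unfolded best_def, rule_format, where R = "real k"])
     fix j
     have "(NN y. ennreal (?Ph (norm (h k j y))) * \<omega> j y) \<le> N j"
      unfolding N_def using Phi_funpow_mono by (intro nn_integral_mono mult_right_mono ennreal_leI) (auto simp: h_def)
     then show "(NN y. ennreal (?Ph (norm (h k j y))) * \<omega> j y) \<le> ennreal (n j)" by (simp only: n(1))
    qed (use hm n(2) in \<open>auto simp: h_def\<close>)
    then have "\<forall>k. \<exists>E. E \<in> sets borel \<and> wm w E \<le> ?R \<and> (\<forall>x\<in>?H k - E. \<forall>\<delta>>0. norm (CI b x (TR x \<delta>) (h k)) \<le> 1)" by blast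
    then obtain E where E0: "\<forall>k. E k \<in> sets borel \<and> wm w (E k) \<le> ?R \<and> (\<forall>x\<in>?H k - E k. \<forall>\<delta>>0. norm (CI b x (TR x \<delta>) (h k)) \<le> 1)"
     unfolding choice_iff by blast
    then have Em [measurable]: "E k \<in> sets borel" for k by blast
    define F where "F i = (\<Inter>k\<in>{i..}. E k)" for i
    have Fm: "F i \<in> sets borel" for i unfolding F_def by (intro sets.countable_INT'') auto
    have "wm w (\<Union>i. F i) = (SUP i. wm w (F i))"
     using Fm by (intro SUP_emeasure_incseq[symmetric]) (auto simp: incseq_def F_def)
    also have "\<dots> \<le> ?R"
    proof (rule SUP_least)
     fix i
     have "wm w (F i) \<le> wm w (E i)" by (intro emeasure_mono) (auto simp: F_def)
     also have "\<dots> \<le> ?R" using E0 by blast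
     finally show "wm w (F i) \<le> ?R" .
    qed
    finally have mF: "wm w (\<Union>i. F i) \<le> ?R" .
    have "x \<in> (\<Union>i. F i)" if d: "0 < \<delta>" and c: "1 < norm (CI b x (TR x \<delta>) g)" for x \<delta>
    proof -
     have "\<forall>\<^sub>F k in sequentially. 1 < norm (CI b x (TR x \<delta>) (h k))"
     proof (rule CI_truncate[OF bm g TR_borel hm _ _ c])
      show "h k j y = g j y \<or> h k j y = 0" for k j y by (auto simp: h_def)
      fix j y
      obtain k0 :: nat where k0: "norm (g j y) \<le> real k0" using real_arch_simple by blast
      from H[of y] eventually_ge_at_top[of k0] show "\<forall>\<^sub>F k in sequentially. h k j y = g j y"
      proof eventually_elim
       case (elim k)
       have "norm (g j y) \<le> real k" using k0 elim(2) by simp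
       then show ?case using elim(1) by (simp only: h_def simp_thms if_True)
      qed
     qed
     with H[of x] have "\<forall>\<^sub>F k in sequentially. x \<in> E k"
     proof eventually_elim
      case (elim k)
      then show ?case using E0 d by (metis Diff_iff not_le)
     qed
     then show ?thesis by (auto simp: eventually_sequentially F_def)
    qed
    then show ?thesis using mF Fm by (intro bexI[of _ "\<Union>i. F i"]) auto
   qed
  qed
  then show "\<exists>E\<in>sets borel. wm w E \<le>
    ennreal C * ennreal_powr (PU j. NN y. ennreal (?Ph (norm (g j y))) * \<omega> j y) (1 / CARD('m)) \<and>
   (\<forall>x \<delta>. 0 < \<delta> --> 1 < norm (CI b x (TR x \<delta>) g) --> x \<in> E)" unfolding N_def .
 qed
qed

text \<open>Borel representatives of the weights, of \<open>b\<close> and of \<open>f\<close> reduce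
  the claim to \<open>uest\<close>; homogeneity of degree m turns the level t^m into 1.\<close>

lemma maximal_commutator_estimate:
 assumes om: "\<omega> \<in> A_ones" and b: "\<forall>j. b j \<in> BMO"
 shows "\<exists>C::real. C > 0 \<and> (\<forall>t>0. \<forall>f :: 'm => 'n cfun. (\<forall>i. f i \<in> leb_fun) -->
    weighted_measure (nu \<omega>) {x. maximal_iterated_commutator K b f x > ennreal (t ^ CARD('m))}
    \<le> ennreal C * ennreal_powr
      (PU i. \<integral>\<^sup>+y. ennreal ((Phi ^^ CARD('m)) (norm (f i y) / t) * \<omega> i y) \<partial>lebesgue) (1 / CARD('m)))"
proof (cases "AE x in lborel. nu \<omega> x = 0")
 \<comment> \<open>The measure with density \<nu> vanishes, so any positive constant serves.\<close>
 case True
 have "weighted_measure (nu \<omega>) X \<le> 0" for X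
 proof -
  have "weighted_measure (nu \<omega>) X \<le> (\<integral>\<^sup>+x. 0 \<partial>(lebesgue :: (real ^ 'n) measure))"
   unfolding weighted_measure_def using AE_completion[OF True] by (intro nn_integral_mono_AE) (elim eventually_mono, simp)
  then show ?thesis by simp
 qed
 then show ?thesis by (intro exI[of _ 1]) (meson order_trans zero_le zero_less_one)
next
 case False
 obtain D \<omega>' w where A: "Avec D \<omega>' w" and om': "\<And>j. AE x in lborel. ennreal (\<omega> j x) = \<omega>' j x" and w: "AE x in lborel. ennreal (nu \<omega> x) = w x"
  by (rule A_ones_Avec[OF om False]) blast
 have wm [measurable]: "w \<in> borel_fun" and omm [measurable]: "\<omega>' j \<in> borel_fun" for j using A by (auto simp: Avec_def)
 have pos: "0 \<le> \<omega> j x" for j x using om by (auto simp: A_ones_def weight_def)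
 have "\<forall>j. \<exists>b' M. bmo b' M \<and> (AE x in lborel. b j x = b' x)" 
 proof
  fix j
  have "b j \<in> BMO" using b by blast
  then show "\<exists>b' M. bmo b' M \<and> (AE x in lborel. b j x = b' x)" by (rule BMO_bmo) blast
 qed
 then obtain b' M where b': "\<And>j. bmo (b' j) (M j)" "\<And>j. AE x in lborel. b j x = b' j x" unfolding choice_iff by blast
 have bm: "b' j \<in> borel_fun" for j using b'(1) by (simp add: bmo_def)
 obtain C where C: "0 < C" "uest b' \<omega>' w C"
  by (rule unbounded_estimate[where b = b', OF A b'(1)]) blast
 show ?thesis
 proof (intro exI[of _ C] conjI C(1) allI impI)
  fix t :: real and f :: "'m => 'n cfun" assume t: "0 < t" and f: "\<forall>i. f i \<in> leb_fun"
  have "\<forall>i. \<exists>f'. f' \<in> borel_fun \<and> (AE x in lborel. f i x = f' x)" using f borel_version by metis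
  then obtain f' where f': "\<And>i. f' i \<in> borel_fun" "\<And>i. AE x in lborel. f i x = f' i x" unfolding choice_iff by blast
  note [measurable] = f'(1)
  define g where "g i y = of_real (1 / t) * f' i y" for i y
  have gm [measurable]: "g i \<in> borel_fun" for i unfolding g_def[abs_def] by measurable
  have tg: "f' i y = of_real t * g i y" for i y using t by (simp add: g_def)
  let ?N = "\<lambda>i. \<integral>\<^sup>+y. ennreal ((Phi ^^ CARD('m)) (norm (g i y))) * \<omega>' i y \<partial>lborel"
  have N: "(\<integral>\<^sup>+y. ennreal ((Phi ^^ CARD('m)) (norm (f i y) / t) * \<omega> i y) \<partial>lebesgue) = ?N i" for i
  proof -
   have "(\<integral>\<^sup>+y. ennreal ((Phi ^^ CARD('m)) (norm (f i y) / t) * \<omega> i y) \<partial>lebesgue) = (\<integral>\<^sup>+y. ennreal ((Phi ^^ CARD('m)) (norm (g i y))) * \<omega>' i y \<partial>lebesgue)"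
   proof (rule nn_integral_cong_AE)
    from AE_completion[OF f'(2)[of i]] AE_completion[OF om'[of i]]
    show "AE y in lebesgue. ennreal ((Phi ^^ CARD('m)) (norm (f i y) / t) * \<omega> i y) = ennreal ((Phi ^^ CARD('m)) (norm (g i y))) * \<omega>' i y"
    proof eventually_elim
     case (elim y)
     have "norm (g i y) = norm (f i y) / t" using t elim(1) by (simp add: g_def norm_divide)
     moreover have "0 \<le> (Phi ^^ CARD('m)) (norm (f i y) / t)" using Phi_funpow_mono[of "norm (f i y) / t" "norm (f i y) / t"] t by simp
     ultimately show ?case unfolding elim(2)[symmetric] using pos by (simp add: ennreal_mult)
    qed
   qed
   also have "\<dots> = ?N i" by (rule nn_integral_completion)
   finally show ?thesis .
  qed
  obtain E where E: "E \<in> sets borel" "wm w E \<le> ennreal C * ennreal_powr (PU j. ?N j) (1 / CARD('m))"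
   "\<And>x \<delta>. 0 < \<delta> ==> 1 < norm (CI b' x (TR x \<delta>) g) ==> x \<in> E" using C(2)[unfolded uest_def, rule_format, of g] gm by blast
  have inE: "x \<in> E" if x: "\<And>j. b j x = b' j x" and gt: "ennreal (t ^ CARD('m)) < maximal_iterated_commutator K b f x" for x
  proof -
   obtain \<delta> where d: "0 < \<delta>" and "ennreal (t ^ CARD('m)) < ennreal (norm
    (LINT y:{y. \<delta>\<^sup>2 < (\<Sum>j\<in>UNIV. (norm (x - y $ j))\<^sup>2)}|lebesgue. (PU j. b j x - b j (y $ j)) * K (point x y) * (PU i. f i (y $ i))))"
    using gt unfolding maximal_iterated_commutator_def less_SUP_iff by auto
   then have "t ^ CARD('m) < norm (CI b' x (TR x \<delta>) f')"
    using commutator_CI[OF b'(2) bm f'(2,1) x, of \<delta>] t by (simp add: TR_def ennreal_less_iff)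
   also have "CI b' x (TR x \<delta>) f' = of_real (t ^ CARD('m)) * CI b' x (TR x \<delta>) g"
    unfolding CI_def integral_mult_right_zero[symmetric] tg by (intro Bochner_Integration.integral_cong refl) (simp add: prod.distrib mult_ac)
   also have "norm \<dots> = t ^ CARD('m) * norm (CI b' x (TR x \<delta>) g)" using t by (simp add: norm_mult norm_power)
   finally show ?thesis using t by (intro E(3)[OF d]) simp
  qed
  have "AE x in lborel. \<forall>j. b j x = b' j x" unfolding AE_all_countable using b'(2) by blast
  with w have "AE x in lborel. ennreal (nu \<omega> x) * indicator {x. ennreal (t ^ CARD('m)) < maximal_iterated_commutator K b f x} x \<le> w x * indicator E x"
   by eventually_elim (use inE in \<open>auto simp: indicator_def\<close>)
  then have "weighted_measure (nu \<omega>) {x. maximal_iterated_commutator K b f x > ennreal (t ^ CARD('m))} \<le> (\<integral>\<^sup>+x. w x * indicator E x \<partial>lebesgue)"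
   unfolding weighted_measure_def by (intro nn_integral_mono_AE AE_completion)
  also have "\<dots> = wm w E" using E(1) by (simp add: nn_integral_completion emeasure_density)
  finally show "weighted_measure (nu \<omega>) {x. maximal_iterated_commutator K b f x > ennreal (t ^ CARD('m))} \<le> ennreal C * ennreal_powr
    (PU i. \<integral>\<^sup>+y. ennreal ((Phi ^^ CARD('m)) (norm (f i y) / t) * \<omega> i y) \<partial>lebesgue) (1 / CARD('m))"
   unfolding N using E(2) by simp
 qed
qed

end

theorem theorem1p2:
  fixes T :: "('m::finite \<Rightarrow> real ^ 'n::finite \<Rightarrow> complex) \<Rightarrow> (real ^ 'n \<Rightarrow> complex) \<Rightarrow> complex"
    and K :: "('m option \<Rightarrow> real ^ 'n) \<Rightarrow> complex"
    and \<omega> :: "'m \<Rightarrow> real ^ 'n \<Rightarrow> real"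
    and b :: "'m \<Rightarrow> real ^ 'n \<Rightarrow> complex"
  assumes "CZ_operator T K"
    and "\<omega> \<in> A_ones"
    and "\<forall>j. b j \<in> BMO"
  shows "\<exists>C::real. C > 0 \<and>
    (\<forall>t>0. \<forall>f :: 'm \<Rightarrow> real ^ 'n \<Rightarrow> complex. (\<forall>i. f i \<in> borel_measurable lebesgue) \<longrightarrow>
       weighted_measure (nu \<omega>) {x. maximal_iterated_commutator K b f x > ennreal (t ^ CARD('m))}
       \<le> ennreal C * ennreal_powr
           (\<Prod>i\<in>UNIV. \<integral>\<^sup>+y. ennreal ((Phi ^^ CARD('m)) (norm (f i y) / t) * \<omega> i y) \<partial>lebesgue)
           (1 / CARD('m)))"
proof -
 from assms(1) obtain p :: "'m => real" and q :: real and S where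
  p: "\<And>j. 1 \<le> p j" "1 / q = (\<Sum>j\<in>UNIV. 1 / p j)" and S: "bounded_multilinear_Lp p q S"
   "\<And>f. (\<And>j. f j \<in> schwartz) ==> coincides_on UNIV (T f) (S f)" and K: "CZ_kernel K"
   "\<And>f. (\<And>j. f j \<in> schwartz) ==> coincides_on (- (\<Inter>j. supp (f j))) (T f) (\<lambda>x. \<integral>y. K (point x y) * (\<Prod>j\<in>UNIV. f j (y $ j)) \<partial>lebesgue)"
  unfolding CZ_operator_def by blast
 from K(1) obtain A \<epsilon> where ker: "CZ_ker K A \<epsilon>" unfolding CZ_kernel_def CZ_ker_def by blast
 from S(1) obtain B where B: "\<And>f. (\<And>j. f j \<in> Lp (p j)) ==> Lp_norm q (S f) \<le> ennreal B * (\<Prod>j\<in>UNIV. Lp_norm (p j) (f j))"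
  unfolding bounded_multilinear_Lp_def by blast
 \<comment> \<open>\<open>ennreal\<close> sends negative reals to 0, so the bound may be taken
   nonnegative, as the locale asks.\<close>
 have "ennreal (max 0 B) = ennreal B" by (simp add: max_def ennreal_neg)
 then interpret CZ_op K A \<epsilon> T S p q "max 0 B"
  using ker p S K(2) B unfolding CZ_op_def CZ_op_axioms_def bounded_multilinear_Lp_def by simp
 show ?thesis using maximal_commutator_estimate[OF assms(2,3)] .
qed

end
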